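(* Let $(P,A,\mathcal T)$ be an extendable poset, let $\underline{\mathcal R}$ be the admissible system of the extended poset $\underline P^m$ (obtained from $P$ by adding a greatest element $m$ and a least element $0$), and let $\Lambda=\Lambda(\underline{\mathcal R})$. Let $\mathcal U$ be the full subcategory of $\mathrm{Mod}\text{-}\Lambda$ whose objects are the right socle-projective $\Lambda$-modules which do not have $e_0\Lambda$ as a direct summand. Then there is an equivalence of categories $$\mathrm{Rep}(P,A,\mathcal T)\cong\mathcal U.$$
   Context: $K$ is a field, $A$ a finite-dimensional $K$-algebra, $P$ a finite poset. A $P$-multiplicative system over $A$ is a family $\mathcal R=\{\mathcal R_{i,j}\subseteq A\mid i\le j\}$ of $K$-subspaces with (M.1) $\mathcal R_{i,j}\mathcal R_{j,l}\subseteq\mathcal R_{i,l}$ for $i\le j\le l$; (M.2) each $\mathcal R_i=\mathcal R_{i,i}$ is a $K$-algebra with unit $1_i$ such that $1_ir=r=r1_j$ for $r\in\mathcal R_{i,j}$. Then $(P,A,\mathcal R)$ is an algebraically equipped poset. Its incidence algebra is $\Lambda(\mathcal R)=\bigoplus_{i\le j}e_{i,j}\mathcal R_{i,j}$ ($e_{i,j}$ matrix units, matrix operations), and $e_i=e_{i,i}1_i$. $\mathrm{Rep}(P,A,\mathcal R)$: objects are collections $(L,L_i:i\in P)$ with $L$ a right $A$-module and $L_i\subseteq L$ $K$-subspaces such that $L_i\mathcal R_{i,j}\subseteq L_j$ for $i\le j$ and $a1_i=a$ for $a\in L_i$; morphisms are right $A$-module maps $h:L\to M$ with $h(L_i)\subseteq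 M_i$ for all $i$. For a poset with greatest element $m$, a multiplicative system is admissible if (A.1) each $\mathcal R_i$ is a division ring; (A.2) if $j<m$ and $0\ne x\in\mathcal R_{i,j}$, there is $y\in\mathcal R_{j,l}$, $l\ne j$, with $xy\ne0$. $P^m$ is $P$ with a greatest element $m$ added, and $\mathcal T^m$ is the $P^m$-multiplicative system with $\mathcal T_{i,j}$ for $i\le j$ in $P$ and $\mathcal T_{i,m}=A$ for all $i\in P^m$. $(P,A,\mathcal T)$ is extendable if $A$ is semisimple with exactly one simple module $\varepsilon_mA$ up to isomorphism, each $\mathcal T_i$ ($i\in P$) is a (unital) subalgebra of $A$, and there are idempotents $\varepsilon_i\in\mathcal T_i$ ($i\in P^m$) such that $\{\varepsilon_i\mathcal T_{i,j}\varepsilon_j\mid i\le j\in P^m\}$ is an admissible system whose incidence algebra is Morita equivalent to $\Lambda(\mathcal T^m)$. Extended system: $\underline P^m=P^m\cup\{0\}$ with $0$ a least element, $\mathcal T_{0,i}=A$ for all $i\in\underline P^m$, $\varepsilon_0=\varepsilon_m$, and $\underline{\mathcal R}=\{\varepsilon_i\mathcal T_{i,j}\varepsilon_j\mid i\le j\in\underline P^m\}$, which is an admissible system. A right module is socle-projective if its socle is projective. Modules may have arbitrary dimension. *)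

theory Defs
  imports
    "HOL-Algebra.Module"
    "HOL-Algebra.AbelCoset"
    "HOL-Library.FuncSet"
    "HOL-Library.Equipollence"
begin

section \<open>Categories and equivalences\<close>

record ('o, 'm) category =
  Obj :: "'o set"
  Hom :: "'o \<Rightarrow> 'o \<Rightarrow> 'm set"
  Idn :: "'o \<Rightarrow> 'm"
  Cmp :: "'o \<Rightarrow> 'o \<Rightarrow> 'o \<Rightarrow> 'm \<Rightarrow> 'm \<Rightarrow> 'm"

text \<open>\<open>Cmp C a b c g f\<close> is the composite of \<open>f : a \<rightarrow> b\<close> followed by \<open>g : b \<rightarrow> c\<close>. The hom sets of
  different pairs of objects need not be disjoint.\<close>

locale category =
  fixes C :: "('o, 'm) category"
  assumes idn: "a \<in> Obj C \<Longrightarrow> Idn C a \<in> Hom C a a"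
    and cmp: "\<lbrakk>a \<in> Obj C; b \<in> Obj C; c \<in> Obj C; f \<in> Hom C a b; g \<in> Hom C b c\<rbrakk>
      \<Longrightarrow> Cmp C a b c g f \<in> Hom C a c"
    and cmp_idn_right: "\<lbrakk>a \<in> Obj C; b \<in> Obj C; f \<in> Hom C a b\<rbrakk> \<Longrightarrow> Cmp C a a b f (Idn C a) = f"
    and cmp_idn_left: "\<lbrakk>a \<in> Obj C; b \<in> Obj C; f \<in> Hom C a b\<rbrakk> \<Longrightarrow> Cmp C a b b (Idn C b) f = f"
    and cmp_assoc: "\<lbrakk>a \<in> Obj C; b \<in> Obj C; c \<in> Obj C; d \<in> Obj C;
        f \<in> Hom C a b; g \<in> Hom C b c; h \<in> Hom C c d\<rbrakk>
      \<Longrightarrow> Cmp C a b d (Cmp C b c d h g) f = Cmp C a c d h (Cmp C a b c g f)"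

text \<open>A functor is given by its action \<open>Fo\<close> on objects and \<open>Fm a b : Hom a b \<rightarrow> Hom (Fo a) (Fo b)\<close> on
  morphisms.\<close>

locale cat_functor = C: category C + D: category D
  for C :: "('o, 'm) category" and D :: "('p, 'n) category" +
  fixes Fo :: "'o \<Rightarrow> 'p" and Fm :: "'o \<Rightarrow> 'o \<Rightarrow> 'm \<Rightarrow> 'n"
  assumes on_obj: "a \<in> Obj C \<Longrightarrow> Fo a \<in> Obj D"
    and on_hom: "\<lbrakk>a \<in> Obj C; b \<in> Obj C; f \<in> Hom C a b\<rbrakk> \<Longrightarrow> Fm a b f \<in> Hom D (Fo a) (Fo b)"
    and on_idn: "a \<in> Obj C \<Longrightarrow> Fm a a (Idn C a) = Idn D (Fo a)"
    and on_cmp: "\<lbrakk>a \<in> Obj C; b \<in> Obj C; c \<in> Obj C; f \<in> Hom C a b; g \<in> Hom C b c\<rbrakk>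
      \<Longrightarrow> Fm a c (Cmp C a b c g f) = Cmp D (Fo a) (Fo b) (Fo c) (Fm b c g) (Fm a b f)"

definition iso_arrow :: "('o, 'm) category \<Rightarrow> 'o \<Rightarrow> 'o \<Rightarrow> 'm \<Rightarrow> bool" where
  "iso_arrow C a b f \<longleftrightarrow> f \<in> Hom C a b \<and>
     (\<exists>g \<in> Hom C b a. Cmp C a b a g f = Idn C a \<and> Cmp C b a b f g = Idn C b)"

definition natural_iso ::
  "('o, 'm) category \<Rightarrow> ('p, 'n) category \<Rightarrow> ('o \<Rightarrow> 'p) \<Rightarrow> ('o \<Rightarrow> 'o \<Rightarrow> 'm \<Rightarrow> 'n) \<Rightarrow>
   ('o \<Rightarrow> 'p) \<Rightarrow> ('o \<Rightarrow> 'o \<Rightarrow> 'm \<Rightarrow> 'n) \<Rightarrow> ('o \<Rightarrow> 'n) \<Rightarrow> bool" where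
  "natural_iso C D Fo Fm Go Gm \<eta> \<longleftrightarrow>
     (\<forall>a \<in> Obj C. iso_arrow D (Fo a) (Go a) (\<eta> a)) \<and>
     (\<forall>a \<in> Obj C. \<forall>b \<in> Obj C. \<forall>f \<in> Hom C a b.
        Cmp D (Fo a) (Fo b) (Go b) (\<eta> b) (Fm a b f) = Cmp D (Fo a) (Go a) (Go b) (Gm a b f) (\<eta> a))"

definition equivalent_categories :: "('o, 'm) category \<Rightarrow> ('p, 'n) category \<Rightarrow> bool" where
  "equivalent_categories C D \<longleftrightarrow> (\<exists>Fo Fm Go Gm \<eta> \<theta>.
     cat_functor C D Fo Fm \<and> cat_functor D C Go Gm \<and>
     natural_iso C C (\<lambda>a. a) (\<lambda>a b f. f) (\<lambda>a. Go (Fo a)) (\<lambda>a b f. Gm (Fo a) (Fo b) (Fm a b f)) \<eta> \<and>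
     natural_iso D D (\<lambda>a. Fo (Go a)) (\<lambda>a b f. Fm (Go a) (Go b) (Gm a b f)) (\<lambda>a. a) (\<lambda>a b f. f) \<theta>)"

definition full_subcategory :: "('o, 'm) category \<Rightarrow> 'o set \<Rightarrow> ('o, 'm) category" where
  "full_subcategory C S = C\<lparr>Obj := Obj C \<inter> S\<rparr>"


section \<open>Right modules\<close>

text \<open>The multiplicative fields inherited from the ring record play no role in a module.\<close>

record ('a, 'b) rmodule = "'b ring" +
  ract :: "['b, 'a] \<Rightarrow> 'b" (infixl \<open>\<cdot>\<index>\<close> 70)

locale right_module = R?: ring R + M?: abelian_group M
  for R :: "('a, 'c) ring_scheme" (structure) and M :: "('a, 'b, 'd) rmodule_scheme" (structure) +
  assumes ract_closed: "\<lbrakk>x \<in> carrier M; a \<in> carrier R\<rbrakk> \<Longrightarrow> x \<cdot>\<^bsub>M\<^esub> a \<in> carrier M"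
    and ract_add_left: "\<lbrakk>x \<in> carrier M; y \<in> carrier M; a \<in> carrier R\<rbrakk>
      \<Longrightarrow> (x \<oplus>\<^bsub>M\<^esub> y) \<cdot>\<^bsub>M\<^esub> a = x \<cdot>\<^bsub>M\<^esub> a \<oplus>\<^bsub>M\<^esub> y \<cdot>\<^bsub>M\<^esub> a"
    and ract_add_right: "\<lbrakk>x \<in> carrier M; a \<in> carrier R; b \<in> carrier R\<rbrakk>
      \<Longrightarrow> x \<cdot>\<^bsub>M\<^esub> (a \<oplus>\<^bsub>R\<^esub> b) = x \<cdot>\<^bsub>M\<^esub> a \<oplus>\<^bsub>M\<^esub> x \<cdot>\<^bsub>M\<^esub> b"
    and ract_assoc: "\<lbrakk>x \<in> carrier M; a \<in> carrier R; b \<in> carrier R\<rbrakk>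
      \<Longrightarrow> x \<cdot>\<^bsub>M\<^esub> (a \<otimes>\<^bsub>R\<^esub> b) = (x \<cdot>\<^bsub>M\<^esub> a) \<cdot>\<^bsub>M\<^esub> b"
    and ract_one: "x \<in> carrier M \<Longrightarrow> x \<cdot>\<^bsub>M\<^esub> \<one>\<^bsub>R\<^esub> = x"

definition rmod_hom ::
  "('a, 'c) ring_scheme \<Rightarrow> ('a, 'b) rmodule \<Rightarrow> ('a, 'd) rmodule \<Rightarrow> ('b \<Rightarrow> 'd) set" where
  "rmod_hom R M N = {h. h \<in> carrier M \<rightarrow> carrier N \<and>
     (\<forall>x \<in> carrier M. \<forall>y \<in> carrier M. h (x \<oplus>\<^bsub>M\<^esub> y) = h x \<oplus>\<^bsub>N\<^esub> h y) \<and>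
     (\<forall>x \<in> carrier M. \<forall>a \<in> carrier R. h (x \<cdot>\<^bsub>M\<^esub> a) = h x \<cdot>\<^bsub>N\<^esub> a)}"

definition rmod_isomorphic ::
  "('a, 'c) ring_scheme \<Rightarrow> ('a, 'b) rmodule \<Rightarrow> ('a, 'd) rmodule \<Rightarrow> bool" where
  "rmod_isomorphic R M N \<longleftrightarrow> (\<exists>h \<in> rmod_hom R M N. bij_betw h (carrier M) (carrier N))"

definition rsubmodule :: "('a, 'c) ring_scheme \<Rightarrow> ('a, 'b) rmodule \<Rightarrow> 'b set \<Rightarrow> bool" where
  "rsubmodule R M N \<longleftrightarrow> subgroup N (add_monoid M) \<and> (\<forall>x \<in> N. \<forall>a \<in> carrier R. x \<cdot>\<^bsub>M\<^esub> a \<in> N)"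

definition simple_rmodule :: "('a, 'c) ring_scheme \<Rightarrow> ('a, 'b) rmodule \<Rightarrow> bool" where
  "simple_rmodule R M \<longleftrightarrow> right_module R M \<and> carrier M \<noteq> {\<zero>\<^bsub>M\<^esub>} \<and>
     (\<forall>N. rsubmodule R M N \<longrightarrow> N = {\<zero>\<^bsub>M\<^esub>} \<or> N = carrier M)"

text \<open>The sum of a family of submodules is the least submodule containing all of them.\<close>

definition socle :: "('a, 'c) ring_scheme \<Rightarrow> ('a, 'b) rmodule \<Rightarrow> 'b set" where
  "socle R M = \<Inter> {N. rsubmodule R M N \<and>
     (\<forall>S. rsubmodule R M S \<and> simple_rmodule R (M\<lparr>carrier := S\<rparr>) \<longrightarrow> S \<subseteq> N)}"

definition principal_rmodule :: "('a, 'c) ring_scheme \<Rightarrow> 'a \<Rightarrow> ('a, 'a) rmodule" where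
  "principal_rmodule R e = \<lparr>carrier = {e \<otimes>\<^bsub>R\<^esub> x | x. x \<in> carrier R},
     monoid.mult = (\<otimes>\<^bsub>R\<^esub>), one = \<one>\<^bsub>R\<^esub>, zero = \<zero>\<^bsub>R\<^esub>, add = (\<oplus>\<^bsub>R\<^esub>), ract = (\<otimes>\<^bsub>R\<^esub>)\<rparr>"

definition semisimple_ring :: "('a, 'c) ring_scheme \<Rightarrow> bool" where
  "semisimple_ring R \<longleftrightarrow> ring R \<and> socle R (principal_rmodule R \<one>\<^bsub>R\<^esub>) = carrier R"

text \<open>The type \<open>'v\<close> is the universe in which the underlying sets of modules live; modules may be
  arbitrarily large, as \<open>'v\<close> is arbitrary. Module maps are made extensional, so that equality of
  morphisms is equality of maps on the domain.\<close>

definition rmod_category :: "('a, 'c) ring_scheme \<Rightarrow> (('a, 'v) rmodule, 'v \<Rightarrow> 'v) category" where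
  "rmod_category R = \<lparr>Obj = {M. right_module R M},
     Hom = (\<lambda>M N. rmod_hom R M N \<inter> extensional (carrier M)),
     Idn = (\<lambda>M. restrict (\<lambda>x. x) (carrier M)),
     Cmp = (\<lambda>M N Q g f. compose (carrier M) g f)\<rparr>"

text \<open>Projectivity is the lifting property against epimorphisms between modules of the same universe.
  If the universe is infinite and not smaller than \<open>R\<close>, it contains a free module mapping onto \<open>M\<close>,
  so that the size of the universe does not matter.\<close>

definition projective_rmodule :: "('a, 'c) ring_scheme \<Rightarrow> ('a, 'v) rmodule \<Rightarrow> bool" where
  "projective_rmodule R M \<longleftrightarrow> right_module R M \<and>
     (\<forall>(X :: ('a, 'v) rmodule) (Y :: ('a, 'v) rmodule). \<forall>p \<in> rmod_hom R X Y. \<forall>f \<in> rmod_hom R M Y.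
        right_module R X \<longrightarrow> right_module R Y \<longrightarrow> p ` carrier X = carrier Y \<longrightarrow>
        (\<exists>g \<in> rmod_hom R M X. \<forall>x \<in> carrier M. p (g x) = f x))"

definition socle_projective :: "('a, 'c) ring_scheme \<Rightarrow> ('a, 'v) rmodule \<Rightarrow> bool" where
  "socle_projective R M \<longleftrightarrow> right_module R M \<and> projective_rmodule R (M\<lparr>carrier := socle R M\<rparr>)"

definition has_direct_summand ::
  "('a, 'c) ring_scheme \<Rightarrow> ('a, 'v) rmodule \<Rightarrow> ('a, 'b) rmodule \<Rightarrow> bool" where
  "has_direct_summand R M X \<longleftrightarrow> (\<exists>N N'. rsubmodule R M N \<and> rsubmodule R M N' \<and>
     N \<inter> N' = {\<zero>\<^bsub>M\<^esub>} \<and> N <+>\<^bsub>M\<^esub> N' = carrier M \<and> rmod_isomorphic R (M\<lparr>carrier := N\<rparr>) X)"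

definition morita_equivalent ::
  "'v itself \<Rightarrow> ('a, 'c) ring_scheme \<Rightarrow> ('b, 'd) ring_scheme \<Rightarrow> bool" where
  "morita_equivalent v R S \<longleftrightarrow> equivalent_categories
     (rmod_category R :: (('a, 'v) rmodule, 'v \<Rightarrow> 'v) category) (rmod_category S :: (('b, 'v) rmodule, 'v \<Rightarrow> 'v) category)"


section \<open>Algebraically equipped posets and their representations\<close>

locale fd_algebra = K: field K + A: ring A + module K A
  for K :: "('k, 'c) ring_scheme" and A :: "('k, 'a) module" +
  assumes smult_mult_left: "\<lbrakk>k \<in> carrier K; x \<in> carrier A; y \<in> carrier A\<rbrakk>
      \<Longrightarrow> (k \<odot>\<^bsub>A\<^esub> x) \<otimes>\<^bsub>A\<^esub> y = k \<odot>\<^bsub>A\<^esub> (x \<otimes>\<^bsub>A\<^esub> y)"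
    and smult_mult_right: "\<lbrakk>k \<in> carrier K; x \<in> carrier A; y \<in> carrier A\<rbrakk>
      \<Longrightarrow> x \<otimes>\<^bsub>A\<^esub> (k \<odot>\<^bsub>A\<^esub> y) = k \<odot>\<^bsub>A\<^esub> (x \<otimes>\<^bsub>A\<^esub> y)"
    and finite_dim: "\<exists>B. finite B \<and> B \<subseteq> carrier A \<and>
      (\<forall>V. submodule V K A \<and> B \<subseteq> V \<longrightarrow> V = carrier A)"

text \<open>A poset is a set \<open>P\<close> with an order relation \<open>r\<close>, where \<open>(i, j) \<in> r\<close> means \<open>i \<le> j\<close>.
  The values \<open>T i j\<close> for \<open>(i, j) \<notin> r\<close> are irrelevant everywhere below.\<close>

definition system_unit :: "('k, 'a) module \<Rightarrow> ('i \<Rightarrow> 'i \<Rightarrow> 'a set) \<Rightarrow> 'i \<Rightarrow> 'a" where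
  "system_unit A T i = (THE e. e \<in> T i i \<and> (\<forall>x \<in> T i i. e \<otimes>\<^bsub>A\<^esub> x = x \<and> x \<otimes>\<^bsub>A\<^esub> e = x))"

definition multiplicative_system ::
  "('k, 'c) ring_scheme \<Rightarrow> ('k, 'a) module \<Rightarrow> 'i set \<Rightarrow> 'i rel \<Rightarrow> ('i \<Rightarrow> 'i \<Rightarrow> 'a set) \<Rightarrow> bool" where
  "multiplicative_system K A P r T \<longleftrightarrow>
     (\<forall>(i, j) \<in> r. submodule (T i j) K A) \<and>
     (\<forall>i j l. (i, j) \<in> r \<longrightarrow> (j, l) \<in> r \<longrightarrow> (\<forall>x \<in> T i j. \<forall>y \<in> T j l. x \<otimes>\<^bsub>A\<^esub> y \<in> T i l)) \<and>
     (\<forall>i \<in> P. \<exists>e \<in> T i i. \<forall>x \<in> T i i. e \<otimes>\<^bsub>A\<^esub> x = x \<and> x \<otimes>\<^bsub>A\<^esub> e = x) \<and>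
     (\<forall>(i, j) \<in> r. \<forall>x \<in> T i j. system_unit A T i \<otimes>\<^bsub>A\<^esub> x = x \<and> x \<otimes>\<^bsub>A\<^esub> system_unit A T j = x)"

definition equipped_poset ::
  "('k, 'c) ring_scheme \<Rightarrow> ('k, 'a) module \<Rightarrow> 'i set \<Rightarrow> 'i rel \<Rightarrow> ('i \<Rightarrow> 'i \<Rightarrow> 'a set) \<Rightarrow> bool" where
  "equipped_poset K A P r T \<longleftrightarrow> fd_algebra K A \<and> finite P \<and> partial_order_on P r \<and>
     multiplicative_system K A P r T"

definition incidence_algebra ::
  "('k, 'a) module \<Rightarrow> 'i set \<Rightarrow> 'i rel \<Rightarrow> ('i \<Rightarrow> 'i \<Rightarrow> 'a set) \<Rightarrow> ('i \<Rightarrow> 'i \<Rightarrow> 'a) ring" where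
  "incidence_algebra A P r T =
     \<lparr>carrier = {f. \<forall>i j. if (i, j) \<in> r then f i j \<in> T i j else f i j = \<zero>\<^bsub>A\<^esub>},
      monoid.mult = (\<lambda>f g i j. \<Oplus>\<^bsub>A\<^esub>l \<in> P. f i l \<otimes>\<^bsub>A\<^esub> g l j),
      one = (\<lambda>i j. if i = j \<and> i \<in> P then system_unit A T i else \<zero>\<^bsub>A\<^esub>),
      zero = (\<lambda>i j. \<zero>\<^bsub>A\<^esub>),
      add = (\<lambda>f g i j. f i j \<oplus>\<^bsub>A\<^esub> g i j)\<rparr>"

definition incidence_idem ::
  "('k, 'a) module \<Rightarrow> ('i \<Rightarrow> 'i \<Rightarrow> 'a set) \<Rightarrow> 'i \<Rightarrow> ('i \<Rightarrow> 'i \<Rightarrow> 'a)" where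
  "incidence_idem A T i = (\<lambda>a b. if a = i \<and> b = i then system_unit A T i else \<zero>\<^bsub>A\<^esub>)"

text \<open>The scalar \<open>k\<close> acts on a right \<open>A\<close>-module through \<open>k \<odot> 1\<close>.\<close>

definition rsubspace ::
  "('k, 'c) ring_scheme \<Rightarrow> ('k, 'a) module \<Rightarrow> ('a, 'v) rmodule \<Rightarrow> 'v set \<Rightarrow> bool" where
  "rsubspace K A L V \<longleftrightarrow> subgroup V (add_monoid L) \<and>
     (\<forall>x \<in> V. \<forall>k \<in> carrier K. x \<cdot>\<^bsub>L\<^esub> (k \<odot>\<^bsub>A\<^esub> \<one>\<^bsub>A\<^esub>) \<in> V)"

definition Rep ::
  "('k, 'c) ring_scheme \<Rightarrow> ('k, 'a) module \<Rightarrow> 'i set \<Rightarrow> 'i rel \<Rightarrow> ('i \<Rightarrow> 'i \<Rightarrow> 'a set) \<Rightarrow>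
   (('a, 'v) rmodule \<times> ('i \<Rightarrow> 'v set), 'v \<Rightarrow> 'v) category" where
  "Rep K A P r T =
     \<lparr>Obj = {(L, W). right_module A L \<and> W \<in> extensional P \<and>
        (\<forall>i \<in> P. rsubspace K A L (W i)) \<and>
        (\<forall>(i, j) \<in> r. \<forall>x \<in> W i. \<forall>t \<in> T i j. x \<cdot>\<^bsub>L\<^esub> t \<in> W j) \<and>
        (\<forall>i \<in> P. \<forall>x \<in> W i. x \<cdot>\<^bsub>L\<^esub> system_unit A T i = x)},
      Hom = (\<lambda>(L, W) (M, X). {h \<in> rmod_hom A L M \<inter> extensional (carrier L). \<forall>i \<in> P. h ` W i \<subseteq> X i}),
      Idn = (\<lambda>(L, W). restrict (\<lambda>x. x) (carrier L)),
      Cmp = (\<lambda>(L, W) _ _ g f. compose (carrier L) g f)\<rparr>"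


section \<open>Admissible systems and extendable posets\<close>

text \<open>The first conjunct is the defining property of the greatest element. A division ring is a ring
  in which exactly the nonzero elements are units.\<close>

definition admissible_system ::
  "('k, 'c) ring_scheme \<Rightarrow> ('k, 'a) module \<Rightarrow> 'i set \<Rightarrow> 'i rel \<Rightarrow> 'i \<Rightarrow> ('i \<Rightarrow> 'i \<Rightarrow> 'a set) \<Rightarrow> bool" where
  "admissible_system K A P r m T \<longleftrightarrow>
     m \<in> P \<and> (\<forall>i \<in> P. (i, m) \<in> r) \<and>
     equipped_poset K A P r T \<and>
     (\<forall>i \<in> P. let D = A\<lparr>carrier := T i i, one := system_unit A T i\<rparr>
        in ring D \<and> Units D = carrier D - {\<zero>\<^bsub>D\<^esub>}) \<and>
     (\<forall>(i, j) \<in> r. j \<noteq> m \<longrightarrow> (\<forall>x \<in> T i j. x \<noteq> \<zero>\<^bsub>A\<^esub> \<longrightarrow>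
        (\<exists>l. (j, l) \<in> r \<and> l \<noteq> j \<and> (\<exists>y \<in> T j l. x \<otimes>\<^bsub>A\<^esub> y \<noteq> \<zero>\<^bsub>A\<^esub>))))"

text \<open>\<open>Top\<close> is the new greatest element \<open>m\<close> and \<open>Bot\<close> the new least element \<open>0\<close>.\<close>

datatype 'p extended = Bot | Elt 'p | Top

definition poset_top :: "'p set \<Rightarrow> 'p extended set" where
  "poset_top P = insert Top (Elt ` P)"

definition order_top :: "'p set \<Rightarrow> 'p rel \<Rightarrow> 'p extended rel" where
  "order_top P r = {(Elt i, Elt j) | i j. (i, j) \<in> r} \<union> poset_top P \<times> {Top}"

definition poset_bot_top :: "'p set \<Rightarrow> 'p extended set" where
  "poset_bot_top P = insert Bot (poset_top P)"

definition order_bot_top :: "'p set \<Rightarrow> 'p rel \<Rightarrow> 'p extended rel" where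
  "order_bot_top P r = order_top P r \<union> {Bot} \<times> poset_bot_top P"

text \<open>Restricted to \<open>order_top\<close> this is \<open>\<T>\<^sup>m\<close>; on \<open>order_bot_top\<close> it has in addition
  the value \<open>A\<close> at all \<open>(Bot, i)\<close>.\<close>

fun extended_system ::
  "('k, 'a) module \<Rightarrow> ('p \<Rightarrow> 'p \<Rightarrow> 'a set) \<Rightarrow> 'p extended \<Rightarrow> 'p extended \<Rightarrow> 'a set" where
  "extended_system A T (Elt i) (Elt j) = T i j"
| "extended_system A T _ _ = carrier A"

definition corner_system ::
  "('k, 'a) module \<Rightarrow> ('i \<Rightarrow> 'a) \<Rightarrow> ('i \<Rightarrow> 'i \<Rightarrow> 'a set) \<Rightarrow> 'i \<Rightarrow> 'i \<Rightarrow> 'a set" where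
  "corner_system A \<epsilon> T i j = {\<epsilon> i \<otimes>\<^bsub>A\<^esub> t \<otimes>\<^bsub>A\<^esub> \<epsilon> j | t. t \<in> T i j}"

text \<open>\<open>\<epsilon>\<close> is a family of idempotents witnessing that \<open>(P, A, T)\<close> is extendable. It is indexed by \<open>P\<^sup>m\<close>;
  its value at \<open>Bot\<close> is irrelevant.\<close>

definition extendable_via ::
  "'v itself \<Rightarrow> ('k, 'c) ring_scheme \<Rightarrow> ('k, 'a) module \<Rightarrow> 'p set \<Rightarrow> 'p rel \<Rightarrow> ('p \<Rightarrow> 'p \<Rightarrow> 'a set) \<Rightarrow>
   ('p extended \<Rightarrow> 'a) \<Rightarrow> bool" where
  "extendable_via v K A P r T \<epsilon> \<longleftrightarrow>
     equipped_poset K A P r T \<and>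
     semisimple_ring A \<and>
     simple_rmodule A (principal_rmodule A (\<epsilon> Top)) \<and>
     (\<forall>S :: ('a, 'v) rmodule. simple_rmodule A S \<longrightarrow>
        rmod_isomorphic A S (principal_rmodule A (\<epsilon> Top))) \<and>
     (\<forall>i \<in> P. \<one>\<^bsub>A\<^esub> \<in> T i i) \<and>
     (\<forall>i \<in> poset_top P. \<epsilon> i \<in> extended_system A T i i \<and> \<epsilon> i \<otimes>\<^bsub>A\<^esub> \<epsilon> i = \<epsilon> i) \<and>
     admissible_system K A (poset_top P) (order_top P r) Top
       (corner_system A \<epsilon> (extended_system A T)) \<and>
     morita_equivalent v
       (incidence_algebra A (poset_top P) (order_top P r) (corner_system A \<epsilon> (extended_system A T)))
       (incidence_algebra A (poset_top P) (order_top P r) (extended_system A T))"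

text \<open>The extended admissible system, with \<open>\<epsilon>\<^sub>0 = \<epsilon>\<^sub>m\<close>.\<close>

definition underline_R ::
  "('k, 'a) module \<Rightarrow> ('p \<Rightarrow> 'p \<Rightarrow> 'a set) \<Rightarrow> ('p extended \<Rightarrow> 'a) \<Rightarrow>
   'p extended \<Rightarrow> 'p extended \<Rightarrow> 'a set" where
  "underline_R A T \<epsilon> = corner_system A (\<epsilon>(Bot := \<epsilon> Top)) (extended_system A T)"

definition underline_Lambda ::
  "('k, 'a) module \<Rightarrow> 'p set \<Rightarrow> 'p rel \<Rightarrow> ('p \<Rightarrow> 'p \<Rightarrow> 'a set) \<Rightarrow> ('p extended \<Rightarrow> 'a) \<Rightarrow>
   ('p extended \<Rightarrow> 'p extended \<Rightarrow> 'a) ring" where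
  "underline_Lambda A P r T \<epsilon> =
     incidence_algebra A (poset_bot_top P) (order_bot_top P r) (underline_R A T \<epsilon>)"

definition category_U ::
  "('k, 'a) module \<Rightarrow> 'p set \<Rightarrow> 'p rel \<Rightarrow> ('p \<Rightarrow> 'p \<Rightarrow> 'a set) \<Rightarrow> ('p extended \<Rightarrow> 'a) \<Rightarrow>
   (('p extended \<Rightarrow> 'p extended \<Rightarrow> 'a, 'v) rmodule, 'v \<Rightarrow> 'v) category" where
  "category_U A P r T \<epsilon> =
     (let \<Lambda> = underline_Lambda A P r T \<epsilon>; e0 = incidence_idem A (underline_R A T \<epsilon>) Bot
      in full_subcategory (rmod_category \<Lambda>)
        {M. socle_projective \<Lambda> M \<and> \<not> has_direct_summand \<Lambda> M (principal_rmodule \<Lambda> e0)})"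

end

(* A module M over the incidence algebra of an admissible system is socle-projective iff
   no nonzero element of M e_i is annihilated by R_{i,m}, that is, iff M embeds into its part M_m at the
   top. If M_0 is nonzero, any nonzero x in M_0 generates a copy of e_0 Lambda, and a complement of the line
   x R_{0,m} in M_m yields a complement of x Lambda, because 1 is a sum of elements a \<epsilon>\<^sub>m b. So the
   objects of U are the socle-projective modules with M_0 = 0, which by M = L \<epsilon>\<^sub>m + sum of the L_i \<epsilon>\<^sub>i
   correspond to representations (L, L_i): L is recovered from M_m by Morita theory for A, and L_i from
   M_i because T_i \<epsilon>\<^sub>i T_i = T_i. The last equality is what the Morita equivalence in the
   definition of extendability provides, by counting simple modules. *)

theory Submission
  imports Defs
begin

section \<open>Equivalences of categories\<close>

text \<open>All modules have to live in the one type \<open>'v\<close>, and this shapes much of the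
  proof. Row vectors are functions from vertices to \<open>'v\<close>, and the representation
  attached to a module consists of functions from A to \<open>'v\<close>; both must be copied into
  \<open>'v\<close>. The copies exist because finitely many elements of an infinite type can be
  packed into one, and because the functions on A in question are determined by finitely many values
  once 1 is a sum of elements \<open>c \<epsilon>_m d\<close>. Morita equivalence is given as an
  equivalence of module categories, so what is taken from it has to be phrased with arrows.
  Simplicity of a module can be phrased so. If \<open>T_i \<epsilon>_i T_i\<close> were a proper
  ideal, the vertex i would carry a simple module killed by \<open>\<epsilon>_i\<close> besides one
  that is not, which makes more simple modules than there are vertices; the corner algebra has at
  most one per vertex. The same count at the greatest element, where the ring is A, gives
  \<open>A \<epsilon>_m A = A\<close>, the fact behind the Morita theory for A.\<close>

lemma iso_arrowE:
  assumes "iso_arrow C a b f"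
  obtains g where "f \<in> Hom C a b" "g \<in> Hom C b a" "Cmp C a b a g f = Idn C a" "Cmp C b a b f g = Idn C b"
  using assms unfolding iso_arrow_def by blast

context category
begin

lemma cancel_left:
  assumes "a \<in> Obj C" "b \<in> Obj C" "c \<in> Obj C" "f \<in> Hom C a b" "s \<in> Hom C b c" "t \<in> Hom C c b"
    and "Cmp C b c b t s = Idn C b"
  shows "Cmp C a c b t (Cmp C a b c s f) = f"
  using assms cmp_assoc[of a b c b f s t] cmp_idn_left by auto

lemma cancel_right:
  assumes "a \<in> Obj C" "b \<in> Obj C" "c \<in> Obj C" "f \<in> Hom C b c" "s \<in> Hom C b a" "t \<in> Hom C a b"
    and "Cmp C b a b t s = Idn C b"
  shows "Cmp C b a c (Cmp C a b c f t) s = f"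
  using assms cmp_assoc[of b a b c s t f] cmp_idn_right by auto

end

text \<open>Meant for the composite of an equivalence with its quasi-inverse. Naturality recovers f
  from \<open>Fm a b f\<close> by composing with one component of \<eta> and an inverse of another.
  The disjunction is there because the two isomorphisms in \<open>equivalent_categories\<close> run
  in opposite directions.\<close>

lemma natural_iso_faithful:
  assumes C: "category C"
    and F: "\<And>a. a \<in> Obj C \<Longrightarrow> Fo a \<in> Obj C"
    and FG: "\<And>a b f. a \<in> Obj C \<Longrightarrow> b \<in> Obj C \<Longrightarrow> f \<in> Hom C a b \<Longrightarrow> Fm a b f \<in> Hom C (Fo a) (Fo b)"
    and n: "natural_iso C C (\<lambda>a. a) (\<lambda>a b f. f) Fo Fm \<eta> \<or> natural_iso C C Fo Fm (\<lambda>a. a) (\<lambda>a b f. f) \<eta>"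
    and ab: "a \<in> Obj C" "b \<in> Obj C" "f \<in> Hom C a b" "g \<in> Hom C a b" and eq: "Fm a b f = Fm a b g"
  shows "f = g"
  using n
proof
  interpret C: category C by fact
  assume n: "natural_iso C C (\<lambda>a. a) (\<lambda>a b f. f) Fo Fm \<eta>"
  obtain t where t: "\<eta> b \<in> Hom C b (Fo b)" "t \<in> Hom C (Fo b) b" "Cmp C b (Fo b) b t (\<eta> b) = Idn C b"
    using n ab(2) unfolding natural_iso_def by (blast elim: iso_arrowE)
  have "Cmp C a b (Fo b) (\<eta> b) h = Cmp C a (Fo a) (Fo b) (Fm a b h) (\<eta> a)" if "h \<in> Hom C a b" for h
    using n that ab unfolding natural_iso_def by blast
  with ab eq have e: "Cmp C a b (Fo b) (\<eta> b) f = Cmp C a b (Fo b) (\<eta> b) g" by metis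
  have "h = Cmp C a (Fo b) b t (Cmp C a b (Fo b) (\<eta> b) h)" if "h \<in> Hom C a b" for h
    using C.cancel_left[of a b "Fo b" h "\<eta> b" t] that ab F t by simp
  then show "f = g" using e ab by metis
next
  interpret C: category C by fact
  assume n: "natural_iso C C Fo Fm (\<lambda>a. a) (\<lambda>a b f. f) \<eta>"
  obtain t where t: "\<eta> a \<in> Hom C (Fo a) a" "t \<in> Hom C a (Fo a)" "Cmp C a (Fo a) a (\<eta> a) t = Idn C a"
    using n ab(1) unfolding natural_iso_def by (blast elim: iso_arrowE)
  have "Cmp C (Fo a) (Fo b) b (\<eta> b) (Fm a b h) = Cmp C (Fo a) a b h (\<eta> a)" if "h \<in> Hom C a b" for h
    using n that ab unfolding natural_iso_def by blast
  with ab eq have e: "Cmp C (Fo a) a b f (\<eta> a) = Cmp C (Fo a) a b g (\<eta> a)" by metis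
  have "h = Cmp C a (Fo a) b (Cmp C (Fo a) a b h (\<eta> a)) t" if "h \<in> Hom C a b" for h
    using C.cancel_right[of "Fo a" a b h t "\<eta> a"] that ab F t by simp
  then show "f = g" using e ab by metis
qed

text \<open>The quasi-inverse picks for every object d a preimage \<open>Go d\<close> with an
  isomorphism \<open>\<theta> d\<close>, conjugates arrows by these isomorphisms and pulls the
  result back through the bijections \<open>Fm\<close>.\<close>

lemma equivalence_if_fully_faithful_dense:
  assumes F: "cat_functor C D Fo Fm"
    and full: "\<And>a b. a \<in> Obj C \<Longrightarrow> b \<in> Obj C \<Longrightarrow> bij_betw (Fm a b) (Hom C a b) (Hom D (Fo a) (Fo b))"
    and dense: "\<And>d. d \<in> Obj D \<Longrightarrow> \<exists>c \<in> Obj C. \<exists>f. iso_arrow D (Fo c) d f"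
  shows "equivalent_categories C D"
proof -
  interpret F: cat_functor C D Fo Fm by fact
  define Go where "Go d = (SOME c. c \<in> Obj C \<and> (\<exists>f. iso_arrow D (Fo c) d f))" for d
  define \<theta> where "\<theta> d = (SOME f. iso_arrow D (Fo (Go d)) d f)" for d
  define \<theta>' where "\<theta>' d = (SOME g. g \<in> Hom D d (Fo (Go d)) \<and> Cmp D (Fo (Go d)) d (Fo (Go d)) g (\<theta> d) = Idn D (Fo (Go d))
     \<and> Cmp D d (Fo (Go d)) d (\<theta> d) g = Idn D d)" for d
  have G: "Go d \<in> Obj C \<and> iso_arrow D (Fo (Go d)) d (\<theta> d)" if "d \<in> Obj D" for d
  proof -
    have "Go d \<in> Obj C \<and> (\<exists>f. iso_arrow D (Fo (Go d)) d f)"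
      unfolding Go_def by (rule someI_ex) (use dense[OF that] in blast)
    then show ?thesis unfolding \<theta>_def by (meson someI_ex)
  qed
  then have Go: "Go d \<in> Obj C" if "d \<in> Obj D" for d using that by blast
  have \<theta>: "\<theta> d \<in> Hom D (Fo (Go d)) d" if "d \<in> Obj D" for d using that G unfolding iso_arrow_def by blast
  have "\<theta>' d \<in> Hom D d (Fo (Go d)) \<and> Cmp D (Fo (Go d)) d (Fo (Go d)) (\<theta>' d) (\<theta> d) = Idn D (Fo (Go d))
     \<and> Cmp D d (Fo (Go d)) d (\<theta> d) (\<theta>' d) = Idn D d" if "d \<in> Obj D" for d
    unfolding \<theta>'_def by (rule someI_ex) (use G[OF that] in \<open>auto simp: iso_arrow_def\<close>)
  then have \<theta>': "\<theta>' d \<in> Hom D d (Fo (Go d))"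
    and l: "Cmp D (Fo (Go d)) d (Fo (Go d)) (\<theta>' d) (\<theta> d) = Idn D (Fo (Go d))"
    and r: "Cmp D d (Fo (Go d)) d (\<theta> d) (\<theta>' d) = Idn D d" if "d \<in> Obj D" for d using that by blast+
  define I where "I a b = inv_into (Hom C a b) (Fm a b)" for a b
  have I: "I a b g \<in> Hom C a b" "Fm a b (I a b g) = g"
    if "a \<in> Obj C" "b \<in> Obj C" "g \<in> Hom D (Fo a) (Fo b)" for a b g
    using full[OF that(1,2)] that(3) unfolding I_def
    by (auto simp: bij_betw_def inv_into_into f_inv_into_f)
  have inj: "f = g" if "a \<in> Obj C" "b \<in> Obj C" "f \<in> Hom C a b" "g \<in> Hom C a b" "Fm a b f = Fm a b g" for a b f g
    using full[OF that(1,2)] that(3-5) unfolding bij_betw_def inj_on_def by blast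
  define H where "H d e g = Cmp D (Fo (Go d)) e (Fo (Go e)) (\<theta>' e) (Cmp D (Fo (Go d)) d e g (\<theta> d))" for d e g
  note ob = Go F.on_obj
  have H: "H d e g \<in> Hom D (Fo (Go d)) (Fo (Go e))" if "d \<in> Obj D" "e \<in> Obj D" "g \<in> Hom D d e" for d e g
    unfolding H_def using that ob \<theta> \<theta>' F.D.cmp by metis
  have H\<theta>: "Cmp D (Fo (Go d)) (Fo (Go e)) e (\<theta> e) (H d e g) = Cmp D (Fo (Go d)) d e g (\<theta> d)"
    if "d \<in> Obj D" "e \<in> Obj D" "g \<in> Hom D d e" for d e g
    unfolding H_def by (rule F.D.cancel_left) (use that ob \<theta> \<theta>' r F.D.cmp in auto)
  \<comment> \<open>\<open>H d e g\<close> is the only arrow that makes the square with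
    \<open>\<theta> d\<close> and \<open>\<theta> e\<close> commute, so preservation of identities
    and composites reduces to a check of that square.\<close>
  have Huniq: "k = H d e g" if "d \<in> Obj D" "e \<in> Obj D" "g \<in> Hom D d e" "k \<in> Hom D (Fo (Go d)) (Fo (Go e))"
      "Cmp D (Fo (Go d)) (Fo (Go e)) e (\<theta> e) k = Cmp D (Fo (Go d)) d e g (\<theta> d)" for d e g k
    using F.D.cancel_left[of "Fo (Go d)" "Fo (Go e)" e k "\<theta> e" "\<theta>' e"] that ob \<theta> \<theta>' l unfolding H_def by simp
  define Gm where "Gm d e g = I (Go d) (Go e) (H d e g)" for d e g
  have Gm: "Gm d e g \<in> Hom C (Go d) (Go e)" "Fm (Go d) (Go e) (Gm d e g) = H d e g"
    if "d \<in> Obj D" "e \<in> Obj D" "g \<in> Hom D d e" for d e g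
    unfolding Gm_def using I H that Go by auto
  have Hid: "H d d (Idn D d) = Idn D (Fo (Go d))" if "d \<in> Obj D" for d
    by (rule Huniq[symmetric])
      (use that ob \<theta> in \<open>auto simp: F.D.idn F.D.cmp_idn_left F.D.cmp_idn_right\<close>)
  have Hcmp: "H d e' (Cmp D d e e' h g) = Cmp D (Fo (Go d)) (Fo (Go e)) (Fo (Go e')) (H e e' h) (H d e g)"
    if o: "d \<in> Obj D" "e \<in> Obj D" "e' \<in> Obj D" and m: "g \<in> Hom D d e" "h \<in> Hom D e e'" for d e e' g h
  proof (rule Huniq[symmetric])
    have ob': "Fo (Go d) \<in> Obj D" "Fo (Go e) \<in> Obj D" "Fo (Go e') \<in> Obj D" using o ob by auto
    show "Cmp D d e e' h g \<in> Hom D d e'" using o m F.D.cmp by blast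
    show "Cmp D (Fo (Go d)) (Fo (Go e)) (Fo (Go e')) (H e e' h) (H d e g) \<in> Hom D (Fo (Go d)) (Fo (Go e'))"
      using o m ob' H F.D.cmp by blast
    have "Cmp D (Fo (Go d)) (Fo (Go e')) e' (\<theta> e') (Cmp D (Fo (Go d)) (Fo (Go e)) (Fo (Go e')) (H e e' h) (H d e g))
      = Cmp D (Fo (Go d)) (Fo (Go e)) e' (Cmp D (Fo (Go e)) (Fo (Go e')) e' (\<theta> e') (H e e' h)) (H d e g)"
      using F.D.cmp_assoc[of "Fo (Go d)" "Fo (Go e)" "Fo (Go e')" e'] o m ob' H \<theta> by auto
    also have "\<dots> = Cmp D (Fo (Go d)) (Fo (Go e)) e' (Cmp D (Fo (Go e)) e e' h (\<theta> e)) (H d e g)"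
      using H\<theta> o m by simp
    also have "\<dots> = Cmp D (Fo (Go d)) e e' h (Cmp D (Fo (Go d)) (Fo (Go e)) e (\<theta> e) (H d e g))"
      using F.D.cmp_assoc[of "Fo (Go d)" "Fo (Go e)" e e'] o m ob' H \<theta> by auto
    also have "\<dots> = Cmp D (Fo (Go d)) e e' h (Cmp D (Fo (Go d)) d e g (\<theta> d))" using H\<theta> o m by simp
    also have "\<dots> = Cmp D (Fo (Go d)) d e' (Cmp D d e e' h g) (\<theta> d)"
      using F.D.cmp_assoc[of "Fo (Go d)" d e e'] o m ob' \<theta> by auto
    finally show "Cmp D (Fo (Go d)) (Fo (Go e')) e' (\<theta> e') (Cmp D (Fo (Go d)) (Fo (Go e)) (Fo (Go e')) (H e e' h) (H d e g))
      = Cmp D (Fo (Go d)) d e' (Cmp D d e e' h g) (\<theta> d)" .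
  qed (use o in auto)
  have GF: "cat_functor D C Go Gm"
  proof (intro cat_functor.intro cat_functor_axioms.intro F.C.category_axioms F.D.category_axioms)
    fix d assume d: "d \<in> Obj D"
    show "Gm d d (Idn D d) = Idn C (Go d)"
      by (rule inj) (use d Go Gm F.D.idn F.C.idn Hid F.on_idn in auto)
  next
    fix d e e' g h assume o: "d \<in> Obj D" "e \<in> Obj D" "e' \<in> Obj D" and m: "g \<in> Hom D d e" "h \<in> Hom D e e'"
    have "Cmp D d e e' h g \<in> Hom D d e'" using o m F.D.cmp by blast
    then show "Gm d e' (Cmp D d e e' h g) = Cmp C (Go d) (Go e) (Go e') (Gm e e' h) (Gm d e g)"
      by (intro inj[of "Go d" "Go e'"]) (use o m Go Gm Hcmp F.on_cmp F.C.cmp in auto)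
  qed (use Go Gm in auto)
  \<comment> \<open>The unit is chosen so that its image under the functor is the inverse of
    \<theta> at \<open>Fo a\<close>. Invertibility and naturality can then be checked after applying
    the functor, which is injective on arrows.\<close>
  define \<eta> where "\<eta> a = I a (Go (Fo a)) (\<theta>' (Fo a))" for a
  have \<eta>: "\<eta> a \<in> Hom C a (Go (Fo a))" "Fm a (Go (Fo a)) (\<eta> a) = \<theta>' (Fo a)" if "a \<in> Obj C" for a
    unfolding \<eta>_def using that ob \<theta>' I by auto
  have \<eta>iso: "iso_arrow C a (Go (Fo a)) (\<eta> a)" if a: "a \<in> Obj C" for a
  proof -
    let ?t = "I (Go (Fo a)) a (\<theta> (Fo a))"
    have t: "?t \<in> Hom C (Go (Fo a)) a" "Fm (Go (Fo a)) a ?t = \<theta> (Fo a)" using a ob \<theta> I by auto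
    have c: "Cmp C a (Go (Fo a)) a ?t (\<eta> a) \<in> Hom C a a"
      "Cmp C (Go (Fo a)) a (Go (Fo a)) (\<eta> a) ?t \<in> Hom C (Go (Fo a)) (Go (Fo a))"
      using F.C.cmp[OF a Go[OF F.on_obj[OF a]] a \<eta>(1)[OF a] t(1)]
        F.C.cmp[OF Go[OF F.on_obj[OF a]] a Go[OF F.on_obj[OF a]] t(1) \<eta>(1)[OF a]] by blast+
    have "Cmp C a (Go (Fo a)) a ?t (\<eta> a) = Idn C a"
    proof (rule inj[OF a a c(1) F.C.idn[OF a]])
      have "Fm a a (Cmp C a (Go (Fo a)) a ?t (\<eta> a)) = Cmp D (Fo a) (Fo (Go (Fo a))) (Fo a) (\<theta> (Fo a)) (\<theta>' (Fo a))"
        using F.on_cmp[OF a Go[OF F.on_obj[OF a]] a \<eta>(1)[OF a] t(1)] \<eta>(2)[OF a] t(2) by (simp only:)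
      then show "Fm a a (Cmp C a (Go (Fo a)) a ?t (\<eta> a)) = Fm a a (Idn C a)"
        using r[OF F.on_obj[OF a]] F.on_idn[OF a] by (simp only:)
    qed
    moreover have "Cmp C (Go (Fo a)) a (Go (Fo a)) (\<eta> a) ?t = Idn C (Go (Fo a))"
    proof (rule inj[OF Go[OF F.on_obj[OF a]] Go[OF F.on_obj[OF a]] c(2) F.C.idn[OF Go[OF F.on_obj[OF a]]]])
      note o = Go[OF F.on_obj[OF a]]
      have "Fm (Go (Fo a)) (Go (Fo a)) (Cmp C (Go (Fo a)) a (Go (Fo a)) (\<eta> a) ?t)
        = Cmp D (Fo (Go (Fo a))) (Fo a) (Fo (Go (Fo a))) (\<theta>' (Fo a)) (\<theta> (Fo a))"
        using F.on_cmp[OF o a o t(1) \<eta>(1)[OF a]] \<eta>(2)[OF a] t(2) by (simp only:)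
      then show "Fm (Go (Fo a)) (Go (Fo a)) (Cmp C (Go (Fo a)) a (Go (Fo a)) (\<eta> a) ?t)
        = Fm (Go (Fo a)) (Go (Fo a)) (Idn C (Go (Fo a)))"
        using l[OF F.on_obj[OF a]] F.on_idn[OF o] by (simp only:)
    qed
    ultimately show ?thesis unfolding iso_arrow_def using t \<eta> a by blast
  qed
  have \<eta>nat: "Cmp C a b (Go (Fo b)) (\<eta> b) f = Cmp C a (Go (Fo a)) (Go (Fo b)) (Gm (Fo a) (Fo b) (Fm a b f)) (\<eta> a)"
    if o: "a \<in> Obj C" "b \<in> Obj C" and f: "f \<in> Hom C a b" for a b f
  proof (rule inj)
    have f': "Fm a b f \<in> Hom D (Fo a) (Fo b)" using F.on_hom o f by blast
    have ob': "Fo a \<in> Obj D" "Fo b \<in> Obj D" "Go (Fo a) \<in> Obj C" "Go (Fo b) \<in> Obj C"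
      "Fo (Go (Fo a)) \<in> Obj D" "Fo (Go (Fo b)) \<in> Obj D" using o ob by auto
    show "Cmp C a b (Go (Fo b)) (\<eta> b) f \<in> Hom C a (Go (Fo b))"
      "Cmp C a (Go (Fo a)) (Go (Fo b)) (Gm (Fo a) (Fo b) (Fm a b f)) (\<eta> a) \<in> Hom C a (Go (Fo b))"
      using F.C.cmp[OF o(1,2) ob'(4) f \<eta>(1)[OF o(2)]]
        F.C.cmp[OF o(1) ob'(3,4) \<eta>(1)[OF o(1)] Gm(1)[OF ob'(1,2) f']] by blast+
    have "Fm a (Go (Fo b)) (Cmp C a (Go (Fo a)) (Go (Fo b)) (Gm (Fo a) (Fo b) (Fm a b f)) (\<eta> a))
      = Cmp D (Fo a) (Fo (Go (Fo a))) (Fo (Go (Fo b))) (H (Fo a) (Fo b) (Fm a b f)) (\<theta>' (Fo a))"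
      using o f f' ob' \<eta> Gm F.on_cmp by simp
    also have "\<dots> = Cmp D (Fo a) (Fo b) (Fo (Go (Fo b))) (\<theta>' (Fo b))
        (Cmp D (Fo a) (Fo (Go (Fo a))) (Fo b) (Cmp D (Fo (Go (Fo a))) (Fo a) (Fo b) (Fm a b f) (\<theta> (Fo a))) (\<theta>' (Fo a)))"
      unfolding H_def using o f f' ob' \<theta> \<theta>' F.D.cmp F.D.cmp_assoc[of "Fo a" "Fo (Go (Fo a))" "Fo b" "Fo (Go (Fo b))"]
      by simp
    also have "\<dots> = Cmp D (Fo a) (Fo b) (Fo (Go (Fo b))) (\<theta>' (Fo b)) (Fm a b f)"
      using F.D.cancel_right[of "Fo (Go (Fo a))" "Fo a" "Fo b" "Fm a b f" "\<theta>' (Fo a)" "\<theta> (Fo a)"] ob' f' \<theta> \<theta>' r by simp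
    finally show "Fm a (Go (Fo b)) (Cmp C a b (Go (Fo b)) (\<eta> b) f)
      = Fm a (Go (Fo b)) (Cmp C a (Go (Fo a)) (Go (Fo b)) (Gm (Fo a) (Fo b) (Fm a b f)) (\<eta> a))"
      using o f f' ob' \<eta> F.on_cmp by simp
  qed (use o ob in auto)
  have "natural_iso C C (\<lambda>a. a) (\<lambda>a b f. f) (\<lambda>a. Go (Fo a)) (\<lambda>a b f. Gm (Fo a) (Fo b) (Fm a b f)) \<eta>"
    unfolding natural_iso_def using \<eta>iso \<eta>nat by simp
  moreover have "natural_iso D D (\<lambda>a. Fo (Go a)) (\<lambda>a b f. Fm (Go a) (Go b) (Gm a b f)) (\<lambda>a. a) (\<lambda>a b f. f) \<theta>"
    unfolding natural_iso_def using G Gm H\<theta> by simp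
  ultimately show ?thesis unfolding equivalent_categories_def using F GF by blast
qed

text \<open>A categorical description of simple modules: every map out of the object is zero (it composes
  equally with all parallel arrows) or a monomorphism.\<close>

definition simple_object :: "('o, 'm) category \<Rightarrow> 'o \<Rightarrow> bool" where
  "simple_object C S \<longleftrightarrow> S \<in> Obj C \<and> (\<exists>p \<in> Hom C S S. \<exists>q \<in> Hom C S S. p \<noteq> q) \<and>
     (\<forall>X \<in> Obj C. \<forall>f \<in> Hom C S X.
        (\<forall>Y \<in> Obj C. \<forall>g \<in> Hom C Y S. \<forall>h \<in> Hom C Y S. Cmp C Y S X f g = Cmp C Y S X f h) \<or>
        (\<forall>Y \<in> Obj C. \<forall>g \<in> Hom C Y S. \<forall>h \<in> Hom C Y S. Cmp C Y S X f g = Cmp C Y S X f h \<longrightarrow> g = h))"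

text \<open>An arrow f out of \<open>Go S\<close> is compared with an arrow out of S: apply the
  functor F and precompose with an inverse s of \<theta>. By \<open>key\<close>, composites with f
  correspond to composites with the new arrow, so the alternative between zero and monomorphism
  passes from S to \<open>Go S\<close>.\<close>

lemma simple_object_image:
  assumes F: "cat_functor C D Fo Fm" and G: "cat_functor D C Go Gm"
    and F_faithful: "\<And>a b f g. \<lbrakk>a \<in> Obj C; b \<in> Obj C; f \<in> Hom C a b; g \<in> Hom C a b; Fm a b f = Fm a b g\<rbrakk> \<Longrightarrow> f = g"
    and G_faithful: "\<And>a b f g. \<lbrakk>a \<in> Obj D; b \<in> Obj D; f \<in> Hom D a b; g \<in> Hom D a b; Gm a b f = Gm a b g\<rbrakk> \<Longrightarrow> f = g"
    and S: "simple_object D S" and iso: "iso_arrow D (Fo (Go S)) S \<theta>"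
  shows "simple_object C (Go S)"
proof -
  interpret F: cat_functor C D Fo Fm by fact
  interpret G: cat_functor D C Go Gm by fact
  obtain s where s: "\<theta> \<in> Hom D (Fo (Go S)) S" "s \<in> Hom D S (Fo (Go S))"
    "Cmp D (Fo (Go S)) S (Fo (Go S)) s \<theta> = Idn D (Fo (Go S))"
    using iso by (blast elim: iso_arrowE)
  have SD: "S \<in> Obj D" using S by (simp add: simple_object_def)
  have ob: "Go S \<in> Obj C" "Fo (Go S) \<in> Obj D" using SD G.on_obj F.on_obj by auto
  have "\<exists>p \<in> Hom C (Go S) (Go S). \<exists>q \<in> Hom C (Go S) (Go S). p \<noteq> q"
    using S G_faithful[of S S] G.on_hom[of S S] SD unfolding simple_object_def by metis
  moreover
  have "(\<forall>Y \<in> Obj C. \<forall>g \<in> Hom C Y (Go S). \<forall>h \<in> Hom C Y (Go S). Cmp C Y (Go S) X f g = Cmp C Y (Go S) X f h) \<or>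
        (\<forall>Y \<in> Obj C. \<forall>g \<in> Hom C Y (Go S). \<forall>h \<in> Hom C Y (Go S). Cmp C Y (Go S) X f g = Cmp C Y (Go S) X f h \<longrightarrow> g = h)"
    if X: "X \<in> Obj C" and f: "f \<in> Hom C (Go S) X" for X f
  proof -
    have X': "Fo X \<in> Obj D" and Ff: "Fm (Go S) X f \<in> Hom D (Fo (Go S)) (Fo X)" using X f ob F.on_obj F.on_hom by auto
    let ?f = "Cmp D S (Fo (Go S)) (Fo X) (Fm (Go S) X f) s"
    have f': "?f \<in> Hom D S (Fo X)" using SD ob X' Ff s F.D.cmp by blast
    have key: "Fm Y X (Cmp C Y (Go S) X f g) = Cmp D (Fo Y) S (Fo X) ?f (Cmp D (Fo Y) (Fo (Go S)) S \<theta> (Fm Y (Go S) g))"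
      and \<theta>g: "Cmp D (Fo Y) (Fo (Go S)) S \<theta> (Fm Y (Go S) g) \<in> Hom D (Fo Y) S"
      and ret: "Cmp D (Fo Y) S (Fo (Go S)) s (Cmp D (Fo Y) (Fo (Go S)) S \<theta> (Fm Y (Go S) g)) = Fm Y (Go S) g"
      if Y: "Y \<in> Obj C" and g: "g \<in> Hom C Y (Go S)" for Y g
    proof -
      have Y': "Fo Y \<in> Obj D" and Fg: "Fm Y (Go S) g \<in> Hom D (Fo Y) (Fo (Go S))" using Y g ob F.on_obj F.on_hom by auto
      show \<theta>g: "Cmp D (Fo Y) (Fo (Go S)) S \<theta> (Fm Y (Go S) g) \<in> Hom D (Fo Y) S"
        using F.D.cmp Y' ob SD Fg s by blast
      \<comment> \<open>As s undoes \<theta>, the arrow g can be read off from its counterpart with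
        target S. Hence an equation between such counterparts gives back the equation between the
        original arrows.\<close>
      show ret: "Cmp D (Fo Y) S (Fo (Go S)) s (Cmp D (Fo Y) (Fo (Go S)) S \<theta> (Fm Y (Go S) g)) = Fm Y (Go S) g"
        by (rule F.D.cancel_left) (use Y' ob SD Fg s in auto)
      show "Fm Y X (Cmp C Y (Go S) X f g) = Cmp D (Fo Y) S (Fo X) ?f (Cmp D (Fo Y) (Fo (Go S)) S \<theta> (Fm Y (Go S) g))"
        using F.D.cmp_assoc[OF Y' SD ob(2) X' \<theta>g s(2) Ff] F.on_cmp[OF Y ob(1) X g f] ret by simp
    qed
    consider "\<forall>Y \<in> Obj D. \<forall>g \<in> Hom D Y S. \<forall>h \<in> Hom D Y S. Cmp D Y S (Fo X) ?f g = Cmp D Y S (Fo X) ?f h"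
      | "\<forall>Y \<in> Obj D. \<forall>g \<in> Hom D Y S. \<forall>h \<in> Hom D Y S. Cmp D Y S (Fo X) ?f g = Cmp D Y S (Fo X) ?f h \<longrightarrow> g = h"
      using S X' f' unfolding simple_object_def by blast
    then show ?thesis
    proof cases
      case 1
      have "Cmp C Y (Go S) X f g = Cmp C Y (Go S) X f h"
        if Y: "Y \<in> Obj C" and g: "g \<in> Hom C Y (Go S)" and h: "h \<in> Hom C Y (Go S)" for Y g h
      proof (rule F_faithful[OF Y X])
        show "Cmp C Y (Go S) X f g \<in> Hom C Y X" "Cmp C Y (Go S) X f h \<in> Hom C Y X"
          using F.C.cmp[OF Y ob(1) X] f g h by blast+
        show "Fm Y X (Cmp C Y (Go S) X f g) = Fm Y X (Cmp C Y (Go S) X f h)"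
          unfolding key[OF Y g] key[OF Y h] using 1 F.on_obj[OF Y] \<theta>g[OF Y g] \<theta>g[OF Y h] by blast
      qed
      then show ?thesis by blast
    next
      case 2
      have "g = h"
        if Y: "Y \<in> Obj C" and g: "g \<in> Hom C Y (Go S)" and h: "h \<in> Hom C Y (Go S)"
          and e: "Cmp C Y (Go S) X f g = Cmp C Y (Go S) X f h" for Y g h
      proof (rule F_faithful[OF Y ob(1) g h])
        have "Cmp D (Fo Y) (Fo (Go S)) S \<theta> (Fm Y (Go S) g) = Cmp D (Fo Y) (Fo (Go S)) S \<theta> (Fm Y (Go S) h)"
          by (rule 2[rule_format, OF F.on_obj[OF Y] \<theta>g[OF Y g] \<theta>g[OF Y h]])
            (simp only: key[OF Y g, symmetric] key[OF Y h, symmetric] e)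
        then show "Fm Y (Go S) g = Fm Y (Go S) h"
          by (subst ret[OF Y g, symmetric], subst ret[OF Y h, symmetric]) (rule arg_cong)
      qed
      then show ?thesis by blast
    qed
  qed
  ultimately show ?thesis unfolding simple_object_def using ob by blast
qed

lemma (in cat_functor) iso_arrow_image:
  assumes "a \<in> Obj C" "b \<in> Obj C" "iso_arrow C a b f"
  shows "iso_arrow D (Fo a) (Fo b) (Fm a b f)"
proof -
  obtain g where g: "f \<in> Hom C a b" "g \<in> Hom C b a" "Cmp C a b a g f = Idn C a" "Cmp C b a b f g = Idn C b"
    using assms(3) by (rule iso_arrowE)
  have "Cmp D (Fo a) (Fo b) (Fo a) (Fm b a g) (Fm a b f) = Idn D (Fo a)"
    "Cmp D (Fo b) (Fo a) (Fo b) (Fm a b f) (Fm b a g) = Idn D (Fo b)"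
    using on_cmp[of a b a f g] on_cmp[of b a b g f] assms(1,2) g on_idn by simp_all
  then show ?thesis unfolding iso_arrow_def using on_hom assms(1,2) g by blast
qed

section \<open>Right modules\<close>

lemma (in abelian_monoid) finsum_swap:
  assumes "finite I" "finite J" "\<And>i j. i \<in> I \<Longrightarrow> j \<in> J \<Longrightarrow> f i j \<in> carrier G"
  shows "(\<Oplus>i\<in>I. \<Oplus>j\<in>J. f i j) = (\<Oplus>j\<in>J. \<Oplus>i\<in>I. f i j)"
  using assms(1,3)
proof (induction I)
  case empty
  then show ?case by (simp add: finsum_zero)
next
  case (insert i I)
  have "(\<Oplus>i\<in>insert i I. \<Oplus>j\<in>J. f i j) = (\<Oplus>j\<in>J. f i j) \<oplus> (\<Oplus>j\<in>J. \<Oplus>i\<in>I. f i j)"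
    using insert by (subst finsum_insert) (auto intro!: finsum_closed)
  also have "\<dots> = (\<Oplus>j\<in>J. f i j \<oplus> (\<Oplus>i\<in>I. f i j))"
    using insert by (subst finsum_addf) (auto intro!: finsum_closed)
  also have "\<dots> = (\<Oplus>j\<in>J. \<Oplus>i\<in>insert i I. f i j)"
    using insert by (intro finsum_cong') (auto intro!: finsum_closed simp: finsum_insert)
  finally show ?case .
qed

lemma (in abelian_monoid) finsum_single:
  assumes "finite J" "j \<in> J" "x \<in> carrier G" "\<And>i. i \<in> J \<Longrightarrow> f i = (if i = j then x else \<zero>)"
  shows "(\<Oplus>i\<in>J. f i) = x"
proof -
  have "(\<Oplus>i\<in>J. f i) = (\<Oplus>i\<in>J. if j = i then (\<lambda>_. x) i else \<zero>)"
    using assms by (intro finsum_cong') auto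
  also have "\<dots> = x" using finsum_singleton[OF assms(2,1), of "\<lambda>_. x"] assms(3) by simp
  finally show ?thesis .
qed

lemma (in abelian_monoid) finsum_mem:
  assumes "finite I" "\<And>i. i \<in> I \<Longrightarrow> f i \<in> H" "H \<subseteq> carrier G" "\<zero> \<in> H" "\<And>x y. x \<in> H \<Longrightarrow> y \<in> H \<Longrightarrow> x \<oplus> y \<in> H"
  shows "(\<Oplus>i\<in>I. f i) \<in> H"
  using assms(1,2)
proof (induction I)
  case (insert i I)
  moreover from insert have "f \<in> I \<rightarrow> carrier G" "f i \<in> carrier G" using assms(3) by auto
  ultimately show ?case using assms(5) by (simp add: finsum_insert)
qed (use assms in simp)

lemma abelian_groupI':
  fixes G (structure)
  assumes "\<And>x y. \<lbrakk>x \<in> carrier G; y \<in> carrier G\<rbrakk> \<Longrightarrow> x \<oplus> y \<in> carrier G" "\<zero> \<in> carrier G"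
    "\<And>x y z. \<lbrakk>x \<in> carrier G; y \<in> carrier G; z \<in> carrier G\<rbrakk> \<Longrightarrow> (x \<oplus> y) \<oplus> z = x \<oplus> (y \<oplus> z)"
    "\<And>x y. \<lbrakk>x \<in> carrier G; y \<in> carrier G\<rbrakk> \<Longrightarrow> x \<oplus> y = y \<oplus> x"
    "\<And>x. x \<in> carrier G \<Longrightarrow> \<zero> \<oplus> x = x"
    "\<And>x. x \<in> carrier G \<Longrightarrow> \<exists>y \<in> carrier G. y \<oplus> x = \<zero>"
  shows "abelian_group G"
  by (rule abelian_groupI) (use assms in auto)

lemma (in abelian_group) minus_eq_zero_iff:
  assumes "x \<in> carrier G" "y \<in> carrier G"
  shows "x \<ominus> y = \<zero> \<longleftrightarrow> x = y"
proof
  assume "x \<ominus> y = \<zero>"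
  then show "x = y" using assms minus_equality[of x "\<ominus> y"] by (simp add: minus_eq)
qed (use assms in \<open>simp add: minus_eq r_neg\<close>)

lemma (in abelian_group) diff_zero: "x \<in> carrier G \<Longrightarrow> x \<ominus> \<zero> = x"
  using minus_equality[of \<zero> \<zero>] by (simp add: minus_eq)

lemma set_addI: "x \<in> N \<Longrightarrow> y \<in> L \<Longrightarrow> x \<oplus>\<^bsub>M\<^esub> y \<in> N <+>\<^bsub>M\<^esub> L"
  unfolding set_add_def' by blast

lemma set_addE:
  assumes "x \<in> N <+>\<^bsub>M\<^esub> L"
  obtains y z where "y \<in> N" "z \<in> L" "x = y \<oplus>\<^bsub>M\<^esub> z"
  using assms unfolding set_add_def' by blast

context right_module
begin

lemma zero_ract: "a \<in> carrier R \<Longrightarrow> \<zero>\<^bsub>M\<^esub> \<cdot>\<^bsub>M\<^esub> a = \<zero>\<^bsub>M\<^esub>"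
  using ract_add_left[of "\<zero>\<^bsub>M\<^esub>" "\<zero>\<^bsub>M\<^esub>" a] ract_closed[of "\<zero>\<^bsub>M\<^esub>" a] M.add.l_cancel_one' by fastforce

lemma ract_zero: "x \<in> carrier M \<Longrightarrow> x \<cdot>\<^bsub>M\<^esub> \<zero>\<^bsub>R\<^esub> = \<zero>\<^bsub>M\<^esub>"
  using ract_add_right[of x "\<zero>\<^bsub>R\<^esub>" "\<zero>\<^bsub>R\<^esub>"] ract_closed[of x "\<zero>\<^bsub>R\<^esub>"] M.add.l_cancel_one' by fastforce

lemma ract_uminus: "x \<in> carrier M \<Longrightarrow> a \<in> carrier R \<Longrightarrow> x \<cdot>\<^bsub>M\<^esub> (\<ominus>\<^bsub>R\<^esub> a) = \<ominus>\<^bsub>M\<^esub> (x \<cdot>\<^bsub>M\<^esub> a)"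
  using ract_add_right[of x "\<ominus>\<^bsub>R\<^esub> a" a] ract_zero ract_closed R.l_neg
  by (metis M.minus_equality R.a_inv_closed)

lemma uminus_ract: "x \<in> carrier M \<Longrightarrow> a \<in> carrier R \<Longrightarrow> (\<ominus>\<^bsub>M\<^esub> x) \<cdot>\<^bsub>M\<^esub> a = \<ominus>\<^bsub>M\<^esub> (x \<cdot>\<^bsub>M\<^esub> a)"
  using ract_add_left[of "\<ominus>\<^bsub>M\<^esub> x" x a] zero_ract ract_closed M.l_neg
  by (metis M.minus_equality M.a_inv_closed)

lemma minus_ract: "x \<in> carrier M \<Longrightarrow> y \<in> carrier M \<Longrightarrow> a \<in> carrier R \<Longrightarrow>
    (x \<ominus>\<^bsub>M\<^esub> y) \<cdot>\<^bsub>M\<^esub> a = x \<cdot>\<^bsub>M\<^esub> a \<ominus>\<^bsub>M\<^esub> y \<cdot>\<^bsub>M\<^esub> a"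
  by (simp add: M.minus_eq ract_add_left uminus_ract)

text \<open>Because negation is an instance of the action, closure under sums and the action already
  gives closure under negation, and maps compatible with the action respect negation.\<close>

lemma uminus_eq_ract: "x \<in> carrier M \<Longrightarrow> \<ominus>\<^bsub>M\<^esub> x = x \<cdot>\<^bsub>M\<^esub> (\<ominus>\<^bsub>R\<^esub> \<one>\<^bsub>R\<^esub>)"
  by (simp add: ract_uminus ract_one)

lemma finsum_ract:
  assumes "finite I" "f \<in> I \<rightarrow> carrier M" "a \<in> carrier R"
  shows "(\<Oplus>\<^bsub>M\<^esub>i\<in>I. f i) \<cdot>\<^bsub>M\<^esub> a = (\<Oplus>\<^bsub>M\<^esub>i\<in>I. f i \<cdot>\<^bsub>M\<^esub> a)"
  using assms(1,2)
  by induction (use assms(3) in \<open>auto simp: zero_ract M.finsum_insert ract_add_left ract_closed M.finsum_closed Pi_iff\<close>)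

lemma ract_finsum:
  assumes "finite I" "f \<in> I \<rightarrow> carrier R" "x \<in> carrier M"
  shows "x \<cdot>\<^bsub>M\<^esub> (\<Oplus>\<^bsub>R\<^esub>i\<in>I. f i) = (\<Oplus>\<^bsub>M\<^esub>i\<in>I. x \<cdot>\<^bsub>M\<^esub> f i)"
  using assms(1,2)
  by induction (use assms(3) in \<open>auto simp: ract_zero M.finsum_insert R.finsum_insert ract_add_right ract_closed R.finsum_closed Pi_iff\<close>)

end

text \<open>The locale \<open>right_module\<close> allows record extensions, whereas submodules,
  homomorphisms and socles are defined for plain \<open>rmodule\<close> records only. Hence the
  specialised type.\<close>

locale rmod = right_module R M for R :: "('a, 'c) ring_scheme" (structure) and M :: "('a, 'b) rmodule" (structure)
begin

lemma rsubmoduleI: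
  assumes "N \<subseteq> carrier M" "\<zero>\<^bsub>M\<^esub> \<in> N" "\<And>x y. x \<in> N \<Longrightarrow> y \<in> N \<Longrightarrow> x \<oplus>\<^bsub>M\<^esub> y \<in> N"
    "\<And>x a. x \<in> N \<Longrightarrow> a \<in> carrier R \<Longrightarrow> x \<cdot>\<^bsub>M\<^esub> a \<in> N"
  shows "rsubmodule R M N"
  unfolding rsubmodule_def
proof
  have "\<ominus>\<^bsub>M\<^esub> x \<in> N" if "x \<in> N" for x
    using assms(1,4) that uminus_eq_ract[of x] by (metis R.a_inv_closed R.one_closed subsetD)
  then show "subgroup N (add_monoid M)"
    using assms by (intro M.add.subgroupI) (auto simp: a_inv_def)
qed (use assms in blast)

lemma rsubmoduleD:
  assumes "rsubmodule R M N"
  shows "N \<subseteq> carrier M" "\<zero>\<^bsub>M\<^esub> \<in> N" "\<And>x y. x \<in> N \<Longrightarrow> y \<in> N \<Longrightarrow> x \<oplus>\<^bsub>M\<^esub> y \<in> N"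
    "\<And>x. x \<in> N \<Longrightarrow> \<ominus>\<^bsub>M\<^esub> x \<in> N" "\<And>x y. x \<in> N \<Longrightarrow> y \<in> N \<Longrightarrow> x \<ominus>\<^bsub>M\<^esub> y \<in> N"
    "\<And>x a. x \<in> N \<Longrightarrow> a \<in> carrier R \<Longrightarrow> x \<cdot>\<^bsub>M\<^esub> a \<in> N"
proof -
  interpret subgroup N "add_monoid M" using assms unfolding rsubmodule_def by blast
  show s: "N \<subseteq> carrier M" "\<zero>\<^bsub>M\<^esub> \<in> N" and a: "\<And>x y. x \<in> N \<Longrightarrow> y \<in> N \<Longrightarrow> x \<oplus>\<^bsub>M\<^esub> y \<in> N"
    using subset one_closed m_closed by auto
  show i: "\<And>x. x \<in> N \<Longrightarrow> \<ominus>\<^bsub>M\<^esub> x \<in> N" using m_inv_closed by (auto simp: a_inv_def)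
  show "\<And>x y. x \<in> N \<Longrightarrow> y \<in> N \<Longrightarrow> x \<ominus>\<^bsub>M\<^esub> y \<in> N" using a i M.minus_eq by simp
  show "\<And>x a. x \<in> N \<Longrightarrow> a \<in> carrier R \<Longrightarrow> x \<cdot>\<^bsub>M\<^esub> a \<in> N" using assms unfolding rsubmodule_def by blast
qed

lemma rsubmodule_carrier: "rsubmodule R M (carrier M)"
  by (rule rsubmoduleI) (auto simp: ract_closed)

lemma rsubmodule_zero: "rsubmodule R M {\<zero>\<^bsub>M\<^esub>}"
  by (rule rsubmoduleI) (auto simp: zero_ract)

lemma rsubmodule_cyclic: "x \<in> carrier M \<Longrightarrow> rsubmodule R M {x \<cdot>\<^bsub>M\<^esub> a | a. a \<in> carrier R}"
proof (rule rsubmoduleI, goal_cases)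
  case 1 then show ?case by (auto simp: ract_closed)
next
  case 2 then show ?case using ract_zero by force
next
  case 3 then show ?case using ract_add_right by (auto simp del: R.add.m_comm) (metis R.a_closed)
next
  case 4 then show ?case using ract_assoc by auto (metis R.m_closed)
qed

lemma rsubmodule_Inter:
  assumes "\<And>N. N \<in> \<N> \<Longrightarrow> rsubmodule R M N" "\<N> \<noteq> {}"
  shows "rsubmodule R M (\<Inter>\<N>)"
proof (rule rsubmoduleI)
  show "\<Inter>\<N> \<subseteq> carrier M" using assms rsubmoduleD(1) by blast
  show "\<zero>\<^bsub>M\<^esub> \<in> \<Inter>\<N>" using assms(1) rsubmoduleD(2) by blast
  show "x \<oplus>\<^bsub>M\<^esub> y \<in> \<Inter>\<N>" if "x \<in> \<Inter>\<N>" "y \<in> \<Inter>\<N>" for x y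
    using that assms(1) rsubmoduleD(3) by (meson InterD InterI)
  show "x \<cdot>\<^bsub>M\<^esub> a \<in> \<Inter>\<N>" if "x \<in> \<Inter>\<N>" "a \<in> carrier R" for x a
    using that assms(1) rsubmoduleD(6) by (meson InterD InterI)
qed

lemma rsubmodule_sum:
  assumes N: "rsubmodule R M N" and L: "rsubmodule R M L"
  shows "rsubmodule R M (N <+>\<^bsub>M\<^esub> L)"
proof (rule rsubmoduleI)
  note n = rsubmoduleD[OF N] and l = rsubmoduleD[OF L]
  show "N <+>\<^bsub>M\<^esub> L \<subseteq> carrier M" using n(1) l(1) by (auto simp: set_add_def')
  show "\<zero>\<^bsub>M\<^esub> \<in> N <+>\<^bsub>M\<^esub> L" using n(2) l(2) M.l_zero[OF M.zero_closed] by (force simp: set_add_def')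
  show "x \<oplus>\<^bsub>M\<^esub> y \<in> N <+>\<^bsub>M\<^esub> L" if xy: "x \<in> N <+>\<^bsub>M\<^esub> L" "y \<in> N <+>\<^bsub>M\<^esub> L" for x y
  proof -
    obtain p q p' q' where e: "p \<in> N" "q \<in> L" "p' \<in> N" "q' \<in> L" "x = p \<oplus>\<^bsub>M\<^esub> q" "y = p' \<oplus>\<^bsub>M\<^esub> q'"
      using xy unfolding set_add_def' by blast
    then have "x \<oplus>\<^bsub>M\<^esub> y = (p \<oplus>\<^bsub>M\<^esub> p') \<oplus>\<^bsub>M\<^esub> (q \<oplus>\<^bsub>M\<^esub> q')" using n(1) l(1) by (auto simp: M.a_ac subset_iff)
    then show ?thesis using set_addI[OF n(3)[OF e(1,3)] l(3)[OF e(2,4)]] by simp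
  qed
  show "x \<cdot>\<^bsub>M\<^esub> a \<in> N <+>\<^bsub>M\<^esub> L" if xa: "x \<in> N <+>\<^bsub>M\<^esub> L" "a \<in> carrier R" for x a
  proof -
    obtain p q where e: "p \<in> N" "q \<in> L" "x = p \<oplus>\<^bsub>M\<^esub> q" using xa(1) by (rule set_addE)
    then have "x \<cdot>\<^bsub>M\<^esub> a = p \<cdot>\<^bsub>M\<^esub> a \<oplus>\<^bsub>M\<^esub> q \<cdot>\<^bsub>M\<^esub> a" using n(1) l(1) xa(2) by (auto simp: ract_add_left subset_iff)
    then show ?thesis using set_addI[OF n(6)[OF e(1) xa(2)] l(6)[OF e(2) xa(2)]] by simp
  qed
qed

lemma submodule_right_module:
  assumes "rsubmodule R M N"
  shows "right_module R (M\<lparr>carrier := N\<rparr>)"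
proof -
  note N = rsubmoduleD[OF assms]
  have "abelian_group (M\<lparr>carrier := N\<rparr>)"
  proof (rule abelian_groupI', goal_cases)
    case (6 x)
    then show ?case using N(4)[of x] N(1) M.l_neg[of x] by force
  qed (use N(1-3) in \<open>auto simp: M.a_ac subset_iff\<close>)
  then show ?thesis
    by (intro right_module.intro right_module_axioms.intro R.ring_axioms)
      (use N(1,6) in \<open>auto simp: subset_iff ract_add_left ract_add_right ract_assoc ract_one\<close>)
qed

lemma rsubmodule_restrict_iff:
  assumes "rsubmodule R M N"
  shows "rsubmodule R (M\<lparr>carrier := N\<rparr>) L \<longleftrightarrow> rsubmodule R M L \<and> L \<subseteq> N"
proof -
  interpret N: rmod R "M\<lparr>carrier := N\<rparr>" using submodule_right_module[OF assms] by (rule rmod.intro)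
  show ?thesis
  proof
    assume L: "rsubmodule R (M\<lparr>carrier := N\<rparr>) L"
    show "rsubmodule R M L \<and> L \<subseteq> N"
    proof
      show "L \<subseteq> N" using N.rsubmoduleD(1)[OF L] by simp
      then show "rsubmodule R M L"
        using N.rsubmoduleD(2,3,6)[OF L] rsubmoduleD(1)[OF assms] by (intro rsubmoduleI) auto
    qed
  next
    assume L: "rsubmodule R M L \<and> L \<subseteq> N"
    then show "rsubmodule R (M\<lparr>carrier := N\<rparr>) L"
      using rsubmoduleD(2,3,6)[of L] by (intro N.rsubmoduleI) auto
  qed
qed

end

lemma rmod_homD:
  assumes "h \<in> rmod_hom R M N"
  shows "x \<in> carrier M \<Longrightarrow> h x \<in> carrier N"
    "\<lbrakk>x \<in> carrier M; y \<in> carrier M\<rbrakk> \<Longrightarrow> h (x \<oplus>\<^bsub>M\<^esub> y) = h x \<oplus>\<^bsub>N\<^esub> h y"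
    "\<lbrakk>x \<in> carrier M; a \<in> carrier R\<rbrakk> \<Longrightarrow> h (x \<cdot>\<^bsub>M\<^esub> a) = h x \<cdot>\<^bsub>N\<^esub> a"
  using assms unfolding rmod_hom_def by auto

lemma rmod_homI:
  assumes "\<And>x. x \<in> carrier M \<Longrightarrow> h x \<in> carrier N"
    "\<And>x y. \<lbrakk>x \<in> carrier M; y \<in> carrier M\<rbrakk> \<Longrightarrow> h (x \<oplus>\<^bsub>M\<^esub> y) = h x \<oplus>\<^bsub>N\<^esub> h y"
    "\<And>x a. \<lbrakk>x \<in> carrier M; a \<in> carrier R\<rbrakk> \<Longrightarrow> h (x \<cdot>\<^bsub>M\<^esub> a) = h x \<cdot>\<^bsub>N\<^esub> a"
  shows "h \<in> rmod_hom R M N"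
  using assms unfolding rmod_hom_def by auto

lemma rmod_hom_compose:
  assumes "f \<in> rmod_hom R L M" "g \<in> rmod_hom R M N"
  shows "(\<lambda>x. g (f x)) \<in> rmod_hom R L N"
  by (rule rmod_homI) (use rmod_homD[OF assms(1)] rmod_homD[OF assms(2)] in auto)

lemma rmod_hom_restrict:
  assumes "right_module R M" "h \<in> rmod_hom R M N" shows "restrict h (carrier M) \<in> rmod_hom R M N"
proof -
  interpret right_module R M by fact
  show ?thesis by (rule rmod_homI) (use rmod_homD[OF assms(2)] ract_closed in auto)
qed

lemma rmod_hom_zero:
  assumes "right_module R M" "right_module R N" "h \<in> rmod_hom R M N"
  shows "h \<zero>\<^bsub>M\<^esub> = \<zero>\<^bsub>N\<^esub>"
proof -
  interpret M: right_module R M by fact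
  interpret N: right_module R N by fact
  have "h \<zero>\<^bsub>M\<^esub> = h (\<zero>\<^bsub>M\<^esub> \<cdot>\<^bsub>M\<^esub> \<zero>\<^bsub>R\<^esub>)" by (simp add: M.zero_ract)
  also have "\<dots> = \<zero>\<^bsub>N\<^esub>" using rmod_homD[OF assms(3)] by (simp add: N.ract_zero)
  finally show ?thesis .
qed

lemma rmod_hom_uminus:
  assumes "right_module R M" "right_module R N" "h \<in> rmod_hom R M N" "x \<in> carrier M"
  shows "h (\<ominus>\<^bsub>M\<^esub> x) = \<ominus>\<^bsub>N\<^esub> h x"
proof -
  interpret M: right_module R M by fact
  interpret N: right_module R N by fact
  show ?thesis using rmod_homD[OF assms(3)] assms(4) by (simp add: M.uminus_eq_ract N.uminus_eq_ract)
qed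

lemma rmod_hom_minus:
  assumes "right_module R M" "right_module R N" "h \<in> rmod_hom R M N" "x \<in> carrier M" "y \<in> carrier M"
  shows "h (x \<ominus>\<^bsub>M\<^esub> y) = h x \<ominus>\<^bsub>N\<^esub> h y"
proof -
  interpret M: right_module R M by fact
  interpret N: right_module R N by fact
  show ?thesis using rmod_homD[OF assms(3)] assms(4,5) rmod_hom_uminus[OF assms(1-3)]
    by (simp add: M.M.minus_eq N.M.minus_eq)
qed

lemma rmod_hom_finsum:
  assumes "right_module R M" "right_module R N" "h \<in> rmod_hom R M N" "finite I" "f \<in> I \<rightarrow> carrier M"
  shows "h (\<Oplus>\<^bsub>M\<^esub>i\<in>I. f i) = (\<Oplus>\<^bsub>N\<^esub>i\<in>I. h (f i))"
proof -
  interpret M: right_module R M by fact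
  interpret N: right_module R N by fact
  show ?thesis using assms(4,5)
    by induction (use rmod_homD[OF assms(3)] rmod_hom_zero[OF assms(1-3)] in
      \<open>auto simp: M.M.finsum_insert N.M.finsum_insert M.M.finsum_closed Pi_iff\<close>)
qed

lemma rmod_hom_inj_iff:
  assumes "right_module R M" "right_module R N" "h \<in> rmod_hom R M N"
  shows "inj_on h (carrier M) \<longleftrightarrow> (\<forall>x \<in> carrier M. h x = \<zero>\<^bsub>N\<^esub> \<longrightarrow> x = \<zero>\<^bsub>M\<^esub>)"
proof -
  interpret M: right_module R M by fact
  interpret N: right_module R N by fact
  show ?thesis
  proof
    assume "inj_on h (carrier M)"
    then show "\<forall>x \<in> carrier M. h x = \<zero>\<^bsub>N\<^esub> \<longrightarrow> x = \<zero>\<^bsub>M\<^esub>"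
      using rmod_hom_zero[OF assms] by (metis M.M.zero_closed inj_onD)
  next
    assume k: "\<forall>x \<in> carrier M. h x = \<zero>\<^bsub>N\<^esub> \<longrightarrow> x = \<zero>\<^bsub>M\<^esub>"
    show "inj_on h (carrier M)"
    proof (rule inj_onI)
      fix x y assume xy: "x \<in> carrier M" "y \<in> carrier M" "h x = h y"
      then have "h (x \<ominus>\<^bsub>M\<^esub> y) = \<zero>\<^bsub>N\<^esub>"
        using rmod_hom_minus[OF assms] rmod_homD(1)[OF assms(3)] N.M.minus_eq_zero_iff by auto
      then show "x = y" using k xy M.M.minus_eq_zero_iff by auto
    qed
  qed
qed

lemma rmod_hom_inv_into:
  assumes "right_module R M" "right_module R N" "h \<in> rmod_hom R M N" "bij_betw h (carrier M) (carrier N)"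
  shows "inv_into (carrier M) h \<in> rmod_hom R N M"
proof -
  interpret M: right_module R M by fact
  interpret N: right_module R N by fact
  let ?g = "inv_into (carrier M) h"
  have g: "?g y \<in> carrier M" "h (?g y) = y" if "y \<in> carrier N" for y
    using assms(4) that by (auto simp: bij_betw_def inv_into_into f_inv_into_f)
  have e: "?g y = x" if "x \<in> carrier M" "h x = y" for x y
    using assms(4) that by (auto simp: bij_betw_def)
  show ?thesis
    by (rule rmod_homI) (use g rmod_homD[OF assms(3)] M.ract_closed in \<open>auto intro!: e\<close>)
qed

lemma rmod_isomorphic_sym:
  assumes "right_module R M" "right_module R N" "rmod_isomorphic R M N"
  shows "rmod_isomorphic R N M"
  using assms rmod_hom_inv_into bij_betw_inv_into unfolding rmod_isomorphic_def by blast

lemma rmod_isomorphic_trans: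
  assumes "rmod_isomorphic R L M" "rmod_isomorphic R M N"
  shows "rmod_isomorphic R L N"
proof -
  obtain f g where f: "f \<in> rmod_hom R L M" "bij_betw f (carrier L) (carrier M)"
    and g: "g \<in> rmod_hom R M N" "bij_betw g (carrier M) (carrier N)"
    using assms unfolding rmod_isomorphic_def by blast
  then show ?thesis unfolding rmod_isomorphic_def
    using rmod_hom_compose[OF f(1) g(1)] bij_betw_trans[OF f(2) g(2)] by (auto simp: comp_def)
qed

subsection \<open>Images, quotients and transport of modules\<close>

text \<open>Pushes the structure of M forward along \<phi> by computing with chosen preimages. One
  construction serves two purposes: an injective \<phi> yields a copy of M in another universe, a
  \<phi> whose fibres are the cosets of a submodule yields a quotient.\<close>

definition image_rmod :: "('b \<Rightarrow> 'v) \<Rightarrow> ('a, 'b) rmodule \<Rightarrow> ('a, 'v) rmodule" where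
  "image_rmod \<phi> M = \<lparr>carrier = \<phi> ` carrier M, monoid.mult = undefined, one = undefined,
     zero = \<phi> \<zero>\<^bsub>M\<^esub>,
     add = (\<lambda>p q. \<phi> (inv_into (carrier M) \<phi> p \<oplus>\<^bsub>M\<^esub> inv_into (carrier M) \<phi> q)),
     ract = (\<lambda>p a. \<phi> (inv_into (carrier M) \<phi> p \<cdot>\<^bsub>M\<^esub> a))\<rparr>"

lemma carrier_image_rmod [simp]: "carrier (image_rmod \<phi> M) = \<phi> ` carrier M"
  by (simp add: image_rmod_def)

lemma zero_image_rmod [simp]: "\<zero>\<^bsub>image_rmod \<phi> M\<^esub> = \<phi> \<zero>\<^bsub>M\<^esub>"
  by (simp add: image_rmod_def)

context rmod
begin

text \<open>Another choice of preimages changes the arguments by elements of N, and then also the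
  result, since N is closed under sums and the action.\<close>

lemma image_rmod:
  fixes \<phi> :: "'b \<Rightarrow> 'v"
  assumes N: "rsubmodule R M N"
    and \<phi>: "\<And>x y. \<lbrakk>x \<in> carrier M; y \<in> carrier M\<rbrakk> \<Longrightarrow> \<phi> x = \<phi> y \<longleftrightarrow> x \<ominus>\<^bsub>M\<^esub> y \<in> N"
  shows "right_module R (image_rmod \<phi> M)" "\<phi> \<in> rmod_hom R M (image_rmod \<phi> M)"
proof -
  note N = rsubmoduleD[OF N]
  define \<rho> where "\<rho> = inv_into (carrier M) \<phi>"
  have \<rho>: "\<rho> p \<in> carrier M" "\<phi> (\<rho> p) = p" if "p \<in> \<phi> ` carrier M" for p
    using that unfolding \<rho>_def by (simp_all add: inv_into_into f_inv_into_f)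
  have add: "\<phi> x \<oplus>\<^bsub>image_rmod \<phi> M\<^esub> \<phi> y = \<phi> (x \<oplus>\<^bsub>M\<^esub> y)" if xy: "x \<in> carrier M" "y \<in> carrier M" for x y
  proof -
    have r: "\<rho> (\<phi> x) \<in> carrier M" "\<rho> (\<phi> y) \<in> carrier M" "\<rho> (\<phi> x) \<ominus>\<^bsub>M\<^esub> x \<in> N" "\<rho> (\<phi> y) \<ominus>\<^bsub>M\<^esub> y \<in> N"
      using \<rho>[of "\<phi> x"] \<rho>[of "\<phi> y"] xy \<phi> by auto
    have "(\<rho> (\<phi> x) \<oplus>\<^bsub>M\<^esub> \<rho> (\<phi> y)) \<ominus>\<^bsub>M\<^esub> (x \<oplus>\<^bsub>M\<^esub> y) = (\<rho> (\<phi> x) \<ominus>\<^bsub>M\<^esub> x) \<oplus>\<^bsub>M\<^esub> (\<rho> (\<phi> y) \<ominus>\<^bsub>M\<^esub> y)"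
      using r xy by (simp add: M.minus_eq M.minus_add M.a_ac)
    then have "\<phi> (\<rho> (\<phi> x) \<oplus>\<^bsub>M\<^esub> \<rho> (\<phi> y)) = \<phi> (x \<oplus>\<^bsub>M\<^esub> y)" using \<phi> r xy N(3) by simp
    then show ?thesis unfolding image_rmod_def by (simp add: \<rho>_def)
  qed
  have act: "\<phi> x \<cdot>\<^bsub>image_rmod \<phi> M\<^esub> a = \<phi> (x \<cdot>\<^bsub>M\<^esub> a)" if x: "x \<in> carrier M" "a \<in> carrier R" for x a
  proof -
    have r: "\<rho> (\<phi> x) \<in> carrier M" "\<rho> (\<phi> x) \<ominus>\<^bsub>M\<^esub> x \<in> N" using \<rho>[of "\<phi> x"] x \<phi> by auto
    have "\<rho> (\<phi> x) \<cdot>\<^bsub>M\<^esub> a \<ominus>\<^bsub>M\<^esub> x \<cdot>\<^bsub>M\<^esub> a = (\<rho> (\<phi> x) \<ominus>\<^bsub>M\<^esub> x) \<cdot>\<^bsub>M\<^esub> a" using r x by (simp add: minus_ract)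
    then have "\<phi> (\<rho> (\<phi> x) \<cdot>\<^bsub>M\<^esub> a) = \<phi> (x \<cdot>\<^bsub>M\<^esub> a)" using \<phi> r x N(6) ract_closed by simp
    then show ?thesis unfolding image_rmod_def by (simp add: \<rho>_def)
  qed
  have c: "carrier (image_rmod \<phi> M) = \<phi> ` carrier M" "\<zero>\<^bsub>image_rmod \<phi> M\<^esub> = \<phi> \<zero>\<^bsub>M\<^esub>"
    by simp_all
  have "abelian_group (image_rmod \<phi> M)"
  proof (rule abelian_groupI', goal_cases)
    case (6 p)
    then obtain x where "p = \<phi> x" "x \<in> carrier M" by (auto simp: c)
    then show ?case using add[of "\<ominus>\<^bsub>M\<^esub> x" x] by (auto simp: c M.l_neg intro!: bexI[of _ "\<ominus>\<^bsub>M\<^esub> x"])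
  qed (auto simp: c add M.a_ac)
  then show "right_module R (image_rmod \<phi> M)"
    by (intro right_module.intro right_module_axioms.intro R.ring_axioms)
      (auto simp: c add act ract_closed ract_add_left ract_add_right ract_assoc ract_one)
  show "\<phi> \<in> rmod_hom R M (image_rmod \<phi> M)"
    by (rule rmod_homI) (auto simp: c act add)
qed

end

context rmod
begin

lemma transport:
  assumes "inj_on \<iota> (carrier M)"
  shows "right_module R (image_rmod \<iota> M)" "\<iota> \<in> rmod_hom R M (image_rmod \<iota> M)"
    "bij_betw \<iota> (carrier M) (carrier (image_rmod \<iota> M))" "rmod_isomorphic R M (image_rmod \<iota> M)"
proof -
  have *: "\<iota> x = \<iota> y \<longleftrightarrow> x \<ominus>\<^bsub>M\<^esub> y \<in> {\<zero>\<^bsub>M\<^esub>}" if "x \<in> carrier M" "y \<in> carrier M" for x y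
    using that inj_onD[OF assms, of x y] M.minus_eq_zero_iff[of x y] by auto
  show "right_module R (image_rmod \<iota> M)" and h: "\<iota> \<in> rmod_hom R M (image_rmod \<iota> M)"
    using image_rmod[OF rsubmodule_zero *] by blast+
  show b: "bij_betw \<iota> (carrier M) (carrier (image_rmod \<iota> M))" using assms by (simp add: bij_betw_def)
  show "rmod_isomorphic R M (image_rmod \<iota> M)" using h b unfolding rmod_isomorphic_def by blast
qed

text \<open>The quotient is carried by one representative of each coset, so it fits into any
  universe that has room for M itself.\<close>

lemma quotient_exists:
  fixes \<iota> :: "'b \<Rightarrow> 'v"
  assumes N: "rsubmodule R M N" and \<iota>: "inj_on \<iota> (carrier M)"
  obtains Q :: "('a, 'v) rmodule" and \<pi> where "right_module R Q" "\<pi> \<in> rmod_hom R M Q" "\<pi> ` carrier M = carrier Q"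
    "\<And>x. x \<in> carrier M \<Longrightarrow> \<pi> x = \<zero>\<^bsub>Q\<^esub> \<longleftrightarrow> x \<in> N"
proof -
  note N' = rsubmoduleD[OF N]
  define \<rho> where "\<rho> x = (SOME y. y \<in> carrier M \<and> x \<ominus>\<^bsub>M\<^esub> y \<in> N)" for x
  have \<rho>: "\<rho> x \<in> carrier M \<and> x \<ominus>\<^bsub>M\<^esub> \<rho> x \<in> N" if "x \<in> carrier M" for x
    unfolding \<rho>_def by (rule someI[of _ x]) (use that N' in \<open>simp add: M.minus_eq M.r_neg\<close>)
  have *: "\<iota> (\<rho> x) = \<iota> (\<rho> y) \<longleftrightarrow> x \<ominus>\<^bsub>M\<^esub> y \<in> N" if xy: "x \<in> carrier M" "y \<in> carrier M" for x y
  proof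
    assume "\<iota> (\<rho> x) = \<iota> (\<rho> y)"
    then have e: "\<rho> x = \<rho> y" using \<rho> xy inj_onD[OF \<iota>] by blast
    have c: "(x \<ominus>\<^bsub>M\<^esub> z) \<ominus>\<^bsub>M\<^esub> (y \<ominus>\<^bsub>M\<^esub> z) = x \<ominus>\<^bsub>M\<^esub> y" if "z \<in> carrier M" for z
    proof -
      have "(x \<ominus>\<^bsub>M\<^esub> z) \<ominus>\<^bsub>M\<^esub> (y \<ominus>\<^bsub>M\<^esub> z) = x \<oplus>\<^bsub>M\<^esub> \<ominus>\<^bsub>M\<^esub> y \<oplus>\<^bsub>M\<^esub> (z \<oplus>\<^bsub>M\<^esub> \<ominus>\<^bsub>M\<^esub> z)"
        using xy that by (simp add: M.minus_eq M.minus_add M.a_ac)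
      also have "\<dots> = x \<ominus>\<^bsub>M\<^esub> y" using xy that M.r_neg[OF that] by (simp add: M.minus_eq)
      finally show ?thesis .
    qed
    show "x \<ominus>\<^bsub>M\<^esub> y \<in> N"
      using N'(5)[of "x \<ominus>\<^bsub>M\<^esub> \<rho> x" "y \<ominus>\<^bsub>M\<^esub> \<rho> y"] \<rho>[OF xy(1)] \<rho>[OF xy(2)] c[of "\<rho> y"] e by simp
  next
    assume d: "x \<ominus>\<^bsub>M\<^esub> y \<in> N"
    have "x \<ominus>\<^bsub>M\<^esub> z \<in> N \<longleftrightarrow> y \<ominus>\<^bsub>M\<^esub> z \<in> N" if z: "z \<in> carrier M" for z
    proof -
      have a: "x \<ominus>\<^bsub>M\<^esub> z = (x \<ominus>\<^bsub>M\<^esub> y) \<oplus>\<^bsub>M\<^esub> (y \<ominus>\<^bsub>M\<^esub> z)"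
      proof -
        have "(x \<ominus>\<^bsub>M\<^esub> y) \<oplus>\<^bsub>M\<^esub> (y \<ominus>\<^bsub>M\<^esub> z) = x \<oplus>\<^bsub>M\<^esub> \<ominus>\<^bsub>M\<^esub> z \<oplus>\<^bsub>M\<^esub> (y \<oplus>\<^bsub>M\<^esub> \<ominus>\<^bsub>M\<^esub> y)"
          using xy z by (simp add: M.minus_eq M.a_ac)
        then show ?thesis using xy z M.r_neg[OF xy(2)] by (simp add: M.minus_eq)
      qed
      have b: "y \<ominus>\<^bsub>M\<^esub> z = (x \<ominus>\<^bsub>M\<^esub> z) \<ominus>\<^bsub>M\<^esub> (x \<ominus>\<^bsub>M\<^esub> y)"
      proof -
        have "(x \<ominus>\<^bsub>M\<^esub> z) \<ominus>\<^bsub>M\<^esub> (x \<ominus>\<^bsub>M\<^esub> y) = y \<oplus>\<^bsub>M\<^esub> \<ominus>\<^bsub>M\<^esub> z \<oplus>\<^bsub>M\<^esub> (x \<oplus>\<^bsub>M\<^esub> \<ominus>\<^bsub>M\<^esub> x)"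
          using xy z by (simp add: M.minus_eq M.minus_add M.a_ac)
        then show ?thesis using xy z M.r_neg[OF xy(1)] by (simp add: M.minus_eq)
      qed
      show ?thesis using a b d N'(3,5) by metis
    qed
    \<comment> \<open>Elements of the same coset satisfy the same predicate under
      \<open>SOME\<close>, so the choices coincide.\<close>
    then have "\<rho> x = \<rho> y" unfolding \<rho>_def by (metis (mono_tags, lifting))
    then show "\<iota> (\<rho> x) = \<iota> (\<rho> y)" by simp
  qed
  note q = image_rmod[OF N, of "\<lambda>x. \<iota> (\<rho> x)", OF *]
  show thesis
  proof (rule that[OF q])
    show "\<iota> (\<rho> x) = \<zero>\<^bsub>image_rmod (\<lambda>x. \<iota> (\<rho> x)) M\<^esub> \<longleftrightarrow> x \<in> N" if "x \<in> carrier M" for x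
      using *[of x "\<zero>\<^bsub>M\<^esub>"] that by (simp add: M.diff_zero)
  qed auto
qed

lemma rsubmodule_kernel:
  assumes "right_module R N" "h \<in> rmod_hom R M N" "rsubmodule R N L"
  shows "rsubmodule R M {x \<in> carrier M. h x \<in> L}"
proof -
  interpret N: rmod R N using assms(1) by (rule rmod.intro)
  show ?thesis
    by (rule rsubmoduleI)
      (use N.rsubmoduleD[OF assms(3)] rmod_homD[OF assms(2)] rmod_hom_zero[OF right_module_axioms assms(1,2)] ract_closed in auto)
qed

lemma rsubmodule_Union_chain:
  assumes "subset.chain {N. rsubmodule R M N} C" "C \<noteq> {}"
  shows "rsubmodule R M (\<Union>C)"
proof -
  have sub: "rsubmodule R M N" if "N \<in> C" for N using assms(1) that unfolding subset.chain_def by blast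
  show ?thesis
  proof (rule rsubmoduleI)
    show "\<Union>C \<subseteq> carrier M" using rsubmoduleD(1)[OF sub] by blast
    show "\<zero>\<^bsub>M\<^esub> \<in> \<Union>C" using rsubmoduleD(2)[OF sub] assms(2) by blast
    show "x \<oplus>\<^bsub>M\<^esub> y \<in> \<Union>C" if xy: "x \<in> \<Union>C" "y \<in> \<Union>C" for x y
    proof -
      obtain N1 N2 where N: "N1 \<in> C" "x \<in> N1" "N2 \<in> C" "y \<in> N2" using xy by blast
      then have "N1 \<subseteq> N2 \<or> N2 \<subseteq> N1" using assms(1) unfolding subset.chain_def by blast
      then obtain N where "N \<in> C" "x \<in> N" "y \<in> N" using N by blast
      then show ?thesis using rsubmoduleD(3)[OF sub] by blast
    qed
    show "x \<cdot>\<^bsub>M\<^esub> a \<in> \<Union>C" if "x \<in> \<Union>C" "a \<in> carrier R" for x a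
      using that rsubmoduleD(6)[OF sub] by blast
  qed
qed

text \<open>The hypothesis says that cyclic submodules are simple or zero.\<close>

lemma complement_exists:
  assumes inv: "\<And>v a. \<lbrakk>v \<in> carrier M; a \<in> carrier R; v \<cdot>\<^bsub>M\<^esub> a \<noteq> \<zero>\<^bsub>M\<^esub>\<rbrakk> \<Longrightarrow> \<exists>b \<in> carrier R. v \<cdot>\<^bsub>M\<^esub> a \<cdot>\<^bsub>M\<^esub> b = v"
    and N: "rsubmodule R M N"
  obtains L where "rsubmodule R M L" "N \<inter> L = {\<zero>\<^bsub>M\<^esub>}" "N <+>\<^bsub>M\<^esub> L = carrier M"
proof -
  note N' = rsubmoduleD[OF N]
  let ?A = "{L. rsubmodule R M L \<and> N \<inter> L = {\<zero>\<^bsub>M\<^esub>}}"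
  \<comment> \<open>A complement is sought as a maximal submodule among those meeting N only in
    zero.\<close>
  have "\<exists>L\<in>?A. \<forall>X\<in>?A. L \<subseteq> X \<longrightarrow> X = L"
  proof (rule subset_Zorn_nonempty)
    show "?A \<noteq> {}" using rsubmodule_zero N' by blast
    fix C assume C: "C \<noteq> {}" "subset.chain ?A C"
    then have u: "rsubmodule R M (\<Union>C)" by (intro rsubmodule_Union_chain) (auto simp: subset.chain_def)
    have "N \<inter> X = {\<zero>\<^bsub>M\<^esub>}" if "X \<in> C" for X using C(2) that unfolding subset.chain_def by auto
    then have "N \<inter> \<Union>C = {\<zero>\<^bsub>M\<^esub>}" using C(1) by auto
    with u show "\<Union>C \<in> ?A" by simp
  qed
  then obtain L where LA: "L \<in> ?A" and LX: "\<forall>X\<in>?A. L \<subseteq> X \<longrightarrow> X = L" by (rule bexE)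
  have L: "rsubmodule R M L" "N \<inter> L = {\<zero>\<^bsub>M\<^esub>}" using LA by simp_all
  have max: "X = L" if "rsubmodule R M X" "N \<inter> X = {\<zero>\<^bsub>M\<^esub>}" "L \<subseteq> X" for X
    by (rule LX[rule_format]) (use that in simp_all)
  note L' = rsubmoduleD[OF L(1)]
  have NL: "rsubmodule R M (N <+>\<^bsub>M\<^esub> L)" by (rule rsubmodule_sum[OF N L(1)])
  note NL' = rsubmoduleD[OF NL]
  have "v \<in> N <+>\<^bsub>M\<^esub> L" if v: "v \<in> carrier M" for v
  proof (rule ccontr)
    assume nv: "v \<notin> N <+>\<^bsub>M\<^esub> L"
    let ?V = "{v \<cdot>\<^bsub>M\<^esub> a | a. a \<in> carrier R}"
    have V: "rsubmodule R M ?V" by (rule rsubmodule_cyclic[OF v])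
    have s: "rsubmodule R M (L <+>\<^bsub>M\<^esub> ?V)" by (rule rsubmodule_sum[OF L(1) V])
    \<comment> \<open>If v is missing from N + L, then L + vR still meets N trivially: an equation n
      = l + va puts va into N + L, and if va were nonzero the hypothesis would bring v = vab there
      as well. This contradicts the maximality of L.\<close>
    have "N \<inter> (L <+>\<^bsub>M\<^esub> ?V) \<subseteq> {\<zero>\<^bsub>M\<^esub>}"
    proof
      fix n assume n: "n \<in> N \<inter> (L <+>\<^bsub>M\<^esub> ?V)"
      then obtain l a where la: "l \<in> L" "a \<in> carrier R" "n = l \<oplus>\<^bsub>M\<^esub> v \<cdot>\<^bsub>M\<^esub> a" by (blast elim: set_addE)
      have va: "v \<cdot>\<^bsub>M\<^esub> a \<in> carrier M" using v la ract_closed by blast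
      have c: "n \<in> carrier M" "l \<in> carrier M" using n la N'(1) L'(1) by auto
      have "v \<cdot>\<^bsub>M\<^esub> a = n \<oplus>\<^bsub>M\<^esub> \<ominus>\<^bsub>M\<^esub> l" using c va la(3) M.r_neg1[of l "v \<cdot>\<^bsub>M\<^esub> a"] by (simp add: M.a_ac)
      then have w: "v \<cdot>\<^bsub>M\<^esub> a \<in> N <+>\<^bsub>M\<^esub> L" using n L'(4)[OF la(1)] by (simp add: set_addI)
      have "v \<cdot>\<^bsub>M\<^esub> a = \<zero>\<^bsub>M\<^esub>"
      proof (rule ccontr)
        assume "v \<cdot>\<^bsub>M\<^esub> a \<noteq> \<zero>\<^bsub>M\<^esub>"
        then obtain b where "b \<in> carrier R" "v \<cdot>\<^bsub>M\<^esub> a \<cdot>\<^bsub>M\<^esub> b = v" using inv v la by blast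
        then show False using NL'(6)[OF w] nv by metis
      qed
      then show "n \<in> {\<zero>\<^bsub>M\<^esub>}" using la c n L(2) by auto
    qed
    moreover have "\<zero>\<^bsub>M\<^esub> \<in> N \<inter> (L <+>\<^bsub>M\<^esub> ?V)" using rsubmoduleD(2)[OF s] N' by blast
    moreover have "l \<in> L <+>\<^bsub>M\<^esub> ?V" if "l \<in> L" for l
    proof -
      have "l \<oplus>\<^bsub>M\<^esub> \<zero>\<^bsub>M\<^esub> \<in> L <+>\<^bsub>M\<^esub> ?V" by (rule set_addI[OF that rsubmoduleD(2)[OF V]])
      then show ?thesis using subsetD[OF L'(1) that] by simp
    qed
    ultimately have e: "L <+>\<^bsub>M\<^esub> ?V = L" using s by (intro max) auto
    have "v \<in> ?V" using ract_one[OF v] by force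
    then have "\<zero>\<^bsub>M\<^esub> \<oplus>\<^bsub>M\<^esub> v \<in> L <+>\<^bsub>M\<^esub> ?V" by (rule set_addI[OF L'(2)])
    then have "v \<in> L" unfolding e using v by simp
    then have "\<zero>\<^bsub>M\<^esub> \<oplus>\<^bsub>M\<^esub> v \<in> N <+>\<^bsub>M\<^esub> L" by (rule set_addI[OF N'(2)])
    then show False using nv v by simp
  qed
  then have "N <+>\<^bsub>M\<^esub> L = carrier M" using NL'(1) by blast
  then show thesis using that L by blast
qed

text \<open>Take N maximal among the submodules that contain N0 and avoid x; then the image of x
  generates a simple submodule of M/N. In general S is therefore a submodule of a quotient, which is
  why its carrier is only contained in the image of \<pi>.\<close>

lemma simple_quotient:
  fixes \<iota> :: "'b \<Rightarrow> 'v"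
  assumes N0: "rsubmodule R M N0" and x: "x \<in> carrier M" "x \<notin> N0" and \<iota>: "inj_on \<iota> (carrier M)"
  obtains S :: "('a, 'v) rmodule" and \<pi> where "simple_rmodule R S" "carrier S \<subseteq> \<pi> ` carrier M"
    "\<And>y a. \<lbrakk>y \<in> carrier M; a \<in> carrier R\<rbrakk> \<Longrightarrow> \<pi> y \<cdot>\<^bsub>S\<^esub> a = \<pi> (y \<cdot>\<^bsub>M\<^esub> a)"
    "\<And>y. y \<in> N0 \<Longrightarrow> \<pi> y = \<zero>\<^bsub>S\<^esub>" "\<pi> x \<in> carrier S" "\<pi> x \<noteq> \<zero>\<^bsub>S\<^esub>"
proof -
  let ?A = "{N. rsubmodule R M N \<and> N0 \<subseteq> N \<and> x \<notin> N}"
  have "\<exists>L\<in>?A. \<forall>X\<in>?A. L \<subseteq> X \<longrightarrow> X = L"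
  proof (rule subset_Zorn_nonempty)
    show "?A \<noteq> {}" using assms by blast
    fix C assume C: "C \<noteq> {}" "subset.chain ?A C"
    then have u: "rsubmodule R M (\<Union>C)" by (intro rsubmodule_Union_chain) (auto simp: subset.chain_def)
    have "N0 \<subseteq> X \<and> x \<notin> X" if "X \<in> C" for X using C(2) that unfolding subset.chain_def by auto
    then have "N0 \<subseteq> \<Union>C" "x \<notin> \<Union>C" using C(1) by auto
    with u show "\<Union>C \<in> ?A" by simp
  qed
  then obtain N where NA: "N \<in> ?A" and NX: "\<forall>X\<in>?A. N \<subseteq> X \<longrightarrow> X = N" by (rule bexE)
  have N: "rsubmodule R M N" "N0 \<subseteq> N" "x \<notin> N" using NA by simp_all
  have max: "X = N" if "rsubmodule R M X" "N0 \<subseteq> X" "x \<notin> X" "N \<subseteq> X" for X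
    by (rule NX[rule_format]) (use that in simp_all)
  obtain Q :: "('a, 'v) rmodule" and \<pi> where Q: "right_module R Q" "\<pi> \<in> rmod_hom R M Q" "\<pi> ` carrier M = carrier Q"
    and ker: "\<And>x. x \<in> carrier M \<Longrightarrow> \<pi> x = \<zero>\<^bsub>Q\<^esub> \<longleftrightarrow> x \<in> N"
    using quotient_exists[OF N(1) \<iota>] by metis
  interpret Q: rmod R Q using Q(1) by (rule rmod.intro)
  let ?C = "{\<pi> x \<cdot>\<^bsub>Q\<^esub> a | a. a \<in> carrier R}"
  have px: "\<pi> x \<in> carrier Q" using Q(3) x by blast
  have C: "rsubmodule R Q ?C" by (rule Q.rsubmodule_cyclic[OF px])
  have pxC: "\<pi> x \<in> ?C" using Q.ract_one[OF px] by force
  have simple: "simple_rmodule R (Q\<lparr>carrier := ?C\<rparr>)"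
    unfolding simple_rmodule_def
  proof (intro conjI allI impI Q.submodule_right_module[OF C])
    show "carrier (Q\<lparr>carrier := ?C\<rparr>) \<noteq> {\<zero>\<^bsub>Q\<lparr>carrier := ?C\<rparr>\<^esub>}" using pxC ker[OF x(1)] N(3) by auto
    fix L assume "rsubmodule R (Q\<lparr>carrier := ?C\<rparr>) L"
    then have L: "rsubmodule R Q L" "L \<subseteq> ?C" using Q.rsubmodule_restrict_iff[OF C] by auto
    \<comment> \<open>The preimage of L contains N. If it contains x, then L is everything;
      otherwise it equals N by maximality, and L is zero.\<close>
    let ?X = "{y \<in> carrier M. \<pi> y \<in> L}"
    have X: "rsubmodule R M ?X" by (rule rsubmodule_kernel[OF Q(1,2) L(1)])
    have NX: "N \<subseteq> ?X"
    proof
      fix y assume y: "y \<in> N"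
      have "y \<in> carrier M" by (rule subsetD[OF rsubmoduleD(1)[OF N(1)] y])
      moreover from this have "\<pi> y = \<zero>\<^bsub>Q\<^esub>" using ker y by simp
      ultimately show "y \<in> ?X" using Q.rsubmoduleD(2)[OF L(1)] by simp
    qed
    show "L = {\<zero>\<^bsub>Q\<lparr>carrier := ?C\<rparr>\<^esub>} \<or> L = carrier (Q\<lparr>carrier := ?C\<rparr>)"
    proof (cases "x \<in> ?X")
      case True
      then have "?C \<subseteq> L" using Q.rsubmoduleD(6)[OF L(1)] by auto
      then show ?thesis using L(2) by auto
    next
      case False
      have XN: "?X = N" by (rule max[OF X order_trans[OF N(2) NX] False NX])
      have "l = \<zero>\<^bsub>Q\<^esub>" if l: "l \<in> L" for l
      proof -
        obtain y where y: "y \<in> carrier M" "l = \<pi> y" using subsetD[OF Q.rsubmoduleD(1)[OF L(1)] l] Q(3) by (metis imageE)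
        then have "y \<in> ?X" using l by simp
        then have "y \<in> N" unfolding XN .
        then show ?thesis using ker y by simp
      qed
      then have "\<forall>l \<in> L. l = \<zero>\<^bsub>Q\<^esub>" by (intro ballI)
      then have "L \<subseteq> {\<zero>\<^bsub>Q\<^esub>}" by (simp add: subset_iff)
      then show ?thesis using Q.rsubmoduleD(2)[OF L(1)] by auto
    qed
  qed
  have "\<pi> y = \<zero>\<^bsub>Q\<^esub>" if "y \<in> N0" for y
    using ker[OF subsetD[OF rsubmoduleD(1)[OF N(1)] subsetD[OF N(2) that]]] subsetD[OF N(2) that] by blast
  then show thesis
  proof (intro that[OF simple, of \<pi>])
    show "carrier (Q\<lparr>carrier := ?C\<rparr>) \<subseteq> \<pi> ` carrier M" using Q.rsubmoduleD(1)[OF C] Q(3) by simp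
  qed (use rmod_homD(3)[OF Q(2)] ker[OF x(1)] N(3) pxC in auto)
qed

end

subsection \<open>The category of right modules\<close>

lemma rmod_category_simps [simp]:
  "Obj (rmod_category R) = {M. right_module R M}"
  "Hom (rmod_category R) M N = rmod_hom R M N \<inter> extensional (carrier M)"
  "Idn (rmod_category R) M = restrict (\<lambda>x. x) (carrier M)"
  "Cmp (rmod_category R) M N Q g f = compose (carrier M) g f"
  by (simp_all add: rmod_category_def)

lemma rmod_hom_funcset: "h \<in> rmod_hom R M N \<Longrightarrow> h \<in> carrier M \<rightarrow> carrier N"
  by (simp add: rmod_hom_def)

lemma category_rmod: "category (rmod_category R)"
proof
  fix M assume "M \<in> Obj (rmod_category R)"
  then have M: "right_module R M" by simp
  have "(\<lambda>x. x) \<in> rmod_hom R M M" by (simp add: rmod_hom_def)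
  then show "Idn (rmod_category R) M \<in> Hom (rmod_category R) M M"
    using rmod_hom_restrict[OF M] by simp
next
  fix M N Q f g assume "M \<in> Obj (rmod_category R)" and fg: "f \<in> Hom (rmod_category R) M N" "g \<in> Hom (rmod_category R) N Q"
  then have M: "right_module R M" by simp
  show "Cmp (rmod_category R) M N Q g f \<in> Hom (rmod_category R) M Q"
    using fg rmod_hom_restrict[OF M rmod_hom_compose, of f N g Q] by (simp add: compose_def)
qed (auto simp: rmod_hom_def intro!: compose_Id Id_compose compose_assoc[symmetric])

lemma category_full_subcategory: "category C \<Longrightarrow> category (full_subcategory C S)"
  unfolding category_def full_subcategory_def by simp

lemma iso_arrow_full_subcategory:
  "iso_arrow (full_subcategory C S) a b f \<longleftrightarrow> iso_arrow C a b f"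
  unfolding iso_arrow_def full_subcategory_def by simp

lemma iso_arrow_rmod_hom:
  assumes "right_module R M" "right_module R N" "h \<in> rmod_hom R M N" "bij_betw h (carrier M) (carrier N)"
  shows "iso_arrow (rmod_category R) M N (restrict h (carrier M))"
  unfolding iso_arrow_def
proof (intro conjI bexI)
  let ?g = "restrict (inv_into (carrier M) h) (carrier N)"
  show "restrict h (carrier M) \<in> Hom (rmod_category R) M N" using rmod_hom_restrict[OF assms(1,3)] by simp
  show "?g \<in> Hom (rmod_category R) N M" using rmod_hom_restrict[OF assms(2) rmod_hom_inv_into[OF assms]] by simp
  have h: "h x \<in> carrier N" "inv_into (carrier M) h (h x) = x" if "x \<in> carrier M" for x
    using assms(4) that by (auto simp: bij_betw_def)
  have g: "inv_into (carrier M) h y \<in> carrier M" "h (inv_into (carrier M) h y) = y" if "y \<in> carrier N" for y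
    using assms(4) that by (auto simp: bij_betw_def inv_into_into f_inv_into_f)
  show "Cmp (rmod_category R) M N M ?g (restrict h (carrier M)) = Idn (rmod_category R) M"
    by (auto simp: compose_def h intro!: restrict_ext)
  show "Cmp (rmod_category R) N M N (restrict h (carrier M)) ?g = Idn (rmod_category R) N"
    by (auto simp: compose_def g intro!: restrict_ext)
qed

lemma rmod_isomorphic_iso_arrow:
  assumes "iso_arrow (rmod_category R) M N f"
  shows "rmod_isomorphic R M N"
proof -
  obtain g where g: "f \<in> rmod_hom R M N" "g \<in> rmod_hom R N M"
    "compose (carrier M) g f = (\<lambda>x\<in>carrier M. x)" "compose (carrier N) f g = (\<lambda>x\<in>carrier N. x)"
    using assms unfolding iso_arrow_def by auto
  have "g (f x) = x" if "x \<in> carrier M" for x using fun_cong[OF g(3), of x] that by (simp add: compose_def)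
  moreover have "f (g x) = x" if "x \<in> carrier N" for x using fun_cong[OF g(4), of x] that by (simp add: compose_def)
  ultimately have "bij_betw f (carrier M) (carrier N)"
    using rmod_hom_funcset[OF g(1)] rmod_hom_funcset[OF g(2)] by (intro bij_betw_byWitness[of _ g]) auto
  then show ?thesis unfolding rmod_isomorphic_def using g(1) by blast
qed

lemma rmod_isomorphic_iff_iso_arrow:
  assumes "right_module R M" "right_module R N"
  shows "rmod_isomorphic R M N \<longleftrightarrow> (\<exists>f. iso_arrow (rmod_category R) M N f)"
  using iso_arrow_rmod_hom[OF assms] rmod_isomorphic_iso_arrow unfolding rmod_isomorphic_def by blast

text \<open>For a submodule N the projection S -> S/N decides: if it composes equally with the
  identity and the zero map, then N = S; if it is a monomorphism, then comparing the inclusion of N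
  with the zero map gives N = 0. The quotient stays in the universe by
  \<open>quotient_exists\<close>. Conversely, the kernel of an arrow out of a simple module is zero
  or everything.\<close>

lemma simple_object_rmod_category:
  "simple_object (rmod_category R) (S :: ('a, 'v) rmodule) \<longleftrightarrow> simple_rmodule R S"
proof (cases "right_module R S")
  case False
  then show ?thesis by (simp add: simple_object_def simple_rmodule_def)
next
  case S: True
  interpret S: rmod R S using S by (rule rmod.intro)
  let ?C = "rmod_category R :: (('a, 'v) rmodule, 'v \<Rightarrow> 'v) category"
  have triv: "restrict (\<lambda>_. \<zero>\<^bsub>S\<^esub>) (carrier Y) \<in> Hom ?C Y S" if "right_module R Y" for Y :: "('a, 'v) rmodule"
    using rmod_hom_restrict[OF that, of "\<lambda>_. \<zero>\<^bsub>S\<^esub>" S] by (simp add: rmod_hom_def S.zero_ract)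
  show ?thesis
  proof
    assume so: "simple_object ?C S"
    show "simple_rmodule R S" unfolding simple_rmodule_def
    proof (intro conjI allI impI S)
      show "carrier S \<noteq> {\<zero>\<^bsub>S\<^esub>}"
      proof
        assume e: "carrier S = {\<zero>\<^bsub>S\<^esub>}"
        have "p = q" if "p \<in> Hom ?C S S" "q \<in> Hom ?C S S" for p q
          using that e rmod_hom_funcset[of p R S S] rmod_hom_funcset[of q R S S]
          by (intro extensionalityI[of p "carrier S" q]) auto
        then show False using so unfolding simple_object_def by blast
      qed
      fix N assume N: "rsubmodule R S N"
      note N' = S.rsubmoduleD[OF N]
      obtain Q :: "('a, 'v) rmodule" and \<pi> where Q: "right_module R Q" "\<pi> \<in> rmod_hom R S Q"
        and ker: "\<And>x. x \<in> carrier S \<Longrightarrow> \<pi> x = \<zero>\<^bsub>Q\<^esub> \<longleftrightarrow> x \<in> N"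
        using S.quotient_exists[OF N inj_on_id] by metis
      let ?p = "restrict \<pi> (carrier S)"
      have p: "?p \<in> Hom ?C S Q" using rmod_hom_restrict[OF S Q(2)] by simp
      have p0: "\<pi> \<zero>\<^bsub>S\<^esub> = \<zero>\<^bsub>Q\<^esub>" using ker N' by simp
      consider (zero) "\<And>Y g h. Y \<in> Obj ?C \<Longrightarrow> g \<in> Hom ?C Y S \<Longrightarrow> h \<in> Hom ?C Y S \<Longrightarrow> Cmp ?C Y S Q ?p g = Cmp ?C Y S Q ?p h"
        | (mono) "\<And>Y g h. Y \<in> Obj ?C \<Longrightarrow> g \<in> Hom ?C Y S \<Longrightarrow> h \<in> Hom ?C Y S \<Longrightarrow>
            Cmp ?C Y S Q ?p g = Cmp ?C Y S Q ?p h \<Longrightarrow> g = h"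
        using so Q(1) p unfolding simple_object_def by (metis (no_types, lifting) mem_Collect_eq rmod_category_simps(1))
      then show "N = {\<zero>\<^bsub>S\<^esub>} \<or> N = carrier S"
      proof cases
        case zero
        have "restrict (\<lambda>x. x) (carrier S) \<in> Hom ?C S S" using category.idn[OF category_rmod, of S R] S by simp
        from zero[OF _ this triv[OF S]] S have e: "compose (carrier S) ?p (\<lambda>x\<in>carrier S. x) = compose (carrier S) ?p (\<lambda>x\<in>carrier S. \<zero>\<^bsub>S\<^esub>)"
          by simp
        have "x \<in> N" if "x \<in> carrier S" for x
          using fun_cong[OF e, of x] that p0 ker by (simp add: compose_def)
        then show ?thesis using N'(1) by blast
      next
        case mono
        let ?Y = "S\<lparr>carrier := N\<rparr>"
        have Y: "right_module R ?Y" by (rule S.submodule_right_module[OF N])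
        have "(\<lambda>x. x) \<in> rmod_hom R ?Y S" using N'(1) by (auto simp: rmod_hom_def)
        then have i: "restrict (\<lambda>x. x) N \<in> Hom ?C ?Y S" using rmod_hom_restrict[OF Y] by simp
        have t: "restrict (\<lambda>_. \<zero>\<^bsub>S\<^esub>) N \<in> Hom ?C ?Y S" using triv[OF Y] by simp
        have "Cmp ?C ?Y S Q ?p (restrict (\<lambda>x. x) N) = Cmp ?C ?Y S Q ?p (restrict (\<lambda>_. \<zero>\<^bsub>S\<^esub>) N)"
        proof -
          have "\<pi> x = \<pi> \<zero>\<^bsub>S\<^esub>" if "x \<in> N" for x using ker[OF subsetD[OF N'(1) that]] that p0 by simp
          then show ?thesis using subsetD[OF N'(1)] by (auto simp: compose_def intro!: restrict_ext)
        qed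
        then have e: "restrict (\<lambda>x. x) N = restrict (\<lambda>_. \<zero>\<^bsub>S\<^esub>) N" using mono[OF _ i t] Y by simp
        have "x = \<zero>\<^bsub>S\<^esub>" if "x \<in> N" for x using fun_cong[OF e, of x] that by simp
        then show ?thesis using N'(2) by blast
      qed
    qed
  next
    assume simple: "simple_rmodule R S"
    show "simple_object ?C S" unfolding simple_object_def
    proof (intro conjI ballI)
      show "S \<in> Obj ?C" using S by simp
      have "\<exists>x \<in> carrier S. x \<noteq> \<zero>\<^bsub>S\<^esub>" using simple S.M.zero_closed unfolding simple_rmodule_def by blast
      then have "restrict (\<lambda>x. x) (carrier S) \<noteq> restrict (\<lambda>_. \<zero>\<^bsub>S\<^esub>) (carrier S)" by (metis restrict_apply')
      then show "\<exists>p\<in>Hom ?C S S. \<exists>q\<in>Hom ?C S S. p \<noteq> q"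
        using triv[OF S] category.idn[OF category_rmod, of S R] S by (metis mem_Collect_eq rmod_category_simps(1,3))
      fix X f assume "X \<in> Obj ?C" and f0: "f \<in> Hom ?C S X"
      then have X: "right_module R X" and f: "f \<in> rmod_hom R S X" by auto
      interpret X: rmod R X using X by (rule rmod.intro)
      let ?K = "{x \<in> carrier S. f x \<in> {\<zero>\<^bsub>X\<^esub>}}"
      have "rsubmodule R S ?K" by (rule S.rsubmodule_kernel[OF X f X.rsubmodule_zero])
      then consider "?K = {\<zero>\<^bsub>S\<^esub>}" | "?K = carrier S" using simple unfolding simple_rmodule_def by blast
      then show "(\<forall>Y\<in>Obj ?C. \<forall>g\<in>Hom ?C Y S. \<forall>h\<in>Hom ?C Y S. Cmp ?C Y S X f g = Cmp ?C Y S X f h) \<or>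
        (\<forall>Y\<in>Obj ?C. \<forall>g\<in>Hom ?C Y S. \<forall>h\<in>Hom ?C Y S. Cmp ?C Y S X f g = Cmp ?C Y S X f h \<longrightarrow> g = h)"
      proof cases
        case 1
        then have inj: "inj_on f (carrier S)" using rmod_hom_inj_iff[OF S X f] by auto
        have "g = h" if gh: "g \<in> Hom ?C Y S" "h \<in> Hom ?C Y S" and e: "Cmp ?C Y S X f g = Cmp ?C Y S X f h" for Y g h
        proof (rule extensionalityI[of _ "carrier Y"])
          fix x assume x: "x \<in> carrier Y"
          then have "f (g x) = f (h x)" using fun_cong[OF e, of x] by (simp add: compose_def)
          then show "g x = h x" using inj gh x rmod_homD(1) by (metis IntD1 inj_onD rmod_category_simps(2))
        qed (use gh in auto)
        then show ?thesis by blast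
      next
        case 2
        then have z: "f x = \<zero>\<^bsub>X\<^esub>" if "x \<in> carrier S" for x using that by blast
        have "Cmp ?C Y S X f g = Cmp ?C Y S X f h" if gh: "g \<in> Hom ?C Y S" "h \<in> Hom ?C Y S" for Y g h
          using gh rmod_homD(1)[of g R Y S] rmod_homD(1)[of h R Y S] z by (auto simp: compose_def intro!: restrict_ext)
        then show ?thesis by blast
      qed
    qed
  qed
qed

section \<open>Two-sided ideals generated by an element\<close>

text \<open>The set B e B of finite sums of products c e d, which is the two-sided ideal of e when B
  is a unital ring. The inductive form is what the applications need: a statement about an element
  times 1, with 1 in B e B, is proved by adding one term at a time.\<close>

inductive_set two_sided :: "('a, 'c) ring_scheme \<Rightarrow> 'a set \<Rightarrow> 'a \<Rightarrow> 'a set"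
  for R :: "('a, 'c) ring_scheme" (structure) and B :: "'a set" and e :: 'a where
  zero: "\<zero> \<in> two_sided R B e"
| step: "\<lbrakk>x \<in> two_sided R B e; c \<in> B; d \<in> B\<rbrakk> \<Longrightarrow> c \<otimes> e \<otimes> d \<oplus> x \<in> two_sided R B e"

context ring
begin

lemma two_sided_closed:
  assumes "B \<subseteq> carrier R" "e \<in> carrier R" "x \<in> two_sided R B e"
  shows "x \<in> carrier R"
  using assms(3) by induction (use assms(1,2) in \<open>auto simp: subset_iff\<close>)

lemma two_sided_add:
  assumes "B \<subseteq> carrier R" "e \<in> carrier R" "x \<in> two_sided R B e" "y \<in> two_sided R B e"
  shows "x \<oplus> y \<in> two_sided R B e"
  using assms(3)
proof induction
  case zero
  then show ?case using assms(4) two_sided_closed[OF assms(1,2,4)] by simp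
next
  case (step x c d)
  then have "c \<otimes> e \<otimes> d \<oplus> x \<oplus> y = c \<otimes> e \<otimes> d \<oplus> (x \<oplus> y)"
    using assms(2) subsetD[OF assms(1) step(2)] subsetD[OF assms(1) step(3)] two_sided_closed[OF assms(1,2) step(1)]
      two_sided_closed[OF assms(1,2,4)] by (simp add: a_assoc)
  then show ?case using two_sided.step[OF step(4,2,3)] by simp
qed

lemma two_sided_gen:
  assumes "B \<subseteq> carrier R" "e \<in> carrier R" "c \<in> B" "d \<in> B"
  shows "c \<otimes> e \<otimes> d \<in> two_sided R B e"
  using two_sided.step[OF two_sided.zero[of R B e] assms(3,4)] assms by (simp add: subset_iff)

lemma two_sided_mult:
  assumes "B \<subseteq> carrier R" "e \<in> carrier R" "\<And>x y. x \<in> B \<Longrightarrow> y \<in> B \<Longrightarrow> x \<otimes> y \<in> B"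
    and "x \<in> two_sided R B e" "b \<in> B"
  shows "x \<otimes> b \<in> two_sided R B e"
  using assms(4)
proof induction
  case zero
  then show ?case using assms two_sided.zero by (simp add: subset_iff)
next
  case (step x c d)
  then have "(c \<otimes> e \<otimes> d \<oplus> x) \<otimes> b = c \<otimes> e \<otimes> (d \<otimes> b) \<oplus> x \<otimes> b"
    using assms(2) subsetD[OF assms(1) step(2)] subsetD[OF assms(1) step(3)] two_sided_closed[OF assms(1,2) step(1)]
      subsetD[OF assms(1,5)] by (simp add: m_assoc l_distr)
  then show ?case using two_sided.step[OF step(4,2) assms(3)[OF step(3) assms(5)]] by simp
qed

lemma two_sided_sum:
  assumes "B \<subseteq> carrier R" "e \<in> carrier R" "x \<in> two_sided R B e"
  shows "\<exists>n c d. (\<forall>k<n. c k \<in> B \<and> d k \<in> B) \<and> x = (\<Oplus>k\<in>{..<n::nat}. c k \<otimes> e \<otimes> d k)"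
proof -
  have "\<exists>n c d. (\<forall>k<n. c k \<in> B \<and> d k \<in> B) \<and> x = (\<Oplus>k\<in>{..<n::nat}. c k \<otimes> e \<otimes> d k)"
    using assms(3)
  proof induction
    case zero
    then show ?case by (intro exI[of _ "0::nat"]) simp
  next
    case (step x c d)
    then obtain n c' d' where n: "\<forall>k<n. c' k \<in> B \<and> d' k \<in> B" "x = (\<Oplus>k\<in>{..<n::nat}. c' k \<otimes> e \<otimes> d' k)" by blast
    have "(\<Oplus>k\<in>{..<Suc n}. (c'(n := c)) k \<otimes> e \<otimes> (d'(n := d)) k)
      = c \<otimes> e \<otimes> d \<oplus> (\<Oplus>k\<in>{..<n}. (c'(n := c)) k \<otimes> e \<otimes> (d'(n := d)) k)"
      unfolding lessThan_Suc using n step assms(1,2) by (subst finsum_insert) (auto simp: subset_iff)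
    also have "(\<Oplus>k\<in>{..<n}. (c'(n := c)) k \<otimes> e \<otimes> (d'(n := d)) k) = x"
      unfolding n(2) using n assms(1,2) by (intro finsum_cong') (auto simp: subset_iff)
    finally have "c \<otimes> e \<otimes> d \<oplus> x = (\<Oplus>k\<in>{..<Suc n}. (c'(n := c)) k \<otimes> e \<otimes> (d'(n := d)) k)" by simp
    moreover have "\<forall>k<Suc n. (c'(n := c)) k \<in> B \<and> (d'(n := d)) k \<in> B" using n step by (auto simp: less_Suc_eq)
    ultimately show ?case by blast
  qed
  then show ?thesis .
qed

end

section \<open>Incidence algebras and their modules\<close>

lemma finite_maximal_element:
  assumes "finite B" "B \<noteq> {}" "antisym r" "trans r"
  shows "\<exists>m \<in> B. \<forall>l \<in> B. (m, l) \<in> r \<longrightarrow> l = m"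
  using assms(1,2)
proof (induction rule: finite_ne_induct)
  case (insert x B)
  then obtain m where m: "m \<in> B" "\<And>l. l \<in> B \<Longrightarrow> (m, l) \<in> r \<Longrightarrow> l = m" by blast
  show ?case
  proof (cases "(m, x) \<in> r")
    case True
    have "l = x" if "l \<in> B" "(x, l) \<in> r" for l
      using m(2)[OF that(1) transD[OF assms(4) True that(2)]] that antisymD[OF assms(3) True] by blast
    then show ?thesis by blast
  next
    case False
    then show ?thesis using m by blast
  qed
qed simp

definition matrix_unit :: "('k, 'a) module \<Rightarrow> 'i \<Rightarrow> 'i \<Rightarrow> 'a \<Rightarrow> 'i \<Rightarrow> 'i \<Rightarrow> 'a" where
  "matrix_unit A i j a = (\<lambda>x y. if x = i \<and> y = j then a else \<zero>\<^bsub>A\<^esub>)"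

locale incidence =
  fixes K :: "('k, 'c) ring_scheme" and A :: "('k, 'a) module"
    and P :: "'i set" and r :: "'i rel" and T :: "'i \<Rightarrow> 'i \<Rightarrow> 'a set"
  assumes equipped: "equipped_poset K A P r T"
begin

sublocale fd_algebra K A using equipped by (simp add: equipped_poset_def)

abbreviation "u i \<equiv> system_unit A T i"
abbreviation "E \<equiv> matrix_unit A"
abbreviation "\<Lambda> \<equiv> incidence_algebra A P r T"

lemma finite_P: "finite P" and partial_order: "partial_order_on P r"
  and system: "multiplicative_system K A P r T"
  using equipped by (simp_all add: equipped_poset_def)

lemma r_sub: "(i, j) \<in> r \<Longrightarrow> i \<in> P \<and> j \<in> P"
  using partial_order_onD(4)[OF partial_order] by blast

lemma r_refl: "i \<in> P \<Longrightarrow> (i, i) \<in> r"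
  using refl_onD[OF partial_order_onD(1)[OF partial_order]] .

lemma r_trans: "(i, j) \<in> r \<Longrightarrow> (j, l) \<in> r \<Longrightarrow> (i, l) \<in> r"
  using transD[OF partial_order_onD(2)[OF partial_order]] .

lemma r_antisym: "(i, j) \<in> r \<Longrightarrow> (j, i) \<in> r \<Longrightarrow> i = j"
  using antisymD[OF partial_order_onD(3)[OF partial_order]] .

lemma r_props: "antisym r" "trans r"
  using partial_order_onD[OF partial_order] by simp_all

lemma T_submodule: "(i, j) \<in> r \<Longrightarrow> submodule (T i j) K A"
  using system unfolding multiplicative_system_def by blast

lemma T_sub: "(i, j) \<in> r \<Longrightarrow> x \<in> T i j \<Longrightarrow> x \<in> carrier A"
  using submoduleE(1)[OF T_submodule] by (rule subsetD)

lemma T_zero: "(i, j) \<in> r \<Longrightarrow> \<zero>\<^bsub>A\<^esub> \<in> T i j"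
  using subgroup.one_closed[OF submodule.axioms(1)[OF T_submodule]] by simp

lemma T_add: "(i, j) \<in> r \<Longrightarrow> x \<in> T i j \<Longrightarrow> y \<in> T i j \<Longrightarrow> x \<oplus>\<^bsub>A\<^esub> y \<in> T i j"
  by (rule submoduleE(5)[OF T_submodule])

lemma T_uminus: "(i, j) \<in> r \<Longrightarrow> x \<in> T i j \<Longrightarrow> \<ominus>\<^bsub>A\<^esub> x \<in> T i j"
  by (rule submoduleE(3)[OF T_submodule])

lemma T_smult: "(i, j) \<in> r \<Longrightarrow> k \<in> carrier K \<Longrightarrow> x \<in> T i j \<Longrightarrow> k \<odot>\<^bsub>A\<^esub> x \<in> T i j"
  by (rule submoduleE(4)[OF T_submodule])

lemma T_mult: "(i, j) \<in> r \<Longrightarrow> (j, l) \<in> r \<Longrightarrow> x \<in> T i j \<Longrightarrow> y \<in> T j l \<Longrightarrow> x \<otimes>\<^bsub>A\<^esub> y \<in> T i l"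
  using system unfolding multiplicative_system_def by blast

lemma unit_eqI:
  assumes "e \<in> T i i" "\<And>x. x \<in> T i i \<Longrightarrow> e \<otimes>\<^bsub>A\<^esub> x = x \<and> x \<otimes>\<^bsub>A\<^esub> e = x"
  shows "u i = e"
  unfolding system_unit_def by (rule the_equality) (use assms in metis)+

lemma unit_mem: "i \<in> P \<Longrightarrow> u i \<in> T i i"
proof -
  assume "i \<in> P"
  then obtain e where "e \<in> T i i" "\<And>x. x \<in> T i i \<Longrightarrow> e \<otimes>\<^bsub>A\<^esub> x = x \<and> x \<otimes>\<^bsub>A\<^esub> e = x"
    using system unfolding multiplicative_system_def by blast
  then show ?thesis using unit_eqI by metis
qed

lemma unit_left: "(i, j) \<in> r \<Longrightarrow> x \<in> T i j \<Longrightarrow> u i \<otimes>\<^bsub>A\<^esub> x = x"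
  and unit_right: "(i, j) \<in> r \<Longrightarrow> x \<in> T i j \<Longrightarrow> x \<otimes>\<^bsub>A\<^esub> u j = x"
  using system unfolding multiplicative_system_def by blast+

lemma unit_carrier: "i \<in> P \<Longrightarrow> u i \<in> carrier A"
  using unit_mem r_refl T_sub by blast

lemma incidence_algebra_simps:
  "carrier \<Lambda> = {f. \<forall>i j. if (i, j) \<in> r then f i j \<in> T i j else f i j = \<zero>\<^bsub>A\<^esub>}"
  "f \<otimes>\<^bsub>\<Lambda>\<^esub> g = (\<lambda>i j. \<Oplus>\<^bsub>A\<^esub>l \<in> P. f i l \<otimes>\<^bsub>A\<^esub> g l j)"
  "\<one>\<^bsub>\<Lambda>\<^esub> = (\<lambda>i j. if i = j \<and> i \<in> P then u i else \<zero>\<^bsub>A\<^esub>)"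
  "\<zero>\<^bsub>\<Lambda>\<^esub> = (\<lambda>i j. \<zero>\<^bsub>A\<^esub>)"
  "f \<oplus>\<^bsub>\<Lambda>\<^esub> g = (\<lambda>i j. f i j \<oplus>\<^bsub>A\<^esub> g i j)"
  by (simp_all add: incidence_algebra_def)

lemma incidence_mem: "f \<in> carrier \<Lambda> \<Longrightarrow> (i, j) \<in> r \<Longrightarrow> f i j \<in> T i j"
  and incidence_zero: "f \<in> carrier \<Lambda> \<Longrightarrow> (i, j) \<notin> r \<Longrightarrow> f i j = \<zero>\<^bsub>A\<^esub>"
  unfolding incidence_algebra_simps by (auto split: if_splits)

lemma incidence_carrier: "f \<in> carrier \<Lambda> \<Longrightarrow> f i j \<in> carrier A"
  using incidence_mem incidence_zero T_sub A.zero_closed by metis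

lemma incidenceI:
  assumes "\<And>i j. (i, j) \<in> r \<Longrightarrow> f i j \<in> T i j" "\<And>i j. (i, j) \<notin> r \<Longrightarrow> f i j = \<zero>\<^bsub>A\<^esub>"
  shows "f \<in> carrier \<Lambda>"
  unfolding incidence_algebra_simps using assms by simp

text \<open>A product with both factors nonzero needs i \<le> l \<le> j. So the sums over all of P
  in the matrix product pick up nothing outside the order.\<close>

lemma incidence_term:
  assumes "f \<in> carrier \<Lambda>" "g \<in> carrier \<Lambda>"
  shows "f i l \<otimes>\<^bsub>A\<^esub> g l j \<in> (if (i, j) \<in> r then T i j else {\<zero>\<^bsub>A\<^esub>})"
proof (cases "(i, l) \<in> r \<and> (l, j) \<in> r")
  case True
  then show ?thesis using T_mult[of i l j] r_trans[of i l j] incidence_mem[OF assms(1)] incidence_mem[OF assms(2)] by auto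
next
  case False
  then have "f i l \<otimes>\<^bsub>A\<^esub> g l j = \<zero>\<^bsub>A\<^esub>"
    using incidence_zero[OF assms(1), of i l] incidence_zero[OF assms(2), of l j]
      incidence_carrier[OF assms(1)] incidence_carrier[OF assms(2)] by auto
  then show ?thesis using T_zero by simp
qed

lemma incidence_mult_closed:
  assumes "f \<in> carrier \<Lambda>" "g \<in> carrier \<Lambda>"
  shows "f \<otimes>\<^bsub>\<Lambda>\<^esub> g \<in> carrier \<Lambda>"
proof (rule incidenceI)
  fix i j
  show "(f \<otimes>\<^bsub>\<Lambda>\<^esub> g) i j \<in> T i j" if ij: "(i, j) \<in> r"
    unfolding incidence_algebra_simps
    by (rule A.finsum_mem[OF finite_P]) (use incidence_term[OF assms, of i _ j] ij T_sub T_zero T_add in auto)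
  show "(f \<otimes>\<^bsub>\<Lambda>\<^esub> g) i j = \<zero>\<^bsub>A\<^esub>" if ij: "(i, j) \<notin> r"
  proof -
    have "(\<Oplus>\<^bsub>A\<^esub>l\<in>P. f i l \<otimes>\<^bsub>A\<^esub> g l j) \<in> {\<zero>\<^bsub>A\<^esub>}"
      by (rule A.finsum_mem[OF finite_P]) (use incidence_term[OF assms, of i _ j] ij in auto)
    then show ?thesis unfolding incidence_algebra_simps by simp
  qed
qed

lemma incidence_one_closed: "\<one>\<^bsub>\<Lambda>\<^esub> \<in> carrier \<Lambda>"
  unfolding incidence_algebra_simps using unit_mem T_zero r_refl by auto

lemma ring_incidence: "ring \<Lambda>"
proof (rule ringI)
  show "abelian_group \<Lambda>"
  proof (rule abelian_groupI', goal_cases)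
    case (6 f)
    have "(\<lambda>i j. \<ominus>\<^bsub>A\<^esub> f i j) \<in> carrier \<Lambda>"
      by (rule incidenceI) (use incidence_mem[OF 6] incidence_zero[OF 6] T_uminus in auto)
    moreover have "(\<lambda>i j. \<ominus>\<^bsub>A\<^esub> f i j) \<oplus>\<^bsub>\<Lambda>\<^esub> f = \<zero>\<^bsub>\<Lambda>\<^esub>"
      using incidence_carrier[OF 6] by (simp add: incidence_algebra_simps A.l_neg)
    ultimately show ?case by blast
  next
    case (1 f g)
    then show ?case
      by (intro incidenceI) (simp_all add: incidence_algebra_simps(5) incidence_mem incidence_zero T_add)
  next
    case 2 show ?case by (rule incidenceI) (simp_all add: incidence_algebra_simps(4) T_zero)
  next
    case (3 f g h) then show ?case by (simp add: incidence_algebra_simps(5) incidence_carrier A.a_assoc)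
  next
    case (4 f g) then show ?case by (simp add: incidence_algebra_simps(5) incidence_carrier A.a_comm)
  next
    case (5 f) then show ?case by (simp add: incidence_algebra_simps(4,5) incidence_carrier)
  qed
  show "monoid \<Lambda>"
  proof (rule monoidI)
    fix f g h assume fgh: "f \<in> carrier \<Lambda>" "g \<in> carrier \<Lambda>" "h \<in> carrier \<Lambda>"
    note c = incidence_carrier[OF fgh(1)] incidence_carrier[OF fgh(2)] incidence_carrier[OF fgh(3)]
    have "(\<Oplus>\<^bsub>A\<^esub>l\<in>P. (\<Oplus>\<^bsub>A\<^esub>k\<in>P. f i k \<otimes>\<^bsub>A\<^esub> g k l) \<otimes>\<^bsub>A\<^esub> h l j)
      = (\<Oplus>\<^bsub>A\<^esub>k\<in>P. f i k \<otimes>\<^bsub>A\<^esub> (\<Oplus>\<^bsub>A\<^esub>l\<in>P. g k l \<otimes>\<^bsub>A\<^esub> h l j))" for i j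
    proof -
      have "(\<Oplus>\<^bsub>A\<^esub>l\<in>P. (\<Oplus>\<^bsub>A\<^esub>k\<in>P. f i k \<otimes>\<^bsub>A\<^esub> g k l) \<otimes>\<^bsub>A\<^esub> h l j)
        = (\<Oplus>\<^bsub>A\<^esub>l\<in>P. \<Oplus>\<^bsub>A\<^esub>k\<in>P. f i k \<otimes>\<^bsub>A\<^esub> (g k l \<otimes>\<^bsub>A\<^esub> h l j))"
        using c by (intro A.finsum_cong') (auto simp: A.finsum_ldistr finite_P A.m_assoc intro!: A.finsum_closed)
      also have "\<dots> = (\<Oplus>\<^bsub>A\<^esub>k\<in>P. \<Oplus>\<^bsub>A\<^esub>l\<in>P. f i k \<otimes>\<^bsub>A\<^esub> (g k l \<otimes>\<^bsub>A\<^esub> h l j))"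
        using c by (intro A.finsum_swap finite_P) auto
      also have "\<dots> = (\<Oplus>\<^bsub>A\<^esub>k\<in>P. f i k \<otimes>\<^bsub>A\<^esub> (\<Oplus>\<^bsub>A\<^esub>l\<in>P. g k l \<otimes>\<^bsub>A\<^esub> h l j))"
        using c by (intro A.finsum_cong') (auto simp: A.finsum_rdistr finite_P intro!: A.finsum_closed)
      finally show ?thesis .
    qed
    then show "f \<otimes>\<^bsub>\<Lambda>\<^esub> g \<otimes>\<^bsub>\<Lambda>\<^esub> h = f \<otimes>\<^bsub>\<Lambda>\<^esub> (g \<otimes>\<^bsub>\<Lambda>\<^esub> h)"
      by (simp add: incidence_algebra_simps(2))
  next
    fix f assume f: "f \<in> carrier \<Lambda>"
    have "(\<Oplus>\<^bsub>A\<^esub>l\<in>P. \<one>\<^bsub>\<Lambda>\<^esub> i l \<otimes>\<^bsub>A\<^esub> f l j) = f i j" for i j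
    proof (cases "(i, j) \<in> r")
      case True
      then have "i \<in> P" using r_sub by blast
      then show ?thesis
        by (intro A.finsum_single[of _ i] finite_P)
          (use True incidence_carrier[OF f] incidence_mem[OF f] unit_left in \<open>auto simp: incidence_algebra_simps(3)\<close>)
    next
      case False
      have "(\<Oplus>\<^bsub>A\<^esub>l\<in>P. \<one>\<^bsub>\<Lambda>\<^esub> i l \<otimes>\<^bsub>A\<^esub> f l j) = (\<Oplus>\<^bsub>A\<^esub>l\<in>P. \<zero>\<^bsub>A\<^esub>)"
        by (rule A.finsum_cong') (use False incidence_carrier[OF f] incidence_zero[OF f] unit_carrier in \<open>auto simp: incidence_algebra_simps(3)\<close>)
      then show ?thesis using False incidence_zero[OF f] by (simp add: A.finsum_zero)
    qed
    then show "\<one>\<^bsub>\<Lambda>\<^esub> \<otimes>\<^bsub>\<Lambda>\<^esub> f = f" by (simp add: incidence_algebra_simps(2))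
    have "(\<Oplus>\<^bsub>A\<^esub>l\<in>P. f i l \<otimes>\<^bsub>A\<^esub> \<one>\<^bsub>\<Lambda>\<^esub> l j) = f i j" for i j
    proof (cases "(i, j) \<in> r")
      case True
      then have "j \<in> P" using r_sub by blast
      then show ?thesis
        by (intro A.finsum_single[of _ j] finite_P)
          (use True incidence_carrier[OF f] incidence_mem[OF f] unit_right in \<open>auto simp: incidence_algebra_simps(3)\<close>)
    next
      case False
      have "(\<Oplus>\<^bsub>A\<^esub>l\<in>P. f i l \<otimes>\<^bsub>A\<^esub> \<one>\<^bsub>\<Lambda>\<^esub> l j) = (\<Oplus>\<^bsub>A\<^esub>l\<in>P. \<zero>\<^bsub>A\<^esub>)"
        by (rule A.finsum_cong') (use False incidence_carrier[OF f] incidence_zero[OF f] unit_carrier in \<open>auto simp: incidence_algebra_simps(3)\<close>)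
      then show ?thesis using False incidence_zero[OF f] by (simp add: A.finsum_zero)
    qed
    then show "f \<otimes>\<^bsub>\<Lambda>\<^esub> \<one>\<^bsub>\<Lambda>\<^esub> = f" by (simp add: incidence_algebra_simps(2))
  qed (simp_all add: incidence_mult_closed incidence_one_closed)
next
  fix f g h assume "f \<in> carrier \<Lambda>" "g \<in> carrier \<Lambda>" "h \<in> carrier \<Lambda>"
  note c = incidence_carrier[OF this(1)] incidence_carrier[OF this(2)] incidence_carrier[OF this(3)]
  show "(f \<oplus>\<^bsub>\<Lambda>\<^esub> g) \<otimes>\<^bsub>\<Lambda>\<^esub> h = f \<otimes>\<^bsub>\<Lambda>\<^esub> h \<oplus>\<^bsub>\<Lambda>\<^esub> g \<otimes>\<^bsub>\<Lambda>\<^esub> h"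
    "h \<otimes>\<^bsub>\<Lambda>\<^esub> (f \<oplus>\<^bsub>\<Lambda>\<^esub> g) = h \<otimes>\<^bsub>\<Lambda>\<^esub> f \<oplus>\<^bsub>\<Lambda>\<^esub> h \<otimes>\<^bsub>\<Lambda>\<^esub> g"
    using c by (auto simp: incidence_algebra_simps(2,5) A.l_distr A.r_distr A.finsum_addf Pi_iff)
qed

sublocale \<Lambda>: ring \<Lambda> by (rule ring_incidence)

lemma E_closed: "(i, j) \<in> r \<Longrightarrow> a \<in> T i j \<Longrightarrow> E i j a \<in> carrier \<Lambda>"
  by (rule incidenceI) (auto simp: matrix_unit_def T_zero)

lemma E_zero: "E i j \<zero>\<^bsub>A\<^esub> = \<zero>\<^bsub>\<Lambda>\<^esub>"
  by (simp add: incidence_algebra_simps(4) matrix_unit_def)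

lemma E_add: "E i j (a \<oplus>\<^bsub>A\<^esub> b) = E i j a \<oplus>\<^bsub>\<Lambda>\<^esub> E i j b"
  by (auto simp: incidence_algebra_simps(5) matrix_unit_def fun_eq_iff)

lemma E_mult:
  assumes "j \<in> P" "a \<in> carrier A" "f \<in> carrier \<Lambda>"
  shows "E i j a \<otimes>\<^bsub>\<Lambda>\<^esub> f = (\<lambda>x y. if x = i then a \<otimes>\<^bsub>A\<^esub> f j y else \<zero>\<^bsub>A\<^esub>)"
proof (intro ext)
  fix x y
  note c = incidence_carrier[OF assms(3)]
  show "(E i j a \<otimes>\<^bsub>\<Lambda>\<^esub> f) x y = (if x = i then a \<otimes>\<^bsub>A\<^esub> f j y else \<zero>\<^bsub>A\<^esub>)"
    unfolding incidence_algebra_simps(2)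
    by (rule A.finsum_single[OF finite_P assms(1)]) (use c assms in \<open>auto simp: matrix_unit_def\<close>)
qed

lemma E_mult_E: "(i, j) \<in> r \<Longrightarrow> (j, l) \<in> r \<Longrightarrow> a \<in> T i j \<Longrightarrow> b \<in> T j l \<Longrightarrow> E i j a \<otimes>\<^bsub>\<Lambda>\<^esub> E j l b = E i l (a \<otimes>\<^bsub>A\<^esub> b)"
  using E_mult[of j a "E j l b" i] r_sub[of i j] E_closed[of j l b] T_sub[of i j a]
  by (auto simp: matrix_unit_def fun_eq_iff)

lemma E_mult_E_zero: "j \<noteq> k \<Longrightarrow> (i, j) \<in> r \<Longrightarrow> (k, l) \<in> r \<Longrightarrow> a \<in> T i j \<Longrightarrow> b \<in> T k l \<Longrightarrow> E i j a \<otimes>\<^bsub>\<Lambda>\<^esub> E k l b = \<zero>\<^bsub>\<Lambda>\<^esub>"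
  using E_mult[of j a "E k l b" i] r_sub[of i j] E_closed[of k l b] T_sub[of i j a]
  by (auto simp: matrix_unit_def fun_eq_iff incidence_algebra_simps(4))

text \<open>Every element is a finite sum of matrix units with coefficients, so an additive property
  need only be checked on those. The sum is built up over the finite set B of positions at which
  entries of f are kept.\<close>

lemma incidence_induct [consumes 1, case_names zero add unit]:
  assumes f: "f \<in> carrier \<Lambda>"
    and zero: "Q \<zero>\<^bsub>\<Lambda>\<^esub>"
    and add: "\<And>f g. \<lbrakk>f \<in> carrier \<Lambda>; g \<in> carrier \<Lambda>; Q f; Q g\<rbrakk> \<Longrightarrow> Q (f \<oplus>\<^bsub>\<Lambda>\<^esub> g)"
    and unit: "\<And>i j a. \<lbrakk>(i, j) \<in> r; a \<in> T i j\<rbrakk> \<Longrightarrow> Q (E i j a)"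
  shows "Q f"
proof -
  let ?f = "\<lambda>B i j. if (i, j) \<in> B then f i j else \<zero>\<^bsub>A\<^esub>"
  have c: "?f B \<in> carrier \<Lambda>" for B
    by (rule incidenceI) (use incidence_mem[OF f] incidence_zero[OF f] T_zero in auto)
  have Qf: "Q (?f B)" if "finite B" for B using that
  proof (induction B)
    case empty
    then show ?case using zero by (simp add: incidence_algebra_simps(4))
  next
    case (insert p B)
    obtain i j where p: "p = (i, j)" by force
    have e: "?f (insert p B) = E i j (f i j) \<oplus>\<^bsub>\<Lambda>\<^esub> ?f B"
      using insert(2) incidence_carrier[OF f] by (auto simp: p incidence_algebra_simps(5) matrix_unit_def fun_eq_iff)
    have "E i j (f i j) \<in> carrier \<Lambda> \<and> Q (E i j (f i j))"
    proof (cases "(i, j) \<in> r")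
      case True
      then show ?thesis using unit E_closed incidence_mem[OF f] by blast
    next
      case False
      then show ?thesis using zero E_zero incidence_zero[OF f] by simp
    qed
    then show ?case unfolding e using add c insert by blast
  qed
  have e: "?f (P \<times> P) = f"
  proof (intro ext)
    show "?f (P \<times> P) i j = f i j" for i j
      using r_sub[of i j] incidence_zero[OF f, of i j] by (cases "(i, j) \<in> r") auto
  qed
  show ?thesis using Qf[OF finite_cartesian_product[OF finite_P finite_P]] unfolding e .
qed

subsection \<open>Modules of families of subspaces\<close>

definition subspace_family :: "('a, 'v) rmodule \<Rightarrow> ('i \<Rightarrow> 'v set) \<Rightarrow> bool" where
  "subspace_family L V \<longleftrightarrow>
     (\<forall>i \<in> P. V i \<subseteq> carrier L \<and> \<zero>\<^bsub>L\<^esub> \<in> V i \<and> (\<forall>x \<in> V i. \<forall>y \<in> V i. x \<oplus>\<^bsub>L\<^esub> y \<in> V i) \<and> (\<forall>x \<in> V i. x \<cdot>\<^bsub>L\<^esub> u i = x)) \<and>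
     (\<forall>i j. (i, j) \<in> r \<longrightarrow> (\<forall>x \<in> V i. \<forall>a \<in> T i j. x \<cdot>\<^bsub>L\<^esub> a \<in> V j))"

text \<open>The elements are row vectors with i-th coordinate in \<open>V i\<close>, and the algebra
  acts by multiplying a row vector with a matrix. The vectors are extensional, so that equality only
  concerns the coordinates in P.\<close>

definition family_rmod :: "('a, 'v) rmodule \<Rightarrow> ('i \<Rightarrow> 'v set) \<Rightarrow> ('i \<Rightarrow> 'i \<Rightarrow> 'a, 'i \<Rightarrow> 'v) rmodule" where
  "family_rmod L V = \<lparr>carrier = PiE P V, monoid.mult = undefined, one = undefined,
     zero = (\<lambda>i\<in>P. \<zero>\<^bsub>L\<^esub>), add = (\<lambda>x y. \<lambda>i\<in>P. x i \<oplus>\<^bsub>L\<^esub> y i),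
     ract = (\<lambda>x f. \<lambda>j\<in>P. \<Oplus>\<^bsub>L\<^esub>i\<in>P. x i \<cdot>\<^bsub>L\<^esub> f i j)\<rparr>"

lemma family_rmod_simps:
  "carrier (family_rmod L V) = PiE P V"
  "\<zero>\<^bsub>family_rmod L V\<^esub> = (\<lambda>i\<in>P. \<zero>\<^bsub>L\<^esub>)"
  "x \<oplus>\<^bsub>family_rmod L V\<^esub> y = (\<lambda>i\<in>P. x i \<oplus>\<^bsub>L\<^esub> y i)"
  "x \<cdot>\<^bsub>family_rmod L V\<^esub> f = (\<lambda>j\<in>P. \<Oplus>\<^bsub>L\<^esub>i\<in>P. x i \<cdot>\<^bsub>L\<^esub> f i j)"
  by (simp_all add: family_rmod_def)

lemma family_rmod_E:
  assumes "right_module A L" "subspace_family L V" "x \<in> PiE P V" "(i, j) \<in> r" "a \<in> T i j"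
  shows "x \<cdot>\<^bsub>family_rmod L V\<^esub> E i j a = (\<lambda>k\<in>P. if k = j then x i \<cdot>\<^bsub>L\<^esub> a else \<zero>\<^bsub>L\<^esub>)"
proof -
  interpret L: rmod A L using assms(1) by (rule rmod.intro)
  have c: "x l \<in> carrier L" if "l \<in> P" for l
    using assms(2) PiE_mem[OF assms(3) that] that unfolding subspace_family_def by blast
  have "(\<Oplus>\<^bsub>L\<^esub>l\<in>P. x l \<cdot>\<^bsub>L\<^esub> E i j a l k) = (if k = j then x i \<cdot>\<^bsub>L\<^esub> a else \<zero>\<^bsub>L\<^esub>)" for k
    by (rule L.M.finsum_single[OF finite_P, of i])
      (use assms(4,5) r_sub c T_sub L.ract_closed in \<open>auto simp: matrix_unit_def L.ract_zero\<close>)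
  then show ?thesis by (simp add: family_rmod_simps)
qed

lemma right_module_family_rmod:
  assumes "right_module A L" "subspace_family L V"
  shows "right_module \<Lambda> (family_rmod L V)"
proof -
  interpret L: rmod A L using assms(1) by (rule rmod.intro)
  have V: "\<And>i x. i \<in> P \<Longrightarrow> x \<in> V i \<Longrightarrow> x \<in> carrier L" "\<And>i. i \<in> P \<Longrightarrow> \<zero>\<^bsub>L\<^esub> \<in> V i"
    "\<And>i x y. i \<in> P \<Longrightarrow> x \<in> V i \<Longrightarrow> y \<in> V i \<Longrightarrow> x \<oplus>\<^bsub>L\<^esub> y \<in> V i" "\<And>i x. i \<in> P \<Longrightarrow> x \<in> V i \<Longrightarrow> x \<cdot>\<^bsub>L\<^esub> u i = x"
    "\<And>i j x a. (i, j) \<in> r \<Longrightarrow> x \<in> V i \<Longrightarrow> a \<in> T i j \<Longrightarrow> x \<cdot>\<^bsub>L\<^esub> a \<in> V j"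
    using assms(2) unfolding subspace_family_def by (blast, blast, blast, blast, blast)
  \<comment> \<open>Negatives are not part of \<open>subspace_family\<close>; they arise from the
    action of the negated unit of \<open>T i i\<close>.\<close>
  have Vm: "\<ominus>\<^bsub>L\<^esub> x \<in> V i" if "i \<in> P" "x \<in> V i" for i x
    using V(5)[OF r_refl that(2) T_uminus[OF r_refl unit_mem]] that L.ract_uminus[OF V(1)[OF that] unit_carrier] V(4) by simp
  have term_mem: "x i \<cdot>\<^bsub>L\<^esub> f i j \<in> V j" if "x \<in> PiE P V" "f \<in> carrier \<Lambda>" "i \<in> P" "j \<in> P" for x f i j
  proof (cases "(i, j) \<in> r")
    case True
    then show ?thesis using that incidence_mem V(5) by (meson PiE_mem)
  next
    case False
    then show ?thesis using that incidence_zero V(1,2) L.ract_zero by (metis PiE_mem)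
  qed
  have act: "x \<cdot>\<^bsub>family_rmod L V\<^esub> f \<in> PiE P V" if "x \<in> PiE P V" "f \<in> carrier \<Lambda>" for x f
    unfolding family_rmod_simps using that term_mem V(1-3) finite_P
    by (intro restrict_PiE_iff[THEN iffD2] ballI L.M.finsum_mem) auto
  have c: "x i \<in> carrier L" if "x \<in> PiE P V" "i \<in> P" for x i using that V(1) by (meson PiE_mem)
  show ?thesis
  proof (intro right_module.intro right_module_axioms.intro ring_incidence)
    show "abelian_group (family_rmod L V)"
    proof (rule abelian_groupI', goal_cases)
      case (6 x)
      then have "(\<lambda>i\<in>P. \<ominus>\<^bsub>L\<^esub> x i) \<in> carrier (family_rmod L V)" using PiE_mem[of x P V] by (auto simp: family_rmod_simps intro!: Vm)
      moreover have "(\<lambda>i\<in>P. \<ominus>\<^bsub>L\<^esub> x i) \<oplus>\<^bsub>family_rmod L V\<^esub> x = \<zero>\<^bsub>family_rmod L V\<^esub>"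
        using 6 by (auto simp: family_rmod_simps c L.M.l_neg intro!: restrict_ext)
      ultimately show ?case by blast
    next
      case (5 x)
      then show ?case by (intro extensionalityI[of _ P]) (auto simp: family_rmod_simps c PiE_iff)
    next
      case (1 x y)
      then show ?case using PiE_mem[of x P V] PiE_mem[of y P V] V(3) by (auto simp: family_rmod_simps)
    qed (auto simp: family_rmod_simps V c L.M.a_ac intro!: restrict_ext)
  next
    fix x f g assume xfg: "x \<in> carrier (family_rmod L V)" "f \<in> carrier \<Lambda>" "g \<in> carrier \<Lambda>"
    then have x: "x \<in> PiE P V" by (simp add: family_rmod_simps)
    note cf = incidence_carrier[OF xfg(2)] and cg = incidence_carrier[OF xfg(3)] and cx = c[OF x]
    have "(\<Oplus>\<^bsub>L\<^esub>i\<in>P. x i \<cdot>\<^bsub>L\<^esub> (\<Oplus>\<^bsub>A\<^esub>l\<in>P. f i l \<otimes>\<^bsub>A\<^esub> g l j)) = (\<Oplus>\<^bsub>L\<^esub>l\<in>P. (\<Oplus>\<^bsub>L\<^esub>i\<in>P. x i \<cdot>\<^bsub>L\<^esub> f i l) \<cdot>\<^bsub>L\<^esub> g l j)" for j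
    proof -
      have "(\<Oplus>\<^bsub>L\<^esub>i\<in>P. x i \<cdot>\<^bsub>L\<^esub> (\<Oplus>\<^bsub>A\<^esub>l\<in>P. f i l \<otimes>\<^bsub>A\<^esub> g l j)) = (\<Oplus>\<^bsub>L\<^esub>i\<in>P. \<Oplus>\<^bsub>L\<^esub>l\<in>P. x i \<cdot>\<^bsub>L\<^esub> f i l \<cdot>\<^bsub>L\<^esub> g l j)"
        using cf cg cx by (intro L.M.finsum_cong')
          (auto simp: L.ract_finsum finite_P L.ract_assoc Pi_iff intro!: L.M.finsum_closed L.ract_closed L.M.finsum_cong')
      also have "\<dots> = (\<Oplus>\<^bsub>L\<^esub>l\<in>P. \<Oplus>\<^bsub>L\<^esub>i\<in>P. x i \<cdot>\<^bsub>L\<^esub> f i l \<cdot>\<^bsub>L\<^esub> g l j)"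
        using cf cg cx by (intro L.M.finsum_swap finite_P) (auto intro!: L.ract_closed)
      also have "\<dots> = (\<Oplus>\<^bsub>L\<^esub>l\<in>P. (\<Oplus>\<^bsub>L\<^esub>i\<in>P. x i \<cdot>\<^bsub>L\<^esub> f i l) \<cdot>\<^bsub>L\<^esub> g l j)"
        using cf cg cx by (intro L.M.finsum_cong')
          (auto simp: L.finsum_ract finite_P Pi_iff L.ract_closed intro!: L.M.finsum_closed L.ract_closed)
      finally show ?thesis .
    qed
    then have *: "x \<cdot>\<^bsub>family_rmod L V\<^esub> (f \<otimes>\<^bsub>\<Lambda>\<^esub> g) = (\<lambda>j\<in>P. \<Oplus>\<^bsub>L\<^esub>l\<in>P. (\<Oplus>\<^bsub>L\<^esub>i\<in>P. x i \<cdot>\<^bsub>L\<^esub> f i l) \<cdot>\<^bsub>L\<^esub> g l j)"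
      unfolding family_rmod_simps incidence_algebra_simps(2) by simp
    have "(\<Oplus>\<^bsub>L\<^esub>l\<in>P. (\<Oplus>\<^bsub>L\<^esub>i\<in>P. x i \<cdot>\<^bsub>L\<^esub> f i l) \<cdot>\<^bsub>L\<^esub> g l j) = (\<Oplus>\<^bsub>L\<^esub>l\<in>P. (x \<cdot>\<^bsub>family_rmod L V\<^esub> f) l \<cdot>\<^bsub>L\<^esub> g l j)" for j
      by (rule L.M.finsum_cong') (use cf cg cx in \<open>auto simp: family_rmod_simps intro!: L.M.finsum_closed L.ract_closed\<close>)
    then show "x \<cdot>\<^bsub>family_rmod L V\<^esub> (f \<otimes>\<^bsub>\<Lambda>\<^esub> g) = x \<cdot>\<^bsub>family_rmod L V\<^esub> f \<cdot>\<^bsub>family_rmod L V\<^esub> g"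
      unfolding * family_rmod_simps(4)[of L V "x \<cdot>\<^bsub>family_rmod L V\<^esub> f"] by simp
    show "x \<cdot>\<^bsub>family_rmod L V\<^esub> (f \<oplus>\<^bsub>\<Lambda>\<^esub> g) = x \<cdot>\<^bsub>family_rmod L V\<^esub> f \<oplus>\<^bsub>family_rmod L V\<^esub> x \<cdot>\<^bsub>family_rmod L V\<^esub> g"
    proof -
      have "(\<Oplus>\<^bsub>L\<^esub>i\<in>P. x i \<cdot>\<^bsub>L\<^esub> (f i j \<oplus>\<^bsub>A\<^esub> g i j)) = (\<Oplus>\<^bsub>L\<^esub>i\<in>P. x i \<cdot>\<^bsub>L\<^esub> f i j \<oplus>\<^bsub>L\<^esub> x i \<cdot>\<^bsub>L\<^esub> g i j)" for j
        by (rule L.M.finsum_cong') (use cf cg cx in \<open>auto simp: L.ract_add_right L.ract_closed\<close>)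
      also have "\<dots> j = (\<Oplus>\<^bsub>L\<^esub>i\<in>P. x i \<cdot>\<^bsub>L\<^esub> f i j) \<oplus>\<^bsub>L\<^esub> (\<Oplus>\<^bsub>L\<^esub>i\<in>P. x i \<cdot>\<^bsub>L\<^esub> g i j)" for j
        using cf cg cx by (intro L.M.finsum_addf) (auto intro!: L.ract_closed)
      finally show ?thesis
        unfolding family_rmod_simps incidence_algebra_simps(5) by (auto intro!: restrict_ext)
    qed
  next
    fix x y f assume xy: "x \<in> carrier (family_rmod L V)" "y \<in> carrier (family_rmod L V)" "f \<in> carrier \<Lambda>"
    then have xy': "x \<in> PiE P V" "y \<in> PiE P V" by (simp_all add: family_rmod_simps)
    have "(\<Oplus>\<^bsub>L\<^esub>i\<in>P. (x \<oplus>\<^bsub>family_rmod L V\<^esub> y) i \<cdot>\<^bsub>L\<^esub> f i j) = (\<Oplus>\<^bsub>L\<^esub>i\<in>P. x i \<cdot>\<^bsub>L\<^esub> f i j \<oplus>\<^bsub>L\<^esub> y i \<cdot>\<^bsub>L\<^esub> f i j)" for j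
      by (rule L.M.finsum_cong')
        (use c[OF xy'(1)] c[OF xy'(2)] incidence_carrier[OF xy(3)] in \<open>auto simp: family_rmod_simps L.ract_add_left L.ract_closed\<close>)
    also have "\<dots> j = (\<Oplus>\<^bsub>L\<^esub>i\<in>P. x i \<cdot>\<^bsub>L\<^esub> f i j) \<oplus>\<^bsub>L\<^esub> (\<Oplus>\<^bsub>L\<^esub>i\<in>P. y i \<cdot>\<^bsub>L\<^esub> f i j)" for j
      using c[OF xy'(1)] c[OF xy'(2)] incidence_carrier[OF xy(3)] by (intro L.M.finsum_addf) (auto intro!: L.ract_closed)
    finally show "(x \<oplus>\<^bsub>family_rmod L V\<^esub> y) \<cdot>\<^bsub>family_rmod L V\<^esub> f = x \<cdot>\<^bsub>family_rmod L V\<^esub> f \<oplus>\<^bsub>family_rmod L V\<^esub> y \<cdot>\<^bsub>family_rmod L V\<^esub> f"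
      unfolding family_rmod_simps(4) family_rmod_simps(3)[where x = "restrict _ _"] by (auto intro!: restrict_ext)
  next
    fix x assume "x \<in> carrier (family_rmod L V)"
    then have x: "x \<in> PiE P V" by (simp add: family_rmod_simps)
    have "(\<Oplus>\<^bsub>L\<^esub>i\<in>P. x i \<cdot>\<^bsub>L\<^esub> \<one>\<^bsub>\<Lambda>\<^esub> i j) = x j" if "j \<in> P" for j
      by (rule L.M.finsum_single[OF finite_P that])
        (use that x c[OF x] V(4) in \<open>auto simp: incidence_algebra_simps(3) L.ract_zero\<close>)
    then show "x \<cdot>\<^bsub>family_rmod L V\<^esub> \<one>\<^bsub>\<Lambda>\<^esub> = x"
      by (intro extensionalityI[of _ P]) (use x in \<open>auto simp: family_rmod_simps PiE_iff\<close>)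
  qed (use act in \<open>simp_all add: family_rmod_simps(1)\<close>)
qed

subsection \<open>Modules concentrated at a vertex\<close>

text \<open>The ring \<open>T i i\<close> becomes a right module over the incidence algebra through
  the projection of a matrix to its diagonal entry at i.\<close>

definition vertex_rmod :: "'i \<Rightarrow> ('i \<Rightarrow> 'i \<Rightarrow> 'a, 'a) rmodule" where
  "vertex_rmod i = \<lparr>carrier = T i i, monoid.mult = undefined, one = undefined, zero = \<zero>\<^bsub>A\<^esub>, add = (\<oplus>\<^bsub>A\<^esub>),
     ract = (\<lambda>x f. x \<otimes>\<^bsub>A\<^esub> f i i)\<rparr>"

lemma vertex_rmod_simps:
  "carrier (vertex_rmod i) = T i i" "\<zero>\<^bsub>vertex_rmod i\<^esub> = \<zero>\<^bsub>A\<^esub>" "x \<oplus>\<^bsub>vertex_rmod i\<^esub> y = x \<oplus>\<^bsub>A\<^esub> y"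
  "x \<cdot>\<^bsub>vertex_rmod i\<^esub> f = x \<otimes>\<^bsub>A\<^esub> f i i"
  by (simp_all add: vertex_rmod_def)

text \<open>If \<open>f i l\<close> and \<open>g l i\<close> are both nonzero, then i \<le> l \<le>
  i, hence l = i by antisymmetry. This makes the projection to a diagonal entry
  multiplicative.\<close>

lemma incidence_mult_diag:
  assumes "f \<in> carrier \<Lambda>" "g \<in> carrier \<Lambda>" "i \<in> P"
  shows "(f \<otimes>\<^bsub>\<Lambda>\<^esub> g) i i = f i i \<otimes>\<^bsub>A\<^esub> g i i"
  unfolding incidence_algebra_simps(2)
proof (rule A.finsum_single[OF finite_P assms(3)])
  fix l assume "l \<in> P"
  show "f i l \<otimes>\<^bsub>A\<^esub> g l i = (if l = i then f i i \<otimes>\<^bsub>A\<^esub> g i i else \<zero>\<^bsub>A\<^esub>)"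
    using incidence_zero[OF assms(1), of i l] incidence_zero[OF assms(2), of l i] r_antisym[of i l]
      incidence_carrier[OF assms(1)] incidence_carrier[OF assms(2)]
    by (cases "(i, l) \<in> r"; cases "(l, i) \<in> r") auto
qed (use incidence_carrier[OF assms(1)] incidence_carrier[OF assms(2)] in auto)

lemma right_module_vertex_rmod:
  assumes i: "i \<in> P"
  shows "right_module \<Lambda> (vertex_rmod i)"
proof (intro right_module.intro right_module_axioms.intro ring_incidence)
  note t = T_sub[OF r_refl[OF i]] T_add[OF r_refl[OF i]] T_zero[OF r_refl[OF i]] T_uminus[OF r_refl[OF i]]
  show "abelian_group (vertex_rmod i)"
  proof (rule abelian_groupI', goal_cases)
    case (6 x)
    then show ?case using t(4)[of x] t(1)[of x] A.l_neg[of x] by (auto simp: vertex_rmod_simps)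
  qed (auto simp: vertex_rmod_simps t A.a_ac)
qed (use i in \<open>auto simp: vertex_rmod_simps incidence_mult_diag incidence_carrier T_sub[OF r_refl[OF i]]
  T_mult[OF r_refl[OF i] r_refl[OF i]] incidence_mem r_refl A.l_distr A.r_distr A.m_assoc
  incidence_algebra_simps(3,5) unit_right[OF r_refl[OF i]]\<close>)

end

text \<open>Right inverses of all nonzero elements make \<open>T i i\<close> a division ring, or
  zero. Right inverses are the form in which simple right modules use the property.\<close>

definition (in incidence) division_vertex :: "'i \<Rightarrow> bool" where
  "division_vertex i \<longleftrightarrow> i \<in> P \<and> (\<forall>a \<in> T i i. a \<noteq> \<zero>\<^bsub>A\<^esub> \<longrightarrow> (\<exists>b \<in> T i i. a \<otimes>\<^bsub>A\<^esub> b = u i))"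

section \<open>Modules over an incidence algebra, vertex by vertex\<close>

locale incidence_module = incidence K A P r T + rmod "incidence_algebra A P r T" M
  for K :: "('k, 'c) ring_scheme" and A :: "('k, 'a) module"
    and P :: "'i set" and r :: "'i rel" and T :: "'i \<Rightarrow> 'i \<Rightarrow> 'a set" and M :: "('i \<Rightarrow> 'i \<Rightarrow> 'a, 'v) rmodule"
begin

text \<open>This is the part \<open>M e_i\<close>, written as the set of fixed points of the
  idempotent \<open>e_i\<close>, so that membership is an equation ready for rewriting.\<close>

definition vert :: "'i \<Rightarrow> 'v set" where
  "vert i = {x \<in> carrier M. x \<cdot>\<^bsub>M\<^esub> E i i (u i) = x}"

lemma vert_carrier: "x \<in> vert i \<Longrightarrow> x \<in> carrier M"
  and vert_unit: "x \<in> vert i \<Longrightarrow> x \<cdot>\<^bsub>M\<^esub> E i i (u i) = x"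
  by (simp_all add: vert_def)

lemma unit_E_closed: "i \<in> P \<Longrightarrow> E i i (u i) \<in> carrier \<Lambda>"
  by (intro E_closed r_refl unit_mem)

lemma act_E_vert: "x \<in> carrier M \<Longrightarrow> (i, j) \<in> r \<Longrightarrow> a \<in> T i j \<Longrightarrow> x \<cdot>\<^bsub>M\<^esub> E i j a \<in> vert j"
  using ract_assoc[of x "E i j a" "E j j (u j)"] E_mult_E[of i j j a "u j"] r_sub[of i j] unit_mem r_refl
    unit_right[of i j a] E_closed unit_E_closed ract_closed by (simp add: vert_def)

lemma act_E_E: "x \<in> carrier M \<Longrightarrow> (i, j) \<in> r \<Longrightarrow> (j, l) \<in> r \<Longrightarrow> a \<in> T i j \<Longrightarrow> b \<in> T j l \<Longrightarrow>
    x \<cdot>\<^bsub>M\<^esub> E i j a \<cdot>\<^bsub>M\<^esub> E j l b = x \<cdot>\<^bsub>M\<^esub> E i l (a \<otimes>\<^bsub>A\<^esub> b)"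
  using ract_assoc[of x "E i j a" "E j l b"] E_mult_E E_closed by simp

lemma vert_act_other: "x \<in> vert i \<Longrightarrow> i \<in> P \<Longrightarrow> k \<noteq> i \<Longrightarrow> (k, l) \<in> r \<Longrightarrow> b \<in> T k l \<Longrightarrow> x \<cdot>\<^bsub>M\<^esub> E k l b = \<zero>\<^bsub>M\<^esub>"
proof -
  assume a: "x \<in> vert i" "i \<in> P" "k \<noteq> i" "(k, l) \<in> r" "b \<in> T k l"
  have "x \<cdot>\<^bsub>M\<^esub> E k l b = x \<cdot>\<^bsub>M\<^esub> E i i (u i) \<cdot>\<^bsub>M\<^esub> E k l b" using vert_unit a by simp
  also have "\<dots> = \<zero>\<^bsub>M\<^esub>"
    using a E_mult_E_zero[of i k i l "u i" b] unit_mem r_refl ract_assoc[of x "E i i (u i)" "E k l b"]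
      vert_carrier unit_E_closed E_closed by (simp add: ract_zero)
  finally show ?thesis .
qed

lemma act_E_unit: "x \<in> carrier M \<Longrightarrow> (i, j) \<in> r \<Longrightarrow> a \<in> T i j \<Longrightarrow> x \<cdot>\<^bsub>M\<^esub> E i j a = x \<cdot>\<^bsub>M\<^esub> E i i (u i) \<cdot>\<^bsub>M\<^esub> E i j a"
  using act_E_E[of x i i j "u i" a] r_sub[of i j] r_refl unit_mem unit_left by simp

lemma act_E_add: "x \<in> carrier M \<Longrightarrow> (i, j) \<in> r \<Longrightarrow> a \<in> T i j \<Longrightarrow> b \<in> T i j \<Longrightarrow>
    x \<cdot>\<^bsub>M\<^esub> E i j (a \<oplus>\<^bsub>A\<^esub> b) = x \<cdot>\<^bsub>M\<^esub> E i j a \<oplus>\<^bsub>M\<^esub> x \<cdot>\<^bsub>M\<^esub> E i j b"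
  using ract_add_right E_closed by (simp add: E_add)

lemma act_E_zero: "x \<in> carrier M \<Longrightarrow> x \<cdot>\<^bsub>M\<^esub> E i j \<zero>\<^bsub>A\<^esub> = \<zero>\<^bsub>M\<^esub>"
  by (simp add: E_zero ract_zero)

lemma act_E_finsum:
  assumes "finite I" "x \<in> carrier M" "(i, j) \<in> r" "\<And>k. k \<in> I \<Longrightarrow> a k \<in> T i j"
  shows "x \<cdot>\<^bsub>M\<^esub> E i j (\<Oplus>\<^bsub>A\<^esub>k\<in>I. a k) = (\<Oplus>\<^bsub>M\<^esub>k\<in>I. x \<cdot>\<^bsub>M\<^esub> E i j (a k))"
  using assms(1,4)
proof (induction I)
  case empty
  then show ?case by (simp add: act_E_zero assms(2))
next
  case (insert k I)
  have c: "a l \<in> carrier A" if "l \<in> insert k I" for l using T_sub[OF assms(3)] insert(4)[OF that] .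
  have s: "(\<Oplus>\<^bsub>A\<^esub>k\<in>I. a k) \<in> T i j"
    by (rule A.finsum_mem) (use insert T_sub[OF assms(3)] T_zero[OF assms(3)] T_add[OF assms(3)] in auto)
  have "x \<cdot>\<^bsub>M\<^esub> E i j (a l) \<in> carrier M" if "l \<in> insert k I" for l
    using ract_closed[OF assms(2) E_closed[OF assms(3) insert(4)[OF that]]] .
  then show ?case
    using insert c s act_E_add[OF assms(2,3) insert(4)[OF insertI1] s]
    by (simp add: A.finsum_insert M.finsum_insert Pi_iff)
qed

lemma act_mem:
  assumes "x \<in> carrier M" "f \<in> carrier \<Lambda>" "\<zero>\<^bsub>M\<^esub> \<in> N" "\<And>y z. y \<in> N \<Longrightarrow> z \<in> N \<Longrightarrow> y \<oplus>\<^bsub>M\<^esub> z \<in> N"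
    "\<And>i j a. (i, j) \<in> r \<Longrightarrow> a \<in> T i j \<Longrightarrow> x \<cdot>\<^bsub>M\<^esub> E i j a \<in> N"
  shows "x \<cdot>\<^bsub>M\<^esub> f \<in> N"
  using assms(2)
proof (induction rule: incidence_induct)
  case (add f g)
  then show ?case using assms(4)[OF add(3,4)] by (simp add: ract_add_right assms(1))
qed (simp_all add: ract_zero assms(1,3,5))

text \<open>M is the sum of its parts \<open>M e_i\<close>: by \<open>x = x 1\<close>, every x is a
  sum of elements \<open>x E_jk a\<close>, and each of these lies at a vertex.\<close>

lemma module_induct [consumes 1, case_names zero add vert]:
  assumes "x \<in> carrier M" "Q \<zero>\<^bsub>M\<^esub>" "\<And>y z. \<lbrakk>y \<in> carrier M; z \<in> carrier M; Q y; Q z\<rbrakk> \<Longrightarrow> Q (y \<oplus>\<^bsub>M\<^esub> z)"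
    "\<And>i y. i \<in> P \<Longrightarrow> y \<in> vert i \<Longrightarrow> Q y"
  shows "Q x"
proof -
  have "x \<cdot>\<^bsub>M\<^esub> \<one>\<^bsub>\<Lambda>\<^esub> \<in> {y \<in> carrier M. Q y}"
  proof (rule act_mem[OF assms(1) \<Lambda>.one_closed])
    fix i j a assume ij: "(i, j) \<in> r" "a \<in> T i j"
    have "x \<cdot>\<^bsub>M\<^esub> E i j a \<in> vert j" by (rule act_E_vert[OF assms(1) ij])
    then show "x \<cdot>\<^bsub>M\<^esub> E i j a \<in> {y \<in> carrier M. Q y}" using assms(4) r_sub[OF ij(1)] vert_carrier by blast
  qed (use assms(2,3) in auto)
  then show ?thesis using ract_one[OF assms(1)] by simp
qed

lemma rsubmoduleI_E:
  assumes "N \<subseteq> carrier M" "\<zero>\<^bsub>M\<^esub> \<in> N" "\<And>x y. x \<in> N \<Longrightarrow> y \<in> N \<Longrightarrow> x \<oplus>\<^bsub>M\<^esub> y \<in> N"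
    "\<And>x i j a. x \<in> N \<Longrightarrow> (i, j) \<in> r \<Longrightarrow> a \<in> T i j \<Longrightarrow> x \<cdot>\<^bsub>M\<^esub> E i j a \<in> N"
  shows "rsubmodule \<Lambda> M N"
proof (rule rsubmoduleI[OF assms(1-3)])
  fix x f assume x: "x \<in> N" and f: "f \<in> carrier \<Lambda>"
  show "x \<cdot>\<^bsub>M\<^esub> f \<in> N" by (rule act_mem[OF subsetD[OF assms(1) x] f assms(2,3) assms(4)[OF x]])
qed

lemma rmod_homI_E:
  assumes N: "right_module \<Lambda> N" and c: "\<And>x. x \<in> carrier M \<Longrightarrow> h x \<in> carrier N"
    and add: "\<And>x y. x \<in> carrier M \<Longrightarrow> y \<in> carrier M \<Longrightarrow> h (x \<oplus>\<^bsub>M\<^esub> y) = h x \<oplus>\<^bsub>N\<^esub> h y"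
    and E: "\<And>x i j a. x \<in> carrier M \<Longrightarrow> (i, j) \<in> r \<Longrightarrow> a \<in> T i j \<Longrightarrow> h (x \<cdot>\<^bsub>M\<^esub> E i j a) = h x \<cdot>\<^bsub>N\<^esub> E i j a"
  shows "h \<in> rmod_hom \<Lambda> M N"
proof (rule rmod_homI[OF c add])
  interpret N: rmod \<Lambda> N using N by (rule rmod.intro)
  have "h \<zero>\<^bsub>M\<^esub> \<oplus>\<^bsub>N\<^esub> h \<zero>\<^bsub>M\<^esub> = h \<zero>\<^bsub>M\<^esub>" using add[of "\<zero>\<^bsub>M\<^esub>" "\<zero>\<^bsub>M\<^esub>"] by simp
  then have h0: "h \<zero>\<^bsub>M\<^esub> = \<zero>\<^bsub>N\<^esub>" using c N.M.add.l_cancel_one' M.zero_closed by metis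
  fix x f assume x: "x \<in> carrier M" and f: "f \<in> carrier \<Lambda>"
  show "h (x \<cdot>\<^bsub>M\<^esub> f) = h x \<cdot>\<^bsub>N\<^esub> f"
    using f
  proof (induction rule: incidence_induct)
    case (add f g)
    then show ?case using assms(3)[OF ract_closed[OF x add(1)] ract_closed[OF x add(2)]]
      by (simp add: ract_add_right x N.ract_add_right c)
  qed (simp_all add: ract_zero N.ract_zero x c h0 E)
qed

lemma vert_props:
  assumes "i \<in> P"
  shows "\<zero>\<^bsub>M\<^esub> \<in> vert i" "x \<in> vert i \<Longrightarrow> y \<in> vert i \<Longrightarrow> x \<oplus>\<^bsub>M\<^esub> y \<in> vert i"
    "x \<in> vert i \<Longrightarrow> \<ominus>\<^bsub>M\<^esub> x \<in> vert i" "x \<in> vert i \<Longrightarrow> y \<in> vert i \<Longrightarrow> x \<ominus>\<^bsub>M\<^esub> y \<in> vert i"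
  using unit_E_closed[OF assms] by (auto simp: vert_def zero_ract ract_add_left uminus_ract M.minus_eq)

lemma vert_disjoint:
  assumes "i \<in> P" "j \<in> P" "i \<noteq> j" "x \<in> vert i" "x \<in> vert j"
  shows "x = \<zero>\<^bsub>M\<^esub>"
  using vert_act_other[OF assms(4,1), of j j "u j"] vert_unit[OF assms(5)] assms unit_mem r_refl by simp

text \<open>On an element of \<open>M e_i\<close> only the row i of f acts, and of the result only
  the column i survives multiplication by \<open>e_i\<close>.\<close>

lemma vert_act_diag:
  assumes i: "i \<in> P" and x: "x \<in> vert i" and f: "f \<in> carrier \<Lambda>"
  shows "x \<cdot>\<^bsub>M\<^esub> f \<cdot>\<^bsub>M\<^esub> E i i (u i) = x \<cdot>\<^bsub>M\<^esub> E i i (f i i)"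
  using f
proof (induction rule: incidence_induct)
  case zero
  have "\<zero>\<^bsub>\<Lambda>\<^esub> i i = \<zero>\<^bsub>A\<^esub>" by (simp only: incidence_algebra_simps(4))
  then show ?case using vert_carrier[OF x] unit_E_closed[OF i] act_E_zero[OF vert_carrier[OF x]]
    by (simp add: ract_zero zero_ract)
next
  case (add f g)
  have "x \<cdot>\<^bsub>M\<^esub> (f \<oplus>\<^bsub>\<Lambda>\<^esub> g) \<cdot>\<^bsub>M\<^esub> E i i (u i) = x \<cdot>\<^bsub>M\<^esub> f \<cdot>\<^bsub>M\<^esub> E i i (u i) \<oplus>\<^bsub>M\<^esub> x \<cdot>\<^bsub>M\<^esub> g \<cdot>\<^bsub>M\<^esub> E i i (u i)"
    using add(1,2) vert_carrier[OF x] unit_E_closed[OF i] by (simp add: ract_add_right ract_add_left ract_closed)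
  also have "\<dots> = x \<cdot>\<^bsub>M\<^esub> E i i ((f \<oplus>\<^bsub>\<Lambda>\<^esub> g) i i)"
    using act_E_add[OF vert_carrier[OF x] r_refl[OF i] incidence_mem[OF add(1) r_refl[OF i]] incidence_mem[OF add(2) r_refl[OF i]]]
      add(3,4) by (simp add: incidence_algebra_simps(5))
  finally show ?case .
next
  case (unit k l a)
  note kl = r_sub[OF unit(1)]
  have v: "x \<cdot>\<^bsub>M\<^esub> E k l a \<in> vert l" by (rule act_E_vert[OF vert_carrier[OF x] unit])
  show ?case
  proof (cases "k = i \<and> l = i")
    case True
    then show ?thesis using vert_unit[OF v] by (simp add: matrix_unit_def)
  next
    case False
    have "x \<cdot>\<^bsub>M\<^esub> E k l a \<cdot>\<^bsub>M\<^esub> E i i (u i) = \<zero>\<^bsub>M\<^esub>"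
    proof (cases "l = i")
      case True
      then have "x \<cdot>\<^bsub>M\<^esub> E k l a = \<zero>\<^bsub>M\<^esub>" using vert_act_other[OF x i _ unit] False by blast
      then show ?thesis using unit_E_closed[OF i] by (simp add: zero_ract)
    next
      case False
      then show ?thesis using vert_act_other[OF v _ _ r_refl[OF i] unit_mem[OF i]] kl by auto
    qed
    moreover have "E k l a i i = \<zero>\<^bsub>A\<^esub>" using False by (auto simp: matrix_unit_def)
    ultimately show ?thesis using act_E_zero[OF vert_carrier[OF x]] by simp
  qed
qed

text \<open>This is the hypothesis of \<open>complement_exists\<close> for a module concentrated at
  a vertex with a division ring, in other words for a vector space.\<close>

lemma division_inverse:
  assumes i: "division_vertex i" and v: "carrier M \<subseteq> vert i" "v \<in> carrier M" and f: "f \<in> carrier \<Lambda>" and n: "v \<cdot>\<^bsub>M\<^esub> f \<noteq> \<zero>\<^bsub>M\<^esub>"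
  shows "\<exists>b \<in> carrier \<Lambda>. v \<cdot>\<^bsub>M\<^esub> f \<cdot>\<^bsub>M\<^esub> b = v"
proof -
  have iP: "i \<in> P" using i by (simp add: division_vertex_def)
  note ri = r_refl[OF iP]
  have vi: "v \<in> vert i" "v \<cdot>\<^bsub>M\<^esub> f \<in> vert i" using v ract_closed[OF v(2) f] by auto
  have e: "v \<cdot>\<^bsub>M\<^esub> f = v \<cdot>\<^bsub>M\<^esub> E i i (f i i)" using vert_act_diag[OF iP vi(1) f] vert_unit[OF vi(2)] by simp
  have fi: "f i i \<in> T i i" by (rule incidence_mem[OF f ri])
  have "f i i \<noteq> \<zero>\<^bsub>A\<^esub>" using n e act_E_zero[OF v(2)] by auto
  then obtain b where b: "b \<in> T i i" "f i i \<otimes>\<^bsub>A\<^esub> b = u i" using i fi unfolding division_vertex_def by blast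
  have "v \<cdot>\<^bsub>M\<^esub> f \<cdot>\<^bsub>M\<^esub> E i i b = v" unfolding e using act_E_E[OF v(2) ri ri fi b(1)] b(2) vert_unit[OF vi(1)] by simp
  then show ?thesis using E_closed[OF ri b(1)] by blast
qed

text \<open>Choose i maximal among the vertices with \<open>M e_i\<close> nonzero. Entries that
  leave i lead to zero parts, so \<open>M e_i\<close> is a submodule and hence all of M.\<close>

lemma simple_vert:
  assumes S: "simple_rmodule \<Lambda> M"
  shows "\<exists>i \<in> P. carrier M \<subseteq> vert i"
proof -
  let ?B = "{i \<in> P. \<exists>x \<in> vert i. x \<noteq> \<zero>\<^bsub>M\<^esub>}"
  have "?B \<noteq> {}"
  proof
    assume B: "?B = {}"
    have "x = \<zero>\<^bsub>M\<^esub>" if "x \<in> carrier M" for x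
      using that by (induction rule: module_induct) (use B in auto)
    then have "carrier M = {\<zero>\<^bsub>M\<^esub>}" by auto
    then show False using S by (simp add: simple_rmodule_def)
  qed
  then obtain i where "i \<in> ?B" and imax: "\<forall>l \<in> ?B. (i, l) \<in> r \<longrightarrow> l = i"
    using finite_maximal_element[of ?B r] finite_P r_props by auto
  then obtain x where x: "x \<in> vert i" "x \<noteq> \<zero>\<^bsub>M\<^esub>" and i: "i \<in> P" by blast
  have "rsubmodule \<Lambda> M (vert i)"
  proof (rule rsubmoduleI_E)
    fix y k l a assume y: "y \<in> vert i" and kl: "(k, l) \<in> r" "a \<in> T k l"
    have v: "y \<cdot>\<^bsub>M\<^esub> E k l a \<in> vert l" by (rule act_E_vert[OF vert_carrier[OF y] kl])
    show "y \<cdot>\<^bsub>M\<^esub> E k l a \<in> vert i"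
    proof (cases "l = i \<or> y \<cdot>\<^bsub>M\<^esub> E k l a = \<zero>\<^bsub>M\<^esub>")
      case True
      then show ?thesis using v vert_props[OF i] by auto
    next
      case False
      then have "k = i" using vert_act_other[OF y i _ kl] by blast
      then show ?thesis using imax kl(1) v False r_sub[OF kl(1)] by blast
    qed
  qed (use vert_props[OF i] in \<open>auto simp: vert_def\<close>)
  then have "vert i = carrier M" using S x unfolding simple_rmodule_def by blast
  then show ?thesis using i by blast
qed

lemma simple_nonzero: "simple_rmodule \<Lambda> M \<Longrightarrow> \<exists>x \<in> carrier M. x \<noteq> \<zero>\<^bsub>M\<^esub>"
  unfolding simple_rmodule_def using M.zero_closed by blast

lemma simple_generated:
  assumes S: "simple_rmodule \<Lambda> M" and i: "i \<in> P" "carrier M \<subseteq> vert i" and s: "s \<in> carrier M" "s \<noteq> \<zero>\<^bsub>M\<^esub>" and x: "x \<in> carrier M"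
  shows "\<exists>a \<in> T i i. x = s \<cdot>\<^bsub>M\<^esub> E i i a"
proof -
  let ?N = "{s \<cdot>\<^bsub>M\<^esub> f | f. f \<in> carrier \<Lambda>}"
  have "rsubmodule \<Lambda> M ?N" by (rule rsubmodule_cyclic[OF s(1)])
  moreover have "s \<in> ?N" using ract_one[OF s(1)] by force
  ultimately have "?N = carrier M" using S s(2) unfolding simple_rmodule_def by blast
  then obtain f where f: "f \<in> carrier \<Lambda>" "x = s \<cdot>\<^bsub>M\<^esub> f" using x by blast
  have "x = s \<cdot>\<^bsub>M\<^esub> E i i (f i i)"
    using vert_act_diag[OF i(1) subsetD[OF i(2) s(1)] f(1)] vert_unit[OF subsetD[OF i(2) x]] f(2) by simp
  then show ?thesis using incidence_mem[OF f(1) r_refl[OF i(1)]] by blast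
qed

end

text \<open>Both modules are lines over the same division ring, spanned by s and s', and the
  isomorphism sends sa to s'a. This bounds the number of simple modules by the number of
  vertices.\<close>

lemma (in incidence) simple_isomorphic_at_division_vertex:
  assumes i: "division_vertex i" and S: "simple_rmodule \<Lambda> S" "simple_rmodule \<Lambda> S'"
    and v: "\<And>x. x \<in> carrier S \<Longrightarrow> x \<cdot>\<^bsub>S\<^esub> E i i (u i) = x" "\<And>x. x \<in> carrier S' \<Longrightarrow> x \<cdot>\<^bsub>S'\<^esub> E i i (u i) = x"
  shows "rmod_isomorphic \<Lambda> S S'"
proof -
  have "right_module \<Lambda> S" "right_module \<Lambda> S'" using S by (simp_all add: simple_rmodule_def)
  then interpret S: incidence_module K A P r T S + S': incidence_module K A P r T S'
    by (auto intro!: incidence_module.intro rmod.intro incidence_axioms)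
  have iP: "i \<in> P" using i by (simp add: division_vertex_def)
  note ri = r_refl[OF iP]
  have vs: "carrier S \<subseteq> S.vert i" "carrier S' \<subseteq> S'.vert i" using v by (auto simp: S.vert_def S'.vert_def)
  obtain s s' where s: "s \<in> carrier S" "s \<noteq> \<zero>\<^bsub>S\<^esub>" and s': "s' \<in> carrier S'" "s' \<noteq> \<zero>\<^bsub>S'\<^esub>"
    using S.simple_nonzero[OF S(1)] S'.simple_nonzero[OF S(2)] by blast
  have inj: "a = b" if ab: "a \<in> T i i" "b \<in> T i i" "s \<cdot>\<^bsub>S\<^esub> E i i a = s \<cdot>\<^bsub>S\<^esub> E i i b" for a b
  proof (rule ccontr)
    assume "a \<noteq> b"
    then have n: "a \<ominus>\<^bsub>A\<^esub> b \<noteq> \<zero>\<^bsub>A\<^esub>" using A.minus_eq_zero_iff T_sub[OF ri] ab by auto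
    have m: "a \<ominus>\<^bsub>A\<^esub> b \<in> T i i" using ab T_add[OF ri] T_uminus[OF ri] by (simp add: A.minus_eq)
    have "s \<cdot>\<^bsub>S\<^esub> E i i (a \<ominus>\<^bsub>A\<^esub> b) \<oplus>\<^bsub>S\<^esub> s \<cdot>\<^bsub>S\<^esub> E i i b = s \<cdot>\<^bsub>S\<^esub> E i i (a \<ominus>\<^bsub>A\<^esub> b \<oplus>\<^bsub>A\<^esub> b)"
      using S.act_E_add[OF s(1) ri m ab(2)] by simp
    also have "a \<ominus>\<^bsub>A\<^esub> b \<oplus>\<^bsub>A\<^esub> b = a" using T_sub[OF ri] ab by (simp add: A.minus_eq A.a_assoc A.l_neg)
    finally have "s \<cdot>\<^bsub>S\<^esub> E i i (a \<ominus>\<^bsub>A\<^esub> b) \<oplus>\<^bsub>S\<^esub> s \<cdot>\<^bsub>S\<^esub> E i i b = s \<cdot>\<^bsub>S\<^esub> E i i b" using ab(3) by simp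
    then have z: "s \<cdot>\<^bsub>S\<^esub> E i i (a \<ominus>\<^bsub>A\<^esub> b) = \<zero>\<^bsub>S\<^esub>"
      using S.M.add.r_cancel_one[of "s \<cdot>\<^bsub>S\<^esub> E i i b" "s \<cdot>\<^bsub>S\<^esub> E i i (a \<ominus>\<^bsub>A\<^esub> b)"] S.ract_closed[OF s(1) E_closed[OF ri ab(2)]]
        S.ract_closed[OF s(1) E_closed[OF ri m]] by simp
    obtain c where c: "c \<in> T i i" "(a \<ominus>\<^bsub>A\<^esub> b) \<otimes>\<^bsub>A\<^esub> c = u i" using i m n unfolding division_vertex_def by blast
    have "s = s \<cdot>\<^bsub>S\<^esub> E i i (a \<ominus>\<^bsub>A\<^esub> b) \<cdot>\<^bsub>S\<^esub> E i i c"
      using S.act_E_E[OF s(1) ri ri m c(1)] c(2) v(1)[OF s(1)] by simp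
    then show False using z S.zero_ract[OF E_closed[OF ri c(1)]] s(2) by simp
  qed
  \<comment> \<open>The coordinate of x with respect to s; it is unique by
    \<open>inj\<close>.\<close>
  define c where "c x = (SOME a. a \<in> T i i \<and> x = s \<cdot>\<^bsub>S\<^esub> E i i a)" for x
  have c: "c x \<in> T i i \<and> x = s \<cdot>\<^bsub>S\<^esub> E i i (c x)" if "x \<in> carrier S" for x
    unfolding c_def by (rule someI_ex) (use S.simple_generated[OF S(1) iP vs(1) s that] in blast)
  have ceq: "c (s \<cdot>\<^bsub>S\<^esub> E i i a) = a" if "a \<in> T i i" for a
    using c[OF S.ract_closed[OF s(1) E_closed[OF ri that]]] inj[OF _ that] by metis
  let ?h = "\<lambda>x. s' \<cdot>\<^bsub>S'\<^esub> E i i (c x)"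
  have h: "?h \<in> rmod_hom \<Lambda> S S'"
  proof (rule rmod_homI)
    fix x assume x: "x \<in> carrier S"
    show "?h x \<in> carrier S'" using S'.ract_closed[OF s'(1) E_closed[OF ri]] c[OF x] by blast
    fix y assume y: "y \<in> carrier S"
    have "x \<oplus>\<^bsub>S\<^esub> y = s \<cdot>\<^bsub>S\<^esub> E i i (c x \<oplus>\<^bsub>A\<^esub> c y)" using S.act_E_add[OF s(1) ri] c[OF x] c[OF y] by simp
    then have "c (x \<oplus>\<^bsub>S\<^esub> y) = c x \<oplus>\<^bsub>A\<^esub> c y" using ceq T_add[OF ri] c[OF x] c[OF y] by simp
    then show "?h (x \<oplus>\<^bsub>S\<^esub> y) = ?h x \<oplus>\<^bsub>S'\<^esub> ?h y" using S'.act_E_add[OF s'(1) ri] c[OF x] c[OF y] by simp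
  next
    fix x f assume x: "x \<in> carrier S" and f: "f \<in> carrier \<Lambda>"
    have fi: "f i i \<in> T i i" by (rule incidence_mem[OF f ri])
    have "x \<cdot>\<^bsub>S\<^esub> f = x \<cdot>\<^bsub>S\<^esub> E i i (f i i)"
      using S.vert_act_diag[OF iP _ f, of x] v(1)[OF S.ract_closed[OF x f]] vs(1) x by auto
    also have "\<dots> = s \<cdot>\<^bsub>S\<^esub> E i i (c x \<otimes>\<^bsub>A\<^esub> f i i)" 
      using S.act_E_E[OF s(1) ri ri conjunct1[OF c[OF x]] fi] conjunct2[OF c[OF x], symmetric] by simp
    finally have e: "c (x \<cdot>\<^bsub>S\<^esub> f) = c x \<otimes>\<^bsub>A\<^esub> f i i" using ceq T_mult[OF ri ri _ fi] c[OF x] by simp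
    have hx: "?h x \<in> carrier S'" using S'.ract_closed[OF s'(1) E_closed[OF ri]] c[OF x] by blast
    have "?h x \<cdot>\<^bsub>S'\<^esub> f = ?h x \<cdot>\<^bsub>S'\<^esub> E i i (f i i)"
      using S'.vert_act_diag[OF iP _ f, of "?h x"] v(2)[OF S'.ract_closed[OF hx f]] vs(2) hx by auto
    also have "\<dots> = ?h (x \<cdot>\<^bsub>S\<^esub> f)" unfolding e using S'.act_E_E[OF s'(1) ri ri _ fi] c[OF x] by simp
    finally show "?h (x \<cdot>\<^bsub>S\<^esub> f) = ?h x \<cdot>\<^bsub>S'\<^esub> f" by simp
  qed
  have "inj_on ?h (carrier S)"
    unfolding rmod_hom_inj_iff[OF S.right_module_axioms S'.right_module_axioms h]
  proof (intro ballI impI)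
    fix x assume x: "x \<in> carrier S" and z: "?h x = \<zero>\<^bsub>S'\<^esub>"
    show "x = \<zero>\<^bsub>S\<^esub>"
    proof (rule ccontr)
      assume "x \<noteq> \<zero>\<^bsub>S\<^esub>"
      then have "c x \<noteq> \<zero>\<^bsub>A\<^esub>" using c[OF x] S.act_E_zero[OF s(1)] by auto
      then obtain b where b: "b \<in> T i i" "c x \<otimes>\<^bsub>A\<^esub> b = u i" using i c[OF x] unfolding division_vertex_def by blast
      have "s' = ?h x \<cdot>\<^bsub>S'\<^esub> E i i b" using S'.act_E_E[OF s'(1) ri ri _ b(1)] c[OF x] b(2) v(2)[OF s'(1)] by simp
      then show False using z S'.zero_ract[OF E_closed[OF ri b(1)]] s'(2) by simp
    qed
  qed
  moreover have "?h ` carrier S = carrier S'"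
  proof
    show "?h ` carrier S \<subseteq> carrier S'" using rmod_homD(1)[OF h] by blast
    show "carrier S' \<subseteq> ?h ` carrier S"
    proof
      fix y assume "y \<in> carrier S'"
      then obtain a where a: "a \<in> T i i" "y = s' \<cdot>\<^bsub>S'\<^esub> E i i a" using S'.simple_generated[OF S(2) iP vs(2) s'] by blast
      then have "y = ?h (s \<cdot>\<^bsub>S\<^esub> E i i a)" using ceq by simp
      then show "y \<in> ?h ` carrier S" using S.ract_closed[OF s(1) E_closed[OF ri a(1)]] by blast
    qed
  qed
  ultimately show ?thesis using h unfolding rmod_isomorphic_def bij_betw_def by blast
qed

section \<open>Socle-projective modules\<close>

lemma right_module_principal:
  assumes "ring R" "e \<in> carrier R"
  shows "right_module R (principal_rmodule R e)"
proof -
  interpret ring R by fact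
  have c: "{e \<otimes>\<^bsub>R\<^esub> x | x. x \<in> carrier R} \<subseteq> carrier R" using assms(2) by auto
  have "abelian_group (principal_rmodule R e)"
  proof (rule abelian_groupI', goal_cases)
    case (1 x y)
    then obtain a b where "x = e \<otimes>\<^bsub>R\<^esub> a" "y = e \<otimes>\<^bsub>R\<^esub> b" "a \<in> carrier R" "b \<in> carrier R"
      by (auto simp: principal_rmodule_def)
    then show ?case using assms(2) by (auto simp: principal_rmodule_def r_distr[symmetric])
  next
    case 2
    have "\<zero>\<^bsub>R\<^esub> \<in> {e \<otimes>\<^bsub>R\<^esub> x | x. x \<in> carrier R}"
      using r_null[OF assms(2), symmetric] zero_closed by (intro CollectI exI conjI)
    then show ?case by (simp add: principal_rmodule_def)
  next
    case (6 x)
    then obtain a where a: "x = e \<otimes>\<^bsub>R\<^esub> a" "a \<in> carrier R" by (auto simp: principal_rmodule_def)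
    then have "e \<otimes>\<^bsub>R\<^esub> (\<ominus>\<^bsub>R\<^esub> a) \<oplus>\<^bsub>R\<^esub> x = \<zero>\<^bsub>R\<^esub>" using assms(2) by (simp add: r_minus l_neg)
    moreover have "e \<otimes>\<^bsub>R\<^esub> (\<ominus>\<^bsub>R\<^esub> a) \<in> carrier (principal_rmodule R e)"
      using a_inv_closed[OF a(2)] by (auto simp: principal_rmodule_def)
    ultimately show ?case by (auto simp: principal_rmodule_def)
  qed (use c in \<open>auto simp: principal_rmodule_def subset_iff a_ac assms(2)\<close>)
  then show ?thesis
  proof (intro right_module.intro right_module_axioms.intro assms(1), goal_cases)
    case (2 x a)
    then obtain b where "x = e \<otimes>\<^bsub>R\<^esub> b" "b \<in> carrier R" by (auto simp: principal_rmodule_def)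
    then have "x \<otimes>\<^bsub>R\<^esub> a = e \<otimes>\<^bsub>R\<^esub> (b \<otimes>\<^bsub>R\<^esub> a)" "b \<otimes>\<^bsub>R\<^esub> a \<in> carrier R" using 2 assms(2) by (auto simp: m_assoc)
    then show ?case by (auto simp: principal_rmodule_def)
  qed (use c in \<open>auto simp: principal_rmodule_def assms(2) l_distr r_distr m_assoc\<close>)
qed

lemma infinite_pair_injection:
  assumes "infinite (UNIV :: 'v set)"
  obtains c :: "'v \<times> 'v \<Rightarrow> 'v" where "inj c"
proof -
  obtain c :: "'v \<times> 'v \<Rightarrow> 'v" where "bij_betw c (UNIV \<times> UNIV) UNIV"
    using card_of_Times_same_infinite[OF assms] card_of_ordIso[of "UNIV \<times> UNIV :: ('v \<times> 'v) set" "UNIV :: 'v set"] by blast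
  then have "inj c" by (simp add: bij_betw_def)
  then show thesis by (rule that)
qed

text \<open>Packs a finite family of elements of \<open>'v\<close> into a single one. Modules made
  of row vectors can thereby be copied into \<open>'v\<close>.\<close>

lemma PiE_injection:
  assumes "infinite (UNIV :: 'v set)" "finite P"
  shows "\<exists>c :: ('i \<Rightarrow> 'v) \<Rightarrow> 'v. inj_on c (extensional P)"
proof -
  obtain pr :: "'v \<times> 'v \<Rightarrow> 'v" where pr: "inj pr" using infinite_pair_injection[OF assms(1)] by blast
  show ?thesis using assms(2)
  proof (induction P)
    case empty
    show ?case by (rule exI[of _ "\<lambda>_. undefined"]) simp
  next
    case (insert i P)
    then obtain c :: "('i \<Rightarrow> 'v) \<Rightarrow> 'v" where c: "inj_on c (extensional P)" by blast
    \<comment> \<open>The coordinate at the new index is paired with the code of the remaining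
      family.\<close>
    have "inj_on (\<lambda>x. pr (x i, c (restrict x P))) (extensional (insert i P))"
    proof (rule inj_onI)
      fix x y assume xy: "x \<in> extensional (insert i P)" "y \<in> extensional (insert i P)"
        and "pr (x i, c (restrict x P)) = pr (y i, c (restrict y P))"
      then have e: "x i = y i" "c (restrict x P) = c (restrict y P)" using pr by (auto dest: injD)
      then have "restrict x P = restrict y P" using c by (auto dest: inj_onD)
      then have "x k = y k" if "k \<in> P" for k using that by (metis restrict_apply')
      then show "x = y" using xy e(1) by (intro extensionalityI[OF xy]) auto
    qed
    then show ?case by blast
  qed
qed

section \<open>The socle and the elements annihilated by the off-diagonal part\<close>

context rmod
begin

lemma socle_submodule: "rsubmodule R M (socle R M)"
  unfolding socle_def
  by (rule rsubmodule_Inter) (use rsubmodule_carrier rsubmoduleD(1) in auto)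

lemma simple_sub_socle: "rsubmodule R M S \<Longrightarrow> simple_rmodule R (M\<lparr>carrier := S\<rparr>) \<Longrightarrow> S \<subseteq> socle R M"
  unfolding socle_def by blast

lemma socle_least:
  assumes "rsubmodule R M N" "\<And>S. rsubmodule R M S \<Longrightarrow> simple_rmodule R (M\<lparr>carrier := S\<rparr>) \<Longrightarrow> S \<subseteq> N"
  shows "socle R M \<subseteq> N"
  unfolding socle_def using assms by blast

end

context incidence_module
begin

lemma submodule_incidence_module:
  "rsubmodule \<Lambda> M N \<Longrightarrow> incidence_module K A P r T (M\<lparr>carrier := N\<rparr>)"
  by (intro incidence_module.intro rmod.intro incidence_axioms submodule_right_module)

text \<open>The off-diagonal part of the incidence algebra is its radical when the diagonal rings are
  division rings.\<close>

definition radical_annihilator :: "'v set" where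
  "radical_annihilator = {x \<in> carrier M. \<forall>k l. (k, l) \<in> r \<longrightarrow> k \<noteq> l \<longrightarrow> (\<forall>a \<in> T k l. x \<cdot>\<^bsub>M\<^esub> E k l a = \<zero>\<^bsub>M\<^esub>)}"

lemma radical_annihilatorD:
  "x \<in> radical_annihilator \<Longrightarrow> x \<in> carrier M"
  "x \<in> radical_annihilator \<Longrightarrow> (k, l) \<in> r \<Longrightarrow> k \<noteq> l \<Longrightarrow> a \<in> T k l \<Longrightarrow> x \<cdot>\<^bsub>M\<^esub> E k l a = \<zero>\<^bsub>M\<^esub>"
  by (simp_all add: radical_annihilator_def)

text \<open>Multiplying by a further entry leads from an off-diagonal entry to an off-diagonal one:
  p \<le> k \<le> l with k different from l forces p to differ from l, by antisymmetry.\<close>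

lemma radical_annihilator_submodule: "rsubmodule \<Lambda> M radical_annihilator"
proof (rule rsubmoduleI_E)
  fix x p q b assume x: "x \<in> radical_annihilator" and pq: "(p, q) \<in> r" "b \<in> T p q"
  note xc = radical_annihilatorD(1)[OF x]
  have c: "x \<cdot>\<^bsub>M\<^esub> E p q b \<in> carrier M" by (rule ract_closed[OF xc E_closed[OF pq]])
  have "x \<cdot>\<^bsub>M\<^esub> E p q b \<cdot>\<^bsub>M\<^esub> E k l a = \<zero>\<^bsub>M\<^esub>" if kl: "(k, l) \<in> r" "k \<noteq> l" "a \<in> T k l" for k l a
  proof (cases "q = k")
    case True
    have "p \<noteq> l" using r_antisym[of l k] kl pq True by auto
    then have "x \<cdot>\<^bsub>M\<^esub> E p l (b \<otimes>\<^bsub>A\<^esub> a) = \<zero>\<^bsub>M\<^esub>"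
      using radical_annihilatorD(2)[OF x] r_trans[of p q l] T_mult[of p q l b a] pq kl True by simp
    then show ?thesis using act_E_E[OF xc pq(1) _ pq(2)] kl True by simp
  next
    case False
    show ?thesis
      by (rule vert_act_other[OF act_E_vert[OF xc pq] _ _ kl(1,3)]) (use r_sub[OF pq(1)] False in auto)
  qed
  then show "x \<cdot>\<^bsub>M\<^esub> E p q b \<in> radical_annihilator" using c by (simp add: radical_annihilator_def)
qed (use E_closed in \<open>auto simp: radical_annihilator_def zero_ract ract_add_left\<close>)

text \<open>A simple submodule lives at one vertex i. An entry from k to l with k different from l
  either does not start at i, or ends at another vertex, where the simple submodule is zero.\<close>

lemma socle_sub_radical_annihilator: "socle \<Lambda> M \<subseteq> radical_annihilator"
proof (rule socle_least[OF radical_annihilator_submodule])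
  fix S assume S: "rsubmodule \<Lambda> M S" "simple_rmodule \<Lambda> (M\<lparr>carrier := S\<rparr>)"
  interpret S: incidence_module K A P r T "M\<lparr>carrier := S\<rparr>" by (rule submodule_incidence_module[OF S(1)])
  note S' = rsubmoduleD[OF S(1)]
  obtain i where i: "i \<in> P" "S \<subseteq> vert i" using S.simple_vert[OF S(2)] S'(1) by (auto simp: S.vert_def vert_def)
  show "S \<subseteq> radical_annihilator"
  proof
    fix x assume x: "x \<in> S"
    have "x \<cdot>\<^bsub>M\<^esub> E k l a = \<zero>\<^bsub>M\<^esub>" if kl: "(k, l) \<in> r" "k \<noteq> l" "a \<in> T k l" for k l a
    proof (cases "l = i")
      case True
      then show ?thesis using vert_act_other[of x i k l a] i x kl by auto
    next
      case False
      have "x \<cdot>\<^bsub>M\<^esub> E k l a \<in> vert i" using S'(6)[OF x E_closed[OF kl(1,3)]] i(2) by blast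
      then show ?thesis using vert_disjoint[of l i] act_E_vert[of x k l a] False i r_sub[OF kl(1)] x S'(1) kl by blast
    qed
    then show "x \<in> radical_annihilator" using x S'(1) by (auto simp: radical_annihilator_def)
  qed
qed

text \<open>On these elements the algebra acts through its diagonal. Unlike in
  \<open>vert_act_diag\<close>, s may have components at several vertices.\<close>

lemma radical_annihilator_act:
  assumes j: "j \<in> P" and s: "s \<in> radical_annihilator" and f: "f \<in> carrier \<Lambda>"
  shows "s \<cdot>\<^bsub>M\<^esub> f \<cdot>\<^bsub>M\<^esub> E j j (u j) = s \<cdot>\<^bsub>M\<^esub> E j j (u j) \<cdot>\<^bsub>M\<^esub> E j j (f j j)"
proof -
  note sc = radical_annihilatorD(1)[OF s] and rj = r_refl[OF j]
  have fj: "f j j \<in> T j j" by (rule incidence_mem[OF f rj])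
  have "s \<cdot>\<^bsub>M\<^esub> f \<cdot>\<^bsub>M\<^esub> E j j (u j) = s \<cdot>\<^bsub>M\<^esub> E j j (f j j)"
    using f
  proof (induction rule: incidence_induct)
    case zero
    have "\<zero>\<^bsub>\<Lambda>\<^esub> j j = \<zero>\<^bsub>A\<^esub>" by (simp only: incidence_algebra_simps(4))
    then show ?case using sc unit_E_closed[OF j] act_E_zero[OF sc] by (simp add: ract_zero zero_ract)
  next
    case (add f g)
    have "s \<cdot>\<^bsub>M\<^esub> (f \<oplus>\<^bsub>\<Lambda>\<^esub> g) \<cdot>\<^bsub>M\<^esub> E j j (u j) = s \<cdot>\<^bsub>M\<^esub> f \<cdot>\<^bsub>M\<^esub> E j j (u j) \<oplus>\<^bsub>M\<^esub> s \<cdot>\<^bsub>M\<^esub> g \<cdot>\<^bsub>M\<^esub> E j j (u j)"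
      using add(1,2) sc unit_E_closed[OF j] by (simp add: ract_add_right ract_add_left ract_closed)
    also have "\<dots> = s \<cdot>\<^bsub>M\<^esub> E j j ((f \<oplus>\<^bsub>\<Lambda>\<^esub> g) j j)"
      using act_E_add[OF sc rj incidence_mem[OF add(1) rj] incidence_mem[OF add(2) rj]]
        add(3,4) by (simp add: incidence_algebra_simps(5))
    finally show ?case .
  next
    case (unit k l a)
    show ?case
    proof (cases "k = l")
      case True
      show ?thesis
      proof (cases "l = j")
        case lj: True
        then show ?thesis using True vert_unit[OF act_E_vert[OF sc unit]] by (simp add: matrix_unit_def)
      next
        case False
        then have "E k l a j j = \<zero>\<^bsub>A\<^esub>" by (auto simp: matrix_unit_def)
        then show ?thesis using act_E_zero[OF sc]
            vert_act_other[OF act_E_vert[OF sc unit] _ _ rj unit_mem[OF j]] r_sub[OF unit(1)] False by auto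
      qed
    next
      case False
      then have "E k l a j j = \<zero>\<^bsub>A\<^esub>" by (auto simp: matrix_unit_def)
      then show ?thesis using radical_annihilatorD(2)[OF s unit(1) False unit(2)] act_E_zero[OF sc]
          unit_E_closed[OF j] by (simp add: zero_ract)
    qed
  qed
  also have "\<dots> = s \<cdot>\<^bsub>M\<^esub> E j j (u j) \<cdot>\<^bsub>M\<^esub> E j j (f j j)" by (rule act_E_unit[OF sc rj fj])
  finally show ?thesis .
qed

text \<open>Without off-diagonal action the vertices do not interact, so each vertex part of a
  submodule is again a submodule.\<close>

lemma radical_annihilator_vert_submodule:
  assumes j: "j \<in> P" and N: "rsubmodule \<Lambda> M N" "N \<subseteq> radical_annihilator"
  shows "rsubmodule \<Lambda> M (N \<inter> vert j)"
proof (rule rsubmoduleI_E)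
  note N' = rsubmoduleD[OF N(1)]
  fix x k l a assume x: "x \<in> N \<inter> vert j" and kl: "(k, l) \<in> r" "a \<in> T k l"
  have "x \<cdot>\<^bsub>M\<^esub> E k l a \<in> vert j"
  proof (cases "k = l \<and> l = j")
    case True
    then show ?thesis using act_E_vert[of x k l a] x kl vert_carrier by auto
  next
    case False
    then have "x \<cdot>\<^bsub>M\<^esub> E k l a = \<zero>\<^bsub>M\<^esub>"
      using x kl N(2) radical_annihilatorD(2)[of x k l a] vert_act_other[of x j k l a] j by blast
    then show ?thesis using vert_props(1)[OF j] by simp
  qed
  then show "x \<cdot>\<^bsub>M\<^esub> E k l a \<in> N \<inter> vert j" using N'(6)[OF _ E_closed[OF kl]] x by blast
qed (use rsubmoduleD[OF N(1)] vert_props[OF j] in auto)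

end

text \<open>The assumption \<open>faithful\<close> is (A.2) followed up to the greatest element: a
  nonzero entry stays nonzero after multiplication by some element of \<open>T j m\<close>. In the
  application it is derived from \<open>A \<epsilon>_m A = A\<close>.\<close>

locale incidence_top = incidence K A P r T
  for K :: "('k, 'c) ring_scheme" and A :: "('k, 'a) module"
    and P :: "'i set" and r :: "'i rel" and T :: "'i \<Rightarrow> 'i \<Rightarrow> 'a set" +
  fixes m :: 'i
  assumes m: "m \<in> P" and m_top: "i \<in> P \<Longrightarrow> (i, m) \<in> r"
    and division: "i \<in> P \<Longrightarrow> division_vertex i"
    and faithful: "(i, j) \<in> r \<Longrightarrow> x \<in> T i j \<Longrightarrow> (\<And>a. a \<in> T j m \<Longrightarrow> x \<otimes>\<^bsub>A\<^esub> a = \<zero>\<^bsub>A\<^esub>) \<Longrightarrow> x = \<zero>\<^bsub>A\<^esub>"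

locale incidence_top_module = incidence_top K A P r T m + incidence_module K A P r T M
  for K :: "('k, 'c) ring_scheme" and A :: "('k, 'a) module"
    and P :: "'i set" and r :: "'i rel" and T :: "'i \<Rightarrow> 'i \<Rightarrow> 'a set" and m :: 'i
    and M :: "('i \<Rightarrow> 'i \<Rightarrow> 'a, 'v) rmodule"
begin

definition top_faithful :: bool where
  "top_faithful \<longleftrightarrow> (\<forall>i \<in> P. \<forall>x \<in> vert i. (\<forall>a \<in> T i m. x \<cdot>\<^bsub>M\<^esub> E i m a = \<zero>\<^bsub>M\<^esub>) \<longrightarrow> x = \<zero>\<^bsub>M\<^esub>)"

lemma top_faithfulD: "top_faithful \<Longrightarrow> i \<in> P \<Longrightarrow> x \<in> vert i \<Longrightarrow> (\<And>a. a \<in> T i m \<Longrightarrow> x \<cdot>\<^bsub>M\<^esub> E i m a = \<zero>\<^bsub>M\<^esub>) \<Longrightarrow> x = \<zero>\<^bsub>M\<^esub>"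
  unfolding top_faithful_def by blast

lemma vert_top_submodule: "rsubmodule \<Lambda> M (vert m)"
proof (rule rsubmoduleI_E)
  fix x i j a assume x: "x \<in> vert m" and ij: "(i, j) \<in> r" "a \<in> T i j"
  have v: "x \<cdot>\<^bsub>M\<^esub> E i j a \<in> vert j" by (rule act_E_vert[OF vert_carrier[OF x] ij])
  show "x \<cdot>\<^bsub>M\<^esub> E i j a \<in> vert m"
  proof (cases "i = m")
    case True
    then have "j = m" using r_antisym[OF ij(1)] m_top r_sub[OF ij(1)] by blast
    then show ?thesis using v by simp
  next
    case False
    then show ?thesis using vert_act_other[OF x m False ij] vert_props(1)[OF m] by simp
  qed
qed (use vert_props[OF m] in \<open>auto simp: vert_def\<close>)

text \<open>A submodule contained in one vertex part is a vector space over the division ring at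
  that vertex, so its subspaces have complements.\<close>

lemma complement_in_vert:
  assumes i: "i \<in> P" and V: "rsubmodule \<Lambda> M V" "V \<subseteq> vert i" and N: "rsubmodule \<Lambda> M N" "N \<subseteq> V"
  shows "\<exists>L. rsubmodule \<Lambda> M L \<and> L \<subseteq> V \<and> N \<inter> L = {\<zero>\<^bsub>M\<^esub>} \<and> N <+>\<^bsub>M\<^esub> L = V"
proof -
  interpret V: incidence_module K A P r T "M\<lparr>carrier := V\<rparr>" by (rule submodule_incidence_module[OF V(1)])
  have vi: "carrier (M\<lparr>carrier := V\<rparr>) \<subseteq> V.vert i" using V by (auto simp: V.vert_def vert_def)
  have "rsubmodule \<Lambda> (M\<lparr>carrier := V\<rparr>) N" using rsubmodule_restrict_iff[OF V(1)] N by simp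
  from V.complement_exists[OF V.division_inverse[OF division[OF i] vi] this]
  obtain L where L: "rsubmodule \<Lambda> (M\<lparr>carrier := V\<rparr>) L" "N \<inter> L = {\<zero>\<^bsub>M\<lparr>carrier := V\<rparr>\<^esub>}"
    "N <+>\<^bsub>M\<lparr>carrier := V\<rparr>\<^esub> L = carrier (M\<lparr>carrier := V\<rparr>)" by blast
  have "N <+>\<^bsub>M\<lparr>carrier := V\<rparr>\<^esub> L = N <+>\<^bsub>M\<^esub> L" unfolding set_add_def' by simp
  then show ?thesis using L rsubmodule_restrict_iff[OF V(1)] by auto
qed

end

text \<open>The part \<open>X e_m\<close> is a submodule because nothing lies above m, and it is a
  vector space. On a complement L of the kernel of p in \<open>X e_m\<close> the map p is injective,
  and its image contains the image of f; the lift g inverts p there.\<close>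

lemma (in incidence_top) projective_if_top:
  fixes N :: "('i \<Rightarrow> 'i \<Rightarrow> 'a, 'v) rmodule"
  assumes N: "right_module \<Lambda> N" and v: "\<And>x. x \<in> carrier N \<Longrightarrow> x \<cdot>\<^bsub>N\<^esub> E m m (u m) = x"
  shows "projective_rmodule \<Lambda> N"
  unfolding projective_rmodule_def
proof (intro conjI N allI ballI impI)
  fix X Y :: "('i \<Rightarrow> 'i \<Rightarrow> 'a, 'v) rmodule" and p f
  assume p: "p \<in> rmod_hom \<Lambda> X Y" and f: "f \<in> rmod_hom \<Lambda> N Y" and X: "right_module \<Lambda> X" and Y: "right_module \<Lambda> Y"
    and surj: "p ` carrier X = carrier Y"
  interpret N: rmod \<Lambda> N using N by (rule rmod.intro)
  interpret X: incidence_top_module K A P r T m X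
    using X by (intro incidence_top_module.intro incidence_module.intro rmod.intro incidence_axioms incidence_top_axioms)
  interpret Y: incidence_module K A P r T Y
    using Y by (intro incidence_module.intro rmod.intro incidence_axioms)
  note um = X.unit_E_closed[OF m]
  let ?K = "{x \<in> carrier X. p x \<in> {\<zero>\<^bsub>Y\<^esub>}} \<inter> X.vert m"
  have ker: "rsubmodule \<Lambda> X {x \<in> carrier X. p x \<in> {\<zero>\<^bsub>Y\<^esub>}}" by (rule X.rsubmodule_kernel[OF Y p Y.rsubmodule_zero])
  have "rsubmodule \<Lambda> X (\<Inter>{{x \<in> carrier X. p x \<in> {\<zero>\<^bsub>Y\<^esub>}}, X.vert m})"
    by (rule X.rsubmodule_Inter) (use ker X.vert_top_submodule in auto)
  then have "rsubmodule \<Lambda> X ?K" by simp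
  from X.complement_in_vert[OF m X.vert_top_submodule subset_refl this]
  obtain L where L: "rsubmodule \<Lambda> X L" "L \<subseteq> X.vert m" "?K \<inter> L = {\<zero>\<^bsub>X\<^esub>}" "?K <+>\<^bsub>X\<^esub> L = X.vert m" by blast
  note L' = X.rsubmoduleD[OF L(1)]
  have ex: "\<exists>l \<in> L. p l = f n" if n: "n \<in> carrier N" for n
  proof -
    have fn: "f n \<in> carrier Y" "f n \<cdot>\<^bsub>Y\<^esub> E m m (u m) = f n"
      using rmod_homD[OF f] n v[OF n] um by metis+
    then obtain x0 where x0: "x0 \<in> carrier X" "p x0 = f n" using surj by (metis imageE)
    \<comment> \<open>Multiplying a preimage of \<open>f n\<close> by \<open>e_m\<close> moves it
      into \<open>X e_m\<close> and keeps it a preimage, since \<open>f n\<close> is fixed by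
      \<open>e_m\<close>.\<close>
    have xv: "x0 \<cdot>\<^bsub>X\<^esub> E m m (u m) \<in> X.vert m" by (rule X.act_E_vert[OF x0(1) r_refl[OF m] unit_mem[OF m]])
    then obtain k l where kl: "k \<in> ?K" "l \<in> L" "x0 \<cdot>\<^bsub>X\<^esub> E m m (u m) = k \<oplus>\<^bsub>X\<^esub> l" using L(4) by (blast elim: set_addE)
    have lc: "l \<in> carrier X" using L'(1) kl(2) by blast
    have "f n = p (x0 \<cdot>\<^bsub>X\<^esub> E m m (u m))" using rmod_homD(3)[OF p x0(1) um] x0 fn by simp
    also have "\<dots> = p k \<oplus>\<^bsub>Y\<^esub> p l" using kl rmod_homD(2)[OF p] lc by simp
    also have "\<dots> = p l" using kl(1) rmod_homD(1)[OF p lc] by simp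
    finally show ?thesis using kl(2) by metis
  qed
  have uniq: "l = l'" if l: "l \<in> L" "l' \<in> L" "p l = p l'" for l l'
  proof -
    have c: "l \<in> carrier X" "l' \<in> carrier X" using L'(1) l by auto
    have "p (l \<ominus>\<^bsub>X\<^esub> l') = \<zero>\<^bsub>Y\<^esub>"
      using rmod_hom_minus[OF X Y p c] l(3) rmod_homD(1)[OF p] c Y.M.minus_eq_zero_iff by simp
    moreover have "l \<ominus>\<^bsub>X\<^esub> l' \<in> L" by (rule L'(5)[OF l(1,2)])
    ultimately have "l \<ominus>\<^bsub>X\<^esub> l' \<in> ?K \<inter> L" using L'(1) L(2) by blast
    then show ?thesis using L(3) X.M.minus_eq_zero_iff[OF c] by auto
  qed
  define g where "g n = (SOME l. l \<in> L \<and> p l = f n)" for n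
  have g: "g n \<in> L \<and> p (g n) = f n" if "n \<in> carrier N" for n
    unfolding g_def by (rule someI_ex) (use ex[OF that] in blast)
  have gc: "g n \<in> carrier X" if "n \<in> carrier N" for n using g[OF that] L'(1) by blast
  have "g \<in> rmod_hom \<Lambda> N X"
  proof (rule rmod_homI)
    fix x y assume x: "x \<in> carrier N" and y: "y \<in> carrier N"
    have xy: "x \<oplus>\<^bsub>N\<^esub> y \<in> carrier N" using x y by simp
    show "g (x \<oplus>\<^bsub>N\<^esub> y) = g x \<oplus>\<^bsub>X\<^esub> g y"
    proof (rule uniq)
      show "g (x \<oplus>\<^bsub>N\<^esub> y) \<in> L" using g[OF xy] by blast
      show "g x \<oplus>\<^bsub>X\<^esub> g y \<in> L" using L'(3) g[OF x] g[OF y] by blast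
      show "p (g (x \<oplus>\<^bsub>N\<^esub> y)) = p (g x \<oplus>\<^bsub>X\<^esub> g y)"
        using g[OF x] g[OF y] g[OF xy] rmod_homD(2)[OF p gc[OF x] gc[OF y]] rmod_homD(2)[OF f x y] by simp
    qed
  next
    fix x a assume x: "x \<in> carrier N" and a: "a \<in> carrier \<Lambda>"
    have xa: "x \<cdot>\<^bsub>N\<^esub> a \<in> carrier N" by (rule N.ract_closed[OF x a])
    show "g (x \<cdot>\<^bsub>N\<^esub> a) = g x \<cdot>\<^bsub>X\<^esub> a"
    proof (rule uniq)
      show "g (x \<cdot>\<^bsub>N\<^esub> a) \<in> L" using g[OF xa] by blast
      show "g x \<cdot>\<^bsub>X\<^esub> a \<in> L" using L'(6) g[OF x] a by blast
      show "p (g (x \<cdot>\<^bsub>N\<^esub> a)) = p (g x \<cdot>\<^bsub>X\<^esub> a)"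
        using g[OF x] g[OF xa] rmod_homD(3)[OF p gc[OF x] a] rmod_homD(3)[OF f x a] by simp
    qed
  qed (use gc in blast)
  then show "\<exists>g \<in> rmod_hom \<Lambda> N X. \<forall>x \<in> carrier N. p (g x) = f x" using g by blast
qed

section \<open>Socle-projectivity as faithfulness at the top\<close>

context incidence_top_module
begin

text \<open>A simple submodule at a vertex i contains a nonzero element multiplied into
  \<open>M e_m\<close>, which forces i = m. So the socle lies in \<open>M e_m\<close>, and such
  modules are projective.\<close>

lemma socle_projective_if_top_faithful:
  assumes t: "top_faithful"
  shows "socle_projective \<Lambda> M"
proof -
  have "socle \<Lambda> M \<subseteq> vert m"
  proof (rule socle_least[OF vert_top_submodule])
    fix S assume S: "rsubmodule \<Lambda> M S" "simple_rmodule \<Lambda> (M\<lparr>carrier := S\<rparr>)"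
    interpret S: incidence_module K A P r T "M\<lparr>carrier := S\<rparr>" by (rule submodule_incidence_module[OF S(1)])
    note S' = rsubmoduleD[OF S(1)]
    obtain i where i: "i \<in> P" "S \<subseteq> vert i" using S.simple_vert[OF S(2)] S'(1) by (auto simp: S.vert_def vert_def)
    obtain x where x: "x \<in> S" "x \<noteq> \<zero>\<^bsub>M\<^esub>" using S.simple_nonzero[OF S(2)] by auto
    obtain a where a: "a \<in> T i m" "x \<cdot>\<^bsub>M\<^esub> E i m a \<noteq> \<zero>\<^bsub>M\<^esub>" using top_faithfulD[OF t i(1), of x] x i(2) by blast
    have "x \<cdot>\<^bsub>M\<^esub> E i m a \<in> vert i" using S'(6)[OF x(1) E_closed[OF m_top[OF i(1)] a(1)]] i(2) by blast
    moreover have "x \<cdot>\<^bsub>M\<^esub> E i m a \<in> vert m" using act_E_vert[OF _ m_top[OF i(1)] a(1)] x(1) S'(1) by blast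
    ultimately have "i = m" using vert_disjoint[OF i(1) m] a(2) by blast
    then show "S \<subseteq> vert m" using i by simp
  qed
  then have "projective_rmodule \<Lambda> (M\<lparr>carrier := socle \<Lambda> M\<rparr>)"
    by (intro projective_if_top submodule_right_module[OF socle_submodule]) (auto simp: vert_def)
  then show ?thesis using right_module_axioms by (simp add: socle_projective_def)
qed

text \<open>A nonzero element killed on its way to the top produces a simple module y\<Lambda> in
  the socle at some vertex j other than m. Lifting the projection of the socle onto y\<Lambda>
  through the map from \<open>e_j \<Lambda>\<close> to \<open>T_j\<close> would put a nonzero
  element annihilated by \<open>T_jm\<close> into \<open>T_j\<close>. The hypotheses on
  \<open>'v\<close> allow \<open>e_j \<Lambda>\<close> and \<open>T_j\<close> to be copied into the
  universe in which projectivity is tested.\<close>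

lemma top_faithful_if_socle_projective:
  assumes sp: "socle_projective \<Lambda> M" and inf: "infinite (UNIV :: 'v set)" and \<kappa>: "inj_on (\<kappa> :: 'a \<Rightarrow> 'v) (carrier A)"
  shows "top_faithful"
  unfolding top_faithful_def
proof (intro ballI impI, rule ccontr)
  fix i0 x0 assume i0: "i0 \<in> P" and x0: "x0 \<in> vert i0" and kill: "\<forall>a\<in>T i0 m. x0 \<cdot>\<^bsub>M\<^esub> E i0 m a = \<zero>\<^bsub>M\<^esub>" and nz: "x0 \<noteq> \<zero>\<^bsub>M\<^esub>"
  note x0c = vert_carrier[OF x0]
  \<comment> \<open>The vertices at which x0 still has a nonzero product. The vertex m is not among
    them, and at a maximal one, j, the product y is killed by every entry that leaves j.\<close>
  let ?J = "{j \<in> P. (i0, j) \<in> r \<and> (\<exists>a\<in>T i0 j. x0 \<cdot>\<^bsub>M\<^esub> E i0 j a \<noteq> \<zero>\<^bsub>M\<^esub>)}"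
  have "x0 \<cdot>\<^bsub>M\<^esub> E i0 i0 (u i0) \<noteq> \<zero>\<^bsub>M\<^esub>" using vert_unit[OF x0] nz by simp
  then have "i0 \<in> ?J" using i0 r_refl[OF i0] unit_mem[OF i0] by blast
  then obtain j where jJ: "j \<in> ?J" and jmax: "\<forall>l \<in> ?J. (j, l) \<in> r \<longrightarrow> l = j"
    using finite_maximal_element[of ?J r] finite_P r_props by auto
  then obtain a0 where j: "j \<in> P" "(i0, j) \<in> r" and a0: "a0 \<in> T i0 j" "x0 \<cdot>\<^bsub>M\<^esub> E i0 j a0 \<noteq> \<zero>\<^bsub>M\<^esub>" by blast
  have jm: "j \<noteq> m" using kill a0 by blast
  note rj = r_refl[OF j(1)]
  define y where "y = x0 \<cdot>\<^bsub>M\<^esub> E i0 j a0"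
  have yv: "y \<in> vert j" unfolding y_def by (rule act_E_vert[OF x0c j(2) a0(1)])
  note yc = vert_carrier[OF yv]
  have y0: "y \<noteq> \<zero>\<^bsub>M\<^esub>" using a0 y_def by simp
  have yrad: "y \<in> radical_annihilator"
    unfolding radical_annihilator_def
  proof (intro CollectI conjI yc allI impI ballI)
    fix k l b assume kl: "(k, l) \<in> r" "k \<noteq> l" "b \<in> T k l"
    show "y \<cdot>\<^bsub>M\<^esub> E k l b = \<zero>\<^bsub>M\<^esub>"
    proof (cases "k = j")
      case True
      then have jl: "(j, l) \<in> r" "b \<in> T j l" using kl by auto
      have e: "y \<cdot>\<^bsub>M\<^esub> E j l b = x0 \<cdot>\<^bsub>M\<^esub> E i0 l (a0 \<otimes>\<^bsub>A\<^esub> b)" unfolding y_def by (rule act_E_E[OF x0c j(2) jl(1) a0(1) jl(2)])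
      have ab: "a0 \<otimes>\<^bsub>A\<^esub> b \<in> T i0 l" by (rule T_mult[OF j(2) jl(1) a0(1) jl(2)])
      have "l \<notin> ?J" using jmax jl(1) kl(2) True by blast
      then have "x0 \<cdot>\<^bsub>M\<^esub> E i0 l (a0 \<otimes>\<^bsub>A\<^esub> b) = \<zero>\<^bsub>M\<^esub>" using ab r_trans[OF j(2) jl(1)] r_sub[OF jl(1)] by blast
      then show ?thesis using e True by simp
    next
      case False
      show ?thesis by (rule vert_act_other[OF yv j(1) False kl(1,3)])
    qed
  qed
  have yinv: "\<exists>c\<in>T j j. y \<cdot>\<^bsub>M\<^esub> E j j b \<cdot>\<^bsub>M\<^esub> E j j c = y" if b: "b \<in> T j j" "b \<noteq> \<zero>\<^bsub>A\<^esub>" for b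
  proof -
    obtain c where "c \<in> T j j" "b \<otimes>\<^bsub>A\<^esub> c = u j" using division[OF j(1)] b unfolding division_vertex_def by blast
    then show ?thesis using act_E_E[OF yc rj rj b(1)] vert_unit[OF yv] by force
  qed
  let ?N = "{y \<cdot>\<^bsub>M\<^esub> f | f. f \<in> carrier \<Lambda>}"
  have N: "rsubmodule \<Lambda> M ?N" by (rule rsubmodule_cyclic[OF yc])
  have rv: "rsubmodule \<Lambda> M (radical_annihilator \<inter> vert j)"
    by (rule radical_annihilator_vert_submodule[OF j(1) radical_annihilator_submodule subset_refl])
  \<comment> \<open>Since y lies in the radical annihilator and at j, the submodule it generates is
    the line \<open>y T_j\<close>; with \<open>yinv\<close> it is simple.\<close>
  have yf: "y \<cdot>\<^bsub>M\<^esub> f = y \<cdot>\<^bsub>M\<^esub> E j j (f j j)" if f: "f \<in> carrier \<Lambda>" for f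
  proof -
    have "y \<cdot>\<^bsub>M\<^esub> f \<in> vert j" using rsubmoduleD(6)[OF rv _ f] yrad yv by blast
    then show ?thesis using vert_act_diag[OF j(1) yv f] vert_unit by metis
  qed
  have Ndesc: "\<exists>b \<in> T j j. n = y \<cdot>\<^bsub>M\<^esub> E j j b" if "n \<in> ?N" for n
    using that yf incidence_mem[OF _ rj] by blast
  have yN: "y \<in> ?N" using ract_one[OF yc] by force
  have "simple_rmodule \<Lambda> (M\<lparr>carrier := ?N\<rparr>)"
    unfolding simple_rmodule_def
  proof (intro conjI allI impI submodule_right_module[OF N])
    show "carrier (M\<lparr>carrier := ?N\<rparr>) \<noteq> {\<zero>\<^bsub>M\<lparr>carrier := ?N\<rparr>\<^esub>}" using yN y0 by auto
    fix L assume "rsubmodule \<Lambda> (M\<lparr>carrier := ?N\<rparr>) L"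
    then have L: "rsubmodule \<Lambda> M L" "L \<subseteq> ?N" using rsubmodule_restrict_iff[OF N] by auto
    show "L = {\<zero>\<^bsub>M\<lparr>carrier := ?N\<rparr>\<^esub>} \<or> L = carrier (M\<lparr>carrier := ?N\<rparr>)"
    proof (cases "L \<subseteq> {\<zero>\<^bsub>M\<^esub>}")
      case True
      then show ?thesis using rsubmoduleD(2)[OF L(1)] by auto
    next
      case False
      then obtain l where l: "l \<in> L" "l \<noteq> \<zero>\<^bsub>M\<^esub>" by auto
      then obtain b where b: "b \<in> T j j" "l = y \<cdot>\<^bsub>M\<^esub> E j j b" using Ndesc L(2) by blast
      then have "b \<noteq> \<zero>\<^bsub>A\<^esub>" using l(2) act_E_zero[OF yc] by auto
      then obtain c where c: "c \<in> T j j" "l \<cdot>\<^bsub>M\<^esub> E j j c = y" using yinv[OF b(1)] b(2) by blast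
      then have "y \<in> L" using rsubmoduleD(6)[OF L(1) l(1) E_closed[OF rj c(1)]] by simp
      then have "?N \<subseteq> L" using rsubmoduleD(6)[OF L(1)] by blast
      then show ?thesis using L(2) by auto
    qed
  qed
  then have Nsoc: "?N \<subseteq> socle \<Lambda> M" by (rule simple_sub_socle[OF N])
  note soc = socle_submodule socle_sub_radical_annihilator
  note soc' = rsubmoduleD[OF soc(1)]
  let ?V = "socle \<Lambda> M \<inter> vert j"
  have V: "rsubmodule \<Lambda> M ?V" by (rule radical_annihilator_vert_submodule[OF j(1) soc])
  have "?N \<subseteq> vert j"
  proof
    fix n assume "n \<in> ?N"
    from Ndesc[OF this] obtain b where "b \<in> T j j" "n = y \<cdot>\<^bsub>M\<^esub> E j j b" by (rule bexE)
    then show "n \<in> vert j" using act_E_vert[OF yc rj] by simp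
  qed
  then have NV: "?N \<subseteq> ?V" using Nsoc by blast
  obtain U where U: "rsubmodule \<Lambda> M U" "U \<subseteq> ?V" "?N \<inter> U = {\<zero>\<^bsub>M\<^esub>}" "?N <+>\<^bsub>M\<^esub> U = ?V"
    using complement_in_vert[OF j(1) V _ N NV] by blast
  note U' = rsubmoduleD[OF U(1)]
  \<comment> \<open>\<open>?P s b\<close> says that b is the coordinate along y of the j-component
    of s, in the decomposition of the part of the socle at j into y\<Lambda> and U. The coordinate
    map \<beta> is linear over \<Lambda> because \<Lambda> acts on the socle through its
    diagonal.\<close>
  let ?P = "\<lambda>s b. b \<in> T j j \<and> (\<exists>v\<in>U. s \<cdot>\<^bsub>M\<^esub> E j j (u j) = y \<cdot>\<^bsub>M\<^esub> E j j b \<oplus>\<^bsub>M\<^esub> v)"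
  have yE: "y \<cdot>\<^bsub>M\<^esub> E j j b \<in> carrier M" "y \<cdot>\<^bsub>M\<^esub> E j j b \<in> ?N" if "b \<in> T j j" for b
    using ract_closed[OF yc E_closed[OF rj that]] E_closed[OF rj that] by auto
  have Pex: "\<exists>b. ?P s b" if s: "s \<in> socle \<Lambda> M" for s
  proof -
    have "s \<cdot>\<^bsub>M\<^esub> E j j (u j) \<in> ?V"
      using soc'(6)[OF s unit_E_closed[OF j(1)]] act_E_vert[OF _ rj unit_mem[OF j(1)]] s soc'(1) by blast
    then obtain n v where nv: "n \<in> ?N" "v \<in> U" "s \<cdot>\<^bsub>M\<^esub> E j j (u j) = n \<oplus>\<^bsub>M\<^esub> v" using U(4) by (blast elim: set_addE)
    from Ndesc[OF nv(1)] obtain b where "b \<in> T j j" "n = y \<cdot>\<^bsub>M\<^esub> E j j b" by (rule bexE)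
    then show ?thesis using nv(2,3) by auto
  qed
  have Puniq: "b = b'" if b: "?P s b" "?P s b'" for s b b'
  proof (rule ccontr)
    assume n: "b \<noteq> b'"
    obtain v v' where v: "v \<in> U" "v' \<in> U" "y \<cdot>\<^bsub>M\<^esub> E j j b \<oplus>\<^bsub>M\<^esub> v = y \<cdot>\<^bsub>M\<^esub> E j j b' \<oplus>\<^bsub>M\<^esub> v'" using b by auto
    have bT: "b \<in> T j j" "b' \<in> T j j" using b by auto
    have vc: "v \<in> carrier M" "v' \<in> carrier M" using v U'(1) by auto
    have d: "b \<ominus>\<^bsub>A\<^esub> b' \<in> T j j" "b \<ominus>\<^bsub>A\<^esub> b' \<noteq> \<zero>\<^bsub>A\<^esub>"
      using bT T_add[OF rj] T_uminus[OF rj] n A.minus_eq_zero_iff T_sub[OF rj] by (auto simp: A.minus_eq)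
    have "b \<ominus>\<^bsub>A\<^esub> b' \<oplus>\<^bsub>A\<^esub> b' = b" using bT T_sub[OF rj] by (simp add: A.minus_eq A.a_assoc A.l_neg)
    then have "y \<cdot>\<^bsub>M\<^esub> E j j b = y \<cdot>\<^bsub>M\<^esub> E j j (b \<ominus>\<^bsub>A\<^esub> b') \<oplus>\<^bsub>M\<^esub> y \<cdot>\<^bsub>M\<^esub> E j j b'"
      using act_E_add[OF yc rj d(1) bT(2)] by simp
    then have "y \<cdot>\<^bsub>M\<^esub> E j j b' \<oplus>\<^bsub>M\<^esub> (y \<cdot>\<^bsub>M\<^esub> E j j (b \<ominus>\<^bsub>A\<^esub> b') \<oplus>\<^bsub>M\<^esub> v) = y \<cdot>\<^bsub>M\<^esub> E j j b' \<oplus>\<^bsub>M\<^esub> v'"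
      using v(3) yE(1)[OF bT(2)] yE(1)[OF d(1)] vc by (simp add: M.a_ac)
    then have e: "y \<cdot>\<^bsub>M\<^esub> E j j (b \<ominus>\<^bsub>A\<^esub> b') \<oplus>\<^bsub>M\<^esub> v = v'"
      using yE(1)[OF bT(2)] yE(1)[OF d(1)] vc by simp
    have "y \<cdot>\<^bsub>M\<^esub> E j j (b \<ominus>\<^bsub>A\<^esub> b') = v' \<ominus>\<^bsub>M\<^esub> v"
      unfolding e[symmetric] using yE(1)[OF d(1)] vc by (simp add: M.minus_eq M.a_assoc M.r_neg)
    then have "y \<cdot>\<^bsub>M\<^esub> E j j (b \<ominus>\<^bsub>A\<^esub> b') \<in> ?N \<inter> U" using U'(5)[OF v(2,1)] yE(2)[OF d(1)] by simp
    then have z: "y \<cdot>\<^bsub>M\<^esub> E j j (b \<ominus>\<^bsub>A\<^esub> b') = \<zero>\<^bsub>M\<^esub>" using U(3) by blast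
    obtain c where "c \<in> T j j" "y \<cdot>\<^bsub>M\<^esub> E j j (b \<ominus>\<^bsub>A\<^esub> b') \<cdot>\<^bsub>M\<^esub> E j j c = y" using yinv[OF d] by blast
    then show False using z zero_ract[OF E_closed[OF rj]] y0 by auto
  qed
  define \<beta> where "\<beta> s = (SOME b. ?P s b)" for s
  have \<beta>: "?P s (\<beta> s)" if "s \<in> socle \<Lambda> M" for s
    unfolding \<beta>_def by (rule someI_ex) (rule Pex[OF that])
  have \<beta>eq: "\<beta> s = b" if "s \<in> socle \<Lambda> M" "?P s b" for s b by (rule Puniq[OF \<beta>[OF that(1)] that(2)])
  let ?S = "M\<lparr>carrier := socle \<Lambda> M\<rparr>"
  have \<beta>hom: "\<beta> \<in> rmod_hom \<Lambda> ?S (vertex_rmod j)"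
  proof (rule rmod_homI)
    show "\<beta> s \<in> carrier (vertex_rmod j)" if "s \<in> carrier ?S" for s using \<beta>[of s] that by (simp add: vertex_rmod_simps)
    fix s assume "s \<in> carrier ?S"
    then have s: "s \<in> socle \<Lambda> M" and sc: "s \<in> carrier M" using soc'(1) by auto
    obtain v where v: "v \<in> U" "s \<cdot>\<^bsub>M\<^esub> E j j (u j) = y \<cdot>\<^bsub>M\<^esub> E j j (\<beta> s) \<oplus>\<^bsub>M\<^esub> v" and bs: "\<beta> s \<in> T j j" using \<beta>[OF s] by blast
    have vc: "v \<in> carrier M" using v U'(1) by blast
    {
      fix t assume "t \<in> carrier ?S"
      then have t: "t \<in> socle \<Lambda> M" and tc: "t \<in> carrier M" using soc'(1) by auto
      obtain w where w: "w \<in> U" "t \<cdot>\<^bsub>M\<^esub> E j j (u j) = y \<cdot>\<^bsub>M\<^esub> E j j (\<beta> t) \<oplus>\<^bsub>M\<^esub> w" and bt: "\<beta> t \<in> T j j" using \<beta>[OF t] by blast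
      have wc: "w \<in> carrier M" using w U'(1) by blast
      have "(s \<oplus>\<^bsub>M\<^esub> t) \<cdot>\<^bsub>M\<^esub> E j j (u j) = y \<cdot>\<^bsub>M\<^esub> E j j (\<beta> s \<oplus>\<^bsub>A\<^esub> \<beta> t) \<oplus>\<^bsub>M\<^esub> (v \<oplus>\<^bsub>M\<^esub> w)"
        using ract_add_left[OF sc tc unit_E_closed[OF j(1)]] v(2) w(2) act_E_add[OF yc rj bs bt]
          yE(1)[OF bs] yE(1)[OF bt] vc wc by (simp add: M.a_ac)
      then have "?P (s \<oplus>\<^bsub>M\<^esub> t) (\<beta> s \<oplus>\<^bsub>A\<^esub> \<beta> t)" using T_add[OF rj bs bt] U'(3)[OF v(1) w(1)] by blast
      from \<beta>eq[OF soc'(3)[OF s t] this]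
      show "\<beta> (s \<oplus>\<^bsub>?S\<^esub> t) = \<beta> s \<oplus>\<^bsub>vertex_rmod j\<^esub> \<beta> t" by (simp add: vertex_rmod_simps)
    }
    fix f assume f: "f \<in> carrier \<Lambda>"
    have fj: "f j j \<in> T j j" by (rule incidence_mem[OF f rj])
    have "s \<cdot>\<^bsub>M\<^esub> f \<cdot>\<^bsub>M\<^esub> E j j (u j) = s \<cdot>\<^bsub>M\<^esub> E j j (u j) \<cdot>\<^bsub>M\<^esub> E j j (f j j)"
      by (rule radical_annihilator_act[OF j(1) _ f]) (use s soc(2) in blast)
    also have "\<dots> = y \<cdot>\<^bsub>M\<^esub> E j j (\<beta> s \<otimes>\<^bsub>A\<^esub> f j j) \<oplus>\<^bsub>M\<^esub> v \<cdot>\<^bsub>M\<^esub> E j j (f j j)"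
      using v(2) ract_add_left[OF yE(1)[OF bs] vc E_closed[OF rj fj]] act_E_E[OF yc rj rj bs fj] by simp
    finally have "?P (s \<cdot>\<^bsub>M\<^esub> f) (\<beta> s \<otimes>\<^bsub>A\<^esub> f j j)"
      using T_mult[OF rj rj bs fj] U'(6)[OF v(1) E_closed[OF rj fj]] by blast
    from \<beta>eq[OF soc'(6)[OF s f] this]
    show "\<beta> (s \<cdot>\<^bsub>?S\<^esub> f) = \<beta> s \<cdot>\<^bsub>vertex_rmod j\<^esub> f" by (simp add: vertex_rmod_simps)
  qed
  have ysoc: "y \<in> socle \<Lambda> M" using yN Nsoc by blast
  have uj: "u j \<noteq> \<zero>\<^bsub>A\<^esub>" using vert_unit[OF yv] y0 act_E_zero[OF yc] by auto
  have "?P y (u j)" using unit_mem[OF j(1)] vert_unit[OF yv] U'(2) yc by (auto intro!: bexI[of _ "\<zero>\<^bsub>M\<^esub>"])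
  then have \<beta>y: "\<beta> y = u j" by (rule \<beta>eq[OF ysoc])
  let ?e = "E j j (u j)" and ?X = "principal_rmodule \<Lambda> (E j j (u j))" and ?Y = "vertex_rmod j"
  have eC: "?e \<in> carrier \<Lambda>" by (rule unit_E_closed[OF j(1)])
  have X: "right_module \<Lambda> ?X" by (rule right_module_principal[OF ring_incidence eC])
  have Y: "right_module \<Lambda> ?Y" by (rule right_module_vertex_rmod[OF j(1)])
  have Xs: "carrier ?X = {?e \<otimes>\<^bsub>\<Lambda>\<^esub> f | f. f \<in> carrier \<Lambda>}" "f \<cdot>\<^bsub>?X\<^esub> g = f \<otimes>\<^bsub>\<Lambda>\<^esub> g" "f \<oplus>\<^bsub>?X\<^esub> g = f \<oplus>\<^bsub>\<Lambda>\<^esub> g" "\<zero>\<^bsub>?X\<^esub> = \<zero>\<^bsub>\<Lambda>\<^esub>" for f g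
    by (simp_all add: principal_rmodule_def)
  have Xc: "f \<in> carrier \<Lambda>" if "f \<in> carrier ?X" for f using that Xs(1) eC by auto
  have Xrow: "f k l = \<zero>\<^bsub>A\<^esub>" if "f \<in> carrier ?X" "k \<noteq> j" for f k l
    using that E_mult[OF j(1) unit_carrier[OF j(1)]] unfolding Xs(1) by auto
  obtain \<iota> :: "('i \<Rightarrow> 'v) \<Rightarrow> 'v" where \<iota>: "inj_on \<iota> (extensional P)" using PiE_injection[OF inf finite_P] by blast
  \<comment> \<open>An element of \<open>e_j \<Lambda>\<close> is a matrix with the single row j,
    that is a finite family in A. Its entries are moved to \<open>'v\<close> by \<kappa> and then
    packed into one element by \<iota>.\<close>
  let ?\<iota> = "\<lambda>f. \<iota> (\<lambda>l\<in>P. \<kappa> (f j l))"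
  have \<iota>X: "inj_on ?\<iota> (carrier ?X)"
  proof (rule inj_onI)
    fix f g assume fg: "f \<in> carrier ?X" "g \<in> carrier ?X" "?\<iota> f = ?\<iota> g"
    note fc = incidence_carrier[OF Xc[OF fg(1)]] incidence_carrier[OF Xc[OF fg(2)]]
    have e: "(\<lambda>l\<in>P. \<kappa> (f j l)) = (\<lambda>l\<in>P. \<kappa> (g j l))" using fg(3) by (intro inj_onD[OF \<iota>]) auto
    have "f j l = g j l" for l
    proof (cases "l \<in> P")
      case True
      then have "\<kappa> (f j l) = \<kappa> (g j l)" using fun_cong[OF e, of l] by simp
      then show ?thesis using inj_onD[OF \<kappa>] fc by blast
    next
      case False
      then have "(j, l) \<notin> r" using r_sub by blast
      then show ?thesis using incidence_zero[OF Xc[OF fg(1)]] incidence_zero[OF Xc[OF fg(2)]] by simp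
    qed
    then have "f k l = g k l" for k l using Xrow[OF fg(1)] Xrow[OF fg(2)] by (cases "k = j") auto
    then show "f = g" by blast
  qed
  have \<kappa>Y: "inj_on \<kappa> (carrier ?Y)" using \<kappa> by (rule inj_on_subset) (use T_sub[OF rj] in \<open>auto simp: vertex_rmod_simps\<close>)
  interpret X: rmod \<Lambda> ?X using X by (rule rmod.intro)
  interpret Y: rmod \<Lambda> ?Y using Y by (rule rmod.intro)
  let ?X' = "image_rmod ?\<iota> ?X" and ?Y' = "image_rmod \<kappa> ?Y"
  note XT = X.transport[OF \<iota>X] and YT = Y.transport[OF \<kappa>Y]
  \<comment> \<open>The test epimorphism takes the entry at (j, j). A lift of \<beta> through it
    sends y to a row w whose entry at (j, j) is the unit.\<close>
  have ph: "(\<lambda>f. f j j) \<in> rmod_hom \<Lambda> ?X ?Y"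
    by (rule rmod_homI) (use Xc incidence_mem[OF _ rj] incidence_mult_diag[OF _ _ j(1)] in
      \<open>auto simp: vertex_rmod_simps Xs(2,3) incidence_algebra_simps(5)\<close>)
  let ?d = "inv_into (carrier ?X) ?\<iota>"
  have d: "?d \<in> rmod_hom \<Lambda> ?X' ?X" by (rule rmod_hom_inv_into[OF X XT(1-3)])
  have p: "(\<lambda>z. \<kappa> (?d z j j)) \<in> rmod_hom \<Lambda> ?X' ?Y'"
    by (rule rmod_hom_compose[OF rmod_hom_compose[OF d ph] YT(2)])
  have dinv: "?d (?\<iota> f) = f" if "f \<in> carrier ?X" for f by (rule inv_into_f_f[OF \<iota>X that])
  have psurj: "(\<lambda>z. \<kappa> (?d z j j)) ` carrier ?X' = carrier ?Y'"
  proof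
    show "(\<lambda>z. \<kappa> (?d z j j)) ` carrier ?X' \<subseteq> carrier ?Y'" using rmod_homD(1)[OF p] by blast
    show "carrier ?Y' \<subseteq> (\<lambda>z. \<kappa> (?d z j j)) ` carrier ?X'"
    proof
      fix q assume "q \<in> carrier ?Y'"
      then obtain b where b: "b \<in> T j j" "q = \<kappa> b" by (auto simp: vertex_rmod_simps)
      have bX: "E j j b \<in> carrier ?X"
        using E_mult_E[OF rj rj unit_mem[OF j(1)] b(1)] unit_left[OF rj b(1)] E_closed[OF rj b(1)] unfolding Xs(1) by force
      have "q = \<kappa> (?d (?\<iota> (E j j b)) j j)" unfolding dinv[OF bX] b(2) by (simp add: matrix_unit_def)
      then show "q \<in> (\<lambda>z. \<kappa> (?d z j j)) ` carrier ?X'" using bX by auto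
    qed
  qed
  have bh: "(\<lambda>s. \<kappa> (\<beta> s)) \<in> rmod_hom \<Lambda> ?S ?Y'" by (rule rmod_hom_compose[OF \<beta>hom YT(2)])
  obtain g where g: "g \<in> rmod_hom \<Lambda> ?S ?X'" "\<forall>s\<in>carrier ?S. \<kappa> (?d (g s) j j) = \<kappa> (\<beta> s)"
  proof -
    have "projective_rmodule \<Lambda> ?S" using sp by (simp add: socle_projective_def)
    then have "\<forall>f\<in>rmod_hom \<Lambda> ?S ?Y'. \<exists>g\<in>rmod_hom \<Lambda> ?S ?X'. \<forall>s\<in>carrier ?S. \<kappa> (?d (g s) j j) = f s"
      using p XT(1) YT(1) psurj unfolding projective_rmodule_def by meson
    then show thesis using bh that by meson
  qed
  define w where "w = ?d (g y)"
  have gy: "g y \<in> carrier ?X'" using rmod_homD(1)[OF g(1), of y] ysoc by simp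
  have w: "w \<in> carrier ?X" unfolding w_def by (rule rmod_homD(1)[OF d gy])
  have wj: "w j j = u j"
    using g(2) ysoc \<beta>y inj_onD[OF \<kappa>, of "w j j" "u j"] incidence_carrier[OF Xc[OF w]] unit_carrier[OF j(1)] unfolding w_def by simp
  \<comment> \<open>The lift is linear and y is annihilated by \<open>T_jm\<close>, so w is
    annihilated as well. By \<open>faithful\<close> this is impossible for a nonzero entry.\<close>
  have "w j j \<otimes>\<^bsub>A\<^esub> c = \<zero>\<^bsub>A\<^esub>" if c: "c \<in> T j m" for c
  proof -
    note rm = m_top[OF j(1)]
    have Ec: "E j m c \<in> carrier \<Lambda>" by (rule E_closed[OF rm c])
    have "y \<cdot>\<^bsub>M\<^esub> E j m c = \<zero>\<^bsub>M\<^esub>" by (rule radical_annihilatorD(2)[OF yrad rm jm c])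
    then have "g (y \<cdot>\<^bsub>?S\<^esub> E j m c) = \<zero>\<^bsub>?X'\<^esub>"
      using rmod_hom_zero[OF submodule_right_module[OF soc(1)] XT(1) g(1)] by simp
    then have "g y \<cdot>\<^bsub>?X'\<^esub> E j m c = \<zero>\<^bsub>?X'\<^esub>" using rmod_homD(3)[OF g(1) _ Ec, of y] ysoc by simp
    then have "w \<cdot>\<^bsub>?X\<^esub> E j m c = \<zero>\<^bsub>?X\<^esub>"
      unfolding w_def using rmod_homD(3)[OF d gy Ec] rmod_hom_zero[OF XT(1) X d] by simp
    then have "(w \<otimes>\<^bsub>\<Lambda>\<^esub> E j m c) j m = \<zero>\<^bsub>A\<^esub>" by (simp add: Xs(2,4) incidence_algebra_simps(4))
    moreover have "(w \<otimes>\<^bsub>\<Lambda>\<^esub> E j m c) j m = w j j \<otimes>\<^bsub>A\<^esub> c"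
      unfolding incidence_algebra_simps(2)
      by (rule A.finsum_single[OF finite_P j(1)]) (use incidence_carrier[OF Xc[OF w]] T_sub[OF rm c] in \<open>auto simp: matrix_unit_def\<close>)
    ultimately show ?thesis by simp
  qed
  then have "w j j = \<zero>\<^bsub>A\<^esub>" using faithful[OF rj] wj unit_mem[OF j(1)] by metis
  then show False using wj uj by simp
qed

end

section \<open>Full idempotents\<close>

text \<open>Morita equivalence enters only through the number of simple modules: an incidence algebra with
  division rings on the diagonal has at most one simple module per vertex, whereas \<open>\<Lambda>\<close> has at each vertex
  \<open>j\<close> a simple module not killed by \<open>\<epsilon> j\<close>, and a further one at \<open>i\<close> if \<open>\<epsilon> i\<close> generates a proper ideal.\<close>

lemma (in incidence) idempotent_full_if_morita_equivalent:
  fixes \<kappa> :: "'a \<Rightarrow> 'v"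
  assumes B: "incidence K A P r B" and div: "\<And>j. j \<in> P \<Longrightarrow> incidence.division_vertex A P B j"
    and morita: "morita_equivalent TYPE('v) (incidence_algebra A P r B) \<Lambda>"
    and \<epsilon>: "\<And>j. j \<in> P \<Longrightarrow> \<epsilon> j \<in> T j j \<and> \<epsilon> j \<otimes>\<^bsub>A\<^esub> \<epsilon> j = \<epsilon> j \<and> \<epsilon> j \<noteq> \<zero>\<^bsub>A\<^esub>"
    and \<kappa>: "inj_on \<kappa> (carrier A)" and i: "i \<in> P"
  shows "u i \<in> two_sided A (T i i) (\<epsilon> i)"
proof (rule ccontr)
  assume no: "u i \<notin> two_sided A (T i i) (\<epsilon> i)"
  interpret B: incidence K A P r B by (rule B)
  let ?C = "rmod_category B.\<Lambda> :: (('i \<Rightarrow> 'i \<Rightarrow> 'a, 'v) rmodule, 'v \<Rightarrow> 'v) category"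
  let ?D = "rmod_category \<Lambda> :: (('i \<Rightarrow> 'i \<Rightarrow> 'a, 'v) rmodule, 'v \<Rightarrow> 'v) category"
  obtain Fo Fm Go Gm \<eta> \<theta> where F: "cat_functor ?C ?D Fo Fm" and G: "cat_functor ?D ?C Go Gm"
    and \<eta>: "natural_iso ?C ?C (\<lambda>a. a) (\<lambda>a b f. f) (\<lambda>a. Go (Fo a)) (\<lambda>a b f. Gm (Fo a) (Fo b) (Fm a b f)) \<eta>"
    and \<theta>: "natural_iso ?D ?D (\<lambda>a. Fo (Go a)) (\<lambda>a b f. Fm (Go a) (Go b) (Gm a b f)) (\<lambda>a. a) (\<lambda>a b f. f) \<theta>"
    using morita unfolding morita_equivalent_def equivalent_categories_def by blast
  interpret F: cat_functor ?C ?D Fo Fm by (rule F)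
  interpret G: cat_functor ?D ?C Go Gm by (rule G)
  \<comment> \<open>F is faithful because its composite with G is naturally isomorphic to the
    identity; \<open>Gf\<close> is the same for the other composite.\<close>
  have Ff: "f = g" if o: "a \<in> Obj ?C" "b \<in> Obj ?C" and m: "f \<in> Hom ?C a b" "g \<in> Hom ?C a b" and e: "Fm a b f = Fm a b g" for a b f g
  proof (rule natural_iso_faithful[OF category_rmod _ _ disjI1[OF \<eta>] o m])
    show "Go (Fo c) \<in> Obj ?C" if "c \<in> Obj ?C" for c by (rule G.on_obj[OF F.on_obj[OF that]])
    show "Gm (Fo c) (Fo d) (Fm c d k) \<in> Hom ?C (Go (Fo c)) (Go (Fo d))"
      if "c \<in> Obj ?C" "d \<in> Obj ?C" "k \<in> Hom ?C c d" for c d k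
      by (rule G.on_hom[OF F.on_obj[OF that(1)] F.on_obj[OF that(2)] F.on_hom[OF that]])
    show "Gm (Fo a) (Fo b) (Fm a b f) = Gm (Fo a) (Fo b) (Fm a b g)" by (simp only: e)
  qed
  have Gf: "f = g" if o: "a \<in> Obj ?D" "b \<in> Obj ?D" and m: "f \<in> Hom ?D a b" "g \<in> Hom ?D a b" and e: "Gm a b f = Gm a b g" for a b f g
  proof (rule natural_iso_faithful[OF category_rmod _ _ disjI2[OF \<theta>] o m])
    show "Fo (Go c) \<in> Obj ?D" if "c \<in> Obj ?D" for c by (rule F.on_obj[OF G.on_obj[OF that]])
    show "Fm (Go c) (Go d) (Gm c d k) \<in> Hom ?D (Fo (Go c)) (Fo (Go d))"
      if "c \<in> Obj ?D" "d \<in> Obj ?D" "k \<in> Hom ?D c d" for c d k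
      by (rule F.on_hom[OF G.on_obj[OF that(1)] G.on_obj[OF that(2)] G.on_hom[OF that]])
    show "Fm (Go a) (Go b) (Gm a b f) = Fm (Go a) (Go b) (Gm a b g)" by (simp only: e)
  qed
  have iso: "iso_arrow ?D (Fo (Go S)) S (\<theta> S)" if "right_module \<Lambda> S" for S
    using \<theta> that unfolding natural_iso_def by simp
  have Gsimple: "simple_rmodule B.\<Lambda> (Go S)" if S: "simple_rmodule \<Lambda> S" for S
  proof -
    have "right_module \<Lambda> S" using S by (simp add: simple_rmodule_def)
    moreover have "simple_object ?D S" using S by (simp add: simple_object_rmod_category)
    ultimately have "simple_object ?C (Go S)"
    proof (intro simple_object_image[OF F G _ _ _ iso])
      show "\<And>a b f g. \<lbrakk>a \<in> Obj ?C; b \<in> Obj ?C; f \<in> Hom ?C a b; g \<in> Hom ?C a b; Fm a b f = Fm a b g\<rbrakk> \<Longrightarrow> f = g"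
        by (fact Ff)
      show "\<And>a b f g. \<lbrakk>a \<in> Obj ?D; b \<in> Obj ?D; f \<in> Hom ?D a b; g \<in> Hom ?D a b; Gm a b f = Gm a b g\<rbrakk> \<Longrightarrow> f = g"
        by (fact Gf)
    qed
    then show ?thesis by (simp add: simple_object_rmod_category)
  qed
  have Giso: "rmod_isomorphic \<Lambda> S S'"
    if S: "right_module \<Lambda> S" "right_module \<Lambda> S'" and GS: "rmod_isomorphic B.\<Lambda> (Go S) (Go S')" for S S'
  proof -
    have o: "Go S \<in> Obj ?C" "Go S' \<in> Obj ?C" using G.on_obj S by auto
    have fo: "right_module \<Lambda> (Fo (Go S))" "right_module \<Lambda> (Fo (Go S'))" using F.on_obj[OF o(1)] F.on_obj[OF o(2)] by auto
    have go: "right_module B.\<Lambda> (Go S)" "right_module B.\<Lambda> (Go S')" using o by auto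
    obtain f where "iso_arrow ?C (Go S) (Go S') f" using GS rmod_isomorphic_iff_iso_arrow[OF go] by blast
    then have "rmod_isomorphic \<Lambda> (Fo (Go S)) (Fo (Go S'))"
      using F.iso_arrow_image[OF o] rmod_isomorphic_iso_arrow by blast
    moreover have "rmod_isomorphic \<Lambda> (Fo (Go S)) S" "rmod_isomorphic \<Lambda> (Fo (Go S')) S'"
      using rmod_isomorphic_iso_arrow[OF iso] S by blast+
    ultimately show ?thesis
      using rmod_isomorphic_trans rmod_isomorphic_sym[OF fo(1) S(1)] by blast
  qed
  have conc: "\<exists>v \<in> P. \<forall>x \<in> carrier S. x \<cdot>\<^bsub>S\<^esub> matrix_unit A v v (system_unit A B v) = x"
    if S: "simple_rmodule B.\<Lambda> S" for S :: "('i \<Rightarrow> 'i \<Rightarrow> 'a, 'v) rmodule"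
  proof -
    interpret S: incidence_module K A P r B S
      using S by (intro incidence_module.intro rmod.intro B.incidence_axioms) (simp add: simple_rmodule_def)
    show ?thesis using S.simple_vert[OF S] unfolding S.vert_def by blast
  qed
  \<comment> \<open>States that S is concentrated at the vertex k; by \<open>distinct\<close>,
    isomorphic simple modules share their vertex.\<close>
  define conc_at where "conc_at S k \<longleftrightarrow> (\<forall>x \<in> carrier S. x \<cdot>\<^bsub>S\<^esub> E k k (u k) = x)"
    for S :: "('i \<Rightarrow> 'i \<Rightarrow> 'a, 'v) rmodule" and k
  have distinct: "j = k" if S: "simple_rmodule \<Lambda> S" "simple_rmodule \<Lambda> S'" and c: "conc_at S j" "conc_at S' k" and jk: "j \<in> P" "k \<in> P"
      and ii: "rmod_isomorphic \<Lambda> S S'" for S S' j k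
  proof (rule ccontr)
    assume n: "j \<noteq> k"
    have SM: "right_module \<Lambda> S" "right_module \<Lambda> S'" using S by (simp_all add: simple_rmodule_def)
    interpret S: incidence_module K A P r T S
      using SM by (intro incidence_module.intro rmod.intro incidence_axioms)
    interpret S': incidence_module K A P r T S'
      using SM by (intro incidence_module.intro rmod.intro incidence_axioms)
    obtain h where h: "h \<in> rmod_hom \<Lambda> S S'" "bij_betw h (carrier S) (carrier S')" using ii unfolding rmod_isomorphic_def by blast
    obtain x where x: "x \<in> carrier S" "x \<noteq> \<zero>\<^bsub>S\<^esub>" using S.simple_nonzero[OF S(1)] by blast
    have hx: "h x \<in> carrier S'" by (rule rmod_homD(1)[OF h(1) x(1)])
    have "h x \<in> S'.vert j"
      using rmod_homD(3)[OF h(1) x(1) S.unit_E_closed[OF jk(1)]] c(1) x(1) hx by (simp add: S'.vert_def conc_at_def)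
    moreover have "h x \<in> S'.vert k" using c(2) hx by (simp add: S'.vert_def conc_at_def)
    ultimately have "h x = \<zero>\<^bsub>S'\<^esub>" by (rule S'.vert_disjoint[OF jk n])
    then show False using x rmod_hom_inj_iff[OF SM h(1)] h(2) unfolding bij_betw_def by blast
  qed
  have \<kappa>T: "inj_on \<kappa> (carrier (vertex_rmod j))" if "j \<in> P" for j
    using inj_on_subset[OF \<kappa>] T_sub[OF r_refl[OF that]] by (auto simp: vertex_rmod_simps)
  \<comment> \<open>The simple module is a subquotient of \<open>vertex_rmod j\<close> in which the
    image of \<open>\<epsilon> j\<close> survives. This image is fixed by the action of
    \<open>\<epsilon> j\<close>, which is idempotent.\<close>
  have "\<exists>S :: ('i \<Rightarrow> 'i \<Rightarrow> 'a, 'v) rmodule. simple_rmodule \<Lambda> S \<and> conc_at S j \<and>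
      (\<exists>x \<in> carrier S. x \<noteq> \<zero>\<^bsub>S\<^esub> \<and> x \<cdot>\<^bsub>S\<^esub> E j j (\<epsilon> j) = x)" if j: "j \<in> P" for j
  proof -
    note rj = r_refl[OF j]
    interpret V: rmod \<Lambda> "vertex_rmod j" by (rule rmod.intro[OF right_module_vertex_rmod[OF j]])
    have e: "\<epsilon> j \<in> carrier (vertex_rmod j)" "\<epsilon> j \<notin> {\<zero>\<^bsub>vertex_rmod j\<^esub>}" using \<epsilon>[OF j] by (simp_all add: vertex_rmod_simps)
    obtain S :: "('i \<Rightarrow> 'i \<Rightarrow> 'a, 'v) rmodule" and \<pi> where S: "simple_rmodule \<Lambda> S" "carrier S \<subseteq> \<pi> ` carrier (vertex_rmod j)"
      "\<And>y a. \<lbrakk>y \<in> carrier (vertex_rmod j); a \<in> carrier \<Lambda>\<rbrakk> \<Longrightarrow> \<pi> y \<cdot>\<^bsub>S\<^esub> a = \<pi> (y \<cdot>\<^bsub>vertex_rmod j\<^esub> a)"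
      "\<pi> (\<epsilon> j) \<in> carrier S" "\<pi> (\<epsilon> j) \<noteq> \<zero>\<^bsub>S\<^esub>"
      using V.simple_quotient[OF V.rsubmodule_zero e \<kappa>T[OF j]] by metis
    have "conc_at S j" unfolding conc_at_def
    proof
      fix s assume "s \<in> carrier S"
      then obtain y where y: "y \<in> T j j" "s = \<pi> y" using S(2) by (auto simp: vertex_rmod_simps)
      then show "s \<cdot>\<^bsub>S\<^esub> E j j (u j) = s"
        using S(3)[of y "E j j (u j)"] E_closed[OF rj unit_mem[OF j]] unit_right[OF rj y(1)] by (simp add: vertex_rmod_simps matrix_unit_def)
    qed
    moreover have "\<pi> (\<epsilon> j) \<cdot>\<^bsub>S\<^esub> E j j (\<epsilon> j) = \<pi> (\<epsilon> j)"
      using S(3)[OF e(1), of "E j j (\<epsilon> j)"] E_closed[OF rj] \<epsilon>[OF j] by (simp add: vertex_rmod_simps matrix_unit_def)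
    ultimately show ?thesis using S(1,4,5) by blast
  qed
  then have "\<exists>S :: 'i \<Rightarrow> ('i \<Rightarrow> 'i \<Rightarrow> 'a, 'v) rmodule. \<forall>j \<in> P. simple_rmodule \<Lambda> (S j) \<and> conc_at (S j) j \<and>
      (\<exists>x \<in> carrier (S j). x \<noteq> \<zero>\<^bsub>S j\<^esub> \<and> x \<cdot>\<^bsub>S j\<^esub> E j j (\<epsilon> j) = x)" by (intro bchoice ballI)
  then obtain S :: "'i \<Rightarrow> ('i \<Rightarrow> 'i \<Rightarrow> 'a, 'v) rmodule" where S: "\<And>j. j \<in> P \<Longrightarrow> simple_rmodule \<Lambda> (S j)"
    "\<And>j. j \<in> P \<Longrightarrow> conc_at (S j) j" "\<And>j. j \<in> P \<Longrightarrow> \<exists>x \<in> carrier (S j). x \<noteq> \<zero>\<^bsub>S j\<^esub> \<and> x \<cdot>\<^bsub>S j\<^esub> E j j (\<epsilon> j) = x" by blast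
  have SM: "right_module \<Lambda> (S j)" if "j \<in> P" for j using S(1)[OF that] by (simp add: simple_rmodule_def)
  \<comment> \<open>The extra simple module is cut out of \<open>T i i\<close> modulo the ideal of
    \<open>\<epsilon> i\<close>, in which the unit survives by assumption. Every product
    \<open>y \<epsilon>_i\<close> lies in that ideal, so \<open>\<epsilon> i\<close> acts as
    zero.\<close>
  obtain S' :: "('i \<Rightarrow> 'i \<Rightarrow> 'a, 'v) rmodule" where S': "simple_rmodule \<Lambda> S'" "conc_at S' i"
    "\<And>x. x \<in> carrier S' \<Longrightarrow> x \<cdot>\<^bsub>S'\<^esub> E i i (\<epsilon> i) = \<zero>\<^bsub>S'\<^esub>"
  proof -
    note ri = r_refl[OF i]
    interpret V: rmod \<Lambda> "vertex_rmod i" by (rule rmod.intro[OF right_module_vertex_rmod[OF i]])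
    have Tc: "T i i \<subseteq> carrier A" using T_sub[OF ri] by blast
    have \<epsilon>c: "\<epsilon> i \<in> carrier A" using \<epsilon>[OF i] Tc by blast
    let ?J = "two_sided A (T i i) (\<epsilon> i)"
    have TJ: "?J \<subseteq> T i i"
    proof
      fix x assume "x \<in> ?J"
      then show "x \<in> T i i"
        by induction (use \<epsilon>[OF i] in \<open>auto intro!: T_zero[OF ri] T_add[OF ri] T_mult[OF ri ri]\<close>)
    qed
    have J: "rsubmodule \<Lambda> (vertex_rmod i) ?J"
    proof (rule V.rsubmoduleI)
      show "x \<oplus>\<^bsub>vertex_rmod i\<^esub> y \<in> ?J" if "x \<in> ?J" "y \<in> ?J" for x y
        using A.two_sided_add[OF Tc \<epsilon>c that] by (simp add: vertex_rmod_simps)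
      show "x \<cdot>\<^bsub>vertex_rmod i\<^esub> f \<in> ?J" if "x \<in> ?J" "f \<in> carrier \<Lambda>" for x f
        using A.two_sided_mult[OF Tc \<epsilon>c T_mult[OF ri ri] that(1) incidence_mem[OF that(2) ri]] by (simp add: vertex_rmod_simps)
    qed (use TJ in \<open>auto simp: vertex_rmod_simps two_sided.zero\<close>)
    have ui: "u i \<in> carrier (vertex_rmod i)" using unit_mem[OF i] by (simp add: vertex_rmod_simps)
    obtain S' :: "('i \<Rightarrow> 'i \<Rightarrow> 'a, 'v) rmodule" and \<pi> where S: "simple_rmodule \<Lambda> S'" "carrier S' \<subseteq> \<pi> ` carrier (vertex_rmod i)"
      "\<And>y a. \<lbrakk>y \<in> carrier (vertex_rmod i); a \<in> carrier \<Lambda>\<rbrakk> \<Longrightarrow> \<pi> y \<cdot>\<^bsub>S'\<^esub> a = \<pi> (y \<cdot>\<^bsub>vertex_rmod i\<^esub> a)"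
      "\<And>y. y \<in> ?J \<Longrightarrow> \<pi> y = \<zero>\<^bsub>S'\<^esub>"
      using V.simple_quotient[OF J ui no \<kappa>T[OF i]] by metis
    have el: "\<exists>y \<in> T i i. s = \<pi> y" if "s \<in> carrier S'" for s using S(2) that by (auto simp: vertex_rmod_simps)
    have "conc_at S' i" unfolding conc_at_def
    proof
      fix s assume "s \<in> carrier S'"
      then obtain y where y: "y \<in> T i i" "s = \<pi> y" using el by blast
      then show "s \<cdot>\<^bsub>S'\<^esub> E i i (u i) = s"
        using S(3)[of y "E i i (u i)"] E_closed[OF ri unit_mem[OF i]] unit_right[OF ri y(1)] by (simp add: vertex_rmod_simps matrix_unit_def)
    qed
    moreover have "s \<cdot>\<^bsub>S'\<^esub> E i i (\<epsilon> i) = \<zero>\<^bsub>S'\<^esub>" if sS: "s \<in> carrier S'" for s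
    proof -
      obtain y where y: "y \<in> T i i" "s = \<pi> y" using el[OF sS] by blast
      have \<epsilon>T: "\<epsilon> i \<in> T i i" using \<epsilon>[OF i] by blast
      have "y \<otimes>\<^bsub>A\<^esub> \<epsilon> i \<otimes>\<^bsub>A\<^esub> u i \<in> ?J" by (rule A.two_sided_gen[OF Tc \<epsilon>c y(1) unit_mem[OF i]])
      \<comment> \<open>The ideal consists of sums of products with factors on both sides of
        \<open>\<epsilon> i\<close>; the unit serves as the right factor here.\<close>
      then have "y \<otimes>\<^bsub>A\<^esub> \<epsilon> i \<in> ?J" using unit_right[OF ri T_mult[OF ri ri y(1) \<epsilon>T]] by simp
      then show ?thesis using S(3)[of y "E i i (\<epsilon> i)"] S(4) y E_closed[OF ri \<epsilon>T] by (simp add: vertex_rmod_simps matrix_unit_def)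
    qed
    ultimately show thesis using that S(1) by blast
  qed
  have S'M: "right_module \<Lambda> S'" using S'(1) by (simp add: simple_rmodule_def)
  \<comment> \<open>\<open>v j\<close> is the vertex of the corner algebra at which
    \<open>Go (S j)\<close> lives. It determines \<open>Go (S j)\<close> up to isomorphism, hence
    also \<open>S j\<close> and with it j.\<close>
  have "\<exists>v. \<forall>j\<in>P. v j \<in> P \<and> (\<forall>x \<in> carrier (Go (S j)). x \<cdot>\<^bsub>Go (S j)\<^esub> matrix_unit A (v j) (v j) (system_unit A B (v j)) = x)"
    using conc[OF Gsimple[OF S(1)]] by (intro bchoice) blast
  then obtain v where v: "\<And>j. j \<in> P \<Longrightarrow> v j \<in> P"
    "\<And>j x. j \<in> P \<Longrightarrow> x \<in> carrier (Go (S j)) \<Longrightarrow> x \<cdot>\<^bsub>Go (S j)\<^esub> matrix_unit A (v j) (v j) (system_unit A B (v j)) = x" by blast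
  have "inj_on v P"
  proof (rule inj_onI)
    fix j k assume jk: "j \<in> P" "k \<in> P" "v j = v k"
    have "rmod_isomorphic B.\<Lambda> (Go (S j)) (Go (S k))"
      by (rule B.simple_isomorphic_at_division_vertex[OF div[OF v(1)[OF jk(1)]] Gsimple[OF S(1)[OF jk(1)]] Gsimple[OF S(1)[OF jk(2)]]])
        (use v(2)[OF jk(1)] v(2)[OF jk(2)] jk(3) in simp_all)
    then have "rmod_isomorphic \<Lambda> (S j) (S k)" by (rule Giso[OF SM[OF jk(1)] SM[OF jk(2)]])
    then show "j = k" by (rule distinct[OF S(1)[OF jk(1)] S(1)[OF jk(2)] S(2)[OF jk(1)] S(2)[OF jk(2)] jk(1,2)])
  qed
  \<comment> \<open>An injective self-map of a finite set is onto, so \<open>Go S'\<close> shares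
    its vertex with some \<open>Go (S j)\<close>. Then S' is isomorphic to \<open>S j\<close>, and j
    = i as both live at one vertex. But \<open>\<epsilon> i\<close> fixes a nonzero element of
    \<open>S i\<close> and kills S'.\<close>
  then have vP: "v ` P = P" using finite_P v(1) by (intro endo_inj_surj) auto
  obtain v' where v': "v' \<in> P" "\<And>x. x \<in> carrier (Go S') \<Longrightarrow> x \<cdot>\<^bsub>Go S'\<^esub> matrix_unit A v' v' (system_unit A B v') = x"
    using conc[OF Gsimple[OF S'(1)]] by blast
  obtain j where j: "j \<in> P" "v' = v j" using vP v'(1) by blast
  have "rmod_isomorphic B.\<Lambda> (Go (S j)) (Go S')"
    by (rule B.simple_isomorphic_at_division_vertex[OF div[OF v(1)[OF j(1)]] Gsimple[OF S(1)[OF j(1)]] Gsimple[OF S'(1)]])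
      (use v(2)[OF j(1)] v'(2) j(2) in simp_all)
  then have ii: "rmod_isomorphic \<Lambda> (S j) S'" by (rule Giso[OF SM[OF j(1)] S'M])
  have ji: "j = i" by (rule distinct[OF S(1)[OF j(1)] S'(1) S(2)[OF j(1)] S'(2) j(1) i ii])
  obtain h where h: "h \<in> rmod_hom \<Lambda> (S i) S'" "bij_betw h (carrier (S i)) (carrier S')" using ii ji unfolding rmod_isomorphic_def by blast
  obtain x where x: "x \<in> carrier (S i)" "x \<noteq> \<zero>\<^bsub>S i\<^esub>" "x \<cdot>\<^bsub>S i\<^esub> E i i (\<epsilon> i) = x" using S(3)[OF i] by blast
  have \<epsilon>\<Lambda>: "E i i (\<epsilon> i) \<in> carrier \<Lambda>" using E_closed[OF r_refl[OF i]] \<epsilon>[OF i] by blast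
  have "h x = \<zero>\<^bsub>S'\<^esub>"
    using rmod_homD(3)[OF h(1) x(1) \<epsilon>\<Lambda>] S'(3)[OF rmod_homD(1)[OF h(1) x(1)]] unfolding x(3) by (rule trans)
  then show False using x(1,2) rmod_hom_inj_iff[OF SM[OF i] S'M h(1)] h(2) unfolding bij_betw_def by blast
qed

section \<open>Extended systems\<close>

context incidence
begin

text \<open>The corner consists of the elements of \<open>T i j\<close> fixed by
  \<open>\<epsilon> i\<close> on the left and by \<open>\<epsilon> j\<close> on the right:
  \<open>el\<close> and \<open>mem\<close> are the two inclusions. In this form closure under sums,
  scalars and products is immediate.\<close>

lemma corner_system_equipped:
  assumes \<epsilon>: "\<And>i. i \<in> P \<Longrightarrow> \<epsilon> i \<in> T i i \<and> \<epsilon> i \<otimes>\<^bsub>A\<^esub> \<epsilon> i = \<epsilon> i"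
  shows "equipped_poset K A P r (corner_system A \<epsilon> T)"
    and "i \<in> P \<Longrightarrow> system_unit A (corner_system A \<epsilon> T) i = \<epsilon> i"
proof -
  let ?C = "corner_system A \<epsilon> T"
  have \<epsilon>c: "\<epsilon> i \<in> carrier A" if "i \<in> P" for i using \<epsilon>[OF that] T_sub[OF r_refl[OF that]] by blast
  have el: "x \<in> carrier A" "\<epsilon> i \<otimes>\<^bsub>A\<^esub> x = x" "x \<otimes>\<^bsub>A\<^esub> \<epsilon> j = x" "x \<in> T i j" if ij: "(i, j) \<in> r" and x: "x \<in> ?C i j" for i j x
  proof -
    have ijP: "i \<in> P" "j \<in> P" using r_sub[OF ij] by auto
    obtain t where t: "t \<in> T i j" "x = \<epsilon> i \<otimes>\<^bsub>A\<^esub> t \<otimes>\<^bsub>A\<^esub> \<epsilon> j" using x unfolding corner_system_def by blast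
    note c = \<epsilon>c[OF ijP(1)] \<epsilon>c[OF ijP(2)] T_sub[OF ij t(1)]
    show xT: "x \<in> T i j" unfolding t(2)
      using T_mult[OF ij r_refl[OF ijP(2)] T_mult[OF r_refl[OF ijP(1)] ij _ t(1)]] \<epsilon>[OF ijP(1)] \<epsilon>[OF ijP(2)] by blast
    then show "x \<in> carrier A" using T_sub[OF ij] by blast
    have "\<epsilon> i \<otimes>\<^bsub>A\<^esub> x = (\<epsilon> i \<otimes>\<^bsub>A\<^esub> \<epsilon> i) \<otimes>\<^bsub>A\<^esub> t \<otimes>\<^bsub>A\<^esub> \<epsilon> j" unfolding t(2) using c by (simp add: A.m_assoc)
    then show "\<epsilon> i \<otimes>\<^bsub>A\<^esub> x = x" using \<epsilon>[OF ijP(1)] t(2) by simp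
    have "x \<otimes>\<^bsub>A\<^esub> \<epsilon> j = \<epsilon> i \<otimes>\<^bsub>A\<^esub> t \<otimes>\<^bsub>A\<^esub> (\<epsilon> j \<otimes>\<^bsub>A\<^esub> \<epsilon> j)" unfolding t(2) using c by (simp add: A.m_assoc)
    then show "x \<otimes>\<^bsub>A\<^esub> \<epsilon> j = x" using \<epsilon>[OF ijP(2)] t(2) by simp
  qed
  have mem: "x \<in> ?C i j" if ij: "(i, j) \<in> r" and x: "x \<in> T i j" "\<epsilon> i \<otimes>\<^bsub>A\<^esub> x = x" "x \<otimes>\<^bsub>A\<^esub> \<epsilon> j = x" for i j x
    unfolding corner_system_def using x by force
  have \<epsilon>m: "\<epsilon> i \<in> ?C i i" if "i \<in> P" for i using mem[OF r_refl[OF that]] \<epsilon>[OF that] by simp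
  show unit: "system_unit A ?C i = \<epsilon> i" if "i \<in> P" for i
    unfolding system_unit_def
  proof (rule the_equality)
    show "\<epsilon> i \<in> ?C i i \<and> (\<forall>x\<in>?C i i. \<epsilon> i \<otimes>\<^bsub>A\<^esub> x = x \<and> x \<otimes>\<^bsub>A\<^esub> \<epsilon> i = x)"
      using \<epsilon>m[OF that] el(2,3)[OF r_refl[OF that]] by blast
    show "e = \<epsilon> i" if e: "e \<in> ?C i i \<and> (\<forall>x\<in>?C i i. e \<otimes>\<^bsub>A\<^esub> x = x \<and> x \<otimes>\<^bsub>A\<^esub> e = x)" for e
    proof -
      have "e \<otimes>\<^bsub>A\<^esub> \<epsilon> i = \<epsilon> i" using e \<epsilon>m[OF \<open>i \<in> P\<close>] by blast
      moreover have "e \<otimes>\<^bsub>A\<^esub> \<epsilon> i = e" using e el(3)[OF r_refl[OF \<open>i \<in> P\<close>]] by blast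
      ultimately show ?thesis by simp
    qed
  qed
  have sub: "submodule (?C i j) K A" if ij: "(i, j) \<in> r" for i j
  proof (rule submoduleI)
    have ijP: "i \<in> P" "j \<in> P" using r_sub[OF ij] by auto
    note c = \<epsilon>c[OF ijP(1)] \<epsilon>c[OF ijP(2)]
    show "?C i j \<subseteq> carrier A" using el(1)[OF ij] by blast
    show "\<zero>\<^bsub>A\<^esub> \<in> ?C i j" using mem[OF ij T_zero[OF ij]] c by simp
    fix x assume x: "x \<in> ?C i j"
    note xe = el[OF ij x]
    show "\<ominus>\<^bsub>A\<^esub> x \<in> ?C i j" using mem[OF ij T_uminus[OF ij xe(4)]] xe c by (simp add: A.l_minus A.r_minus)
    show "k \<odot>\<^bsub>A\<^esub> x \<in> ?C i j" if k: "k \<in> carrier K" for k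
      using mem[OF ij T_smult[OF ij k xe(4)]] smult_mult_left[OF k xe(1) c(2)] smult_mult_right[OF k c(1) xe(1)] xe by simp
    fix y assume y: "y \<in> ?C i j"
    show "x \<oplus>\<^bsub>A\<^esub> y \<in> ?C i j" using mem[OF ij T_add[OF ij xe(4) el(4)[OF ij y]]] xe el[OF ij y] c by (simp add: A.l_distr A.r_distr)
  qed
  have mult: "x \<otimes>\<^bsub>A\<^esub> y \<in> ?C i l" if ij: "(i, j) \<in> r" and jl: "(j, l) \<in> r" and x: "x \<in> ?C i j" and y: "y \<in> ?C j l" for i j l x y
  proof (rule mem[OF r_trans[OF ij jl] T_mult[OF ij jl el(4)[OF ij x] el(4)[OF jl y]]])
    have c: "\<epsilon> i \<in> carrier A" "\<epsilon> l \<in> carrier A" using \<epsilon>c r_sub[OF ij] r_sub[OF jl] by auto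
    show "\<epsilon> i \<otimes>\<^bsub>A\<^esub> (x \<otimes>\<^bsub>A\<^esub> y) = x \<otimes>\<^bsub>A\<^esub> y"
      using A.m_assoc[OF c(1) el(1)[OF ij x] el(1)[OF jl y]] el(2)[OF ij x] by simp
    show "x \<otimes>\<^bsub>A\<^esub> y \<otimes>\<^bsub>A\<^esub> \<epsilon> l = x \<otimes>\<^bsub>A\<^esub> y"
      using A.m_assoc[OF el(1)[OF ij x] el(1)[OF jl y] c(2)] el(3)[OF jl y] by simp
  qed
  have "multiplicative_system K A P r ?C"
    unfolding multiplicative_system_def
  proof (intro conjI)
    show "\<forall>(i, j)\<in>r. submodule (?C i j) K A" using sub by auto
    show "\<forall>i j l. (i, j) \<in> r \<longrightarrow> (j, l) \<in> r \<longrightarrow> (\<forall>x\<in>?C i j. \<forall>y\<in>?C j l. x \<otimes>\<^bsub>A\<^esub> y \<in> ?C i l)" using mult by blast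
    show "\<forall>i\<in>P. \<exists>e\<in>?C i i. \<forall>x\<in>?C i i. e \<otimes>\<^bsub>A\<^esub> x = x \<and> x \<otimes>\<^bsub>A\<^esub> e = x"
      using \<epsilon>m el(2,3)[OF r_refl] by blast
    show "\<forall>(i, j)\<in>r. \<forall>x\<in>?C i j. system_unit A ?C i \<otimes>\<^bsub>A\<^esub> x = x \<and> x \<otimes>\<^bsub>A\<^esub> system_unit A ?C j = x"
      using unit r_sub el(2,3) by auto
  qed
  then show "equipped_poset K A P r ?C" using equipped by (simp add: equipped_poset_def)
qed

end

section \<open>Posets with an added greatest and least element\<close>

lemma poset_members [simp]:
  "Elt i \<in> poset_top P \<longleftrightarrow> i \<in> P" "Top \<in> poset_top P" "Bot \<notin> poset_top P"
  "i' \<in> poset_bot_top P \<longleftrightarrow> i' = Bot \<or> i' \<in> poset_top P"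
  by (auto simp: poset_top_def poset_bot_top_def)

lemma order_members [simp]:
  "(Elt i, Elt j) \<in> order_bot_top P r \<longleftrightarrow> (i, j) \<in> r"
  "(i', Top) \<in> order_bot_top P r \<longleftrightarrow> i' \<in> poset_bot_top P"
  "(Bot, i') \<in> order_bot_top P r \<longleftrightarrow> i' \<in> poset_bot_top P"
  "(Elt i, Bot) \<notin> order_bot_top P r" "(Top, Bot) \<notin> order_bot_top P r" "(Top, Elt i) \<notin> order_bot_top P r"
  by (auto simp: order_bot_top_def order_top_def)

lemma order_top_eq:
  assumes "r \<subseteq> P \<times> P"
  shows "order_top P r = order_bot_top P r \<inter> poset_top P \<times> poset_top P"
  using assms by (auto simp: order_bot_top_def order_top_def)

lemma partial_order_bot_top:
  assumes "partial_order_on P r"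
  shows "partial_order_on (poset_bot_top P) (order_bot_top P r)"
proof -
  note p = partial_order_onD[OF assms]
  have s: "(x, y) \<in> order_bot_top P r \<Longrightarrow> x \<in> poset_bot_top P \<and> y \<in> poset_bot_top P" for x y
    using p(4) by (cases x; cases y) auto
  have "refl_on (poset_bot_top P) (order_bot_top P r)"
  proof (rule refl_onI)
    fix x assume "x \<in> poset_bot_top P"
    then show "(x, x) \<in> order_bot_top P r" using refl_onD[OF p(1)] by (cases x) auto
  qed
  moreover have "trans (order_bot_top P r)"
  proof (rule transI)
    fix x y z assume xy: "(x, y) \<in> order_bot_top P r" and yz: "(y, z) \<in> order_bot_top P r"
    show "(x, z) \<in> order_bot_top P r"
    proof (cases x)
      case Bot then show ?thesis using s[OF yz] by simp
    next
      case x: (Elt i)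
      show ?thesis
      proof (cases z)
        case z: (Elt k)
        then obtain j where "y = Elt j" using yz xy x by (cases y) auto
        then show ?thesis using xy yz x z transD[OF p(2)] by simp
      qed (use xy yz x s[OF xy] in \<open>cases y; auto\<close>)+
    next
      case Top
      then have "y = Top" using xy by (cases y) auto
      then show ?thesis using Top yz by simp
    qed
  qed
  moreover have "antisym (order_bot_top P r)"
  proof (rule antisymI)
    fix x y assume "(x, y) \<in> order_bot_top P r" "(y, x) \<in> order_bot_top P r"
    then show "x = y" using antisymD[OF p(3)] by (cases x; cases y) auto
  qed
  ultimately show ?thesis unfolding partial_order_on_def preorder_on_def using s by auto
qed

text \<open>Lets the poset with only the greatest element added inherit what is proved for the one
  with both elements added, so that the case analysis over the added points is done once.\<close>

lemma equipped_restrict: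
  assumes e: "equipped_poset K A P r T" and Q: "Q \<subseteq> P"
  shows "equipped_poset K A Q (r \<inter> Q \<times> Q) T"
proof -
  interpret incidence K A P r T using e by (rule incidence.intro)
  have "partial_order_on Q (r \<inter> Q \<times> Q)"
    unfolding partial_order_on_def preorder_on_def
    using Q r_refl r_trans r_antisym by (auto intro!: refl_onI transI antisymI)
  moreover have "finite Q" using finite_P Q by (rule rev_finite_subset)
  moreover have "multiplicative_system K A Q (r \<inter> Q \<times> Q) T"
    unfolding multiplicative_system_def
  proof (intro conjI)
    show "\<forall>(i, j)\<in>r \<inter> Q \<times> Q. submodule (T i j) K A" using T_submodule by auto
    show "\<forall>i j l. (i, j) \<in> r \<inter> Q \<times> Q \<longrightarrow> (j, l) \<in> r \<inter> Q \<times> Q \<longrightarrow> (\<forall>x\<in>T i j. \<forall>y\<in>T j l. x \<otimes>\<^bsub>A\<^esub> y \<in> T i l)"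
      using T_mult by blast
    show "\<forall>i\<in>Q. \<exists>e\<in>T i i. \<forall>x\<in>T i i. e \<otimes>\<^bsub>A\<^esub> x = x \<and> x \<otimes>\<^bsub>A\<^esub> e = x"
      using unit_mem unit_left[OF r_refl] unit_right[OF r_refl] Q by blast
    show "\<forall>(i, j)\<in>r \<inter> Q \<times> Q. \<forall>x\<in>T i j. u i \<otimes>\<^bsub>A\<^esub> x = x \<and> x \<otimes>\<^bsub>A\<^esub> u j = x"
      using unit_left unit_right by auto
  qed
  ultimately show ?thesis using e by (simp add: equipped_poset_def)
qed

locale unital_poset = P: incidence K A P r T
  for K :: "('k, 'c) ring_scheme" and A :: "('k, 'a) module"
    and P :: "'p set" and r :: "'p rel" and T :: "'p \<Rightarrow> 'p \<Rightarrow> 'a set" +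
  assumes one: "i \<in> P \<Longrightarrow> \<one>\<^bsub>A\<^esub> \<in> T i i"
begin

abbreviation "Q \<equiv> poset_bot_top P"
abbreviation "rQ \<equiv> order_bot_top P r"
abbreviation "T0 \<equiv> extended_system A T"

lemma P_unit: "i \<in> P \<Longrightarrow> system_unit A T i = \<one>\<^bsub>A\<^esub>"
  by (rule P.unit_eqI[OF one]) (use P.T_sub[OF P.r_refl] in auto)

lemma T0_sub: "(i, j) \<in> rQ \<Longrightarrow> x \<in> T0 i j \<Longrightarrow> x \<in> carrier A"
  using P.T_sub by (cases i; cases j) auto

lemma T0_one: "i \<in> Q \<Longrightarrow> \<one>\<^bsub>A\<^esub> \<in> T0 i i"
  using one by (cases i) auto

text \<open>An entry with an end outside P is all of A. A chain i \<le> j \<le> l with both ends in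
  P stays in P, so closure under products has content only there.\<close>

lemma extended_equipped: "equipped_poset K A Q rQ T0"
proof -
  have po: "partial_order_on Q rQ" by (rule partial_order_bot_top[OF P.partial_order])
  have one': "system_unit A T0 i = \<one>\<^bsub>A\<^esub>" if "i \<in> Q" for i
    unfolding system_unit_def
  proof (rule the_equality)
    have "(i, i) \<in> rQ" using po that by (simp add: partial_order_on_def preorder_on_def refl_on_def)
    then show "\<one>\<^bsub>A\<^esub> \<in> T0 i i \<and> (\<forall>x\<in>T0 i i. \<one>\<^bsub>A\<^esub> \<otimes>\<^bsub>A\<^esub> x = x \<and> x \<otimes>\<^bsub>A\<^esub> \<one>\<^bsub>A\<^esub> = x)"
      using T0_one[OF that] T0_sub[of i i] by auto
    show "e = \<one>\<^bsub>A\<^esub>" if e: "e \<in> T0 i i \<and> (\<forall>x\<in>T0 i i. e \<otimes>\<^bsub>A\<^esub> x = x \<and> x \<otimes>\<^bsub>A\<^esub> e = x)" for e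
      using e T0_one[OF \<open>i \<in> Q\<close>] T0_sub[OF \<open>(i, i) \<in> rQ\<close>, of e] P.A.r_one by metis
  qed
  have sub: "submodule (T0 i j) K A" if "(i, j) \<in> rQ" for i j
    using that P.T_submodule P.carrier_is_submodule by (cases i; cases j) auto
  have "multiplicative_system K A Q rQ T0"
    unfolding multiplicative_system_def
  proof (intro conjI)
    show "\<forall>(i, j)\<in>rQ. submodule (T0 i j) K A" using sub by auto
    show "\<forall>i j l. (i, j) \<in> rQ \<longrightarrow> (j, l) \<in> rQ \<longrightarrow> (\<forall>x\<in>T0 i j. \<forall>y\<in>T0 j l. x \<otimes>\<^bsub>A\<^esub> y \<in> T0 i l)"
    proof (intro allI impI ballI)
      fix i j l x y assume ij: "(i, j) \<in> rQ" "(j, l) \<in> rQ" and x: "x \<in> T0 i j" and y: "y \<in> T0 j l"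
      have "x \<otimes>\<^bsub>A\<^esub> y \<in> carrier A" using T0_sub[OF ij(1) x] T0_sub[OF ij(2) y] by simp
      then show "x \<otimes>\<^bsub>A\<^esub> y \<in> T0 i l" using ij x y P.T_mult by (cases i; cases j; cases l) auto
    qed
    show "\<forall>i\<in>Q. \<exists>e\<in>T0 i i. \<forall>x\<in>T0 i i. e \<otimes>\<^bsub>A\<^esub> x = x \<and> x \<otimes>\<^bsub>A\<^esub> e = x"
    proof
      fix i assume i: "i \<in> Q"
      have "(i, i) \<in> rQ" using po i by (simp add: partial_order_on_def preorder_on_def refl_on_def)
      then show "\<exists>e\<in>T0 i i. \<forall>x\<in>T0 i i. e \<otimes>\<^bsub>A\<^esub> x = x \<and> x \<otimes>\<^bsub>A\<^esub> e = x"
        using T0_one[OF i] T0_sub[of i i] by (intro bexI[of _ "\<one>\<^bsub>A\<^esub>"]) auto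
    qed
    have "i \<in> Q \<and> j \<in> Q" if "(i, j) \<in> rQ" for i j using that po by (auto simp: partial_order_on_def preorder_on_def)
    then show "\<forall>(i, j)\<in>rQ. \<forall>x\<in>T0 i j. system_unit A T0 i \<otimes>\<^bsub>A\<^esub> x = x \<and> x \<otimes>\<^bsub>A\<^esub> system_unit A T0 j = x"
      using one' T0_sub by auto
  qed
  moreover have "finite Q" using P.finite_P by (simp add: poset_bot_top_def poset_top_def)
  ultimately show ?thesis using po P.equipped by (simp add: equipped_poset_def)
qed

end

text \<open>The assumptions \<open>full_top\<close> and \<open>full\<close> say that \<open>A \<epsilon>\<^sub>m A = A\<close> and \<open>T\<^sub>i \<epsilon>\<^sub>i T\<^sub>i = T\<^sub>i\<close>.\<close>

locale extendable_poset = unital_poset K A P r T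
  for K :: "('k, 'c) ring_scheme" and A :: "('k, 'a) module"
    and P :: "'p set" and r :: "'p rel" and T :: "'p \<Rightarrow> 'p \<Rightarrow> 'a set" +
  fixes \<epsilon> :: "'p extended \<Rightarrow> 'a"
  assumes idem: "x \<in> poset_top P \<Longrightarrow> \<epsilon> x \<in> extended_system A T x x \<and> \<epsilon> x \<otimes>\<^bsub>A\<^esub> \<epsilon> x = \<epsilon> x"
    and inverse: "\<lbrakk>x \<in> poset_top P; a \<in> corner_system A \<epsilon> (extended_system A T) x x; a \<noteq> \<zero>\<^bsub>A\<^esub>\<rbrakk>
      \<Longrightarrow> \<exists>b \<in> corner_system A \<epsilon> (extended_system A T) x x. a \<otimes>\<^bsub>A\<^esub> b = \<epsilon> x"
    and full_top: "\<one>\<^bsub>A\<^esub> \<in> two_sided A (carrier A) (\<epsilon> Top)"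
    and full: "i \<in> P \<Longrightarrow> \<one>\<^bsub>A\<^esub> \<in> two_sided A (T i i) (\<epsilon> (Elt i))"
    and top_nonzero: "\<epsilon> Top \<noteq> \<zero>\<^bsub>A\<^esub>"

text \<open>Distils \<open>extendable_via\<close> into the equalities of ideals on which the
  equivalence rests, by applying the count of simple modules to the corner system and to the full
  system over the poset with the greatest element added.\<close>

lemma extendable_posetI:
  fixes K :: "('k, 'c) ring_scheme" and A :: "('k, 'a) module" and \<kappa> :: "'a \<Rightarrow> 'v"
  assumes ext: "extendable_via TYPE('v) K A P r T \<epsilon>" and \<kappa>: "inj_on \<kappa> (carrier A)"
  shows "extendable_poset K A P r T \<epsilon>"
proof -
  note E = ext[unfolded extendable_via_def]
  let ?C = "corner_system A \<epsilon> (extended_system A T)"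
  have eq: "equipped_poset K A P r T" and one: "\<And>i. i \<in> P \<Longrightarrow> \<one>\<^bsub>A\<^esub> \<in> T i i" using E by blast+
  interpret unital_poset K A P r T using eq one by (intro unital_poset.intro incidence.intro unital_poset_axioms.intro)
  have idem: "\<epsilon> i \<in> T0 i i \<and> \<epsilon> i \<otimes>\<^bsub>A\<^esub> \<epsilon> i = \<epsilon> i" if "i \<in> poset_top P" for i using E that by blast
  have r_sub: "r \<subseteq> P \<times> P" using P.r_sub by auto
  have sub: "poset_top P \<subseteq> Q" by auto
  have ge: "equipped_poset K A (poset_top P) (order_top P r) T0"
    unfolding order_top_eq[OF r_sub] by (rule equipped_restrict[OF extended_equipped sub])
  interpret G: incidence K A "poset_top P" "order_top P r" T0 using ge by (rule incidence.intro)
  have adm: "admissible_system K A (poset_top P) (order_top P r) Top ?C" using E by blast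
  then interpret C: incidence K A "poset_top P" "order_top P r" ?C
    by (intro incidence.intro) (simp add: admissible_system_def)
  have unit: "system_unit A ?C i = \<epsilon> i" if "i \<in> poset_top P" for i
    by (rule G.corner_system_equipped(2)) (use idem that in auto)
  have D: "ring (A\<lparr>carrier := ?C i i, one := system_unit A ?C i\<rparr>) \<and>
      Units (A\<lparr>carrier := ?C i i, one := system_unit A ?C i\<rparr>) = ?C i i - {\<zero>\<^bsub>A\<^esub>}" if "i \<in> poset_top P" for i
    using adm that unfolding admissible_system_def Let_def by auto
  have inv: "\<exists>y \<in> ?C i i. x \<otimes>\<^bsub>A\<^esub> y = \<epsilon> i" if i: "i \<in> poset_top P" and x: "x \<in> ?C i i" "x \<noteq> \<zero>\<^bsub>A\<^esub>" for i x
  proof -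
    have "x \<in> Units (A\<lparr>carrier := ?C i i, one := system_unit A ?C i\<rparr>)" using D[OF i] x by simp
    then show ?thesis using unit[OF i] unfolding Units_def by auto
  qed
  \<comment> \<open>The units of the corner ring are exactly its nonzero elements, and its one is a
    unit.\<close>
  have nonzero: "\<epsilon> i \<noteq> \<zero>\<^bsub>A\<^esub>" if i: "i \<in> poset_top P" for i
  proof -
    interpret D: ring "A\<lparr>carrier := ?C i i, one := system_unit A ?C i\<rparr>" using D[OF i] by blast
    show ?thesis using D.Units_one_closed D[OF i] unit[OF i] by auto
  qed
  have Gunit: "system_unit A T0 i = \<one>\<^bsub>A\<^esub>" if "i \<in> poset_top P" for i
    by (rule G.unit_eqI) (use that T0_one[of i] G.T_sub[OF G.r_refl[OF that]] in auto)
  have div: "C.division_vertex i" if "i \<in> poset_top P" for i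
    unfolding C.division_vertex_def using inv that unit by auto
  \<comment> \<open>At \<open>Elt i\<close> this concerns the ring \<open>T i i\<close>; at
    \<open>Top\<close> the ring is A, which gives \<open>A \<epsilon>_m A = A\<close>.\<close>
  have full: "\<one>\<^bsub>A\<^esub> \<in> two_sided A (T0 i i) (\<epsilon> i)" if i: "i \<in> poset_top P" for i
  proof -
    have "system_unit A T0 i \<in> two_sided A (T0 i i) (\<epsilon> i)"
    proof (rule G.idempotent_full_if_morita_equivalent[OF C.incidence_axioms div _ _ \<kappa> i])
      show "morita_equivalent TYPE('v) C.\<Lambda> G.\<Lambda>" using E by blast
    qed (use idem nonzero in auto)
    then show ?thesis using Gunit[OF i] by simp
  qed
  show ?thesis
  proof (intro extendable_poset.intro extendable_poset_axioms.intro unital_poset_axioms)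
    show "\<one>\<^bsub>A\<^esub> \<in> two_sided A (carrier A) (\<epsilon> Top)" using full[of Top] by simp
    show "\<one>\<^bsub>A\<^esub> \<in> two_sided A (T i i) (\<epsilon> (Elt i))" if "i \<in> P" for i using full[of "Elt i"] that by simp
  qed (use idem inv nonzero in auto)
qed

context incidence_module
begin

lemma eq_zero_if_components_zero:
  assumes w: "w \<in> carrier M" and z: "\<And>i. i \<in> P \<Longrightarrow> w \<cdot>\<^bsub>M\<^esub> E i i (u i) = \<zero>\<^bsub>M\<^esub>"
  shows "w = \<zero>\<^bsub>M\<^esub>"
proof -
  have "w \<cdot>\<^bsub>M\<^esub> \<one>\<^bsub>\<Lambda>\<^esub> \<in> {\<zero>\<^bsub>M\<^esub>}"
  proof (rule act_mem[OF w \<Lambda>.one_closed])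
    fix i j a assume ij: "(i, j) \<in> r" "a \<in> T i j"
    have "w \<cdot>\<^bsub>M\<^esub> E i j a = \<zero>\<^bsub>M\<^esub>"
      using act_E_unit[OF w ij] z r_sub[OF ij(1)] zero_ract[OF E_closed[OF ij]] by simp
    then show "w \<cdot>\<^bsub>M\<^esub> E i j a \<in> {\<zero>\<^bsub>M\<^esub>}" by simp
  qed auto
  then show ?thesis using ract_one[OF w] by simp
qed

end

context incidence_top_module
begin

text \<open>Faithfulness at the top is inherited along injective homomorphisms. It carries the
  property from modules of row vectors to their copies in \<open>'v\<close>.\<close>

lemma top_faithful_embedding:
  fixes N :: "('i \<Rightarrow> 'i \<Rightarrow> 'a, 'w) rmodule"
  assumes t: "incidence_top_module.top_faithful A P T m N" and N: "right_module \<Lambda> N"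
    and h: "h \<in> rmod_hom \<Lambda> M N" "inj_on h (carrier M)"
  shows "top_faithful"
  unfolding top_faithful_def
proof (intro ballI impI)
  interpret N: incidence_top_module K A P r T m N
    using N by (intro incidence_top_module.intro incidence_module.intro rmod.intro incidence_axioms incidence_top_axioms)
  fix i x assume i: "i \<in> P" and x: "x \<in> vert i" and z: "\<forall>a\<in>T i m. x \<cdot>\<^bsub>M\<^esub> E i m a = \<zero>\<^bsub>M\<^esub>"
  note xc = vert_carrier[OF x]
  have h0: "h \<zero>\<^bsub>M\<^esub> = \<zero>\<^bsub>N\<^esub>" by (rule rmod_hom_zero[OF right_module_axioms N h(1)])
  have "h x \<in> N.vert i"
    using rmod_homD(1)[OF h(1) xc] rmod_homD(3)[OF h(1) xc unit_E_closed[OF i]] vert_unit[OF x] by (simp add: N.vert_def)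
  moreover have "h x \<cdot>\<^bsub>N\<^esub> E i m a = \<zero>\<^bsub>N\<^esub>" if "a \<in> T i m" for a
    using rmod_homD(3)[OF h(1) xc E_closed[OF m_top[OF i] that]] z that h0 by simp
  ultimately have "h x = \<zero>\<^bsub>N\<^esub>" by (rule N.top_faithfulD[OF t i])
  then show "x = \<zero>\<^bsub>M\<^esub>" using h(2) h0 xc M.zero_closed by (metis inj_onD)
qed

end

section \<open>The admissible system of the extended poset\<close>

context extendable_poset
begin

abbreviation "\<eta> \<equiv> \<epsilon> Top"
abbreviation "\<epsilon>0 \<equiv> \<epsilon>(Bot := \<epsilon> Top)"
abbreviation "\<R> \<equiv> underline_R A T \<epsilon>"

sublocale X: incidence K A Q rQ T0 by (rule incidence.intro[OF extended_equipped])

lemma T0_bounds [simp]: "T0 x Top = carrier A" "T0 Bot x = carrier A" "T0 Top x = carrier A"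
  by (cases x; simp)+

lemma eta: "\<eta> \<in> carrier A" "\<eta> \<otimes>\<^bsub>A\<^esub> \<eta> = \<eta>"
  using idem[of Top] by simp_all

lemma idem0: "x \<in> Q \<Longrightarrow> \<epsilon>0 x \<in> T0 x x \<and> \<epsilon>0 x \<otimes>\<^bsub>A\<^esub> \<epsilon>0 x = \<epsilon>0 x"
  using idem[of x] eta by (cases x) auto

lemma eps_carrier: "x \<in> Q \<Longrightarrow> \<epsilon>0 x \<in> carrier A"
  using idem0[of x] X.T_sub[OF X.r_refl] by blast

lemma R_eq: "\<R> = corner_system A \<epsilon>0 T0"
  by (simp add: underline_R_def)

sublocale R: incidence K A Q rQ \<R>
  unfolding R_eq by (rule incidence.intro, rule X.corner_system_equipped(1)) (rule idem0)

lemma R_unit: "x \<in> Q \<Longrightarrow> system_unit A \<R> x = \<epsilon>0 x"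
  unfolding R_eq by (rule X.corner_system_equipped(2)) (rule idem0)

lemma R_mem: "t \<in> T0 x y \<Longrightarrow> \<epsilon>0 x \<otimes>\<^bsub>A\<^esub> t \<otimes>\<^bsub>A\<^esub> \<epsilon>0 y \<in> \<R> x y"
  unfolding R_eq corner_system_def by blast

lemma R_left: "(x, y) \<in> rQ \<Longrightarrow> a \<in> \<R> x y \<Longrightarrow> \<epsilon>0 x \<otimes>\<^bsub>A\<^esub> a = a"
  and R_right: "(x, y) \<in> rQ \<Longrightarrow> a \<in> \<R> x y \<Longrightarrow> a \<otimes>\<^bsub>A\<^esub> \<epsilon>0 y = a"
  using R.unit_left R.unit_right R_unit R.r_sub by metis+

lemma R_top_mem: "x \<in> Q \<Longrightarrow> a \<in> carrier A \<Longrightarrow> \<epsilon>0 x \<otimes>\<^bsub>A\<^esub> a \<otimes>\<^bsub>A\<^esub> \<eta> \<in> \<R> x Top"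
  using R_mem[of a x Top] by simp

text \<open>A consequence of \<open>\<epsilon>_0 = \<epsilon>_m\<close>. In particular
  \<open>\<R> Bot Top\<close> is the division ring at the top, a line over itself.\<close>

lemma R_bot_eq: "\<R> Bot x = \<R> Top x"
  unfolding R_eq corner_system_def by (cases x) auto

lemma R_sub_T0: "(x, y) \<in> rQ \<Longrightarrow> a \<in> \<R> x y \<Longrightarrow> a \<in> T0 x y"
proof -
  assume xy: "(x, y) \<in> rQ" and "a \<in> \<R> x y"
  then obtain t where t: "t \<in> T0 x y" "a = \<epsilon>0 x \<otimes>\<^bsub>A\<^esub> t \<otimes>\<^bsub>A\<^esub> \<epsilon>0 y" unfolding R_eq corner_system_def by blast
  have q: "x \<in> Q" "y \<in> Q" using X.r_sub[OF xy] by auto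
  show "a \<in> T0 x y"
    unfolding t(2)
    by (rule X.T_mult[OF xy X.r_refl[OF q(2)] X.T_mult[OF X.r_refl[OF q(1)] xy conjunct1[OF idem0[OF q(1)]] t(1)]
          conjunct1[OF idem0[OF q(2)]]])
qed

text \<open>By \<open>full_top\<close>, 1 is a sum of products \<open>c \<eta> d\<close>, and
  \<open>x c \<eta> d\<close> vanishes by assumption. Stated for an arbitrary A-module, so that it
  applies to representations and to A itself.\<close>

lemma mult_top_zero:
  fixes L :: "('a, 'v) rmodule"
  assumes L: "right_module A L" and x: "x \<in> carrier L" and z: "\<And>b. b \<in> carrier A \<Longrightarrow> x \<cdot>\<^bsub>L\<^esub> (b \<otimes>\<^bsub>A\<^esub> \<eta>) = \<zero>\<^bsub>L\<^esub>"
  shows "x = \<zero>\<^bsub>L\<^esub>"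
proof -
  interpret L: rmod A L using L by (rule rmod.intro)
  have "x \<cdot>\<^bsub>L\<^esub> y = \<zero>\<^bsub>L\<^esub>" if "y \<in> two_sided A (carrier A) \<eta>" for y
    using that
  proof induction
    case zero
    then show ?case using L.ract_zero[OF x] by simp
  next
    case (step y c d)
    have yc: "y \<in> carrier A" by (rule P.A.two_sided_closed[OF subset_refl eta(1) step(1)])
    have "x \<cdot>\<^bsub>L\<^esub> (c \<otimes>\<^bsub>A\<^esub> \<eta> \<otimes>\<^bsub>A\<^esub> d \<oplus>\<^bsub>A\<^esub> y) = x \<cdot>\<^bsub>L\<^esub> (c \<otimes>\<^bsub>A\<^esub> \<eta>) \<cdot>\<^bsub>L\<^esub> d \<oplus>\<^bsub>L\<^esub> x \<cdot>\<^bsub>L\<^esub> y"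
      using step yc x eta by (simp add: L.ract_add_right L.ract_assoc)
    then show ?case using step z[OF step(2)] L.zero_ract by simp
  qed
  then have "x \<cdot>\<^bsub>L\<^esub> \<one>\<^bsub>A\<^esub> = \<zero>\<^bsub>L\<^esub>" using full_top by blast
  then show ?thesis using L.ract_one[OF x] by simp
qed

lemma right_module_regular: "right_module A (principal_rmodule A \<one>\<^bsub>A\<^esub>)"
  by (rule right_module_principal[OF P.A.ring_axioms P.A.one_closed])

lemma regular_simps:
  "carrier (principal_rmodule A \<one>\<^bsub>A\<^esub>) = carrier A" "\<zero>\<^bsub>principal_rmodule A \<one>\<^bsub>A\<^esub>\<^esub> = \<zero>\<^bsub>A\<^esub>"
  "x \<cdot>\<^bsub>principal_rmodule A \<one>\<^bsub>A\<^esub>\<^esub> a = x \<otimes>\<^bsub>A\<^esub> a"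
proof -
  show "carrier (principal_rmodule A \<one>\<^bsub>A\<^esub>) = carrier A"
  proof
    show "carrier A \<subseteq> carrier (principal_rmodule A \<one>\<^bsub>A\<^esub>)"
    proof
      fix x assume "x \<in> carrier A"
      then have "x = \<one>\<^bsub>A\<^esub> \<otimes>\<^bsub>A\<^esub> x \<and> x \<in> carrier A" by simp
      then show "x \<in> carrier (principal_rmodule A \<one>\<^bsub>A\<^esub>)" unfolding principal_rmodule_def by auto
    qed
  qed (auto simp: principal_rmodule_def)
qed (simp_all add: principal_rmodule_def)

lemma R_division: "x \<in> Q \<Longrightarrow> R.division_vertex x"
proof -
  assume x: "x \<in> Q"
  have "\<exists>b\<in>\<R> x x. a \<otimes>\<^bsub>A\<^esub> b = \<epsilon>0 x" if a: "a \<in> \<R> x x" "a \<noteq> \<zero>\<^bsub>A\<^esub>" for a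
  proof (cases "x = Bot")
    case True
    have "\<R> Bot Bot = corner_system A \<epsilon> T0 Top Top" unfolding R_eq corner_system_def by auto
    then show ?thesis using inverse[of Top a] a True by simp
  next
    case False
    then have "\<R> x x = corner_system A \<epsilon> T0 x x" unfolding R_eq corner_system_def by auto
    then show ?thesis using inverse[of x a] a x False by simp
  qed
  then show ?thesis unfolding R.division_vertex_def using x R_unit[OF x] by simp
qed

text \<open>For \<open>faithful\<close>, \<open>mult_top_zero\<close> is applied to the regular
  module: an entry a absorbs \<epsilon> at y from the right, so \<open>a b \<eta>\<close> is a
  product of a with the element \<open>\<epsilon>_y b \<eta>\<close> of
  \<open>\<R> y Top\<close>.\<close>

sublocale R: incidence_top K A Q rQ \<R> Top
proof (intro incidence_top.intro R.incidence_axioms incidence_top_axioms.intro)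
  fix x y a assume xy: "(x, y) \<in> rQ" and a: "a \<in> \<R> x y" and z: "\<And>b. b \<in> \<R> y Top \<Longrightarrow> a \<otimes>\<^bsub>A\<^esub> b = \<zero>\<^bsub>A\<^esub>"
  have y: "y \<in> Q" using R.r_sub[OF xy] by blast
  have ac: "a \<in> carrier A" by (rule R.T_sub[OF xy a])
  have "a = \<zero>\<^bsub>principal_rmodule A \<one>\<^bsub>A\<^esub>\<^esub>"
  proof (rule mult_top_zero[OF right_module_regular])
    show "a \<in> carrier (principal_rmodule A \<one>\<^bsub>A\<^esub>)" using ac by (simp add: regular_simps)
    fix b assume b: "b \<in> carrier A"
    have "a \<otimes>\<^bsub>A\<^esub> (b \<otimes>\<^bsub>A\<^esub> \<eta>) = a \<otimes>\<^bsub>A\<^esub> \<epsilon>0 y \<otimes>\<^bsub>A\<^esub> (b \<otimes>\<^bsub>A\<^esub> \<eta>)" using R_right[OF xy a] by simp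
    also have "\<dots> = a \<otimes>\<^bsub>A\<^esub> (\<epsilon>0 y \<otimes>\<^bsub>A\<^esub> b \<otimes>\<^bsub>A\<^esub> \<eta>)" using ac b eta eps_carrier[OF y] by (simp add: P.A.m_assoc del: fun_upd_apply)
    finally show "a \<cdot>\<^bsub>principal_rmodule A \<one>\<^bsub>A\<^esub>\<^esub> (b \<otimes>\<^bsub>A\<^esub> \<eta>) = \<zero>\<^bsub>principal_rmodule A \<one>\<^bsub>A\<^esub>\<^esub>"
      using z[OF R_top_mem[OF y b]] by (simp add: regular_simps)
  qed
  then show "a = \<zero>\<^bsub>A\<^esub>" by (simp add: regular_simps)
qed (use R_division in auto)

abbreviation "\<Lambda> \<equiv> underline_Lambda A P r T \<epsilon>"

lemma Lambda_eq: "\<Lambda> = incidence_algebra A Q rQ \<R>"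
  by (simp add: underline_Lambda_def)

lemma incidence_idem_eq: "incidence_idem A \<R> Bot = matrix_unit A Bot Bot (system_unit A \<R> Bot)"
  by (simp add: incidence_idem_def matrix_unit_def fun_eq_iff)

lemma top_decomposition:
  "\<exists>n c d. (\<forall>k<n. c k \<in> carrier A \<and> d k \<in> carrier A) \<and> \<one>\<^bsub>A\<^esub> = (\<Oplus>\<^bsub>A\<^esub>k\<in>{..<n::nat}. c k \<otimes>\<^bsub>A\<^esub> \<eta> \<otimes>\<^bsub>A\<^esub> d k)"
  using P.A.two_sided_sum[OF subset_refl eta(1) full_top] .

end

section \<open>Direct summands isomorphic to the module of the least element\<close>

locale extended_module = extendable_poset K A P r T \<epsilon> + M: incidence_top_module K A "poset_bot_top P" "order_bot_top P r" "underline_R A T \<epsilon>" Top M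
  for K :: "('k, 'c) ring_scheme" and A :: "('k, 'a) module"
    and P :: "'p set" and r :: "'p rel" and T :: "'p \<Rightarrow> 'p \<Rightarrow> 'a set" and \<epsilon> :: "'p extended \<Rightarrow> 'a"
    and M :: "('p extended \<Rightarrow> 'p extended \<Rightarrow> 'a, 'v) rmodule"
begin

text \<open>The generator \<open>e_0\<close> of \<open>e_0 \<Lambda>\<close> is fixed by
  \<open>e_0\<close>, so the element of N corresponding to it lies in the part of M at
  \<open>Bot\<close> and is nonzero.\<close>

lemma no_summand_if_bottom_zero:
  assumes b: "M.vert Bot \<subseteq> {\<zero>\<^bsub>M\<^esub>}"
  shows "\<not> has_direct_summand R.\<Lambda> M (principal_rmodule R.\<Lambda> (R.E Bot Bot (R.u Bot)))"
proof
  let ?e = "R.E (Bot :: 'p extended) Bot (R.u Bot)" and ?X = "principal_rmodule R.\<Lambda> (R.E Bot Bot (R.u Bot))"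
  assume "has_direct_summand R.\<Lambda> M ?X"
  then obtain N h where N: "rsubmodule R.\<Lambda> M N" and h: "h \<in> rmod_hom R.\<Lambda> (M\<lparr>carrier := N\<rparr>) ?X" "bij_betw h N (carrier ?X)"
    unfolding has_direct_summand_def rmod_isomorphic_def by auto
  note N' = M.rsubmoduleD[OF N]
  have B: "Bot \<in> Q" by simp
  have e: "?e \<in> carrier R.\<Lambda>" by (rule M.unit_E_closed[OF B])
  have ee: "?e \<otimes>\<^bsub>R.\<Lambda>\<^esub> ?e = ?e"
    using R.E_mult_E[OF R.r_refl[OF B] R.r_refl[OF B] R.unit_mem[OF B] R.unit_mem[OF B]] R.unit_left[OF R.r_refl[OF B] R.unit_mem[OF B]] by simp
  then have "?e \<in> carrier ?X" using e by (auto simp: principal_rmodule_def intro!: exI[of _ ?e])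
  then obtain n where n: "n \<in> N" "h n = ?e" using h(2) by (metis bij_betw_imp_surj_on imageE)
  have "h (n \<cdot>\<^bsub>M\<^esub> ?e) = h n" using rmod_homD(3)[OF h(1) _ e, of n] n ee by (simp add: principal_rmodule_def)
  then have "n \<cdot>\<^bsub>M\<^esub> ?e = n" using h(2) n N'(6)[OF n(1) e] unfolding bij_betw_def by (blast dest: inj_onD)
  then have "n = \<zero>\<^bsub>M\<^esub>" using b n N'(1) unfolding M.vert_def by blast
  then have "?e = \<zero>\<^bsub>R.\<Lambda>\<^esub>"
    using rmod_hom_zero[OF M.submodule_right_module[OF N] right_module_principal[OF R.ring_incidence e] h(1)] n
    by (simp add: principal_rmodule_def)
  then have "?e Bot Bot = \<zero>\<^bsub>R.\<Lambda>\<^esub> Bot Bot" by (rule fun_cong[OF fun_cong])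
  then show False using top_nonzero R_unit[OF B] by (simp add: matrix_unit_def R.incidence_algebra_simps(4))
qed

text \<open>The complement of x\<Lambda> consists of the elements whose products into the top part
  all lie in a fixed complement U of the line spanned by x there. It meets x\<Lambda> trivially by
  faithfulness at the top; that the two together span M is the main computation.\<close>

lemma summand_if_bottom_nonzero:
  assumes t: "M.top_faithful" and x: "x \<in> M.vert Bot" "x \<noteq> \<zero>\<^bsub>M\<^esub>"
  shows "has_direct_summand R.\<Lambda> M (principal_rmodule R.\<Lambda> (R.E Bot Bot (R.u Bot)))"
proof -
  let ?e = "R.E (Bot :: 'p extended) Bot (R.u Bot)" and ?X = "principal_rmodule R.\<Lambda> (R.E Bot Bot (R.u Bot))"
  have B: "Bot \<in> Q" and Tp: "Top \<in> Q" by simp_all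
  have rBT: "(Bot, Top) \<in> rQ" and rTT: "(Top, Top) \<in> rQ" and rBB: "(Bot, Bot) \<in> rQ" by simp_all
  note xc = M.vert_carrier[OF x(1)]
  have \<eta>R: "\<eta> \<in> \<R> Top Top" using R.unit_mem[OF Tp] R_unit[OF Tp] by simp
  have RBT: "\<R> Bot Top = \<R> Top Top" by (rule R_bot_eq)
  have \<eta>l: "\<eta> \<otimes>\<^bsub>A\<^esub> a = a" "a \<otimes>\<^bsub>A\<^esub> \<eta> = a" if "a \<in> \<R> Top Top" for a
    using R_left[OF rTT that] R_right[OF rTT that] by simp_all
  \<comment> \<open>The image of x at the top. Since \<open>\<R> Bot Top\<close> is the ring at the
    top, \<open>xy\<close> turns every product of x into the top part into a product of y, and all
    of them lie on the line spanned by y.\<close>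
  define y where "y = x \<cdot>\<^bsub>M\<^esub> R.E Bot Top \<eta>"
  have yv: "y \<in> M.vert Top" unfolding y_def by (rule M.act_E_vert[OF xc rBT]) (use \<eta>R RBT in simp)
  note yc = M.vert_carrier[OF yv]
  have xy: "x \<cdot>\<^bsub>M\<^esub> R.E Bot Top a = y \<cdot>\<^bsub>M\<^esub> R.E Top Top a" if a: "a \<in> \<R> Top Top" for a
    unfolding y_def using M.act_E_E[OF xc rBT rTT _ a, of \<eta>] \<eta>R RBT \<eta>l(1)[OF a] by simp
  have y0: "y \<noteq> \<zero>\<^bsub>M\<^esub>"
  proof
    assume "y = \<zero>\<^bsub>M\<^esub>"
    then have "x \<cdot>\<^bsub>M\<^esub> R.E Bot Top a = \<zero>\<^bsub>M\<^esub>" if "a \<in> \<R> Bot Top" for a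
      using xy[of a] that RBT M.zero_ract[OF R.E_closed[OF rTT]] by simp
    then show False using M.top_faithfulD[OF t B x(1)] x(2) by blast
  qed
  let ?N1 = "{y \<cdot>\<^bsub>M\<^esub> f | f. f \<in> carrier R.\<Lambda>}"
  have N1: "rsubmodule R.\<Lambda> M ?N1" by (rule M.rsubmodule_cyclic[OF yc])
  have N1v: "?N1 \<subseteq> M.vert Top" using M.rsubmoduleD(6)[OF M.vert_top_submodule yv] by blast
  obtain U where U: "rsubmodule R.\<Lambda> M U" "U \<subseteq> M.vert Top" "?N1 \<inter> U = {\<zero>\<^bsub>M\<^esub>}" "?N1 <+>\<^bsub>M\<^esub> U = M.vert Top"
    using M.complement_in_vert[OF Tp M.vert_top_submodule subset_refl N1 N1v] by blast
  note U' = M.rsubmoduleD[OF U(1)]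
  let ?B = "{w \<in> carrier M. \<forall>i\<in>Q. \<forall>a\<in>\<R> i Top. w \<cdot>\<^bsub>M\<^esub> R.E i Top a \<in> U}"
  have rT: "(i, Top) \<in> rQ" if "i \<in> Q" for i using that by simp
  have B_sub: "rsubmodule R.\<Lambda> M ?B"
  proof (rule M.rsubmoduleI_E)
    show "\<zero>\<^bsub>M\<^esub> \<in> ?B" using U'(2) M.zero_ract[OF R.E_closed[OF rT]] by simp
    show "w \<oplus>\<^bsub>M\<^esub> z \<in> ?B" if "w \<in> ?B" "z \<in> ?B" for w z
      using that U'(3) M.ract_add_left[OF _ _ R.E_closed[OF rT]] by simp
    fix w k l b assume w: "w \<in> ?B" and kl: "(k, l) \<in> rQ" and b: "b \<in> \<R> k l"
    have wc: "w \<in> carrier M" using w by blast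
    note v = M.act_E_vert[OF wc kl b]
    have "w \<cdot>\<^bsub>M\<^esub> R.E k l b \<cdot>\<^bsub>M\<^esub> R.E i Top a \<in> U" if i: "i \<in> Q" and a: "a \<in> \<R> i Top" for i a
    proof (cases "i = l")
      case True
      have "w \<cdot>\<^bsub>M\<^esub> R.E k Top (b \<otimes>\<^bsub>A\<^esub> a) \<in> U"
        using w R.T_mult[OF kl _ b, of Top a] a True rT[OF i] R.r_sub[OF kl] by blast
      then show ?thesis using M.act_E_E[OF wc kl _ b, of Top a] a True rT[OF i] by simp
    next
      case False
      then show ?thesis using M.vert_act_other[OF v _ False rT[OF i] a] R.r_sub[OF kl] U'(2) by simp
    qed
    then show "w \<cdot>\<^bsub>M\<^esub> R.E k l b \<in> ?B" using M.vert_carrier[OF v] by blast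
  qed auto
  let ?N = "{x \<cdot>\<^bsub>M\<^esub> f | f. f \<in> carrier R.\<Lambda>}"
  have N: "rsubmodule R.\<Lambda> M ?N" by (rule M.rsubmodule_cyclic[OF xc])
  have NN1: "x \<cdot>\<^bsub>M\<^esub> f \<cdot>\<^bsub>M\<^esub> R.E i Top a \<in> ?N1" if f: "f \<in> carrier R.\<Lambda>" and i: "i \<in> Q" and a: "a \<in> \<R> i Top" for f i a
    using f
  proof (induction rule: R.incidence_induct)
    case zero
    then show ?case using M.rsubmoduleD(2)[OF N1] M.ract_zero[OF xc] M.zero_ract[OF R.E_closed[OF rT[OF i] a]] by simp
  next
    case (add f g)
    then show ?case using M.rsubmoduleD(3)[OF N1 add(3,4)] xc R.E_closed[OF rT[OF i] a]
      by (simp add: M.ract_add_left M.ract_add_right M.ract_closed)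
  next
    case (unit k l b)
    show ?case
    proof (cases "k = Bot \<and> l = i")
      case True
      have ba: "b \<otimes>\<^bsub>A\<^esub> a \<in> \<R> Top Top" using R.T_mult[OF unit(1) _ unit(2), of Top a] a True rT[OF i] RBT by simp
      have "x \<cdot>\<^bsub>M\<^esub> R.E k l b \<cdot>\<^bsub>M\<^esub> R.E i Top a = y \<cdot>\<^bsub>M\<^esub> R.E Top Top (b \<otimes>\<^bsub>A\<^esub> a)"
        using M.act_E_E[OF xc unit(1) _ unit(2), of Top a] a True rT[OF i] xy[OF ba] by simp
      then show ?thesis using R.E_closed[OF rTT ba] by blast
    next
      case False
      have "x \<cdot>\<^bsub>M\<^esub> R.E k l b \<cdot>\<^bsub>M\<^esub> R.E i Top a = \<zero>\<^bsub>M\<^esub>"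
      proof (cases "k = Bot")
        case True
        then show ?thesis
          using M.vert_act_other[OF M.act_E_vert[OF xc unit] _ _ rT[OF i] a] R.r_sub[OF unit(1)] False by auto
      next
        case False
        then show ?thesis using M.vert_act_other[OF x(1) B False unit] M.zero_ract[OF R.E_closed[OF rT[OF i] a]] by simp
      qed
      then show ?thesis using M.rsubmoduleD(2)[OF N1] by simp
    qed
  qed
  have int: "?N \<inter> ?B = {\<zero>\<^bsub>M\<^esub>}"
  proof
    show "{\<zero>\<^bsub>M\<^esub>} \<subseteq> ?N \<inter> ?B" using M.rsubmoduleD(2)[OF N] M.rsubmoduleD(2)[OF B_sub] by blast
    show "?N \<inter> ?B \<subseteq> {\<zero>\<^bsub>M\<^esub>}"
    proof
      fix w assume w: "w \<in> ?N \<inter> ?B"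
      then obtain f where f: "f \<in> carrier R.\<Lambda>" "w = x \<cdot>\<^bsub>M\<^esub> f" by blast
      have wc: "w \<in> carrier M" using w by blast
      have z: "w \<cdot>\<^bsub>M\<^esub> R.E i Top a = \<zero>\<^bsub>M\<^esub>" if "i \<in> Q" "a \<in> \<R> i Top" for i a
      proof -
        have "w \<cdot>\<^bsub>M\<^esub> R.E i Top a \<in> ?N1" unfolding f(2) by (rule NN1[OF f(1) that])
        moreover have "w \<cdot>\<^bsub>M\<^esub> R.E i Top a \<in> U" using w that by blast
        ultimately show ?thesis using U(3) by blast
      qed
      have "w = \<zero>\<^bsub>M\<^esub>"
      proof (rule M.eq_zero_if_components_zero[OF wc])
        fix i assume i: "i \<in> Q"
        show "w \<cdot>\<^bsub>M\<^esub> R.E i i (R.u i) = \<zero>\<^bsub>M\<^esub>"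
        proof (rule M.top_faithfulD[OF t i M.act_E_vert[OF wc R.r_refl[OF i] R.unit_mem[OF i]]])
          fix a assume "a \<in> \<R> i Top"
          then show "w \<cdot>\<^bsub>M\<^esub> R.E i i (R.u i) \<cdot>\<^bsub>M\<^esub> R.E i Top a = \<zero>\<^bsub>M\<^esub>"
            using M.act_E_unit[OF wc rT[OF i]] z[OF i] by simp
        qed
      qed
      then show "w \<in> {\<zero>\<^bsub>M\<^esub>}" by simp
    qed
  qed
  have NB: "rsubmodule R.\<Lambda> M (?N <+>\<^bsub>M\<^esub> ?B)" by (rule M.rsubmodule_sum[OF N B_sub])
  obtain n c d where cd: "\<And>k. k < n \<Longrightarrow> c k \<in> carrier A" "\<And>k. k < n \<Longrightarrow> d k \<in> carrier A"
    and one_sum: "\<one>\<^bsub>A\<^esub> = (\<Oplus>\<^bsub>A\<^esub>k\<in>{..<n::nat}. c k \<otimes>\<^bsub>A\<^esub> \<eta> \<otimes>\<^bsub>A\<^esub> d k)" using top_decomposition by blast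
  have "w \<in> ?N <+>\<^bsub>M\<^esub> ?B" if i: "i \<in> Q" and w: "w \<in> M.vert i" for i w
  proof -
    note wc = M.vert_carrier[OF w] and \<epsilon>c = eps_carrier[OF i]
    \<comment> \<open>The left halves \<open>\<epsilon>_i c_k \<eta>\<close> of the decomposition of
      1. Each moves w to the top, where it splits into a multiple \<open>y f_k\<close> and an
      element \<open>v_k\<close> of U.\<close>
    define p where "p k = \<epsilon>0 i \<otimes>\<^bsub>A\<^esub> c k \<otimes>\<^bsub>A\<^esub> \<eta>" for k
    have p: "p k \<in> \<R> i Top" if "k < n" for k unfolding p_def by (rule R_top_mem[OF i cd(1)[OF that]])
    have "\<exists>f \<in> \<R> Top Top. \<exists>v \<in> U. w \<cdot>\<^bsub>M\<^esub> R.E i Top (p k) = y \<cdot>\<^bsub>M\<^esub> R.E Top Top f \<oplus>\<^bsub>M\<^esub> v" if k: "k < n" for k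
    proof -
      have "w \<cdot>\<^bsub>M\<^esub> R.E i Top (p k) \<in> M.vert Top" by (rule M.act_E_vert[OF wc rT[OF i] p[OF k]])
      then have "w \<cdot>\<^bsub>M\<^esub> R.E i Top (p k) \<in> ?N1 <+>\<^bsub>M\<^esub> U" unfolding U(4) .
      then obtain q v where qv: "q \<in> ?N1" "v \<in> U" "w \<cdot>\<^bsub>M\<^esub> R.E i Top (p k) = q \<oplus>\<^bsub>M\<^esub> v" by (rule set_addE)
      obtain f where f: "f \<in> carrier R.\<Lambda>" "q = y \<cdot>\<^bsub>M\<^esub> f" using qv(1) by blast
      have "q \<in> M.vert Top" using N1v qv(1) by blast
      then have "q = y \<cdot>\<^bsub>M\<^esub> R.E Top Top (f Top Top)" using M.vert_act_diag[OF Tp yv f(1)] f(2) M.vert_unit by metis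
      then show ?thesis using qv(2,3) R.incidence_mem[OF f(1) rTT] by blast
    qed
    then have "\<forall>k\<in>{..<n}. \<exists>fv. fst fv \<in> \<R> Top Top \<and> snd fv \<in> U \<and> w \<cdot>\<^bsub>M\<^esub> R.E i Top (p k) = y \<cdot>\<^bsub>M\<^esub> R.E Top Top (fst fv) \<oplus>\<^bsub>M\<^esub> snd fv"
      by force
    then obtain fv where fv: "\<forall>k\<in>{..<n}. fst (fv k) \<in> \<R> Top Top \<and> snd (fv k) \<in> U \<and>
        w \<cdot>\<^bsub>M\<^esub> R.E i Top (p k) = y \<cdot>\<^bsub>M\<^esub> R.E Top Top (fst (fv k)) \<oplus>\<^bsub>M\<^esub> snd (fv k)" using bchoice by meson
    define f where "f k = fst (fv k)" for k
    define v where "v k = snd (fv k)" for k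
    have f: "f k \<in> \<R> Top Top" and v: "v k \<in> U" and wp: "w \<cdot>\<^bsub>M\<^esub> R.E i Top (p k) = y \<cdot>\<^bsub>M\<^esub> R.E Top Top (f k) \<oplus>\<^bsub>M\<^esub> v k"
      if "k < n" for k using fv that unfolding f_def v_def by auto
    have fc: "f k \<in> carrier A" if "k < n" for k by (rule R.T_sub[OF rTT f[OF that]])
    have vc: "v k \<in> carrier M" if "k < n" for k using v[OF that] U'(1) by blast
    have rBi: "(Bot, i) \<in> rQ" using i by simp
    \<comment> \<open>The coefficients \<open>f_k\<close> are brought back from the top to the
      vertex i by the right halves \<open>d_k \<epsilon>_i\<close>. Their sum \<rho> is the entry
      for which \<open>x \<rho>\<close> agrees with w modulo the complement
      \<open>?B\<close>.\<close>
    define g where "g k = f k \<otimes>\<^bsub>A\<^esub> d k \<otimes>\<^bsub>A\<^esub> \<epsilon>0 i" for k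
    have g: "g k \<in> \<R> Bot i" if k: "k < n" for k
    proof -
      have "\<eta> \<otimes>\<^bsub>A\<^esub> (f k \<otimes>\<^bsub>A\<^esub> d k) \<otimes>\<^bsub>A\<^esub> \<epsilon>0 i \<in> \<R> Bot i" using R_mem[of "f k \<otimes>\<^bsub>A\<^esub> d k" Bot i] fc[OF k] cd(2)[OF k] by simp
      then show ?thesis unfolding g_def using P.A.m_assoc[OF eta(1) fc[OF k] cd(2)[OF k]] \<eta>l(1)[OF f[OF k]] by simp
    qed
    have gc: "g k \<in> carrier A" if "k < n" for k by (rule R.T_sub[OF rBi g[OF that]])
    define \<rho> where "\<rho> = (\<Oplus>\<^bsub>A\<^esub>k\<in>{..<n}. g k)"
    have \<rho>R: "\<rho> \<in> \<R> Bot i" unfolding \<rho>_def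
      by (rule P.A.finsum_mem) (use g R.T_sub[OF rBi] R.T_zero[OF rBi] R.T_add[OF rBi] in auto)
    have \<rho>c: "\<rho> \<in> carrier A" by (rule R.T_sub[OF rBi \<rho>R])
    define z where "z = x \<cdot>\<^bsub>M\<^esub> R.E Bot i \<rho>"
    have zN: "z \<in> ?N" unfolding z_def using R.E_closed[OF rBi \<rho>R] by blast
    have zv: "z \<in> M.vert i" unfolding z_def by (rule M.act_E_vert[OF xc rBi \<rho>R])
    note zc = M.vert_carrier[OF zv]
    have dv: "w \<ominus>\<^bsub>M\<^esub> z \<in> M.vert i" by (rule M.vert_props(4)[OF i w zv])
    note dc = M.vert_carrier[OF dv]
    have "w \<ominus>\<^bsub>M\<^esub> z \<in> ?B"
    proof (intro CollectI conjI ballI dc)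
      fix l a assume l: "l \<in> Q" and a: "a \<in> \<R> l Top"
      show "(w \<ominus>\<^bsub>M\<^esub> z) \<cdot>\<^bsub>M\<^esub> R.E l Top a \<in> U"
      proof (cases "l = i")
        case False
        then show ?thesis using M.vert_act_other[OF dv i False rT[OF l] a] U'(2) by simp
      next
        case True
        then have ai: "a \<in> \<R> i Top" using a by simp
        have ac: "a \<in> carrier A" by (rule R.T_sub[OF rT[OF i] ai])
        have Ea: "R.E i Top a \<in> carrier R.\<Lambda>" by (rule R.E_closed[OF rT[OF i] ai])
        have \<eta>a: "\<epsilon>0 i \<otimes>\<^bsub>A\<^esub> a = a" "a \<otimes>\<^bsub>A\<^esub> \<eta> = a" using R_left[OF rT[OF i] ai] R_right[OF rT[OF i] ai] by simp_all
        \<comment> \<open>With these elements of the ring at the top, a is the sum of the products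
          \<open>p_k s_k\<close>. Hence wa is the sum of all \<open>y f_k s_k + v_k s_k\<close>,
          while za is the sum of the \<open>y f_k s_k\<close>, and the difference lies in U.\<close>
        define s where "s k = \<eta> \<otimes>\<^bsub>A\<^esub> (d k \<otimes>\<^bsub>A\<^esub> a) \<otimes>\<^bsub>A\<^esub> \<eta>" for k
        have s: "s k \<in> \<R> Top Top" if "k < n" for k
          using R_top_mem[OF Tp, of "d k \<otimes>\<^bsub>A\<^esub> a"] cd(2)[OF that] ac unfolding s_def by simp
        have s_eq: "s k = \<eta> \<otimes>\<^bsub>A\<^esub> (d k \<otimes>\<^bsub>A\<^esub> a)" if k: "k < n" for k
          unfolding s_def using P.A.m_assoc cd(2)[OF k] ac eta \<eta>a(2) by simp
        have pc: "p k \<in> carrier A" if "k < n" for k by (rule R.T_sub[OF rT[OF i] p[OF that]])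
        have sc: "s k \<in> carrier A" if "k < n" for k by (rule R.T_sub[OF rTT s[OF that]])
        have "a = \<epsilon>0 i \<otimes>\<^bsub>A\<^esub> ((\<Oplus>\<^bsub>A\<^esub>k\<in>{..<n}. c k \<otimes>\<^bsub>A\<^esub> \<eta> \<otimes>\<^bsub>A\<^esub> d k) \<otimes>\<^bsub>A\<^esub> a)"
          unfolding one_sum[symmetric] using ac \<eta>a(1) by simp
        also have "\<dots> = (\<Oplus>\<^bsub>A\<^esub>k\<in>{..<n}. \<epsilon>0 i \<otimes>\<^bsub>A\<^esub> (c k \<otimes>\<^bsub>A\<^esub> \<eta> \<otimes>\<^bsub>A\<^esub> d k \<otimes>\<^bsub>A\<^esub> a))"
          using cd eta ac \<epsilon>c by (simp add: P.A.finsum_ldistr P.A.finsum_rdistr Pi_iff del: fun_upd_apply)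
        also have "\<dots> = (\<Oplus>\<^bsub>A\<^esub>k\<in>{..<n}. p k \<otimes>\<^bsub>A\<^esub> s k)"
        proof (rule P.A.finsum_cong')
          show "\<epsilon>0 i \<otimes>\<^bsub>A\<^esub> (c k \<otimes>\<^bsub>A\<^esub> \<eta> \<otimes>\<^bsub>A\<^esub> d k \<otimes>\<^bsub>A\<^esub> a) = p k \<otimes>\<^bsub>A\<^esub> s k" if "k \<in> {..<n}" for k
          proof -
            have k: "k < n" using that by simp
            have "p k \<otimes>\<^bsub>A\<^esub> s k = \<epsilon>0 i \<otimes>\<^bsub>A\<^esub> (c k \<otimes>\<^bsub>A\<^esub> ((\<eta> \<otimes>\<^bsub>A\<^esub> \<eta>) \<otimes>\<^bsub>A\<^esub> (d k \<otimes>\<^bsub>A\<^esub> a)))"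
              unfolding s_eq[OF k] p_def using \<epsilon>c cd[OF k] eta(1) ac by (simp add: P.A.m_assoc del: fun_upd_apply)
            then show ?thesis using \<epsilon>c cd[OF k] eta ac by (simp add: P.A.m_assoc del: fun_upd_apply)
          qed
        qed (use pc sc in auto)
        finally have a_sum: "a = (\<Oplus>\<^bsub>A\<^esub>k\<in>{..<n}. p k \<otimes>\<^bsub>A\<^esub> s k)" .
        have ps: "p k \<otimes>\<^bsub>A\<^esub> s k \<in> \<R> i Top" if "k < n" for k by (rule R.T_mult[OF rT[OF i] rTT p[OF that] s[OF that]])
        have fs: "f k \<otimes>\<^bsub>A\<^esub> s k \<in> \<R> Top Top" if "k < n" for k by (rule R.T_mult[OF rTT rTT f[OF that] s[OF that]])
        have ysc: "y \<cdot>\<^bsub>M\<^esub> R.E Top Top (f k \<otimes>\<^bsub>A\<^esub> s k) \<in> carrier M" "v k \<cdot>\<^bsub>M\<^esub> R.E Top Top (s k) \<in> carrier M" if "k < n" for k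
          using M.ract_closed[OF yc R.E_closed[OF rTT fs[OF that]]] M.ract_closed[OF vc[OF that] R.E_closed[OF rTT s[OF that]]] .
        have "w \<cdot>\<^bsub>M\<^esub> R.E i Top a = (\<Oplus>\<^bsub>M\<^esub>k\<in>{..<n}. w \<cdot>\<^bsub>M\<^esub> R.E i Top (p k \<otimes>\<^bsub>A\<^esub> s k))"
          by (subst (1) a_sum) (rule M.act_E_finsum[OF _ wc rT[OF i]], use ps in auto)
        also have "\<dots> = (\<Oplus>\<^bsub>M\<^esub>k\<in>{..<n}. y \<cdot>\<^bsub>M\<^esub> R.E Top Top (f k \<otimes>\<^bsub>A\<^esub> s k) \<oplus>\<^bsub>M\<^esub> v k \<cdot>\<^bsub>M\<^esub> R.E Top Top (s k))"
        proof (rule M.M.finsum_cong')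
          fix k assume "k \<in> {..<n}"
          then have k: "k < n" by simp
          have "w \<cdot>\<^bsub>M\<^esub> R.E i Top (p k \<otimes>\<^bsub>A\<^esub> s k) = (y \<cdot>\<^bsub>M\<^esub> R.E Top Top (f k) \<oplus>\<^bsub>M\<^esub> v k) \<cdot>\<^bsub>M\<^esub> R.E Top Top (s k)"
            using M.act_E_E[OF wc rT[OF i] rTT p[OF k] s[OF k]] wp[OF k] by simp
          then show "w \<cdot>\<^bsub>M\<^esub> R.E i Top (p k \<otimes>\<^bsub>A\<^esub> s k) = y \<cdot>\<^bsub>M\<^esub> R.E Top Top (f k \<otimes>\<^bsub>A\<^esub> s k) \<oplus>\<^bsub>M\<^esub> v k \<cdot>\<^bsub>M\<^esub> R.E Top Top (s k)"
            using M.ract_add_left[OF M.ract_closed[OF yc R.E_closed[OF rTT f[OF k]]] vc[OF k] R.E_closed[OF rTT s[OF k]]]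
              M.act_E_E[OF yc rTT rTT f[OF k] s[OF k]] by simp
        qed (use ysc in auto)
        also have "\<dots> = (\<Oplus>\<^bsub>M\<^esub>k\<in>{..<n}. y \<cdot>\<^bsub>M\<^esub> R.E Top Top (f k \<otimes>\<^bsub>A\<^esub> s k)) \<oplus>\<^bsub>M\<^esub> (\<Oplus>\<^bsub>M\<^esub>k\<in>{..<n}. v k \<cdot>\<^bsub>M\<^esub> R.E Top Top (s k))"
          using ysc by (intro M.M.finsum_addf) auto
        finally have w_sum: "w \<cdot>\<^bsub>M\<^esub> R.E i Top a = (\<Oplus>\<^bsub>M\<^esub>k\<in>{..<n}. y \<cdot>\<^bsub>M\<^esub> R.E Top Top (f k \<otimes>\<^bsub>A\<^esub> s k)) \<oplus>\<^bsub>M\<^esub> (\<Oplus>\<^bsub>M\<^esub>k\<in>{..<n}. v k \<cdot>\<^bsub>M\<^esub> R.E Top Top (s k))" .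
        have \<rho>a: "\<rho> \<otimes>\<^bsub>A\<^esub> a = (\<Oplus>\<^bsub>A\<^esub>k\<in>{..<n}. f k \<otimes>\<^bsub>A\<^esub> s k)"
        proof -
          have "\<rho> \<otimes>\<^bsub>A\<^esub> a = (\<Oplus>\<^bsub>A\<^esub>k\<in>{..<n}. g k \<otimes>\<^bsub>A\<^esub> a)" unfolding \<rho>_def using gc ac by (simp add: P.A.finsum_ldistr Pi_iff)
          also have "\<dots> = (\<Oplus>\<^bsub>A\<^esub>k\<in>{..<n}. f k \<otimes>\<^bsub>A\<^esub> s k)"
          proof (rule P.A.finsum_cong')
            fix k assume "k \<in> {..<n}"
            then have k: "k < n" by simp
            have "g k \<otimes>\<^bsub>A\<^esub> a = f k \<otimes>\<^bsub>A\<^esub> (d k \<otimes>\<^bsub>A\<^esub> (\<epsilon>0 i \<otimes>\<^bsub>A\<^esub> a))"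
              unfolding g_def using fc[OF k] cd(2)[OF k] \<epsilon>c ac by (simp add: P.A.m_assoc del: fun_upd_apply)
            also have "\<dots> = f k \<otimes>\<^bsub>A\<^esub> \<eta> \<otimes>\<^bsub>A\<^esub> (d k \<otimes>\<^bsub>A\<^esub> a)" using \<eta>a(1) \<eta>l(2)[OF f[OF k]] by simp
            also have "\<dots> = f k \<otimes>\<^bsub>A\<^esub> s k" unfolding s_eq[OF k] using fc[OF k] cd(2)[OF k] eta(1) ac by (simp add: P.A.m_assoc)
            finally show "g k \<otimes>\<^bsub>A\<^esub> a = f k \<otimes>\<^bsub>A\<^esub> s k" .
          qed (use fc sc in auto)
          finally show ?thesis .
        qed
        have \<rho>aR: "\<rho> \<otimes>\<^bsub>A\<^esub> a \<in> \<R> Top Top" using R.T_mult[OF rBi rT[OF i] \<rho>R ai] RBT by simp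
        have "z \<cdot>\<^bsub>M\<^esub> R.E i Top a = y \<cdot>\<^bsub>M\<^esub> R.E Top Top (\<rho> \<otimes>\<^bsub>A\<^esub> a)"
          unfolding z_def using M.act_E_E[OF xc rBi rT[OF i] \<rho>R ai] xy[OF \<rho>aR] by simp
        also have "\<dots> = (\<Oplus>\<^bsub>M\<^esub>k\<in>{..<n}. y \<cdot>\<^bsub>M\<^esub> R.E Top Top (f k \<otimes>\<^bsub>A\<^esub> s k))"
          unfolding \<rho>a by (rule M.act_E_finsum[OF _ yc rTT]) (use fs in auto)
        finally have z_sum: "z \<cdot>\<^bsub>M\<^esub> R.E i Top a = (\<Oplus>\<^bsub>M\<^esub>k\<in>{..<n}. y \<cdot>\<^bsub>M\<^esub> R.E Top Top (f k \<otimes>\<^bsub>A\<^esub> s k))" .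
        have sumU: "(\<Oplus>\<^bsub>M\<^esub>k\<in>{..<n}. v k \<cdot>\<^bsub>M\<^esub> R.E Top Top (s k)) \<in> U"
          by (rule M.M.finsum_mem) (use U' v R.E_closed[OF rTT s] in auto)
        have c1: "(\<Oplus>\<^bsub>M\<^esub>k\<in>{..<n}. y \<cdot>\<^bsub>M\<^esub> R.E Top Top (f k \<otimes>\<^bsub>A\<^esub> s k)) \<in> carrier M" using ysc by (intro M.M.finsum_closed) auto
        have c2: "(\<Oplus>\<^bsub>M\<^esub>k\<in>{..<n}. v k \<cdot>\<^bsub>M\<^esub> R.E Top Top (s k)) \<in> carrier M" using sumU U'(1) by blast
        have "(p' \<oplus>\<^bsub>M\<^esub> q') \<ominus>\<^bsub>M\<^esub> p' = q'" if "p' \<in> carrier M" "q' \<in> carrier M" for p' q'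
        proof -
          have "(p' \<oplus>\<^bsub>M\<^esub> q') \<ominus>\<^bsub>M\<^esub> p' = q' \<oplus>\<^bsub>M\<^esub> (p' \<oplus>\<^bsub>M\<^esub> \<ominus>\<^bsub>M\<^esub> p')" using that by (simp add: M.M.minus_eq M.M.a_ac)
          then show ?thesis using that by (simp add: M.M.r_neg)
        qed
        then have "(w \<ominus>\<^bsub>M\<^esub> z) \<cdot>\<^bsub>M\<^esub> R.E i Top a = (\<Oplus>\<^bsub>M\<^esub>k\<in>{..<n}. v k \<cdot>\<^bsub>M\<^esub> R.E Top Top (s k))"
          using M.minus_ract[OF wc zc Ea] w_sum z_sum c1 c2 by simp
        then show ?thesis using sumU True by simp
      qed
    qed
    then have "z \<oplus>\<^bsub>M\<^esub> (w \<ominus>\<^bsub>M\<^esub> z) \<in> ?N <+>\<^bsub>M\<^esub> ?B" by (rule set_addI[OF zN])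
    moreover have "z \<oplus>\<^bsub>M\<^esub> (w \<ominus>\<^bsub>M\<^esub> z) = w"
    proof -
      have "z \<oplus>\<^bsub>M\<^esub> (w \<ominus>\<^bsub>M\<^esub> z) = w \<oplus>\<^bsub>M\<^esub> (z \<oplus>\<^bsub>M\<^esub> \<ominus>\<^bsub>M\<^esub> z)" using wc zc by (simp add: M.M.minus_eq M.M.a_ac)
      then show ?thesis using wc zc by (simp add: M.M.r_neg)
    qed
    ultimately show ?thesis by simp
  qed
  note vert_in = this
  have "w \<in> ?N <+>\<^bsub>M\<^esub> ?B" if "w \<in> carrier M" for w
    using that by (induction rule: M.module_induct) (use M.rsubmoduleD(2,3)[OF NB] vert_in in blast)+
  then have sum: "?N <+>\<^bsub>M\<^esub> ?B = carrier M" using M.rsubmoduleD(1)[OF NB] by blast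
  have e: "?e \<in> carrier R.\<Lambda>" by (rule M.unit_E_closed[OF B])
  have X: "right_module R.\<Lambda> ?X" by (rule right_module_principal[OF R.ring_incidence e])
  have NM: "right_module R.\<Lambda> (M\<lparr>carrier := ?N\<rparr>)" by (rule M.submodule_right_module[OF N])
  have Xs: "carrier ?X = {?e \<otimes>\<^bsub>R.\<Lambda>\<^esub> f | f. f \<in> carrier R.\<Lambda>}" "f \<cdot>\<^bsub>?X\<^esub> g = f \<otimes>\<^bsub>R.\<Lambda>\<^esub> g" "f \<oplus>\<^bsub>?X\<^esub> g = f \<oplus>\<^bsub>R.\<Lambda>\<^esub> g" "\<zero>\<^bsub>?X\<^esub> = \<zero>\<^bsub>R.\<Lambda>\<^esub>" for f g
    by (simp_all add: principal_rmodule_def)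
  have Xc: "f \<in> carrier R.\<Lambda>" if "f \<in> carrier ?X" for f using that Xs(1) e by auto
  have h: "(\<lambda>f. x \<cdot>\<^bsub>M\<^esub> f) \<in> rmod_hom R.\<Lambda> ?X (M\<lparr>carrier := ?N\<rparr>)"
  proof (rule rmod_homI)
    show "x \<cdot>\<^bsub>M\<^esub> f \<in> carrier (M\<lparr>carrier := ?N\<rparr>)" if "f \<in> carrier ?X" for f using Xc[OF that] by auto
    show "x \<cdot>\<^bsub>M\<^esub> (f \<oplus>\<^bsub>?X\<^esub> g) = x \<cdot>\<^bsub>M\<^esub> f \<oplus>\<^bsub>M\<lparr>carrier := ?N\<rparr>\<^esub> x \<cdot>\<^bsub>M\<^esub> g" if "f \<in> carrier ?X" "g \<in> carrier ?X" for f g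
      using M.ract_add_right[OF xc Xc[OF that(1)] Xc[OF that(2)]] by (simp add: Xs(3))
    show "x \<cdot>\<^bsub>M\<^esub> (f \<cdot>\<^bsub>?X\<^esub> a) = x \<cdot>\<^bsub>M\<^esub> f \<cdot>\<^bsub>M\<lparr>carrier := ?N\<rparr>\<^esub> a" if "f \<in> carrier ?X" "a \<in> carrier R.\<Lambda>" for f a
      using M.ract_assoc[OF xc Xc[OF that(1)] that(2)] by (simp add: Xs(2))
  qed
  have "(\<lambda>f. x \<cdot>\<^bsub>M\<^esub> f) ` carrier ?X = ?N"
  proof
    show "(\<lambda>f. x \<cdot>\<^bsub>M\<^esub> f) ` carrier ?X \<subseteq> ?N" using Xc by blast
    show "?N \<subseteq> (\<lambda>f. x \<cdot>\<^bsub>M\<^esub> f) ` carrier ?X"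
    proof
      fix w assume "w \<in> ?N"
      then obtain f where f: "f \<in> carrier R.\<Lambda>" "w = x \<cdot>\<^bsub>M\<^esub> f" by blast
      then have "w = x \<cdot>\<^bsub>M\<^esub> (?e \<otimes>\<^bsub>R.\<Lambda>\<^esub> f)" using M.ract_assoc[OF xc e f(1)] M.vert_unit[OF x(1)] by simp
      then show "w \<in> (\<lambda>f. x \<cdot>\<^bsub>M\<^esub> f) ` carrier ?X" using f(1) unfolding Xs(1) by blast
    qed
  qed
  moreover have "inj_on (\<lambda>f. x \<cdot>\<^bsub>M\<^esub> f) (carrier ?X)"
    unfolding rmod_hom_inj_iff[OF X NM h]
  proof (intro ballI impI)
    fix f assume f: "f \<in> carrier ?X" and z: "x \<cdot>\<^bsub>M\<^esub> f = \<zero>\<^bsub>M\<lparr>carrier := ?N\<rparr>\<^esub>"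
    note fc = Xc[OF f]
    obtain f' where f': "f' \<in> carrier R.\<Lambda>" "f = ?e \<otimes>\<^bsub>R.\<Lambda>\<^esub> f'" using f Xs(1) by blast
    have row: "f k l = \<zero>\<^bsub>A\<^esub>" if "k \<noteq> Bot" for k l
      using that R.E_mult[OF B R.unit_carrier[OF B] f'(1)] f'(2) by simp
    have fi: "f Bot i = \<zero>\<^bsub>A\<^esub>" if i: "i \<in> Q" for i
    proof -
      have rBi: "(Bot, i) \<in> rQ" using i by simp
      have fR: "f Bot i \<in> \<R> Bot i" by (rule R.incidence_mem[OF fc rBi])
      have fA: "f Bot i \<in> carrier A" by (rule R.T_sub[OF rBi fR])
      have "f Bot i \<otimes>\<^bsub>A\<^esub> a = \<zero>\<^bsub>A\<^esub>" if a: "a \<in> \<R> i Top" for a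
      proof (rule ccontr)
        \<comment> \<open>A nonzero product lies in the division ring at the top and is invertible
          there; since y times it vanishes, y would be zero.\<close>
        assume nz: "f Bot i \<otimes>\<^bsub>A\<^esub> a \<noteq> \<zero>\<^bsub>A\<^esub>"
        have b: "f Bot i \<otimes>\<^bsub>A\<^esub> a \<in> \<R> Top Top" using R.T_mult[OF rBi rT[OF i] fR a] RBT by simp
        have ac: "a \<in> carrier A" by (rule R.T_sub[OF rT[OF i] a])
        have Ea: "R.E i Top a \<in> carrier R.\<Lambda>" by (rule R.E_closed[OF rT[OF i] a])
        have "(f \<otimes>\<^bsub>R.\<Lambda>\<^esub> R.E i Top a) k l = R.E Bot Top (f Bot i \<otimes>\<^bsub>A\<^esub> a) k l" for k l
        proof -
          have "(f \<otimes>\<^bsub>R.\<Lambda>\<^esub> R.E i Top a) k l = (if l = Top then f k i \<otimes>\<^bsub>A\<^esub> a else \<zero>\<^bsub>A\<^esub>)"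
            unfolding R.incidence_algebra_simps(2)
            by (rule P.A.finsum_single[OF R.finite_P i]) (use R.incidence_carrier[OF fc] ac in \<open>auto simp: matrix_unit_def\<close>)
          then show ?thesis using row[of k i] ac by (auto simp: matrix_unit_def)
        qed
        then have "f \<otimes>\<^bsub>R.\<Lambda>\<^esub> R.E i Top a = R.E Bot Top (f Bot i \<otimes>\<^bsub>A\<^esub> a)" by (intro ext)
        then have "y \<cdot>\<^bsub>M\<^esub> R.E Top Top (f Bot i \<otimes>\<^bsub>A\<^esub> a) = \<zero>\<^bsub>M\<^esub>"
          using M.ract_assoc[OF xc fc Ea] z M.zero_ract[OF Ea] xy[OF b] by simp
        moreover obtain b' where b': "b' \<in> \<R> Top Top" "f Bot i \<otimes>\<^bsub>A\<^esub> a \<otimes>\<^bsub>A\<^esub> b' = R.u Top"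
          using R_division[OF Tp] b nz unfolding R.division_vertex_def by blast
        ultimately have "y = \<zero>\<^bsub>M\<^esub>"
          using M.act_E_E[OF yc rTT rTT b b'(1)] M.zero_ract[OF R.E_closed[OF rTT b'(1)]] M.vert_unit[OF yv] by simp
        then show False using y0 by simp
      qed
      then show ?thesis by (rule R.faithful[OF rBi fR])
    qed
    have "f k l = \<zero>\<^bsub>A\<^esub>" for k l
    proof (cases "k = Bot \<and> l \<in> Q")
      case True
      then show ?thesis using fi by simp
    next
      case False
      then show ?thesis using row R.incidence_zero[OF fc, of k l] R.r_sub[of k l] by blast
    qed
    then show "f = \<zero>\<^bsub>?X\<^esub>" unfolding Xs(4) R.incidence_algebra_simps(4) by (intro ext)
  qed
  ultimately have "rmod_isomorphic R.\<Lambda> ?X (M\<lparr>carrier := ?N\<rparr>)"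
    unfolding rmod_isomorphic_def bij_betw_def using h by auto
  then have iso: "rmod_isomorphic R.\<Lambda> (M\<lparr>carrier := ?N\<rparr>) ?X" by (rule rmod_isomorphic_sym[OF X NM])
  show ?thesis unfolding has_direct_summand_def
    by (intro exI[of _ ?N] exI[of _ ?B] conjI N B_sub int sum iso)
qed

end

section \<open>The functor from representations to modules\<close>

text \<open>The map g conjugated by the injection \<iota>, made extensional because arrows of
  \<open>rmod_category\<close> are.\<close>

definition transport_map :: "('b \<Rightarrow> 'v) \<Rightarrow> 'b set \<Rightarrow> ('b \<Rightarrow> 'b) \<Rightarrow> 'v \<Rightarrow> 'v" where
  "transport_map \<iota> C g = restrict (\<lambda>z. \<iota> (g (inv_into C \<iota> z))) (\<iota> ` C)"

lemma transport_map_apply: "inj_on \<iota> C \<Longrightarrow> x \<in> C \<Longrightarrow> transport_map \<iota> C g (\<iota> x) = \<iota> (g x)"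
  by (simp add: transport_map_def)

lemma transport_map_hom:
  assumes M: "right_module R M" and N: "right_module R N" and \<iota>: "inj_on \<iota> (carrier M)" "inj_on \<iota> (carrier N)"
    and g: "g \<in> rmod_hom R M N"
  shows "transport_map \<iota> (carrier M) g \<in> rmod_hom R (image_rmod \<iota> M) (image_rmod \<iota> N)"
proof -
  interpret M: rmod R M using M by (rule rmod.intro)
  interpret N: rmod R N using N by (rule rmod.intro)
  note MT = M.transport[OF \<iota>(1)] and NT = N.transport[OF \<iota>(2)]
  have "(\<lambda>z. \<iota> (g (inv_into (carrier M) \<iota> z))) \<in> rmod_hom R (image_rmod \<iota> M) (image_rmod \<iota> N)"
    by (rule rmod_hom_compose[OF rmod_hom_compose[OF rmod_hom_inv_into[OF M MT(1-3)] g] NT(2)])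
  from rmod_hom_restrict[OF MT(1) this] show ?thesis by (simp add: transport_map_def)
qed

lemma transport_map_surj:
  assumes M: "right_module R M" and N: "right_module R N" and \<iota>: "inj_on \<iota> (carrier M)" "inj_on \<iota> (carrier N)"
    and k: "k \<in> rmod_hom R (image_rmod \<iota> M) (image_rmod \<iota> N)" "k \<in> extensional (\<iota> ` carrier M)"
  shows "\<exists>g \<in> rmod_hom R M N. transport_map \<iota> (carrier M) g = k"
proof -
  interpret M: rmod R M using M by (rule rmod.intro)
  interpret N: rmod R N using N by (rule rmod.intro)
  note MT = M.transport[OF \<iota>(1)] and NT = N.transport[OF \<iota>(2)]
  let ?g = "\<lambda>u. inv_into (carrier N) \<iota> (k (\<iota> u))"
  have "?g \<in> rmod_hom R M N"
    by (rule rmod_hom_compose[OF rmod_hom_compose[OF MT(2) k(1)] rmod_hom_inv_into[OF N NT(1-3)]])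
  moreover have "transport_map \<iota> (carrier M) ?g = k"
  proof (rule extensionalityI[OF _ k(2)])
    show "transport_map \<iota> (carrier M) ?g \<in> extensional (\<iota> ` carrier M)" by (simp add: transport_map_def)
    fix z assume "z \<in> \<iota> ` carrier M"
    then obtain x where x: "x \<in> carrier M" "z = \<iota> x" by blast
    have "k (\<iota> x) \<in> \<iota> ` carrier N" using rmod_homD(1)[OF k(1), of "\<iota> x"] x by simp
    then show "transport_map \<iota> (carrier M) ?g z = k z"
      unfolding x(2) transport_map_apply[OF \<iota>(1) x(1)] by (rule f_inv_into_f)
  qed
  ultimately show ?thesis by blast
qed

section \<open>The category of representations and the row vectors of a representation\<close>

context extendable_poset
begin

abbreviation "is_rep L W \<equiv> (L, W) \<in> Obj (Rep K A P r T)"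

lemma is_rep_iff: "is_rep L W \<longleftrightarrow> right_module A L \<and> W \<in> extensional P \<and> (\<forall>i \<in> P. rsubspace K A L (W i)) \<and>
   (\<forall>(i, j) \<in> r. \<forall>x \<in> W i. \<forall>t \<in> T i j. x \<cdot>\<^bsub>L\<^esub> t \<in> W j)"
proof -
  have "x \<cdot>\<^bsub>L\<^esub> system_unit A T i = x" if "right_module A L" "rsubspace K A L (W i)" "i \<in> P" "x \<in> W i" for i x
  proof -
    interpret L: right_module A L using that(1) .
    have "x \<in> carrier L" using that(2,4) subgroup.subset unfolding rsubspace_def by fastforce
    then show ?thesis using L.ract_one P_unit[OF that(3)] by simp
  qed
  then show ?thesis unfolding Rep_def by auto
qed

lemma is_repD:
  assumes "is_rep L W"
  shows "right_module A L" "W \<in> extensional P"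
    "i \<in> P \<Longrightarrow> w \<in> W i \<Longrightarrow> w \<in> carrier L" "i \<in> P \<Longrightarrow> \<zero>\<^bsub>L\<^esub> \<in> W i"
    "i \<in> P \<Longrightarrow> w \<in> W i \<Longrightarrow> w' \<in> W i \<Longrightarrow> w \<oplus>\<^bsub>L\<^esub> w' \<in> W i"
    "(i, j) \<in> r \<Longrightarrow> w \<in> W i \<Longrightarrow> t \<in> T i j \<Longrightarrow> w \<cdot>\<^bsub>L\<^esub> t \<in> W j"
proof -
  show "right_module A L" "W \<in> extensional P" and act: "(i, j) \<in> r \<Longrightarrow> w \<in> W i \<Longrightarrow> t \<in> T i j \<Longrightarrow> w \<cdot>\<^bsub>L\<^esub> t \<in> W j"
    using assms unfolding is_rep_iff by auto
  have sg: "subgroup (W i) (add_monoid L)" if "i \<in> P" using assms that unfolding is_rep_iff rsubspace_def by auto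
  show "i \<in> P \<Longrightarrow> w \<in> W i \<Longrightarrow> w \<in> carrier L" using subgroup.subset[OF sg] by auto
  show "i \<in> P \<Longrightarrow> \<zero>\<^bsub>L\<^esub> \<in> W i" using subgroup.one_closed[OF sg] by simp
  show "i \<in> P \<Longrightarrow> w \<in> W i \<Longrightarrow> w' \<in> W i \<Longrightarrow> w \<oplus>\<^bsub>L\<^esub> w' \<in> W i" using subgroup.m_closed[OF sg] by simp
qed

lemma Rep_simps:
  "Hom (Rep K A P r T) (L, W) (L', W') = {h \<in> rmod_hom A L L' \<inter> extensional (carrier L). \<forall>i \<in> P. h ` W i \<subseteq> W' i}"
  "Idn (Rep K A P r T) (L, W) = restrict (\<lambda>x. x) (carrier L)"
  "Cmp (Rep K A P r T) (L, W) b c g f = compose (carrier L) g f"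
  by (simp_all add: Rep_def)

lemma category_Rep: "category (Rep K A P r T :: (('a, 'v) rmodule \<times> ('p \<Rightarrow> 'v set), 'v \<Rightarrow> 'v) category)"
proof -
  let ?C = "Rep K A P r T :: (('a, 'v) rmodule \<times> ('p \<Rightarrow> 'v set), 'v \<Rightarrow> 'v) category"
  have rest: "h x = x" if "h = restrict (\<lambda>x. x) (carrier L)" "x \<in> carrier L" for h x and L :: "('a, 'v) rmodule" using that by simp
  show ?thesis
  proof
    fix a assume a: "a \<in> Obj ?C"
    obtain L W where e: "a = (L, W)" by force
    have LW: "is_rep L W" using a e by simp
    have "(\<lambda>x. x) \<in> rmod_hom A L L" by (simp add: rmod_hom_def)
    then have "restrict (\<lambda>x. x) (carrier L) \<in> rmod_hom A L L" by (rule rmod_hom_restrict[OF is_repD(1)[OF LW]])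
    then show "Idn ?C a \<in> Hom ?C a a" unfolding e Rep_simps using is_repD(3)[OF LW] by auto
  next
    fix a b c f g assume o: "a \<in> Obj ?C" "b \<in> Obj ?C" "c \<in> Obj ?C" and m: "f \<in> Hom ?C a b" "g \<in> Hom ?C b c"
    obtain L W L1 W1 L2 W2 where e: "a = (L, W)" "b = (L1, W1)" "c = (L2, W2)" by (metis surj_pair)
    have LW: "is_rep L W" using o e by simp
    have f: "f \<in> rmod_hom A L L1" "\<And>i. i \<in> P \<Longrightarrow> f ` W i \<subseteq> W1 i" and g: "g \<in> rmod_hom A L1 L2" "\<And>i. i \<in> P \<Longrightarrow> g ` W1 i \<subseteq> W2 i"
      using m unfolding e Rep_simps by auto
    have "compose (carrier L) g f \<in> rmod_hom A L L2"
      using rmod_hom_restrict[OF is_repD(1)[OF LW] rmod_hom_compose[OF f(1) g(1)]] by (simp add: compose_def)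
    moreover have "compose (carrier L) g f ` W i \<subseteq> W2 i" if "i \<in> P" for i
      using f(2)[OF that] g(2)[OF that] is_repD(3)[OF LW that] by (auto simp: compose_def image_subset_iff)
    ultimately show "Cmp ?C a b c g f \<in> Hom ?C a c" unfolding e Rep_simps by simp
  next
    fix a b f assume o: "a \<in> Obj ?C" "b \<in> Obj ?C" and m: "f \<in> Hom ?C a b"
    obtain L W L1 W1 where e: "a = (L, W)" "b = (L1, W1)" by (metis surj_pair)
    have f: "f \<in> rmod_hom A L L1" "f \<in> extensional (carrier L)" using m unfolding e Rep_simps by auto
    show "Cmp ?C a a b f (Idn ?C a) = f" unfolding e Rep_simps using compose_Id[OF rmod_hom_funcset[OF f(1)] f(2)] .
    show "Cmp ?C a b b (Idn ?C b) f = f" unfolding e Rep_simps using Id_compose[OF rmod_hom_funcset[OF f(1)] f(2)] .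
  next
    fix a b c d f g h assume m: "f \<in> Hom ?C a b" "g \<in> Hom ?C b c" "h \<in> Hom ?C c d"
    obtain L W L1 W1 L2 W2 L3 W3 where e: "a = (L, W)" "b = (L1, W1)" "c = (L2, W2)" "d = (L3, W3)" by (metis surj_pair)
    have "f \<in> rmod_hom A L L1" using m unfolding e Rep_simps by auto
    then show "Cmp ?C a b d (Cmp ?C b c d h g) f = Cmp ?C a c d h (Cmp ?C a b c g f)"
      unfolding e Rep_simps by (rule compose_assoc[OF rmod_hom_funcset, symmetric])
  qed
qed

text \<open>The spaces \<open>L_i \<epsilon>_i\<close> and \<open>L \<epsilon>_m\<close>, written as
  fixed points of the idempotents. The value at \<open>Bot\<close> is zero, as it has to be for
  modules without the summand \<open>e_0 \<Lambda>\<close>.\<close>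

definition component :: "('a, 'v) rmodule \<Rightarrow> ('p \<Rightarrow> 'v set) \<Rightarrow> 'p extended \<Rightarrow> 'v set" where
  "component L W x = (case x of Bot \<Rightarrow> {\<zero>\<^bsub>L\<^esub>} | Elt i \<Rightarrow> {w \<in> W i. w \<cdot>\<^bsub>L\<^esub> \<epsilon> (Elt i) = w}
     | Top \<Rightarrow> {w \<in> carrier L. w \<cdot>\<^bsub>L\<^esub> \<eta> = w})"

lemma component_simps [simp]:
  "component L W Bot = {\<zero>\<^bsub>L\<^esub>}" "component L W (Elt i) = {w \<in> W i. w \<cdot>\<^bsub>L\<^esub> \<epsilon> (Elt i) = w}"
  "component L W Top = {w \<in> carrier L. w \<cdot>\<^bsub>L\<^esub> \<eta> = w}"
  by (simp_all add: component_def)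

lemma component_props:
  assumes LW: "is_rep L W" and x: "x \<in> Q"
  shows "w \<in> component L W x \<Longrightarrow> w \<in> carrier L" "w \<in> component L W x \<Longrightarrow> w \<cdot>\<^bsub>L\<^esub> \<epsilon>0 x = w"
    "\<zero>\<^bsub>L\<^esub> \<in> component L W x"
    "w \<in> component L W x \<Longrightarrow> w' \<in> component L W x \<Longrightarrow> w \<oplus>\<^bsub>L\<^esub> w' \<in> component L W x"
proof -
  interpret L: right_module A L by (rule is_repD(1)[OF LW])
  note e = eps_carrier[OF x]
  show c: "w \<in> carrier L" if "w \<in> component L W x" for w
    using that x is_repD(3)[OF LW] by (cases x) auto
  show "w \<in> component L W x \<Longrightarrow> w \<cdot>\<^bsub>L\<^esub> \<epsilon>0 x = w" using eta(1) by (cases x) (auto simp: L.zero_ract)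
  show "\<zero>\<^bsub>L\<^esub> \<in> component L W x" using x e is_repD(4)[OF LW] by (cases x) (auto simp: L.zero_ract)
  show "w \<oplus>\<^bsub>L\<^esub> w' \<in> component L W x" if "w \<in> component L W x" "w' \<in> component L W x"
    using that c[OF that(1)] c[OF that(2)] x e is_repD(5)[OF LW] by (cases x) (auto simp: L.ract_add_left)
qed

lemma component_act:
  assumes LW: "is_rep L W" and xy: "(x, y) \<in> rQ" and w: "w \<in> component L W x" and a: "a \<in> \<R> x y"
  shows "w \<cdot>\<^bsub>L\<^esub> a \<in> component L W y"
proof -
  interpret L: right_module A L by (rule is_repD(1)[OF LW])
  have q: "x \<in> Q" "y \<in> Q" using R.r_sub[OF xy] by auto
  note wc = component_props(1)[OF LW q(1) w] and ac = R.T_sub[OF xy a]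
  have e: "w \<cdot>\<^bsub>L\<^esub> a \<cdot>\<^bsub>L\<^esub> \<epsilon>0 y = w \<cdot>\<^bsub>L\<^esub> a"
    using L.ract_assoc[OF wc ac eps_carrier[OF q(2)]] R_right[OF xy a] by simp
  have c: "w \<cdot>\<^bsub>L\<^esub> a \<in> carrier L" by (rule L.ract_closed[OF wc ac])
  show ?thesis
  proof (cases y)
    case Bot
    then have "x = Bot" using xy by (cases x) auto
    then show ?thesis using w Bot L.zero_ract[OF ac] by simp
  next
    case y: (Elt j)
    show ?thesis
    proof (cases x)
      case Bot
      then show ?thesis using w L.zero_ract[OF ac] component_props(3)[OF LW q(2)] by simp
    next
      case x: (Elt i)
      have "w \<cdot>\<^bsub>L\<^esub> a \<in> W j" using is_repD(6)[OF LW, of i j w a] w xy R_sub_T0[OF xy a] x y by simp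
      then show ?thesis using e y by simp
    next
      case Top
      then show ?thesis using xy y by simp
    qed
  next
    case Top
    then show ?thesis using e c by simp
  qed
qed

lemma component_family:
  assumes LW: "is_rep L W"
  shows "R.subspace_family L (component L W)"
  unfolding R.subspace_family_def
proof (intro conjI allI impI ballI)
  fix x y a w assume "(x, y) \<in> rQ" "w \<in> component L W x" "a \<in> \<R> x y"
  then show "w \<cdot>\<^bsub>L\<^esub> a \<in> component L W y" by (rule component_act[OF LW])
qed (use component_props[OF LW] in \<open>auto simp: R_unit simp del: component_simps fun_upd_apply\<close>)

definition rep_module :: "('a, 'v) rmodule \<Rightarrow> ('p \<Rightarrow> 'v set) \<Rightarrow> ('p extended \<Rightarrow> 'p extended \<Rightarrow> 'a, 'p extended \<Rightarrow> 'v) rmodule" where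
  "rep_module L W = R.family_rmod L (component L W)"

lemma right_module_rep_module: "is_rep L W \<Longrightarrow> right_module R.\<Lambda> (rep_module L W)"
  unfolding rep_module_def by (intro R.right_module_family_rmod is_repD(1) component_family)

lemma rep_module_simps:
  "carrier (rep_module L W) = PiE Q (component L W)"
  "\<zero>\<^bsub>rep_module L W\<^esub> = (\<lambda>x\<in>Q. \<zero>\<^bsub>L\<^esub>)"
  "u \<oplus>\<^bsub>rep_module L W\<^esub> v = (\<lambda>x\<in>Q. u x \<oplus>\<^bsub>L\<^esub> v x)"
  "u \<cdot>\<^bsub>rep_module L W\<^esub> f = (\<lambda>y\<in>Q. \<Oplus>\<^bsub>L\<^esub>x\<in>Q. u x \<cdot>\<^bsub>L\<^esub> f x y)"
  by (simp_all add: rep_module_def R.family_rmod_simps)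

definition single :: "('a, 'v) rmodule \<Rightarrow> 'p extended \<Rightarrow> 'v \<Rightarrow> 'p extended \<Rightarrow> 'v" where
  "single L x w = (\<lambda>y\<in>Q. if y = x then w else \<zero>\<^bsub>L\<^esub>)"

lemma rep_module_E:
  assumes LW: "is_rep L W" and u: "u \<in> PiE Q (component L W)" and xy: "(x, y) \<in> rQ" "a \<in> \<R> x y"
  shows "u \<cdot>\<^bsub>rep_module L W\<^esub> R.E x y a = single L y (u x \<cdot>\<^bsub>L\<^esub> a)"
  unfolding rep_module_def single_def
  by (rule R.family_rmod_E[OF is_repD(1)[OF LW] component_family[OF LW] u xy])

lemma single_mem: "is_rep L W \<Longrightarrow> x \<in> Q \<Longrightarrow> w \<in> component L W x \<Longrightarrow> single L x w \<in> PiE Q (component L W)"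
  by (rule PiE_I) (simp_all add: single_def component_props(3) del: component_simps poset_members)

lemma single_same: "x \<in> Q \<Longrightarrow> single L x w x = w"
  by (simp add: single_def)

lemma rep_module_unit:
  assumes LW: "is_rep L W" and u: "u \<in> PiE Q (component L W)" and x: "x \<in> Q"
  shows "u \<cdot>\<^bsub>rep_module L W\<^esub> R.E x x (R.u x) = single L x (u x)"
  using rep_module_E[OF LW u R.r_refl[OF x] R.unit_mem[OF x]] component_props(2)[OF LW x PiE_mem[OF u x]] R_unit[OF x] by simp

lemma rep_module_top_module: "is_rep L W \<Longrightarrow> incidence_top_module K A Q rQ \<R> Top (rep_module L W)"
  by (intro incidence_top_module.intro incidence_module.intro rmod.intro R.incidence_axioms R.incidence_top_axioms right_module_rep_module)

text \<open>For a coordinate w at x the product \<open>w b \<eta>\<close> equals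
  \<open>w (\<epsilon>_x b \<eta>)\<close>, whose second factor lies in \<open>\<R> x Top\<close>.
  Annihilation by \<open>\<R> x Top\<close> is therefore annihilation by \<open>A \<eta>\<close>,
  and \<open>mult_top_zero\<close> applies.\<close>

lemma rep_module_top_faithful:
  assumes LW: "is_rep L W"
  shows "incidence_top_module.top_faithful A Q \<R> Top (rep_module L W)"
proof -
  interpret L: rmod A L using is_repD(1)[OF LW] by (rule rmod.intro)
  interpret B: incidence_top_module K A Q rQ \<R> Top "rep_module L W" by (rule rep_module_top_module[OF LW])
  show ?thesis unfolding B.top_faithful_def
  proof (intro ballI impI)
    fix x u assume x: "x \<in> Q" and uv: "u \<in> B.vert x" and z: "\<forall>a\<in>\<R> x Top. u \<cdot>\<^bsub>rep_module L W\<^esub> R.E x Top a = \<zero>\<^bsub>rep_module L W\<^esub>"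
    have u: "u \<in> PiE Q (component L W)" using B.vert_carrier[OF uv] by (simp only: rep_module_simps)
    have us: "u = single L x (u x)" using B.vert_unit[OF uv] rep_module_unit[OF LW u x] by simp
    note ux = PiE_mem[OF u x]
    have rx: "(x, Top) \<in> rQ" using x by simp
    note uc = component_props(1)[OF LW x ux]
    have "u x = \<zero>\<^bsub>L\<^esub>"
    proof (rule mult_top_zero[OF is_repD(1)[OF LW] uc])
      fix b assume b: "b \<in> carrier A"
      have m: "\<epsilon>0 x \<otimes>\<^bsub>A\<^esub> b \<otimes>\<^bsub>A\<^esub> \<eta> \<in> \<R> x Top" by (rule R_top_mem[OF x b])
      have "single L Top (u x \<cdot>\<^bsub>L\<^esub> (\<epsilon>0 x \<otimes>\<^bsub>A\<^esub> b \<otimes>\<^bsub>A\<^esub> \<eta>)) Top = \<zero>\<^bsub>rep_module L W\<^esub> Top"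
        using z m rep_module_E[OF LW u rx m] by simp
      then have "u x \<cdot>\<^bsub>L\<^esub> (\<epsilon>0 x \<otimes>\<^bsub>A\<^esub> b \<otimes>\<^bsub>A\<^esub> \<eta>) = \<zero>\<^bsub>L\<^esub>" by (simp add: single_def rep_module_simps)
      moreover have "u x \<cdot>\<^bsub>L\<^esub> (\<epsilon>0 x \<otimes>\<^bsub>A\<^esub> b \<otimes>\<^bsub>A\<^esub> \<eta>) = u x \<cdot>\<^bsub>L\<^esub> \<epsilon>0 x \<cdot>\<^bsub>L\<^esub> (b \<otimes>\<^bsub>A\<^esub> \<eta>)"
        using uc b eta(1) eps_carrier[OF x] by (simp add: L.ract_assoc[symmetric] P.A.m_assoc del: fun_upd_apply)
      ultimately show "u x \<cdot>\<^bsub>L\<^esub> (b \<otimes>\<^bsub>A\<^esub> \<eta>) = \<zero>\<^bsub>L\<^esub>" using component_props(2)[OF LW x ux] by simp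
    qed
    then show "u = \<zero>\<^bsub>rep_module L W\<^esub>" using us by (auto simp: single_def rep_module_simps fun_eq_iff restrict_def)
  qed
qed

lemma rep_map_hom:
  assumes LW: "is_rep L W" and LW': "is_rep L' W'" and h: "h \<in> Hom (Rep K A P r T) (L, W) (L', W')"
  shows "(\<lambda>u. \<lambda>x\<in>Q. h (u x)) \<in> rmod_hom R.\<Lambda> (rep_module L W) (rep_module L' W')"
proof -
  interpret L: rmod A L using is_repD(1)[OF LW] by (rule rmod.intro)
  interpret L': rmod A L' using is_repD(1)[OF LW'] by (rule rmod.intro)
  have hh: "h \<in> rmod_hom A L L'" "\<And>i. i \<in> P \<Longrightarrow> h ` W i \<subseteq> W' i" using h unfolding Rep_simps by auto
  have h0: "h \<zero>\<^bsub>L\<^esub> = \<zero>\<^bsub>L'\<^esub>" by (rule rmod_hom_zero[OF is_repD(1)[OF LW] is_repD(1)[OF LW'] hh(1)])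
  have hc: "h w \<in> component L' W' x" if x: "x \<in> Q" and w: "w \<in> component L W x" for x w
  proof -
    note wc = component_props(1)[OF LW x w]
    have "h w \<cdot>\<^bsub>L'\<^esub> \<epsilon>0 x = h w"
      using rmod_homD(3)[OF hh(1) wc eps_carrier[OF x]] component_props(2)[OF LW x w] by simp
    then show ?thesis using x w hh(2) rmod_homD(1)[OF hh(1) wc] h0 by (cases x) auto
  qed
  have uc: "u x \<in> carrier L" if "u \<in> PiE Q (component L W)" "x \<in> Q" for u x
    by (rule component_props(1)[OF LW that(2) PiE_mem[OF that]])
  show ?thesis
  proof (rule rmod_homI)
    fix u assume u: "u \<in> carrier (rep_module L W)"
    then have u': "u \<in> PiE Q (component L W)" by (simp only: rep_module_simps)
    show "(\<lambda>x\<in>Q. h (u x)) \<in> carrier (rep_module L' W')"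
      unfolding rep_module_simps using hc PiE_mem[OF u'] by auto
    {
      fix v assume "v \<in> carrier (rep_module L W)"
      then have v': "v \<in> PiE Q (component L W)" by (simp only: rep_module_simps)
      show "(\<lambda>x\<in>Q. h ((u \<oplus>\<^bsub>rep_module L W\<^esub> v) x)) = (\<lambda>x\<in>Q. h (u x)) \<oplus>\<^bsub>rep_module L' W'\<^esub> (\<lambda>x\<in>Q. h (v x))"
        unfolding rep_module_simps by (rule restrict_ext) (use rmod_homD(2)[OF hh(1)] uc[OF u'] uc[OF v'] in simp)
    }
    fix f assume f: "f \<in> carrier R.\<Lambda>"
    note fc = R.incidence_carrier[OF f]
    show "(\<lambda>x\<in>Q. h ((u \<cdot>\<^bsub>rep_module L W\<^esub> f) x)) = (\<lambda>x\<in>Q. h (u x)) \<cdot>\<^bsub>rep_module L' W'\<^esub> f"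
      unfolding rep_module_simps
    proof (rule restrict_ext)
      fix y assume y: "y \<in> Q"
      have "h (\<Oplus>\<^bsub>L\<^esub>x\<in>Q. u x \<cdot>\<^bsub>L\<^esub> f x y) = (\<Oplus>\<^bsub>L'\<^esub>x\<in>Q. h (u x \<cdot>\<^bsub>L\<^esub> f x y))"
        by (rule rmod_hom_finsum[OF is_repD(1)[OF LW] is_repD(1)[OF LW'] hh(1) R.finite_P]) (use uc[OF u'] fc L.ract_closed in auto)
      also have "\<dots> = (\<Oplus>\<^bsub>L'\<^esub>x\<in>Q. (\<lambda>x\<in>Q. h (u x)) x \<cdot>\<^bsub>L'\<^esub> f x y)"
        by (rule L'.M.finsum_cong') (use rmod_homD[OF hh(1)] uc[OF u'] fc L'.ract_closed in auto)
      finally show "h ((\<lambda>y\<in>Q. \<Oplus>\<^bsub>L\<^esub>x\<in>Q. u x \<cdot>\<^bsub>L\<^esub> f x y) y) = (\<Oplus>\<^bsub>L'\<^esub>x\<in>Q. (\<lambda>x\<in>Q. h (u x)) x \<cdot>\<^bsub>L'\<^esub> f x y)" using y by simp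
    qed
  qed
qed

lemma top_generates:
  fixes L :: "('a, 'v) rmodule"
  assumes L: "right_module A L" and w: "w \<in> carrier L"
  obtains n :: nat and c d where "\<And>k. k < n \<Longrightarrow> c k \<in> carrier A" "\<And>k. k < n \<Longrightarrow> d k \<in> carrier A"
    "w = (\<Oplus>\<^bsub>L\<^esub>k\<in>{..<n}. w \<cdot>\<^bsub>L\<^esub> (c k \<otimes>\<^bsub>A\<^esub> \<eta>) \<cdot>\<^bsub>L\<^esub> d k)"
proof -
  interpret L: rmod A L using L by (rule rmod.intro)
  obtain n c d where cd: "\<And>k. k < n \<Longrightarrow> c k \<in> carrier A" "\<And>k. k < n \<Longrightarrow> d k \<in> carrier A"
    and one_sum: "\<one>\<^bsub>A\<^esub> = (\<Oplus>\<^bsub>A\<^esub>k\<in>{..<n::nat}. c k \<otimes>\<^bsub>A\<^esub> \<eta> \<otimes>\<^bsub>A\<^esub> d k)" using top_decomposition by blast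
  have "w = w \<cdot>\<^bsub>L\<^esub> (\<Oplus>\<^bsub>A\<^esub>k\<in>{..<n::nat}. c k \<otimes>\<^bsub>A\<^esub> \<eta> \<otimes>\<^bsub>A\<^esub> d k)" unfolding one_sum[symmetric] using L.ract_one[OF w] by simp
  also have "\<dots> = (\<Oplus>\<^bsub>L\<^esub>k\<in>{..<n}. w \<cdot>\<^bsub>L\<^esub> (c k \<otimes>\<^bsub>A\<^esub> \<eta> \<otimes>\<^bsub>A\<^esub> d k))" using cd eta(1) w by (intro L.ract_finsum) auto
  also have "\<dots> = (\<Oplus>\<^bsub>L\<^esub>k\<in>{..<n}. w \<cdot>\<^bsub>L\<^esub> (c k \<otimes>\<^bsub>A\<^esub> \<eta>) \<cdot>\<^bsub>L\<^esub> d k)"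
    using cd eta(1) w by (intro L.M.finsum_cong') (auto simp: L.ract_assoc L.ract_closed)
  finally show thesis using that cd by blast
qed

text \<open>An element of an A-module is determined by its products into \<open>L \<eta>\<close>.
  This serves as the extensionality principle by which maps known only on \<open>L \<eta>\<close>
  are compared.\<close>

lemma eq_if_top_eq:
  fixes L :: "('a, 'v) rmodule"
  assumes L: "right_module A L" and w: "w \<in> carrier L" "w' \<in> carrier L"
    and e: "\<And>b. b \<in> carrier A \<Longrightarrow> w \<cdot>\<^bsub>L\<^esub> (b \<otimes>\<^bsub>A\<^esub> \<eta>) = w' \<cdot>\<^bsub>L\<^esub> (b \<otimes>\<^bsub>A\<^esub> \<eta>)"
  shows "w = w'"
proof -
  interpret L: rmod A L using L by (rule rmod.intro)
  have "w \<ominus>\<^bsub>L\<^esub> w' = \<zero>\<^bsub>L\<^esub>"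
  proof (rule mult_top_zero[OF L])
    fix b assume b: "b \<in> carrier A"
    then have c: "b \<otimes>\<^bsub>A\<^esub> \<eta> \<in> carrier A" using eta(1) by simp
    show "(w \<ominus>\<^bsub>L\<^esub> w') \<cdot>\<^bsub>L\<^esub> (b \<otimes>\<^bsub>A\<^esub> \<eta>) = \<zero>\<^bsub>L\<^esub>"
      using L.minus_ract[OF w c] e[OF b] L.M.minus_eq_zero_iff L.ract_closed[OF w(2) c] by simp
  qed (use w in \<open>simp add: L.M.minus_eq\<close>)
  then show ?thesis using L.M.minus_eq_zero_iff[OF w] by simp
qed

lemma top_component_mem:
  fixes L :: "('a, 'v) rmodule"
  assumes L: "right_module A L" and w: "w \<in> carrier L" and b: "b \<in> carrier A"
  shows "w \<cdot>\<^bsub>L\<^esub> (b \<otimes>\<^bsub>A\<^esub> \<eta>) \<in> component L W Top"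
proof -
  interpret L: rmod A L using L by (rule rmod.intro)
  have "w \<cdot>\<^bsub>L\<^esub> (b \<otimes>\<^bsub>A\<^esub> \<eta>) \<cdot>\<^bsub>L\<^esub> \<eta> = w \<cdot>\<^bsub>L\<^esub> (b \<otimes>\<^bsub>A\<^esub> \<eta>)"
    using w b eta by (simp add: L.ract_assoc[symmetric] P.A.m_assoc)
  then show ?thesis using L.ract_closed[OF w] b eta(1) by simp
qed

text \<open>Row vectors with a single coordinate at \<open>Top\<close> show that h and h' agree on
  \<open>L \<eta>\<close>, and this determines both.\<close>

lemma rep_map_faithful:
  assumes LW: "is_rep L W" and LW': "is_rep L' W'"
    and h: "h \<in> Hom (Rep K A P r T) (L, W) (L', W')" "h' \<in> Hom (Rep K A P r T) (L, W) (L', W')"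
    and e: "\<And>u. u \<in> PiE Q (component L W) \<Longrightarrow> (\<lambda>x\<in>Q. h (u x)) = (\<lambda>x\<in>Q. h' (u x))"
  shows "h = h'"
proof -
  have hh: "h \<in> rmod_hom A L L'" "h' \<in> rmod_hom A L L'" "h \<in> extensional (carrier L)" "h' \<in> extensional (carrier L)"
    using h unfolding Rep_simps by auto
  have top: "h w = h' w" if w: "w \<in> component L W Top" for w
  proof -
    have "(\<lambda>x\<in>Q. h (single L Top w x)) Top = (\<lambda>x\<in>Q. h' (single L Top w x)) Top"
      using e[OF single_mem[OF LW _ w]] by simp
    then show ?thesis by (simp add: single_same)
  qed
  show ?thesis
  proof (rule extensionalityI[OF hh(3,4)])
    fix w assume w: "w \<in> carrier L"
    show "h w = h' w"
    proof (rule eq_if_top_eq[OF is_repD(1)[OF LW'] rmod_homD(1)[OF hh(1) w] rmod_homD(1)[OF hh(2) w]])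
      fix b assume b: "b \<in> carrier A"
      then have c: "b \<otimes>\<^bsub>A\<^esub> \<eta> \<in> carrier A" using eta(1) by simp
      show "h w \<cdot>\<^bsub>L'\<^esub> (b \<otimes>\<^bsub>A\<^esub> \<eta>) = h' w \<cdot>\<^bsub>L'\<^esub> (b \<otimes>\<^bsub>A\<^esub> \<eta>)"
        using rmod_homD(3)[OF hh(1) w c] rmod_homD(3)[OF hh(2) w c] top[OF top_component_mem[OF is_repD(1)[OF LW] w b]] by simp
    qed
  qed
qed

text \<open>A \<open>\<Lambda>\<close>-linear map is determined by its component at the top; \<open>h w\<close> is the element with
  \<open>h w \<cdot> b \<eta> = g\<^sub>m (w \<cdot> b \<eta>)\<close> for all \<open>b\<close>.\<close>

lemma rep_map_full:
  assumes LW: "is_rep L W" and LW': "is_rep L' W'"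
    and g: "g \<in> rmod_hom R.\<Lambda> (rep_module L W) (rep_module L' W')"
  shows "\<exists>h \<in> Hom (Rep K A P r T) (L, W) (L', W'). \<forall>u \<in> PiE Q (component L W). g u = (\<lambda>x\<in>Q. h (u x))"
proof -
  note LM = is_repD(1)[OF LW] and LM' = is_repD(1)[OF LW']
  interpret L: rmod A L using LM by (rule rmod.intro)
  interpret L': rmod A L' using LM' by (rule rmod.intro)
  let ?V = "component L W" and ?V' = "component L' W'"
  \<comment> \<open>The component of g at x. By \<open>gu\<close>, g acts coordinatewise through
    these components, because it commutes with the idempotents of the vertices.\<close>
  define gc where "gc x w = g (single L x w) x" for x w
  have gm: "g u \<in> PiE Q ?V'" if "u \<in> PiE Q ?V" for u using rmod_homD(1)[OF g, of u] that by (simp only: rep_module_simps)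
  have gc_mem: "gc x w \<in> ?V' x" if "x \<in> Q" "w \<in> ?V x" for x w
    unfolding gc_def by (rule PiE_mem[OF gm[OF single_mem[OF LW that]] that(1)])
  have gu: "g u x = gc x (u x)" if u: "u \<in> PiE Q ?V" and x: "x \<in> Q" for u x
  proof -
    have "g (single L x (u x)) = g u \<cdot>\<^bsub>rep_module L' W'\<^esub> R.E x x (R.u x)"
      using rmod_homD(3)[OF g, of u "R.E x x (R.u x)"] u R.E_closed[OF R.r_refl[OF x] R.unit_mem[OF x]]
        rep_module_unit[OF LW u x] by (simp only: rep_module_simps)
    also have "\<dots> = single L' x (g u x)" by (rule rep_module_unit[OF LW' gm[OF u] x])
    finally show ?thesis unfolding gc_def by (simp add: single_same[OF x])
  qed
  have gc_act: "gc y (w \<cdot>\<^bsub>L\<^esub> a) = gc x w \<cdot>\<^bsub>L'\<^esub> a" if xy: "(x, y) \<in> rQ" and a: "a \<in> \<R> x y" and w: "w \<in> ?V x" for x y a w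
  proof -
    have q: "x \<in> Q" "y \<in> Q" using R.r_sub[OF xy] by auto
    note s = single_mem[OF LW q(1) w]
    have "g (single L y (w \<cdot>\<^bsub>L\<^esub> a)) = g (single L x w) \<cdot>\<^bsub>rep_module L' W'\<^esub> R.E x y a"
      using rmod_homD(3)[OF g, of "single L x w" "R.E x y a"] s R.E_closed[OF xy a]
        rep_module_E[OF LW s xy a] by (simp only: rep_module_simps single_same[OF q(1)])
    also have "\<dots> = single L' y (g (single L x w) x \<cdot>\<^bsub>L'\<^esub> a)" by (rule rep_module_E[OF LW' gm[OF s] xy a])
    finally show ?thesis unfolding gc_def by (simp add: single_same[OF q(2)])
  qed
  have gc_add: "gc x (w \<oplus>\<^bsub>L\<^esub> w') = gc x w \<oplus>\<^bsub>L'\<^esub> gc x w'" if x: "x \<in> Q" and w: "w \<in> ?V x" "w' \<in> ?V x" for x w w'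
  proof -
    have "single L x (w \<oplus>\<^bsub>L\<^esub> w') = single L x w \<oplus>\<^bsub>rep_module L W\<^esub> single L x w'"
      unfolding rep_module_simps single_def by (rule restrict_ext) simp
    then have "g (single L x (w \<oplus>\<^bsub>L\<^esub> w')) = g (single L x w) \<oplus>\<^bsub>rep_module L' W'\<^esub> g (single L x w')"
      using rmod_homD(2)[OF g, of "single L x w" "single L x w'"] single_mem[OF LW x] w by (simp only: rep_module_simps)
    then show ?thesis unfolding gc_def using x by (simp add: rep_module_simps)
  qed
  have Tp: "Top \<in> Q" and rTT: "(Top, Top) \<in> rQ" by simp_all
  have gc0: "gc Top \<zero>\<^bsub>L\<^esub> = \<zero>\<^bsub>L'\<^esub>"
  proof -
    have "gc Top \<zero>\<^bsub>L\<^esub> = gc Top (\<zero>\<^bsub>L\<^esub> \<cdot>\<^bsub>L\<^esub> \<zero>\<^bsub>A\<^esub>)" by (simp add: L.zero_ract)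
    also have "\<dots> = gc Top \<zero>\<^bsub>L\<^esub> \<cdot>\<^bsub>L'\<^esub> \<zero>\<^bsub>A\<^esub>" by (rule gc_act[OF rTT R.T_zero[OF rTT] component_props(3)[OF LW Tp]])
    also have "\<dots> = \<zero>\<^bsub>L'\<^esub>" by (rule L'.ract_zero[OF component_props(1)[OF LW' Tp gc_mem[OF Tp component_props(3)[OF LW Tp]]]])
    finally show ?thesis .
  qed
  have gc_sum: "gc Top (\<Oplus>\<^bsub>L\<^esub>k\<in>I. w k) = (\<Oplus>\<^bsub>L'\<^esub>k\<in>I. gc Top (w k))" if "finite I" "\<And>k. k \<in> I \<Longrightarrow> w k \<in> ?V Top" for I :: "nat set" and w
    using that
  proof (induction I)
    case empty
    then show ?case by (simp add: gc0)
  next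
    case (insert k I)
    note wc = component_props(1)[OF LW Tp insert(4)]
    have s: "(\<Oplus>\<^bsub>L\<^esub>k\<in>I. w k) \<in> ?V Top"
      by (rule L.M.finsum_mem[OF insert(1)]) (use insert(4) component_props[OF LW Tp] in \<open>auto simp del: component_simps\<close>)
    have "gc Top (\<Oplus>\<^bsub>L\<^esub>k\<in>insert k I. w k) = gc Top (w k \<oplus>\<^bsub>L\<^esub> (\<Oplus>\<^bsub>L\<^esub>k\<in>I. w k))"
      using insert(1,2) wc by (subst L.M.finsum_insert) auto
    also have "\<dots> = gc Top (w k) \<oplus>\<^bsub>L'\<^esub> gc Top (\<Oplus>\<^bsub>L\<^esub>k\<in>I. w k)" by (rule gc_add[OF Tp insert(4)[OF insertI1] s])
    also have "\<dots> = gc Top (w k) \<oplus>\<^bsub>L'\<^esub> (\<Oplus>\<^bsub>L'\<^esub>k\<in>I. gc Top (w k))" using insert(3)[OF insert(4)] by simp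
    also have "\<dots> = (\<Oplus>\<^bsub>L'\<^esub>k\<in>insert k I. gc Top (w k))"
      using insert(1,2) component_props(1)[OF LW' Tp gc_mem[OF Tp insert(4)]] by (subst L'.M.finsum_insert) auto
    finally show ?case .
  qed
  \<comment> \<open>With 1 the sum of the \<open>c_k \<eta> d_k\<close>, the image of w has to be
    the sum of the \<open>gc Top (w c_k \<eta>) d_k\<close>. The characterisation by products with
    \<open>b \<eta>\<close> does not mention the decomposition.\<close>
  have ex: "\<exists>z \<in> carrier L'. \<forall>b \<in> carrier A. z \<cdot>\<^bsub>L'\<^esub> (b \<otimes>\<^bsub>A\<^esub> \<eta>) = gc Top (w \<cdot>\<^bsub>L\<^esub> (b \<otimes>\<^bsub>A\<^esub> \<eta>))" if w: "w \<in> carrier L" for w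
  proof -
    obtain n :: nat and c d where cd: "\<And>k. k < n \<Longrightarrow> c k \<in> carrier A" "\<And>k. k < n \<Longrightarrow> d k \<in> carrier A"
      and ws: "w = (\<Oplus>\<^bsub>L\<^esub>k\<in>{..<n}. w \<cdot>\<^bsub>L\<^esub> (c k \<otimes>\<^bsub>A\<^esub> \<eta>) \<cdot>\<^bsub>L\<^esub> d k)" using top_generates[OF LM w] by blast
    define v where "v k = w \<cdot>\<^bsub>L\<^esub> (c k \<otimes>\<^bsub>A\<^esub> \<eta>)" for k
    have v: "v k \<in> ?V Top" if "k < n" for k unfolding v_def by (rule top_component_mem[OF LM w cd(1)[OF that]])
    note vc = component_props(1)[OF LW Tp v] and gv = gc_mem[OF Tp v]
    note gvc = component_props(1)[OF LW' Tp gv]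
    let ?z = "\<Oplus>\<^bsub>L'\<^esub>k\<in>{..<n}. gc Top (v k) \<cdot>\<^bsub>L'\<^esub> d k"
    have zc: "?z \<in> carrier L'" using gvc cd(2) L'.ract_closed by (intro L'.M.finsum_closed) auto
    have "?z \<cdot>\<^bsub>L'\<^esub> (b \<otimes>\<^bsub>A\<^esub> \<eta>) = gc Top (w \<cdot>\<^bsub>L\<^esub> (b \<otimes>\<^bsub>A\<^esub> \<eta>))" if b: "b \<in> carrier A" for b
    proof -
      have bc: "b \<otimes>\<^bsub>A\<^esub> \<eta> \<in> carrier A" using b eta(1) by simp
      define s where "s k = \<eta> \<otimes>\<^bsub>A\<^esub> (d k \<otimes>\<^bsub>A\<^esub> b) \<otimes>\<^bsub>A\<^esub> \<eta>" for k
      have s: "s k \<in> \<R> Top Top" if "k < n" for k using R_top_mem[OF Tp, of "d k \<otimes>\<^bsub>A\<^esub> b"] cd(2)[OF that] b unfolding s_def by simp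
      \<comment> \<open>As z is fixed by \<eta>, the factor \<open>d_k b \<eta>\<close> may be
        replaced by \<open>\<eta> d_k b \<eta>\<close>, which lies in the ring at the top, where
        \<open>gc Top\<close> is linear.\<close>
      have act: "z \<cdot>\<^bsub>N\<^esub> d k \<cdot>\<^bsub>N\<^esub> (b \<otimes>\<^bsub>A\<^esub> \<eta>) = z \<cdot>\<^bsub>N\<^esub> s k"
        if N: "right_module A N" and z: "z \<in> component N X Top" and k: "k < n" for N :: "('a, 'b) rmodule" and X z k
      proof -
        interpret N: rmod A N using N by (rule rmod.intro)
        have zc: "z \<in> carrier N" "z \<cdot>\<^bsub>N\<^esub> \<eta> = z" using z by auto
        have "z \<cdot>\<^bsub>N\<^esub> s k = z \<cdot>\<^bsub>N\<^esub> \<eta> \<cdot>\<^bsub>N\<^esub> (d k \<otimes>\<^bsub>A\<^esub> (b \<otimes>\<^bsub>A\<^esub> \<eta>))"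
          unfolding s_def using zc(1) cd(2)[OF k] b eta(1) by (simp add: N.ract_assoc[symmetric] P.A.m_assoc)
        then show ?thesis using zc cd(2)[OF k] bc by (simp add: N.ract_assoc[symmetric])
      qed
      have vs: "v k \<cdot>\<^bsub>L\<^esub> s k \<in> ?V Top" if "k < n" for k by (rule component_act[OF LW rTT v[OF that] s[OF that]])
      have "?z \<cdot>\<^bsub>L'\<^esub> (b \<otimes>\<^bsub>A\<^esub> \<eta>) = (\<Oplus>\<^bsub>L'\<^esub>k\<in>{..<n}. gc Top (v k) \<cdot>\<^bsub>L'\<^esub> d k \<cdot>\<^bsub>L'\<^esub> (b \<otimes>\<^bsub>A\<^esub> \<eta>))"
        using gvc cd(2) L'.ract_closed bc by (intro L'.finsum_ract) auto
      also have "\<dots> = (\<Oplus>\<^bsub>L'\<^esub>k\<in>{..<n}. gc Top (v k \<cdot>\<^bsub>L\<^esub> s k))"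
      proof (rule L'.M.finsum_cong')
        fix k assume "k \<in> {..<n}"
        then have k: "k < n" by simp
        show "gc Top (v k) \<cdot>\<^bsub>L'\<^esub> d k \<cdot>\<^bsub>L'\<^esub> (b \<otimes>\<^bsub>A\<^esub> \<eta>) = gc Top (v k \<cdot>\<^bsub>L\<^esub> s k)"
          using act[OF LM' gv[OF k] k] gc_act[OF rTT s[OF k] v[OF k]] by simp
      qed (use component_props(1)[OF LW' Tp gc_mem[OF Tp vs]] in auto)
      also have "\<dots> = gc Top (\<Oplus>\<^bsub>L\<^esub>k\<in>{..<n}. v k \<cdot>\<^bsub>L\<^esub> s k)" using gc_sum[of "{..<n}" "\<lambda>k. v k \<cdot>\<^bsub>L\<^esub> s k"] vs by simp
      also have "(\<Oplus>\<^bsub>L\<^esub>k\<in>{..<n}. v k \<cdot>\<^bsub>L\<^esub> s k) = (\<Oplus>\<^bsub>L\<^esub>k\<in>{..<n}. v k \<cdot>\<^bsub>L\<^esub> d k \<cdot>\<^bsub>L\<^esub> (b \<otimes>\<^bsub>A\<^esub> \<eta>))"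
        by (rule L.M.finsum_cong') (use act[OF LM v] component_props(1)[OF LW Tp vs] in auto)
      also have "\<dots> = (\<Oplus>\<^bsub>L\<^esub>k\<in>{..<n}. v k \<cdot>\<^bsub>L\<^esub> d k) \<cdot>\<^bsub>L\<^esub> (b \<otimes>\<^bsub>A\<^esub> \<eta>)"
        using vc cd(2) bc L.ract_closed by (intro L.finsum_ract[symmetric]) auto
      also have "(\<Oplus>\<^bsub>L\<^esub>k\<in>{..<n}. v k \<cdot>\<^bsub>L\<^esub> d k) = w" unfolding v_def by (rule ws[symmetric])
      finally show ?thesis .
    qed
    then show ?thesis using zc by blast
  qed
  \<comment> \<open>The element is chosen by its characterising property, so additivity and
    linearity follow by comparing products with \<open>b \<eta>\<close>.\<close>
  define h where "h = (\<lambda>w\<in>carrier L. SOME z. z \<in> carrier L' \<and> (\<forall>b\<in>carrier A. z \<cdot>\<^bsub>L'\<^esub> (b \<otimes>\<^bsub>A\<^esub> \<eta>) = gc Top (w \<cdot>\<^bsub>L\<^esub> (b \<otimes>\<^bsub>A\<^esub> \<eta>))))"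
  have h: "h w \<in> carrier L' \<and> (\<forall>b\<in>carrier A. h w \<cdot>\<^bsub>L'\<^esub> (b \<otimes>\<^bsub>A\<^esub> \<eta>) = gc Top (w \<cdot>\<^bsub>L\<^esub> (b \<otimes>\<^bsub>A\<^esub> \<eta>)))" if w: "w \<in> carrier L" for w
    unfolding h_def restrict_apply'[OF w] by (rule someI_ex) (use ex[OF w] in blast)
  have hc: "h w \<in> carrier L'" if "w \<in> carrier L" for w using h[OF that] by blast
  have hb: "h w \<cdot>\<^bsub>L'\<^esub> (b \<otimes>\<^bsub>A\<^esub> \<eta>) = gc Top (w \<cdot>\<^bsub>L\<^esub> (b \<otimes>\<^bsub>A\<^esub> \<eta>))" if "w \<in> carrier L" "b \<in> carrier A" for w b using h[OF that(1)] that(2) by blast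
  have hom: "h \<in> rmod_hom A L L'"
  proof (rule rmod_homI[OF hc])
    fix x y assume x: "x \<in> carrier L" and y: "y \<in> carrier L"
    have xy: "x \<oplus>\<^bsub>L\<^esub> y \<in> carrier L" using x y by simp
    show "h (x \<oplus>\<^bsub>L\<^esub> y) = h x \<oplus>\<^bsub>L'\<^esub> h y"
    proof (rule eq_if_top_eq[OF LM'])
      fix b assume b: "b \<in> carrier A"
      then have bc: "b \<otimes>\<^bsub>A\<^esub> \<eta> \<in> carrier A" using eta(1) by simp
      show "h (x \<oplus>\<^bsub>L\<^esub> y) \<cdot>\<^bsub>L'\<^esub> (b \<otimes>\<^bsub>A\<^esub> \<eta>) = (h x \<oplus>\<^bsub>L'\<^esub> h y) \<cdot>\<^bsub>L'\<^esub> (b \<otimes>\<^bsub>A\<^esub> \<eta>)"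
        using hb[OF xy b] hb[OF x b] hb[OF y b] L.ract_add_left[OF x y bc] L'.ract_add_left[OF hc[OF x] hc[OF y] bc]
          gc_add[OF Tp top_component_mem[OF LM x b] top_component_mem[OF LM y b]] by simp
    qed (use hc x y xy in auto)
  next
    fix x a assume x: "x \<in> carrier L" and a: "a \<in> carrier A"
    have xa: "x \<cdot>\<^bsub>L\<^esub> a \<in> carrier L" by (rule L.ract_closed[OF x a])
    show "h (x \<cdot>\<^bsub>L\<^esub> a) = h x \<cdot>\<^bsub>L'\<^esub> a"
    proof (rule eq_if_top_eq[OF LM'])
      fix b assume b: "b \<in> carrier A"
      have ab: "a \<otimes>\<^bsub>A\<^esub> b \<in> carrier A" and bc: "b \<otimes>\<^bsub>A\<^esub> \<eta> \<in> carrier A" using a b eta(1) by simp_all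
      have e: "a \<otimes>\<^bsub>A\<^esub> b \<otimes>\<^bsub>A\<^esub> \<eta> = a \<otimes>\<^bsub>A\<^esub> (b \<otimes>\<^bsub>A\<^esub> \<eta>)" by (rule P.A.m_assoc[OF a b eta(1)])
      show "h (x \<cdot>\<^bsub>L\<^esub> a) \<cdot>\<^bsub>L'\<^esub> (b \<otimes>\<^bsub>A\<^esub> \<eta>) = h x \<cdot>\<^bsub>L'\<^esub> a \<cdot>\<^bsub>L'\<^esub> (b \<otimes>\<^bsub>A\<^esub> \<eta>)"
        using hb[OF xa b] hb[OF x ab] L.ract_assoc[OF x a bc] L'.ract_assoc[OF hc[OF x] a bc] unfolding e by simp
    qed (use hc xa x a L'.ract_closed in auto)
  qed
  \<comment> \<open>The map built from the top component restricts to every other component too: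
    both sides have the same products with \<open>b \<eta>\<close>, since g commutes with the
    entries in \<open>\<R> x Top\<close>.\<close>
  have hgc: "h w = gc x w" if x: "x \<in> Q" and w: "w \<in> ?V x" for x w
  proof -
    note wc = component_props(1)[OF LW x w] and gw = gc_mem[OF x w]
    note gwc = component_props(1)[OF LW' x gw] and ec = eps_carrier[OF x]
    have rx: "(x, Top) \<in> rQ" using x by simp
    show ?thesis
    proof (rule eq_if_top_eq[OF LM' hc[OF wc] gwc])
      fix b assume b: "b \<in> carrier A"
      have m: "\<epsilon>0 x \<otimes>\<^bsub>A\<^esub> b \<otimes>\<^bsub>A\<^esub> \<eta> \<in> \<R> x Top" by (rule R_top_mem[OF x b])
      have bc: "b \<otimes>\<^bsub>A\<^esub> \<eta> \<in> carrier A" using b eta(1) by simp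
      have e: "\<epsilon>0 x \<otimes>\<^bsub>A\<^esub> b \<otimes>\<^bsub>A\<^esub> \<eta> = \<epsilon>0 x \<otimes>\<^bsub>A\<^esub> (b \<otimes>\<^bsub>A\<^esub> \<eta>)" by (rule P.A.m_assoc[OF ec b eta(1)])
      have "w \<cdot>\<^bsub>L\<^esub> (b \<otimes>\<^bsub>A\<^esub> \<eta>) = w \<cdot>\<^bsub>L\<^esub> (\<epsilon>0 x \<otimes>\<^bsub>A\<^esub> b \<otimes>\<^bsub>A\<^esub> \<eta>)"
        unfolding e using L.ract_assoc[OF wc ec bc] component_props(2)[OF LW x w] by simp
      moreover have "gc x w \<cdot>\<^bsub>L'\<^esub> (b \<otimes>\<^bsub>A\<^esub> \<eta>) = gc x w \<cdot>\<^bsub>L'\<^esub> (\<epsilon>0 x \<otimes>\<^bsub>A\<^esub> b \<otimes>\<^bsub>A\<^esub> \<eta>)"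
        unfolding e using L'.ract_assoc[OF gwc ec bc] component_props(2)[OF LW' x gw] by simp
      ultimately show "h w \<cdot>\<^bsub>L'\<^esub> (b \<otimes>\<^bsub>A\<^esub> \<eta>) = gc x w \<cdot>\<^bsub>L'\<^esub> (b \<otimes>\<^bsub>A\<^esub> \<eta>)"
        using hb[OF wc b] gc_act[OF rx m w] by simp
    qed
  qed
  have hW: "h w \<in> W' i" if i: "i \<in> P" and w: "w \<in> W i" for i w
  proof -
    note wc = is_repD(3)[OF LW i w] and ri = P.r_refl[OF i]
    have Tc: "T i i \<subseteq> carrier A" using P.T_sub[OF ri] by blast
    have \<epsilon>T: "\<epsilon> (Elt i) \<in> T i i" "\<epsilon> (Elt i) \<otimes>\<^bsub>A\<^esub> \<epsilon> (Elt i) = \<epsilon> (Elt i)" using idem[of "Elt i"] i by simp_all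
    note \<epsilon>c = subsetD[OF Tc \<epsilon>T(1)]
    \<comment> \<open>That h preserves the subspaces is known so far only on the parts
      \<open>W_i \<epsilon>_i\<close>. For a term \<open>c \<epsilon>_i d\<close> of 1 the element
      \<open>w c \<epsilon>_i\<close> lies in such a part, and multiplication by d stays in
      \<open>W' i\<close>.\<close>
    have "h (w \<cdot>\<^bsub>L\<^esub> z) \<in> W' i" if "z \<in> two_sided A (T i i) (\<epsilon> (Elt i))" for z
      using that
    proof induction
      case zero
      then show ?case using L.ract_zero[OF wc] rmod_hom_zero[OF LM LM' hom] is_repD(4)[OF LW' i] by simp
    next
      case (step z c d)
      note cA = subsetD[OF Tc step(2)] and dA = subsetD[OF Tc step(3)]
      have zA: "z \<in> carrier A" by (rule P.A.two_sided_closed[OF Tc \<epsilon>c step(1)])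
      have cT: "c \<otimes>\<^bsub>A\<^esub> \<epsilon> (Elt i) \<in> T i i" by (rule P.T_mult[OF ri ri step(2) \<epsilon>T(1)])
      note ccA = subsetD[OF Tc cT]
      have wV: "w \<cdot>\<^bsub>L\<^esub> (c \<otimes>\<^bsub>A\<^esub> \<epsilon> (Elt i)) \<in> ?V (Elt i)"
        using is_repD(6)[OF LW ri w cT] wc cA \<epsilon>c \<epsilon>T(2) by (simp add: L.ract_assoc[symmetric] P.A.m_assoc)
      have "h (w \<cdot>\<^bsub>L\<^esub> (c \<otimes>\<^bsub>A\<^esub> \<epsilon> (Elt i))) \<in> ?V' (Elt i)" using hgc[OF _ wV] gc_mem[OF _ wV] i by simp
      then have hw: "h (w \<cdot>\<^bsub>L\<^esub> (c \<otimes>\<^bsub>A\<^esub> \<epsilon> (Elt i))) \<in> W' i" by simp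
      have "h (w \<cdot>\<^bsub>L\<^esub> (c \<otimes>\<^bsub>A\<^esub> \<epsilon> (Elt i) \<otimes>\<^bsub>A\<^esub> d \<oplus>\<^bsub>A\<^esub> z)) = h (w \<cdot>\<^bsub>L\<^esub> (c \<otimes>\<^bsub>A\<^esub> \<epsilon> (Elt i))) \<cdot>\<^bsub>L'\<^esub> d \<oplus>\<^bsub>L'\<^esub> h (w \<cdot>\<^bsub>L\<^esub> z)"
        using rmod_homD(2)[OF hom] rmod_homD(3)[OF hom] wc ccA dA zA
        by (simp add: L.ract_add_right L.ract_assoc L.ract_closed)
      then show ?case using is_repD(5)[OF LW' i is_repD(6)[OF LW' ri hw step(3)] step(4)] by simp
    qed
    from this[OF full[OF i]] show ?thesis using L.ract_one[OF wc] by simp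
  qed
  have "h \<in> extensional (carrier L)" by (simp add: h_def)
  then have "h \<in> Hom (Rep K A P r T) (L, W) (L', W')" unfolding Rep_simps using hom hW by blast
  moreover have "g u = (\<lambda>x\<in>Q. h (u x))" if u: "u \<in> PiE Q ?V" for u
  proof (rule extensionalityI[of _ Q])
    show "g u \<in> extensional Q" using gm[OF u] by (simp add: PiE_iff)
    fix x assume x: "x \<in> Q"
    then show "g u x = (\<lambda>x\<in>Q. h (u x)) x" using gu[OF u x] hgc[OF x PiE_mem[OF u x]] by simp
  qed simp
  ultimately show ?thesis by blast
qed

end

section \<open>Every module in \<open>\<U>\<close> comes from a representation\<close>

context extended_module
begin

text \<open>\<open>M\<^sub>m \<otimes> \<epsilon>\<^sub>m A\<close> is realised as the space of maps \<open>A \<rightarrow> M\<^sub>m\<close> that are right linear over \<open>\<epsilon>\<^sub>m A \<epsilon>\<^sub>m\<close>;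
  the action of \<open>a\<close> is precomposition with left multiplication by \<open>a\<close>.\<close>

definition hom_module :: "('a, 'a \<Rightarrow> 'v) rmodule" where
  "hom_module = \<lparr>carrier = {\<phi> \<in> extensional (carrier A). (\<forall>a \<in> carrier A. \<phi> a \<in> M.vert Top) \<and>
       (\<forall>a \<in> carrier A. \<forall>b \<in> carrier A. \<phi> (a \<oplus>\<^bsub>A\<^esub> b) = \<phi> a \<oplus>\<^bsub>M\<^esub> \<phi> b) \<and>
       (\<forall>a \<in> carrier A. \<forall>f \<in> \<R> Top Top. \<phi> (a \<otimes>\<^bsub>A\<^esub> f) = \<phi> a \<cdot>\<^bsub>M\<^esub> R.E Top Top f)},
     monoid.mult = undefined, one = undefined, zero = (\<lambda>a\<in>carrier A. \<zero>\<^bsub>M\<^esub>),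
     add = (\<lambda>\<phi> \<psi>. \<lambda>a\<in>carrier A. \<phi> a \<oplus>\<^bsub>M\<^esub> \<psi> a), ract = (\<lambda>\<phi> b. \<lambda>a\<in>carrier A. \<phi> (b \<otimes>\<^bsub>A\<^esub> a))\<rparr>"

lemma hom_module_simps:
  "\<phi> \<in> carrier hom_module \<longleftrightarrow> \<phi> \<in> extensional (carrier A) \<and> (\<forall>a \<in> carrier A. \<phi> a \<in> M.vert Top) \<and>
       (\<forall>a \<in> carrier A. \<forall>b \<in> carrier A. \<phi> (a \<oplus>\<^bsub>A\<^esub> b) = \<phi> a \<oplus>\<^bsub>M\<^esub> \<phi> b) \<and>
       (\<forall>a \<in> carrier A. \<forall>f \<in> \<R> Top Top. \<phi> (a \<otimes>\<^bsub>A\<^esub> f) = \<phi> a \<cdot>\<^bsub>M\<^esub> R.E Top Top f)"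
  "\<zero>\<^bsub>hom_module\<^esub> = (\<lambda>a\<in>carrier A. \<zero>\<^bsub>M\<^esub>)"
  "\<phi> \<oplus>\<^bsub>hom_module\<^esub> \<psi> = (\<lambda>a\<in>carrier A. \<phi> a \<oplus>\<^bsub>M\<^esub> \<psi> a)"
  "\<phi> \<cdot>\<^bsub>hom_module\<^esub> b = (\<lambda>a\<in>carrier A. \<phi> (b \<otimes>\<^bsub>A\<^esub> a))"
  by (simp_all add: hom_module_def)

lemma hom_moduleD:
  assumes "\<phi> \<in> carrier hom_module"
  shows "\<phi> \<in> extensional (carrier A)" "a \<in> carrier A \<Longrightarrow> \<phi> a \<in> M.vert Top" "a \<in> carrier A \<Longrightarrow> \<phi> a \<in> carrier M"
    "a \<in> carrier A \<Longrightarrow> b \<in> carrier A \<Longrightarrow> \<phi> (a \<oplus>\<^bsub>A\<^esub> b) = \<phi> a \<oplus>\<^bsub>M\<^esub> \<phi> b"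
    "a \<in> carrier A \<Longrightarrow> f \<in> \<R> Top Top \<Longrightarrow> \<phi> (a \<otimes>\<^bsub>A\<^esub> f) = \<phi> a \<cdot>\<^bsub>M\<^esub> R.E Top Top f"
  using assms M.vert_carrier unfolding hom_module_simps by blast+

lemma top_refl: "(Top, Top) \<in> rQ" and top_mem: "Top \<in> Q" and le_top: "x \<in> Q \<Longrightarrow> (x, Top) \<in> rQ"
  by simp_all

lemma eta_R: "\<eta> \<in> \<R> Top Top"
  using R.unit_mem[OF top_mem] R_unit[OF top_mem] by simp

lemma eta_act: "v \<in> M.vert Top \<Longrightarrow> v \<cdot>\<^bsub>M\<^esub> R.E Top Top \<eta> = v"
  using M.vert_unit[of v Top] R_unit[OF top_mem] by simp

lemma right_module_hom_module: "right_module A hom_module"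
proof -
  note v = M.vert_props[OF top_mem] and Ec = R.E_closed[OF top_refl]
  have RA: "f \<in> carrier A" if "f \<in> \<R> Top Top" for f by (rule R.T_sub[OF top_refl that])
  note D = hom_moduleD
  have add: "\<phi> \<oplus>\<^bsub>hom_module\<^esub> \<psi> \<in> carrier hom_module" if \<phi>: "\<phi> \<in> carrier hom_module" and \<psi>: "\<psi> \<in> carrier hom_module" for \<phi> \<psi>
    unfolding hom_module_simps
    using v(2) D(2,4,5)[OF \<phi>] D(2,4,5)[OF \<psi>] D(3)[OF \<phi>] D(3)[OF \<psi>] RA Ec
    by (auto simp: M.M.a_ac M.ract_add_left)
  have act: "\<phi> \<cdot>\<^bsub>hom_module\<^esub> b \<in> carrier hom_module" if \<phi>: "\<phi> \<in> carrier hom_module" and b: "b \<in> carrier A" for \<phi> b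
    unfolding hom_module_simps using D(2,4)[OF \<phi>] D(5)[OF \<phi>] RA b
    by (auto simp: P.A.r_distr P.A.m_assoc[symmetric])
  have zero: "\<zero>\<^bsub>hom_module\<^esub> \<in> carrier hom_module"
    unfolding hom_module_simps using v(1) RA Ec by (auto simp: M.zero_ract)
  show ?thesis
  proof (intro right_module.intro right_module_axioms.intro P.A.ring_axioms)
    show "abelian_group hom_module"
    proof (rule abelian_groupI', goal_cases)
      case (6 \<phi>)
      have "(\<lambda>a\<in>carrier A. \<ominus>\<^bsub>M\<^esub> \<phi> a) \<in> carrier hom_module"
        unfolding hom_module_simps using v(3) D(2,4,5)[OF 6] D(3)[OF 6] RA Ec
        by (auto simp: M.M.minus_add M.uminus_ract M.M.a_comm)
      moreover have "(\<lambda>a\<in>carrier A. \<ominus>\<^bsub>M\<^esub> \<phi> a) \<oplus>\<^bsub>hom_module\<^esub> \<phi> = \<zero>\<^bsub>hom_module\<^esub>"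
        unfolding hom_module_simps by (rule restrict_ext) (use D(3)[OF 6] in \<open>simp add: M.M.l_neg\<close>)
      ultimately show ?case by blast
    next
      case (5 \<phi>)
      show ?case unfolding hom_module_simps
        by (rule extensionalityI[OF _ D(1)[OF 5]]) (use D(3)[OF 5] in auto)
    next
      case (3 \<phi> \<psi> \<chi>)
      show ?case unfolding hom_module_simps
        by (rule restrict_ext) (use D(3)[OF 3(1)] D(3)[OF 3(2)] D(3)[OF 3(3)] in \<open>simp add: M.M.a_assoc\<close>)
    next
      case (4 \<phi> \<psi>)
      show ?case unfolding hom_module_simps
        by (rule restrict_ext) (use D(3)[OF 4(1)] D(3)[OF 4(2)] in \<open>simp add: M.M.a_comm\<close>)
    qed (use add zero in auto)
  next
    fix \<phi> assume \<phi>: "\<phi> \<in> carrier hom_module"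
    show "\<phi> \<cdot>\<^bsub>hom_module\<^esub> \<one>\<^bsub>A\<^esub> = \<phi>" unfolding hom_module_simps
      by (rule extensionalityI[OF _ D(1)[OF \<phi>]]) auto
    fix a b assume ab: "a \<in> carrier A" "b \<in> carrier A"
    show "\<phi> \<cdot>\<^bsub>hom_module\<^esub> (a \<oplus>\<^bsub>A\<^esub> b) = \<phi> \<cdot>\<^bsub>hom_module\<^esub> a \<oplus>\<^bsub>hom_module\<^esub> \<phi> \<cdot>\<^bsub>hom_module\<^esub> b"
      unfolding hom_module_simps by (rule restrict_ext) (use D(4)[OF \<phi>] ab in \<open>simp add: P.A.l_distr\<close>)
    show "\<phi> \<cdot>\<^bsub>hom_module\<^esub> (a \<otimes>\<^bsub>A\<^esub> b) = \<phi> \<cdot>\<^bsub>hom_module\<^esub> a \<cdot>\<^bsub>hom_module\<^esub> b"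
      unfolding hom_module_simps by (rule restrict_ext) (use ab in \<open>simp add: P.A.m_assoc\<close>)
  next
    fix \<phi> \<psi> a assume "\<phi> \<in> carrier hom_module" "\<psi> \<in> carrier hom_module" "a \<in> carrier A"
    then show "(\<phi> \<oplus>\<^bsub>hom_module\<^esub> \<psi>) \<cdot>\<^bsub>hom_module\<^esub> a = \<phi> \<cdot>\<^bsub>hom_module\<^esub> a \<oplus>\<^bsub>hom_module\<^esub> \<psi> \<cdot>\<^bsub>hom_module\<^esub> a"
      unfolding hom_module_simps by (intro restrict_ext) simp
  qed (use act in auto)
qed

text \<open>The function space on A may be larger than \<open>'v\<close>, but these functions are
  determined by their values at the \<open>c_k\<close>: \<open>a \<eta>\<close> is a sum of products
  \<open>c_k s_k\<close> with \<open>s_k\<close> in the ring at the top, over which the functions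
  are linear, and \<open>\<phi> a = \<phi> (a \<eta>)\<close>.\<close>

lemma hom_module_injection:
  assumes inf: "infinite (UNIV :: 'v set)"
  shows "\<exists>c :: ('a \<Rightarrow> 'v) \<Rightarrow> 'v. inj_on c (carrier hom_module)"
proof -
  obtain n c d where cd: "\<And>k. k < n \<Longrightarrow> c k \<in> carrier A" "\<And>k. k < n \<Longrightarrow> d k \<in> carrier A"
    and one_sum: "\<one>\<^bsub>A\<^esub> = (\<Oplus>\<^bsub>A\<^esub>k\<in>{..<n::nat}. c k \<otimes>\<^bsub>A\<^esub> \<eta> \<otimes>\<^bsub>A\<^esub> d k)" using top_decomposition by blast
  obtain \<iota> :: "(nat \<Rightarrow> 'v) \<Rightarrow> 'v" where \<iota>: "inj_on \<iota> (extensional {..<n})" using PiE_injection[OF inf, of "{..<n}"] by blast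
  interpret H: rmod A hom_module using right_module_hom_module by (rule rmod.intro)
  have "inj_on (\<lambda>\<phi>. \<iota> (\<lambda>k\<in>{..<n}. \<phi> (c k))) (carrier hom_module)"
  proof (rule inj_onI)
    fix \<phi> \<psi> assume p: "\<phi> \<in> carrier hom_module" "\<psi> \<in> carrier hom_module"
      and "\<iota> (\<lambda>k\<in>{..<n}. \<phi> (c k)) = \<iota> (\<lambda>k\<in>{..<n}. \<psi> (c k))"
    then have e: "(\<lambda>k\<in>{..<n}. \<phi> (c k)) = (\<lambda>k\<in>{..<n}. \<psi> (c k))" by (intro inj_onD[OF \<iota>]) auto
    have ck: "\<phi> (c k) = \<psi> (c k)" if "k < n" for k using fun_cong[OF e, of k] that by simp
    show "\<phi> = \<psi>"
    proof (rule extensionalityI[OF hom_moduleD(1)[OF p(1)] hom_moduleD(1)[OF p(2)]])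
      fix a assume a: "a \<in> carrier A"
      define s where "s k = \<eta> \<otimes>\<^bsub>A\<^esub> (d k \<otimes>\<^bsub>A\<^esub> a) \<otimes>\<^bsub>A\<^esub> \<eta>" for k
      have s: "s k \<in> \<R> Top Top" if "k < n" for k using R_top_mem[OF top_mem, of "d k \<otimes>\<^bsub>A\<^esub> a"] cd(2)[OF that] a unfolding s_def by simp
      have sc: "s k \<in> carrier A" if "k < n" for k by (rule R.T_sub[OF top_refl s[OF that]])
      have "a \<otimes>\<^bsub>A\<^esub> \<eta> = (\<Oplus>\<^bsub>A\<^esub>k\<in>{..<n}. c k \<otimes>\<^bsub>A\<^esub> \<eta> \<otimes>\<^bsub>A\<^esub> d k) \<otimes>\<^bsub>A\<^esub> (a \<otimes>\<^bsub>A\<^esub> \<eta>)"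
        unfolding one_sum[symmetric] using a eta(1) by simp
      also have "\<dots> = (\<Oplus>\<^bsub>A\<^esub>k\<in>{..<n}. c k \<otimes>\<^bsub>A\<^esub> \<eta> \<otimes>\<^bsub>A\<^esub> d k \<otimes>\<^bsub>A\<^esub> (a \<otimes>\<^bsub>A\<^esub> \<eta>))"
        using cd eta(1) a by (simp add: P.A.finsum_ldistr Pi_iff)
      also have "\<dots> = (\<Oplus>\<^bsub>A\<^esub>k\<in>{..<n}. c k \<otimes>\<^bsub>A\<^esub> s k)"
        by (rule P.A.finsum_cong') (use cd a eta(1) sc in \<open>auto simp: s_def P.A.m_assoc\<close>)
      finally have as: "a \<otimes>\<^bsub>A\<^esub> \<eta> = (\<Oplus>\<^bsub>A\<^esub>k\<in>{..<n}. c k \<otimes>\<^bsub>A\<^esub> s k)" .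
      have \<chi>: "\<chi> a = (\<Oplus>\<^bsub>M\<^esub>k\<in>{..<n}. \<chi> (c k) \<cdot>\<^bsub>M\<^esub> R.E Top Top (s k))" if \<chi>: "\<chi> \<in> carrier hom_module" for \<chi>
      proof -
        note D = hom_moduleD[OF \<chi>]
        have z: "\<chi> \<zero>\<^bsub>A\<^esub> = \<zero>\<^bsub>M\<^esub>"
          using D(5)[OF P.A.one_closed R.T_zero[OF top_refl]] M.act_E_zero[OF D(3)[OF P.A.one_closed]] by simp
        have sum: "\<chi> (\<Oplus>\<^bsub>A\<^esub>k\<in>I. w k) = (\<Oplus>\<^bsub>M\<^esub>k\<in>I. \<chi> (w k))" if "finite I" "w \<in> I \<rightarrow> carrier A" for I :: "nat set" and w
          using that by induction (auto simp: z D(3,4) P.A.finsum_insert M.M.finsum_insert Pi_iff P.A.finsum_closed)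
        have "\<chi> a = \<chi> (a \<otimes>\<^bsub>A\<^esub> \<eta>)" using D(5)[OF a eta_R] eta_act[OF D(2)[OF a]] by simp
        also have "\<dots> = (\<Oplus>\<^bsub>M\<^esub>k\<in>{..<n}. \<chi> (c k \<otimes>\<^bsub>A\<^esub> s k))" unfolding as using cd sc by (intro sum) auto
        also have "\<dots> = (\<Oplus>\<^bsub>M\<^esub>k\<in>{..<n}. \<chi> (c k) \<cdot>\<^bsub>M\<^esub> R.E Top Top (s k))"
          by (rule M.M.finsum_cong') (use D(3,5) cd(1) s M.ract_closed R.E_closed[OF top_refl] in auto)
        finally show ?thesis .
      qed
      show "\<phi> a = \<psi> a" unfolding \<chi>[OF p(1)] \<chi>[OF p(2)]
        by (rule M.M.finsum_cong') (use ck hom_moduleD(3)[OF p(2) cd(1)] s M.ract_closed R.E_closed[OF top_refl] in auto)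
    qed
  qed
  then show ?thesis by blast
qed

text \<open>The embedding of the part of M at x into the space of functions: v is recorded by all
  its products into the top part.\<close>

definition theta :: "'p extended \<Rightarrow> 'v \<Rightarrow> 'a \<Rightarrow> 'v" where
  "theta x v = (\<lambda>a\<in>carrier A. v \<cdot>\<^bsub>M\<^esub> R.E x Top (\<epsilon>0 x \<otimes>\<^bsub>A\<^esub> a \<otimes>\<^bsub>A\<^esub> \<eta>))"

lemma theta_mem:
  assumes x: "x \<in> Q" and v: "v \<in> carrier M"
  shows "theta x v \<in> carrier hom_module"
proof -
  note e = eps_carrier[OF x] and m = R_top_mem[OF x]
  have d: "\<epsilon>0 x \<otimes>\<^bsub>A\<^esub> (a \<oplus>\<^bsub>A\<^esub> b) \<otimes>\<^bsub>A\<^esub> \<eta> = \<epsilon>0 x \<otimes>\<^bsub>A\<^esub> a \<otimes>\<^bsub>A\<^esub> \<eta> \<oplus>\<^bsub>A\<^esub> \<epsilon>0 x \<otimes>\<^bsub>A\<^esub> b \<otimes>\<^bsub>A\<^esub> \<eta>"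
    if "a \<in> carrier A" "b \<in> carrier A" for a b
    using that e eta(1) by (simp add: P.A.r_distr P.A.l_distr del: fun_upd_apply)
  have f: "\<epsilon>0 x \<otimes>\<^bsub>A\<^esub> (a \<otimes>\<^bsub>A\<^esub> f) \<otimes>\<^bsub>A\<^esub> \<eta> = \<epsilon>0 x \<otimes>\<^bsub>A\<^esub> a \<otimes>\<^bsub>A\<^esub> \<eta> \<otimes>\<^bsub>A\<^esub> f"
    if a: "a \<in> carrier A" and f: "f \<in> \<R> Top Top" for a f
  proof -
    have fc: "f \<in> carrier A" and fe: "\<eta> \<otimes>\<^bsub>A\<^esub> f = f" "f \<otimes>\<^bsub>A\<^esub> \<eta> = f"
      using R.T_sub[OF top_refl f] R_left[OF top_refl f] R_right[OF top_refl f] by simp_all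
    show ?thesis using a e fc eta(1) fe by (simp add: P.A.m_assoc del: fun_upd_apply)
  qed
  show ?thesis unfolding hom_module_simps theta_def
    using M.act_E_vert[OF v le_top[OF x] m] M.act_E_add[OF v le_top[OF x] m m] M.act_E_E[OF v le_top[OF x] top_refl m] R.T_sub[OF top_refl] d f
    by (auto simp del: fun_upd_apply)
qed

text \<open>Through \<open>theta\<close>, an entry of the algebra acts as the corresponding element
  of A does. So the copies of the vertex parts inside \<open>hom_module\<close> form a family stable
  under \<open>\<R>\<close>.\<close>

lemma theta_act:
  assumes xy: "(x, y) \<in> rQ" and v: "v \<in> carrier M" and a: "a \<in> \<R> x y"
  shows "theta x v \<cdot>\<^bsub>hom_module\<^esub> a = theta y (v \<cdot>\<^bsub>M\<^esub> R.E x y a)"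
proof -
  have q: "x \<in> Q" "y \<in> Q" using R.r_sub[OF xy] by auto
  note ac = R.T_sub[OF xy a] and ex = eps_carrier[OF q(1)] and ey = eps_carrier[OF q(2)]
  show ?thesis unfolding hom_module_simps theta_def
  proof (rule restrict_ext)
    fix b assume b: "b \<in> carrier A"
    have "a \<otimes>\<^bsub>A\<^esub> (\<epsilon>0 y \<otimes>\<^bsub>A\<^esub> b \<otimes>\<^bsub>A\<^esub> \<eta>) = a \<otimes>\<^bsub>A\<^esub> \<epsilon>0 y \<otimes>\<^bsub>A\<^esub> (b \<otimes>\<^bsub>A\<^esub> \<eta>)"
      using ac ey b eta(1) by (simp add: P.A.m_assoc del: fun_upd_apply)
    also have "\<dots> = \<epsilon>0 x \<otimes>\<^bsub>A\<^esub> a \<otimes>\<^bsub>A\<^esub> (b \<otimes>\<^bsub>A\<^esub> \<eta>)" using R_right[OF xy a] R_left[OF xy a] by simp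
    also have "\<dots> = \<epsilon>0 x \<otimes>\<^bsub>A\<^esub> (a \<otimes>\<^bsub>A\<^esub> b) \<otimes>\<^bsub>A\<^esub> \<eta>"
      using ac ex b eta(1) by (simp add: P.A.m_assoc del: fun_upd_apply)
    finally have e: "a \<otimes>\<^bsub>A\<^esub> (\<epsilon>0 y \<otimes>\<^bsub>A\<^esub> b \<otimes>\<^bsub>A\<^esub> \<eta>) = \<epsilon>0 x \<otimes>\<^bsub>A\<^esub> (a \<otimes>\<^bsub>A\<^esub> b) \<otimes>\<^bsub>A\<^esub> \<eta>" .
    have "v \<cdot>\<^bsub>M\<^esub> R.E x y a \<cdot>\<^bsub>M\<^esub> R.E y Top (\<epsilon>0 y \<otimes>\<^bsub>A\<^esub> b \<otimes>\<^bsub>A\<^esub> \<eta>) = v \<cdot>\<^bsub>M\<^esub> R.E x Top (\<epsilon>0 x \<otimes>\<^bsub>A\<^esub> (a \<otimes>\<^bsub>A\<^esub> b) \<otimes>\<^bsub>A\<^esub> \<eta>)"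
      unfolding e[symmetric] by (rule M.act_E_E[OF v xy le_top[OF q(2)] a R_top_mem[OF q(2) b]])
    then show "(\<lambda>a\<in>carrier A. v \<cdot>\<^bsub>M\<^esub> R.E x Top (\<epsilon>0 x \<otimes>\<^bsub>A\<^esub> a \<otimes>\<^bsub>A\<^esub> \<eta>)) (a \<otimes>\<^bsub>A\<^esub> b)
      = v \<cdot>\<^bsub>M\<^esub> R.E x y a \<cdot>\<^bsub>M\<^esub> R.E y Top (\<epsilon>0 y \<otimes>\<^bsub>A\<^esub> b \<otimes>\<^bsub>A\<^esub> \<eta>)" using ac b by simp
  qed
qed

lemma theta_add:
  assumes "x \<in> Q" "v \<in> carrier M" "w \<in> carrier M"
  shows "theta x (v \<oplus>\<^bsub>M\<^esub> w) = theta x v \<oplus>\<^bsub>hom_module\<^esub> theta x w"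
  unfolding hom_module_simps theta_def
  by (rule restrict_ext) (use M.ract_add_left[OF assms(2,3) R.E_closed[OF le_top[OF assms(1)] R_top_mem[OF assms(1)]]] in simp)

lemma theta_zero: "x \<in> Q \<Longrightarrow> theta x \<zero>\<^bsub>M\<^esub> = \<zero>\<^bsub>hom_module\<^esub>"
  unfolding hom_module_simps theta_def
  by (rule restrict_ext) (rule M.zero_ract[OF R.E_closed[OF le_top R_top_mem]])

lemma theta_inj:
  assumes t: "M.top_faithful" and x: "x \<in> Q" and v: "v \<in> M.vert x" and z: "theta x v = \<zero>\<^bsub>hom_module\<^esub>"
  shows "v = \<zero>\<^bsub>M\<^esub>"
proof (rule M.top_faithfulD[OF t x v])
  fix a assume a: "a \<in> \<R> x Top"
  note ac = R.T_sub[OF le_top[OF x] a]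
  have "\<epsilon>0 x \<otimes>\<^bsub>A\<^esub> a \<otimes>\<^bsub>A\<^esub> \<eta> = a" using R_left[OF le_top[OF x] a] R_right[OF le_top[OF x] a] by simp
  then show "v \<cdot>\<^bsub>M\<^esub> R.E x Top a = \<zero>\<^bsub>M\<^esub>" using fun_cong[OF z, of a] ac unfolding theta_def hom_module_simps by simp
qed

text \<open>Values of \<phi> are fixed by \<eta>, so
  \<open>\<phi> (\<eta> a) = \<phi> (\<eta> a \<eta>)\<close>, which is \<phi> at \<eta> times
  \<open>\<eta> a \<eta>\<close>. Hence \<open>\<phi> \<eta>\<close> is given by the single vector
  v, and the top part of M becomes all of \<open>L \<eta>\<close>.\<close>

lemma theta_top_surj:
  assumes \<phi>: "\<phi> \<in> carrier hom_module"
  shows "\<exists>v \<in> M.vert Top. \<phi> \<cdot>\<^bsub>hom_module\<^esub> \<eta> = theta Top v"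
proof
  note D = hom_moduleD[OF \<phi>]
  show "\<phi> \<eta> \<in> M.vert Top" by (rule D(2)[OF eta(1)])
  show "\<phi> \<cdot>\<^bsub>hom_module\<^esub> \<eta> = theta Top (\<phi> \<eta>)"
    unfolding hom_module_simps theta_def
  proof (rule restrict_ext)
    fix a assume a: "a \<in> carrier A"
    have m: "\<eta> \<otimes>\<^bsub>A\<^esub> a \<otimes>\<^bsub>A\<^esub> \<eta> \<in> \<R> Top Top" using R_top_mem[OF top_mem a] by simp
    have ea: "\<eta> \<otimes>\<^bsub>A\<^esub> a \<in> carrier A" using a eta(1) by simp
    have "\<phi> (\<eta> \<otimes>\<^bsub>A\<^esub> a) = \<phi> (\<eta> \<otimes>\<^bsub>A\<^esub> a \<otimes>\<^bsub>A\<^esub> \<eta>)" using D(5)[OF ea eta_R] eta_act[OF D(2)[OF ea]] by simp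
    also have "\<eta> \<otimes>\<^bsub>A\<^esub> a \<otimes>\<^bsub>A\<^esub> \<eta> = \<eta> \<otimes>\<^bsub>A\<^esub> (\<eta> \<otimes>\<^bsub>A\<^esub> a \<otimes>\<^bsub>A\<^esub> \<eta>)"
      using a eta by (simp add: P.A.m_assoc[symmetric])
    also have "\<phi> \<dots> = \<phi> \<eta> \<cdot>\<^bsub>M\<^esub> R.E Top Top (\<eta> \<otimes>\<^bsub>A\<^esub> a \<otimes>\<^bsub>A\<^esub> \<eta>)" by (rule D(5)[OF eta(1) m])
    finally show "\<phi> (\<eta> \<otimes>\<^bsub>A\<^esub> a) = \<phi> \<eta> \<cdot>\<^bsub>M\<^esub> R.E Top Top (\<epsilon>0 Top \<otimes>\<^bsub>A\<^esub> a \<otimes>\<^bsub>A\<^esub> \<eta>)" by simp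
  qed
qed

text \<open>L is a copy of \<open>hom_module\<close> in \<open>'v\<close>. The point is to find
  subspaces \<open>W i\<close> whose parts \<open>W_i \<epsilon>_i\<close> are the given copies of
  the vertex parts of M.\<close>

lemma representation_exists:
  assumes t: "M.top_faithful" and b: "M.vert Bot \<subseteq> {\<zero>\<^bsub>M\<^esub>}" and inf: "infinite (UNIV :: 'v set)"
  shows "\<exists>(L :: ('a, 'v) rmodule) W. is_rep L W \<and> rmod_isomorphic R.\<Lambda> M (rep_module L W)"
proof -
  obtain c :: "('a \<Rightarrow> 'v) \<Rightarrow> 'v" where c: "inj_on c (carrier hom_module)" using hom_module_injection[OF inf] by blast
  interpret H: rmod A hom_module using right_module_hom_module by (rule rmod.intro)
  define L where "L = image_rmod c hom_module"
  note tr = H.transport[OF c, folded L_def]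
  interpret L: rmod A L using tr(1) by (rule rmod.intro)
  define \<theta> where "\<theta> x v = c (theta x v)" for x v
  have \<theta>c: "\<theta> x v \<in> carrier L" if "x \<in> Q" "v \<in> carrier M" for x v
    unfolding \<theta>_def by (rule rmod_homD(1)[OF tr(2) theta_mem[OF that]])
  have \<theta>act: "\<theta> x v \<cdot>\<^bsub>L\<^esub> a = \<theta> y (v \<cdot>\<^bsub>M\<^esub> R.E x y a)" if xy: "(x, y) \<in> rQ" and v: "v \<in> carrier M" and a: "a \<in> \<R> x y" for x y v a
    unfolding \<theta>_def theta_act[OF that, symmetric]
    by (rule rmod_homD(3)[OF tr(2) theta_mem[OF _ v] R.T_sub[OF xy a], symmetric]) (use R.r_sub[OF xy] in blast)
  have \<theta>add: "\<theta> x (v \<oplus>\<^bsub>M\<^esub> w) = \<theta> x v \<oplus>\<^bsub>L\<^esub> \<theta> x w" if "x \<in> Q" "v \<in> carrier M" "w \<in> carrier M" for x v w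
    unfolding \<theta>_def theta_add[OF that] by (rule rmod_homD(2)[OF tr(2) theta_mem[OF that(1,2)] theta_mem[OF that(1,3)]])
  have c0: "c \<zero>\<^bsub>hom_module\<^esub> = \<zero>\<^bsub>L\<^esub>" by (simp add: L_def)
  have \<theta>0: "\<theta> x \<zero>\<^bsub>M\<^esub> = \<zero>\<^bsub>L\<^esub>" if "x \<in> Q" for x unfolding \<theta>_def theta_zero[OF that] by (rule c0)
  have \<theta>inj: "v = \<zero>\<^bsub>M\<^esub>" if x: "x \<in> Q" and v: "v \<in> M.vert x" and z: "\<theta> x v = \<zero>\<^bsub>L\<^esub>" for x v
  proof (rule theta_inj[OF t x v])
    have "c (theta x v) = c \<zero>\<^bsub>hom_module\<^esub>" using z unfolding \<theta>_def c0 .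
    then show "theta x v = \<zero>\<^bsub>hom_module\<^esub>" by (rule inj_onD[OF c _ theta_mem[OF x M.vert_carrier[OF v]] H.M.zero_closed])
  qed
  have \<theta>unit: "\<theta> x v \<cdot>\<^bsub>L\<^esub> \<epsilon>0 x = \<theta> x v" if x: "x \<in> Q" and v: "v \<in> M.vert x" for x v
    using \<theta>act[OF R.r_refl[OF x] M.vert_carrier[OF v] R.unit_mem[OF x]] M.vert_unit[OF v] R_unit[OF x] by simp
  let ?V = "\<lambda>x. \<theta> x ` M.vert x"
  have Vc: "w \<in> carrier L" if "x \<in> Q" "w \<in> ?V x" for x w using \<theta>c that M.vert_carrier by blast
  have V0: "\<zero>\<^bsub>L\<^esub> \<in> ?V x" if "x \<in> Q" for x using \<theta>0[OF that] M.vert_props(1)[OF that] by (metis imageI)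
  have Vadd: "w \<oplus>\<^bsub>L\<^esub> w' \<in> ?V x" if x: "x \<in> Q" and w: "w \<in> ?V x" "w' \<in> ?V x" for x w w'
  proof -
    obtain v v' where v: "v \<in> M.vert x" "w = \<theta> x v" "v' \<in> M.vert x" "w' = \<theta> x v'" using w by blast
    then show ?thesis using \<theta>add[OF x M.vert_carrier[OF v(1)] M.vert_carrier[OF v(3)]] M.vert_props(2)[OF x v(1,3)] by (metis imageI)
  qed
  have Vact: "w \<cdot>\<^bsub>L\<^esub> a \<in> ?V y" if xy: "(x, y) \<in> rQ" and w: "w \<in> ?V x" and a: "a \<in> \<R> x y" for x y w a
  proof -
    obtain v where v: "v \<in> M.vert x" "w = \<theta> x v" using w by blast
    show ?thesis unfolding v(2) \<theta>act[OF xy M.vert_carrier[OF v(1)] a] using M.act_E_vert[OF M.vert_carrier[OF v(1)] xy a] by blast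
  qed
  \<comment> \<open>The largest \<open>T i i\<close>-stable subspace whose product with
    \<open>\<epsilon>_i\<close> lies in the copy of the vertex part at i. Taking the largest one
    makes the conditions on a single vertex immediate and leaves only the passage from i to
    j.\<close>
  define W where "W = (\<lambda>i\<in>P. {x \<in> carrier L. \<forall>t \<in> T i i. x \<cdot>\<^bsub>L\<^esub> t \<cdot>\<^bsub>L\<^esub> \<epsilon> (Elt i) \<in> ?V (Elt i)})"
  have W: "x \<in> W i \<longleftrightarrow> x \<in> carrier L \<and> (\<forall>t \<in> T i i. x \<cdot>\<^bsub>L\<^esub> t \<cdot>\<^bsub>L\<^esub> \<epsilon> (Elt i) \<in> ?V (Elt i))" if "i \<in> P" for i x
    using that by (simp add: W_def)
  have EQ: "Elt i \<in> Q" if "i \<in> P" for i using that by simp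
  have \<epsilon>T: "\<epsilon> (Elt i) \<in> T i i" "\<epsilon> (Elt i) \<otimes>\<^bsub>A\<^esub> \<epsilon> (Elt i) = \<epsilon> (Elt i)" if "i \<in> P" for i using idem[of "Elt i"] that by simp_all
  have Tc: "a \<in> carrier A" if "(i, j) \<in> r" "a \<in> T i j" for i j a by (rule P.T_sub[OF that])
  have \<epsilon>c: "\<epsilon> (Elt i) \<in> carrier A" if "i \<in> P" for i using Tc[OF P.r_refl[OF that] \<epsilon>T(1)[OF that]] .
  have sub: "rsubspace K A L (W i)" if i: "i \<in> P" for i
    unfolding rsubspace_def
  proof
    note ri = P.r_refl[OF i] and ec = \<epsilon>c[OF i] and e = EQ[OF i]
    show "subgroup (W i) (add_monoid L)"
    proof (rule L.M.add.subgroupI)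
      show "W i \<subseteq> carrier L" using W[OF i] by blast
      have "\<zero>\<^bsub>L\<^esub> \<in> W i" using W[OF i] V0[OF e] L.zero_ract Tc[OF ri] ec by simp
      then show "W i \<noteq> {}" by blast
      fix x assume x: "x \<in> W i"
      then have xc: "x \<in> carrier L" using W[OF i] by blast
      show "\<ominus>\<^bsub>L\<^esub> x \<in> W i" unfolding W[OF i]
      proof (intro conjI ballI)
        show "\<ominus>\<^bsub>L\<^esub> x \<in> carrier L" using xc by simp
        fix s assume s: "s \<in> T i i"
        have "x \<cdot>\<^bsub>L\<^esub> (\<ominus>\<^bsub>A\<^esub> s) \<cdot>\<^bsub>L\<^esub> \<epsilon> (Elt i) \<in> ?V (Elt i)" using x P.T_uminus[OF ri s] W[OF i] by blast
        then show "(\<ominus>\<^bsub>L\<^esub> x) \<cdot>\<^bsub>L\<^esub> s \<cdot>\<^bsub>L\<^esub> \<epsilon> (Elt i) \<in> ?V (Elt i)"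
          using xc Tc[OF ri s] by (simp add: L.ract_uminus L.uminus_ract)
      qed
      fix y assume y: "y \<in> W i"
      then have yc: "y \<in> carrier L" using W[OF i] by blast
      show "x \<oplus>\<^bsub>L\<^esub> y \<in> W i"
        using x y xc yc ec Tc[OF ri] Vadd[OF e] by (simp add: W[OF i] L.ract_add_left L.ract_closed)
    qed
    show "\<forall>x\<in>W i. \<forall>k\<in>carrier K. x \<cdot>\<^bsub>L\<^esub> (k \<odot>\<^bsub>A\<^esub> \<one>\<^bsub>A\<^esub>) \<in> W i"
    proof (intro ballI)
      fix x k assume x: "x \<in> W i" and k: "k \<in> carrier K"
      have xc: "x \<in> carrier L" using x W[OF i] by blast
      have k1: "k \<odot>\<^bsub>A\<^esub> \<one>\<^bsub>A\<^esub> \<in> T i i" by (rule P.T_smult[OF ri k one[OF i]])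
      have "x \<cdot>\<^bsub>L\<^esub> (k \<odot>\<^bsub>A\<^esub> \<one>\<^bsub>A\<^esub>) \<cdot>\<^bsub>L\<^esub> s \<cdot>\<^bsub>L\<^esub> \<epsilon> (Elt i) \<in> ?V (Elt i)" if s: "s \<in> T i i" for s
        using x P.T_mult[OF ri ri k1 s] W[OF i] L.ract_assoc[OF xc Tc[OF ri k1] Tc[OF ri s]] by force
      then show "x \<cdot>\<^bsub>L\<^esub> (k \<odot>\<^bsub>A\<^esub> \<one>\<^bsub>A\<^esub>) \<in> W i" using W[OF i] L.ract_closed[OF xc Tc[OF ri k1]] by blast
    qed
  qed
  have actW: "x \<cdot>\<^bsub>L\<^esub> s \<in> W j" if ij: "(i, j) \<in> r" and x: "x \<in> W i" and s: "s \<in> T i j" for i j x s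
  proof -
    have i: "i \<in> P" and j: "j \<in> P" using P.r_sub[OF ij] by auto
    note ri = P.r_refl[OF i] and rj = P.r_refl[OF j]
    have rQ: "(Elt i, Elt j) \<in> rQ" using ij by simp
    have xc: "x \<in> carrier L" using x W[OF i] by blast
    have Ti: "T i i \<subseteq> carrier A" using Tc[OF ri] by blast
    \<comment> \<open>Here \<open>T_i \<epsilon>_i T_i = T_i\<close> is used: for a term
      \<open>p \<epsilon>_i q\<close> of 1, \<open>x p \<epsilon>_i\<close> lies in the copy at i,
      and \<open>\<epsilon>_i q b \<epsilon>_j\<close> is an entry of \<open>\<R>\<close> that
      carries it to the copy at j.\<close>
    have key: "x \<cdot>\<^bsub>L\<^esub> z \<cdot>\<^bsub>L\<^esub> (b \<otimes>\<^bsub>A\<^esub> \<epsilon> (Elt j)) \<in> ?V (Elt j)" if z: "z \<in> two_sided A (T i i) (\<epsilon> (Elt i))" and b: "b \<in> T i j" for z b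
      using z
    proof induction
      case zero
      then show ?case using L.ract_zero[OF xc] L.zero_ract Tc[OF ij b] \<epsilon>c[OF j] V0[OF EQ[OF j]] by simp
    next
      case (step z p q)
      have zA: "z \<in> carrier A" by (rule P.A.two_sided_closed[OF Ti \<epsilon>c[OF i] step(1)])
      note A = Tc[OF ri step(2)] Tc[OF ri step(3)] Tc[OF ij b] \<epsilon>c[OF i] \<epsilon>c[OF j]
      have w: "x \<cdot>\<^bsub>L\<^esub> p \<cdot>\<^bsub>L\<^esub> \<epsilon> (Elt i) \<in> ?V (Elt i)" using x W[OF i] step(2) by blast
      have wc: "x \<cdot>\<^bsub>L\<^esub> p \<cdot>\<^bsub>L\<^esub> \<epsilon> (Elt i) \<in> carrier L" by (rule Vc[OF EQ[OF i] w])
      have qb: "q \<otimes>\<^bsub>A\<^esub> b \<in> T i j" by (rule P.T_mult[OF ri ij step(3) b])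
      have m: "\<epsilon> (Elt i) \<otimes>\<^bsub>A\<^esub> (q \<otimes>\<^bsub>A\<^esub> b) \<otimes>\<^bsub>A\<^esub> \<epsilon> (Elt j) \<in> \<R> (Elt i) (Elt j)"
        using R_mem[of "q \<otimes>\<^bsub>A\<^esub> b" "Elt i" "Elt j"] qb by simp
      have "x \<cdot>\<^bsub>L\<^esub> (p \<otimes>\<^bsub>A\<^esub> \<epsilon> (Elt i) \<otimes>\<^bsub>A\<^esub> q \<oplus>\<^bsub>A\<^esub> z) \<cdot>\<^bsub>L\<^esub> (b \<otimes>\<^bsub>A\<^esub> \<epsilon> (Elt j))
        = x \<cdot>\<^bsub>L\<^esub> (p \<otimes>\<^bsub>A\<^esub> \<epsilon> (Elt i) \<otimes>\<^bsub>A\<^esub> q) \<cdot>\<^bsub>L\<^esub> (b \<otimes>\<^bsub>A\<^esub> \<epsilon> (Elt j)) \<oplus>\<^bsub>L\<^esub> x \<cdot>\<^bsub>L\<^esub> z \<cdot>\<^bsub>L\<^esub> (b \<otimes>\<^bsub>A\<^esub> \<epsilon> (Elt j))"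
        using xc A zA by (simp add: L.ract_add_right L.ract_add_left L.ract_closed)
      also have "x \<cdot>\<^bsub>L\<^esub> (p \<otimes>\<^bsub>A\<^esub> \<epsilon> (Elt i) \<otimes>\<^bsub>A\<^esub> q) \<cdot>\<^bsub>L\<^esub> (b \<otimes>\<^bsub>A\<^esub> \<epsilon> (Elt j))
        = x \<cdot>\<^bsub>L\<^esub> (p \<otimes>\<^bsub>A\<^esub> \<epsilon> (Elt i)) \<cdot>\<^bsub>L\<^esub> (q \<otimes>\<^bsub>A\<^esub> b \<otimes>\<^bsub>A\<^esub> \<epsilon> (Elt j))"
        using xc A by (simp add: L.ract_assoc[symmetric] P.A.m_assoc)
      also have "\<dots> = x \<cdot>\<^bsub>L\<^esub> p \<cdot>\<^bsub>L\<^esub> \<epsilon> (Elt i) \<cdot>\<^bsub>L\<^esub> (\<epsilon> (Elt i) \<otimes>\<^bsub>A\<^esub> (q \<otimes>\<^bsub>A\<^esub> b) \<otimes>\<^bsub>A\<^esub> \<epsilon> (Elt j))"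
      proof -
        have "p \<otimes>\<^bsub>A\<^esub> \<epsilon> (Elt i) \<otimes>\<^bsub>A\<^esub> (q \<otimes>\<^bsub>A\<^esub> b \<otimes>\<^bsub>A\<^esub> \<epsilon> (Elt j)) = p \<otimes>\<^bsub>A\<^esub> (\<epsilon> (Elt i) \<otimes>\<^bsub>A\<^esub> \<epsilon> (Elt i)) \<otimes>\<^bsub>A\<^esub> (q \<otimes>\<^bsub>A\<^esub> b \<otimes>\<^bsub>A\<^esub> \<epsilon> (Elt j))"
          using \<epsilon>T(2)[OF i] by simp
        then show ?thesis using xc A by (simp add: L.ract_assoc[symmetric] P.A.m_assoc)
      qed
      finally show ?case using Vadd[OF EQ[OF j] Vact[OF rQ w m] step(4)] by simp
    qed
    have xV: "x \<cdot>\<^bsub>L\<^esub> (b \<otimes>\<^bsub>A\<^esub> \<epsilon> (Elt j)) \<in> ?V (Elt j)" if b: "b \<in> T i j" for b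
      using key[OF full[OF i] b] L.ract_one[OF xc] by simp
    have "x \<cdot>\<^bsub>L\<^esub> s \<cdot>\<^bsub>L\<^esub> q \<cdot>\<^bsub>L\<^esub> \<epsilon> (Elt j) \<in> ?V (Elt j)" if q: "q \<in> T j j" for q
      using xV[OF P.T_mult[OF ij rj s q]] xc Tc[OF ij s] Tc[OF rj q] \<epsilon>c[OF j] by (simp add: L.ract_assoc L.ract_closed)
    then show ?thesis using W[OF j] L.ract_closed[OF xc Tc[OF ij s]] by blast
  qed
  have "W \<in> extensional P" by (simp add: W_def)
  then have rep: "is_rep L W"
    unfolding is_rep_iff using tr(1) sub actW by auto
  \<comment> \<open>Inside P one inclusion takes t = 1 in the definition of \<open>W\<close>, the
    other uses that the copies are stable under \<open>\<epsilon>_i s \<epsilon>_i\<close>. At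
    \<open>Top\<close> it is \<open>theta_top_surj\<close>, at \<open>Bot\<close> the assumption
    that the part of M there is zero.\<close>
  have comp: "component L W x = ?V x" if x: "x \<in> Q" for x
  proof (cases x)
    case Bot
    then have "M.vert x = {\<zero>\<^bsub>M\<^esub>}" using b M.vert_props(1)[OF x] by blast
    then have "?V x = {\<zero>\<^bsub>L\<^esub>}" using \<theta>0[OF x] by simp
    then show ?thesis using Bot by simp
  next
    case e: (Elt i)
    then have i: "i \<in> P" using x by simp
    show ?thesis
    proof
      show "component L W x \<subseteq> ?V x"
      proof
        fix w assume "w \<in> component L W x"
        then have w: "w \<in> W i" "w \<cdot>\<^bsub>L\<^esub> \<epsilon> (Elt i) = w" using e by auto
        then show "w \<in> ?V x" using W[OF i, of w] one[OF i] L.ract_one[of w] e by force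
      qed
      show "?V x \<subseteq> component L W x"
      proof
        fix w assume w: "w \<in> ?V x"
        note wc = Vc[OF x w]
        have u: "w \<cdot>\<^bsub>L\<^esub> \<epsilon> (Elt i) = w" using \<theta>unit[OF x] w e by auto
        have "w \<cdot>\<^bsub>L\<^esub> s \<cdot>\<^bsub>L\<^esub> \<epsilon> (Elt i) \<in> ?V (Elt i)" if s: "s \<in> T i i" for s
        proof -
          have m: "\<epsilon> (Elt i) \<otimes>\<^bsub>A\<^esub> s \<otimes>\<^bsub>A\<^esub> \<epsilon> (Elt i) \<in> \<R> (Elt i) (Elt i)" using R_mem[of s "Elt i" "Elt i"] s by simp
          have "w \<cdot>\<^bsub>L\<^esub> (\<epsilon> (Elt i) \<otimes>\<^bsub>A\<^esub> s \<otimes>\<^bsub>A\<^esub> \<epsilon> (Elt i)) \<in> ?V (Elt i)"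
            using Vact[OF R.r_refl[OF EQ[OF i]] _ m, of w] w e by simp
          moreover have "w \<cdot>\<^bsub>L\<^esub> (\<epsilon> (Elt i) \<otimes>\<^bsub>A\<^esub> s \<otimes>\<^bsub>A\<^esub> \<epsilon> (Elt i)) = w \<cdot>\<^bsub>L\<^esub> s \<cdot>\<^bsub>L\<^esub> \<epsilon> (Elt i)"
            using wc u Tc[OF P.r_refl[OF i] s] \<epsilon>c[OF i] by (simp add: L.ract_assoc L.ract_closed)
          ultimately show ?thesis by simp
        qed
        then show "w \<in> component L W x" using W[OF i] wc u e by simp
      qed
    qed
  next
    case Top
    show ?thesis
    proof
      show "component L W x \<subseteq> ?V x"
      proof
        fix w assume "w \<in> component L W x"
        then have w: "w \<in> carrier L" "w \<cdot>\<^bsub>L\<^esub> \<eta> = w" using Top by auto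
        then obtain \<phi> where \<phi>: "\<phi> \<in> carrier hom_module" "w = c \<phi>" unfolding L_def by auto
        obtain v where v: "v \<in> M.vert Top" "\<phi> \<cdot>\<^bsub>hom_module\<^esub> \<eta> = theta Top v" using theta_top_surj[OF \<phi>(1)] by blast
        have "w = \<theta> Top v" using rmod_homD(3)[OF tr(2) \<phi>(1) eta(1)] w(2) \<phi>(2) v(2) unfolding \<theta>_def by simp
        then show "w \<in> ?V x" using v(1) Top by blast
      qed
      show "?V x \<subseteq> component L W x" using \<theta>unit[OF x] Vc[OF x] Top by auto
    qed
  qed
  have pi: "PiE Q (component L W) = PiE Q ?V" using comp by (intro PiE_cong) blast
  \<comment> \<open>Splits w into its vertex components and embeds each of them; the inverse image
    of a row vector is the sum of the components it encodes.\<close>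
  let ?h = "\<lambda>w. \<lambda>x\<in>Q. \<theta> x (w \<cdot>\<^bsub>M\<^esub> R.E x x (R.u x))"
  have pv: "w \<cdot>\<^bsub>M\<^esub> R.E x x (R.u x) \<in> M.vert x" if "w \<in> carrier M" "x \<in> Q" for w x
    by (rule M.act_E_vert[OF that(1) R.r_refl[OF that(2)] R.unit_mem[OF that(2)]])
  note pc = M.vert_carrier[OF pv]
  have RM: "right_module R.\<Lambda> (rep_module L W)" by (rule right_module_rep_module[OF rep])
  have hmem: "?h w \<in> PiE Q (component L W)" if "w \<in> carrier M" for w unfolding pi using pv[OF that] by auto
  have h: "?h \<in> rmod_hom R.\<Lambda> M (rep_module L W)"
  proof (rule M.rmod_homI_E[OF RM])
    show "?h w \<in> carrier (rep_module L W)" if "w \<in> carrier M" for w unfolding rep_module_simps by (rule hmem[OF that])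
    show "?h (w \<oplus>\<^bsub>M\<^esub> w') = ?h w \<oplus>\<^bsub>rep_module L W\<^esub> ?h w'" if w: "w \<in> carrier M" "w' \<in> carrier M" for w w'
      unfolding rep_module_simps
    proof (rule restrict_ext)
      fix x assume x: "x \<in> Q"
      show "\<theta> x ((w \<oplus>\<^bsub>M\<^esub> w') \<cdot>\<^bsub>M\<^esub> R.E x x (R.u x)) = ?h w x \<oplus>\<^bsub>L\<^esub> ?h w' x"
        using x M.ract_add_left[OF w M.unit_E_closed[OF x]] \<theta>add[OF x pc[OF w(1) x] pc[OF w(2) x]] by simp
    qed
    fix w x y a assume w: "w \<in> carrier M" and xy: "(x, y) \<in> rQ" and a: "a \<in> \<R> x y"
    have q: "x \<in> Q" "y \<in> Q" using R.r_sub[OF xy] by auto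
    note v = M.act_E_vert[OF w xy a]
    have "?h w \<cdot>\<^bsub>rep_module L W\<^esub> R.E x y a = single L y (?h w x \<cdot>\<^bsub>L\<^esub> a)" by (rule rep_module_E[OF rep hmem[OF w] xy a])
    also have "\<dots> = ?h (w \<cdot>\<^bsub>M\<^esub> R.E x y a)" unfolding single_def
    proof (rule restrict_ext)
      fix z assume z: "z \<in> Q"
      show "(if z = y then ?h w x \<cdot>\<^bsub>L\<^esub> a else \<zero>\<^bsub>L\<^esub>) = \<theta> z (w \<cdot>\<^bsub>M\<^esub> R.E x y a \<cdot>\<^bsub>M\<^esub> R.E z z (R.u z))"
      proof (cases "z = y")
        case True
        have "?h w x \<cdot>\<^bsub>L\<^esub> a = \<theta> y (w \<cdot>\<^bsub>M\<^esub> R.E x x (R.u x) \<cdot>\<^bsub>M\<^esub> R.E x y a)"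
          using q \<theta>act[OF xy pc[OF w q(1)] a] by simp
        also have "w \<cdot>\<^bsub>M\<^esub> R.E x x (R.u x) \<cdot>\<^bsub>M\<^esub> R.E x y a = w \<cdot>\<^bsub>M\<^esub> R.E x y a" using M.act_E_unit[OF w xy a] by simp
        finally show ?thesis using True M.vert_unit[OF v] by simp
      next
        case False
        then show ?thesis using M.vert_act_other[OF v q(2) False R.r_refl[OF z] R.unit_mem[OF z]] \<theta>0[OF z] by simp
      qed
    qed
    finally show "?h (w \<cdot>\<^bsub>M\<^esub> R.E x y a) = ?h w \<cdot>\<^bsub>rep_module L W\<^esub> R.E x y a" by simp
  qed
  have "inj_on ?h (carrier M)"
    unfolding rmod_hom_inj_iff[OF M.right_module_axioms RM h]
  proof (intro ballI impI)
    fix w assume w: "w \<in> carrier M" and z: "?h w = \<zero>\<^bsub>rep_module L W\<^esub>"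
    show "w = \<zero>\<^bsub>M\<^esub>"
    proof (rule M.eq_zero_if_components_zero[OF w])
      fix x assume x: "x \<in> Q"
      have "\<theta> x (w \<cdot>\<^bsub>M\<^esub> R.E x x (R.u x)) = \<zero>\<^bsub>L\<^esub>" using fun_cong[OF z, of x] x by (simp add: rep_module_simps)
      then show "w \<cdot>\<^bsub>M\<^esub> R.E x x (R.u x) = \<zero>\<^bsub>M\<^esub>" by (rule \<theta>inj[OF x pv[OF w x]])
    qed
  qed
  moreover have "?h ` carrier M = carrier (rep_module L W)"
  proof
    show "?h ` carrier M \<subseteq> carrier (rep_module L W)" using rmod_homD(1)[OF h] by blast
    show "carrier (rep_module L W) \<subseteq> ?h ` carrier M"
    proof
      fix u assume "u \<in> carrier (rep_module L W)"
      then have u: "u \<in> PiE Q ?V" unfolding rep_module_simps pi .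
      then have "\<forall>x\<in>Q. \<exists>v. v \<in> M.vert x \<and> u x = \<theta> x v" by (auto dest: PiE_mem)
      then obtain v where v: "\<forall>x\<in>Q. v x \<in> M.vert x \<and> u x = \<theta> x (v x)" using bchoice by meson
      have vv: "v x \<in> M.vert x" "u x = \<theta> x (v x)" if "x \<in> Q" for x using v that by auto
      note vc = M.vert_carrier[OF vv(1)]
      define w where "w = (\<Oplus>\<^bsub>M\<^esub>x\<in>Q. v x)"
      have w: "w \<in> carrier M" unfolding w_def using vc by (intro M.M.finsum_closed) auto
      have "w \<cdot>\<^bsub>M\<^esub> R.E y y (R.u y) = v y" if y: "y \<in> Q" for y
      proof -
        have "w \<cdot>\<^bsub>M\<^esub> R.E y y (R.u y) = (\<Oplus>\<^bsub>M\<^esub>x\<in>Q. v x \<cdot>\<^bsub>M\<^esub> R.E y y (R.u y))"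
          unfolding w_def using vc by (intro M.finsum_ract R.finite_P M.unit_E_closed[OF y]) auto
        also have "\<dots> = v y"
        proof (rule M.M.finsum_single[OF R.finite_P y vc[OF y]])
          fix x assume x: "x \<in> Q"
          show "v x \<cdot>\<^bsub>M\<^esub> R.E y y (R.u y) = (if x = y then v y else \<zero>\<^bsub>M\<^esub>)"
            using M.vert_unit[OF vv(1)[OF y]] M.vert_act_other[OF vv(1)[OF x] x _ R.r_refl[OF y] R.unit_mem[OF y]] by auto
        qed
        finally show ?thesis .
      qed
      then have "?h w = u" using vv(2) u by (intro extensionalityI[of _ Q]) (auto simp: PiE_iff)
      then show "u \<in> ?h ` carrier M" using w by blast
    qed
  qed
  ultimately have "rmod_isomorphic R.\<Lambda> M (rep_module L W)" unfolding rmod_isomorphic_def bij_betw_def using h by blast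
  then show ?thesis using rep by blast
qed

text \<open>Replaces the two conditions that define objects of \<U> by conditions on vertex parts;
  the main proof uses it both to see that the functor lands in \<U> and to see that it is
  dense.\<close>

lemma category_U_iff:
  assumes inf: "infinite (UNIV :: 'v set)" and \<kappa>: "inj_on (\<kappa> :: 'a \<Rightarrow> 'v) (carrier A)"
  shows "M \<in> Obj (category_U A P r T \<epsilon>) \<longleftrightarrow> M.top_faithful \<and> M.vert Bot \<subseteq> {\<zero>\<^bsub>M\<^esub>}"
proof -
  have "M \<in> Obj (category_U A P r T \<epsilon>) \<longleftrightarrow> socle_projective R.\<Lambda> M \<and>
      \<not> has_direct_summand R.\<Lambda> M (principal_rmodule R.\<Lambda> (R.E Bot Bot (R.u Bot)))"
    unfolding category_U_def Let_def full_subcategory_def Lambda_eq incidence_idem_eq using M.right_module_axioms by simp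
  moreover have "socle_projective R.\<Lambda> M \<longleftrightarrow> M.top_faithful"
    using M.socle_projective_if_top_faithful M.top_faithful_if_socle_projective[OF _ inf \<kappa>] by blast
  ultimately show ?thesis using no_summand_if_bottom_zero summand_if_bottom_nonzero by blast
qed

end

section \<open>The equivalence\<close>

theorem mainTheorem5:
  fixes K :: "('k, 'c) ring_scheme" and A :: "('k, 'a) module"
    and P :: "'p set" and r :: "'p rel" and T :: "'p \<Rightarrow> 'p \<Rightarrow> 'a set"
    and \<epsilon> :: "'p extended \<Rightarrow> 'a"
  assumes "infinite (UNIV :: 'v set)" and "carrier A \<lesssim> (UNIV :: 'v set)"
    and "extendable_via TYPE('v) K A P r T \<epsilon>"
  shows "equivalent_categories
    (Rep K A P r T :: (('a, 'v) rmodule \<times> ('p \<Rightarrow> 'v set), 'v \<Rightarrow> 'v) category)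
    (category_U A P r T \<epsilon> ::
      (('p extended \<Rightarrow> 'p extended \<Rightarrow> 'a, 'v) rmodule, 'v \<Rightarrow> 'v) category)"
proof -
  note inf = assms(1)
  obtain \<kappa> :: "'a \<Rightarrow> 'v" where \<kappa>: "inj_on \<kappa> (carrier A)" using assms(2) unfolding lepoll_def by blast
  interpret extendable_poset K A P r T \<epsilon> by (rule extendable_posetI[OF assms(3) \<kappa>])
  let ?C = "Rep K A P r T :: (('a, 'v) rmodule \<times> ('p \<Rightarrow> 'v set), 'v \<Rightarrow> 'v) category"
  let ?D = "category_U A P r T \<epsilon> :: (('p extended \<Rightarrow> 'p extended \<Rightarrow> 'a, 'v) rmodule, 'v \<Rightarrow> 'v) category"
  obtain S where D: "?D = full_subcategory (rmod_category R.\<Lambda>) S" unfolding category_U_def Let_def Lambda_eq by blast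
  have D_simps: "Hom ?D X Y = rmod_hom R.\<Lambda> X Y \<inter> extensional (carrier X)" "Idn ?D X = restrict (\<lambda>x. x) (carrier X)"
    "Cmp ?D X Y Z g f = compose (carrier X) g f" for X Y Z f g
    unfolding D full_subcategory_def by simp_all
  have D_mod: "right_module R.\<Lambda> X" if "X \<in> Obj ?D" for X using that unfolding D full_subcategory_def by simp
  have em: "extended_module K A P r T \<epsilon> X" if "right_module R.\<Lambda> X" for X :: "('p extended \<Rightarrow> 'p extended \<Rightarrow> 'a, 'v) rmodule"
    using that by (intro extended_module.intro incidence_top_module.intro incidence_module.intro rmod.intro
        R.incidence_axioms R.incidence_top_axioms extendable_poset_axioms)
  obtain \<iota> :: "('p extended \<Rightarrow> 'v) \<Rightarrow> 'v" where \<iota>: "inj_on \<iota> (extensional Q)" using PiE_injection[OF inf R.finite_P] by blast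
  \<comment> \<open>One injection \<iota> on all extensional families serves every representation.
    On arrows the functor is then conjugation by \<iota> of the coordinatewise map, and composites
    match without further choices.\<close>
  define Fo where "Fo a = image_rmod \<iota> (rep_module (fst a) (snd a))" for a :: "('a, 'v) rmodule \<times> ('p \<Rightarrow> 'v set)"
  define Fm where "Fm a b h = transport_map \<iota> (carrier (rep_module (fst a) (snd a))) (\<lambda>u. \<lambda>x\<in>Q. h (u x))"
    for a b :: "('a, 'v) rmodule \<times> ('p \<Rightarrow> 'v set)" and h :: "'v \<Rightarrow> 'v"
  have \<iota>': "inj_on \<iota> (carrier (rep_module L W))" for L :: "('a, 'v) rmodule" and W :: "'p \<Rightarrow> 'v set"
    using \<iota> by (rule inj_on_subset) (auto simp: rep_module_simps PiE_iff)
  have Fmod: "right_module R.\<Lambda> (image_rmod \<iota> (rep_module L W))"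
    and Fiso: "rmod_isomorphic R.\<Lambda> (rep_module L W) (image_rmod \<iota> (rep_module L W))"
    and Finv: "inv_into (carrier (rep_module L W)) \<iota> \<in> rmod_hom R.\<Lambda> (image_rmod \<iota> (rep_module L W)) (rep_module L W)"
      "inj_on (inv_into (carrier (rep_module L W)) \<iota>) (carrier (image_rmod \<iota> (rep_module L W)))"
    if "is_rep L W" for L :: "('a, 'v) rmodule" and W
  proof -
    interpret B: rmod R.\<Lambda> "rep_module L W" by (rule rmod.intro[OF right_module_rep_module[OF that]])
    note t = B.transport[OF \<iota>']
    show "right_module R.\<Lambda> (image_rmod \<iota> (rep_module L W))" "rmod_isomorphic R.\<Lambda> (rep_module L W) (image_rmod \<iota> (rep_module L W))"
      by (rule t(1), rule t(4))
    show "inv_into (carrier (rep_module L W)) \<iota> \<in> rmod_hom R.\<Lambda> (image_rmod \<iota> (rep_module L W)) (rep_module L W)"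
      by (rule rmod_hom_inv_into[OF right_module_rep_module[OF that] t(1-3)])
    show "inj_on (inv_into (carrier (rep_module L W)) \<iota>) (carrier (image_rmod \<iota> (rep_module L W)))"
      using bij_betw_inv_into[OF t(3)] by (simp add: bij_betw_def)
  qed
  have Fobj: "image_rmod \<iota> (rep_module L W) \<in> Obj ?D" if LW: "is_rep L W" for L :: "('a, 'v) rmodule" and W
  proof -
    let ?M = "image_rmod \<iota> (rep_module L W)" and ?k = "inv_into (carrier (rep_module L W)) \<iota>"
    interpret E: extended_module K A P r T \<epsilon> ?M by (rule em[OF Fmod[OF LW]])
    have t: "E.M.top_faithful"
      by (rule E.M.top_faithful_embedding[OF rep_module_top_faithful[OF LW] right_module_rep_module[OF LW] Finv[OF LW]])
    \<comment> \<open>The row vector encoded by w is concentrated at \<open>Bot\<close>, where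
      \<open>component\<close> is zero.\<close>
    have "w = \<zero>\<^bsub>?M\<^esub>" if w: "w \<in> E.M.vert Bot" for w
    proof -
      have B: "Bot \<in> Q" by simp
      note wc = E.M.vert_carrier[OF w]
      have k: "?k w \<in> PiE Q (component L W)" using rmod_homD(1)[OF Finv(1)[OF LW] wc] unfolding rep_module_simps .
      have ks: "?k w = single L Bot (?k w Bot)"
        using rmod_homD(3)[OF Finv(1)[OF LW] wc E.M.unit_E_closed[OF B]] E.M.vert_unit[OF w] rep_module_unit[OF LW k B] by simp
      have k0: "?k w Bot = \<zero>\<^bsub>L\<^esub>" using PiE_mem[OF k B] by simp
      have "single L Bot \<zero>\<^bsub>L\<^esub> = \<zero>\<^bsub>rep_module L W\<^esub>" by (simp add: single_def rep_module_simps)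
      then have "?k w = \<zero>\<^bsub>rep_module L W\<^esub>" using trans[OF ks arg_cong[OF k0, of "single L Bot"]] by simp
      then show ?thesis using rmod_hom_inj_iff[OF Fmod[OF LW] right_module_rep_module[OF LW] Finv(1)[OF LW]] Finv(2)[OF LW] wc by blast
    qed
    then have "E.M.vert Bot \<subseteq> {\<zero>\<^bsub>?M\<^esub>}" by blast
    then show ?thesis using E.category_U_iff[OF inf \<kappa>] t by blast
  qed
  have Fhom: "Fm (L, W) (L', W') h \<in> Hom ?D (Fo (L, W)) (Fo (L', W'))"
    if "is_rep L W" "is_rep L' W'" "h \<in> Hom ?C (L, W) (L', W')" for L W L' W' h
    unfolding D_simps Fo_def Fm_def
    using transport_map_hom[OF right_module_rep_module[OF that(1)] right_module_rep_module[OF that(2)] \<iota>' \<iota>' rep_map_hom[OF that]]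
    by (simp add: transport_map_def)
  have Fapply: "Fm (L, W) b h (\<iota> u) = \<iota> (\<lambda>x\<in>Q. h (u x))" if "u \<in> PiE Q (component L W)" for L W b h u
    unfolding Fm_def using transport_map_apply[OF \<iota>', of u L W] that by (simp add: rep_module_simps)
  have F: "cat_functor ?C ?D Fo Fm"
  proof (intro cat_functor.intro cat_functor_axioms.intro category_Rep)
    show "category ?D" unfolding D by (intro category_full_subcategory category_rmod)
  next
    fix a assume "a \<in> Obj ?C"
    then show "Fo a \<in> Obj ?D" using Fobj unfolding Fo_def by (cases a) simp
  next
    fix a b f assume "a \<in> Obj ?C" "b \<in> Obj ?C" "f \<in> Hom ?C a b"
    then show "Fm a b f \<in> Hom ?D (Fo a) (Fo b)" using Fhom by (cases a; cases b) simp
  next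
    fix a assume a: "a \<in> Obj ?C"
    obtain L W where e: "a = (L, W)" by force
    have LW: "is_rep L W" using a e by simp
    show "Fm a a (Idn ?C a) = Idn ?D (Fo a)"
    proof (rule extensionalityI[of _ "\<iota> ` PiE Q (component L W)"])
      show "Fm a a (Idn ?C a) \<in> extensional (\<iota> ` PiE Q (component L W))"
        "Idn ?D (Fo a) \<in> extensional (\<iota> ` PiE Q (component L W))"
        unfolding Fm_def D_simps Fo_def e by (simp_all add: transport_map_def rep_module_simps)
      fix z assume "z \<in> \<iota> ` PiE Q (component L W)"
      then obtain u where u: "u \<in> PiE Q (component L W)" "z = \<iota> u" by blast
      have "(\<lambda>x\<in>Q. (restrict (\<lambda>x. x) (carrier L)) (u x)) = u"
        by (rule extensionalityI[of _ Q]) (use u(1) component_props(1)[OF LW _ PiE_mem[OF u(1)]] in \<open>auto simp: PiE_iff\<close>)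
      then show "Fm a a (Idn ?C a) z = Idn ?D (Fo a) z"
        unfolding e u(2) Fapply[OF u(1)] Rep_simps D_simps Fo_def using u(1) by (simp add: rep_module_simps)
    qed
  next
    fix a b c f g assume o: "a \<in> Obj ?C" "b \<in> Obj ?C" "c \<in> Obj ?C" and m: "f \<in> Hom ?C a b" "g \<in> Hom ?C b c"
    obtain L W L1 W1 L2 W2 where e: "a = (L, W)" "b = (L1, W1)" "c = (L2, W2)" by (metis surj_pair)
    have LW: "is_rep L W" "is_rep L1 W1" "is_rep L2 W2" using o e by simp_all
    have fh: "f \<in> Hom ?C (L, W) (L1, W1)" using m e by simp
    show "Fm a c (Cmp ?C a b c g f) = Cmp ?D (Fo a) (Fo b) (Fo c) (Fm b c g) (Fm a b f)"
    proof (rule extensionalityI[of _ "\<iota> ` PiE Q (component L W)"])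
      show "Fm a c (Cmp ?C a b c g f) \<in> extensional (\<iota> ` PiE Q (component L W))"
        "Cmp ?D (Fo a) (Fo b) (Fo c) (Fm b c g) (Fm a b f) \<in> extensional (\<iota> ` PiE Q (component L W))"
        unfolding Fm_def D_simps Fo_def e by (simp_all add: transport_map_def rep_module_simps compose_def)
      fix z assume "z \<in> \<iota> ` PiE Q (component L W)"
      then obtain u where u: "u \<in> PiE Q (component L W)" "z = \<iota> u" by blast
      have fu: "(\<lambda>x\<in>Q. f (u x)) \<in> PiE Q (component L1 W1)"
        using rmod_homD(1)[OF rep_map_hom[OF LW(1,2) fh], of u] u(1) unfolding rep_module_simps by simp
      have uc: "u x \<in> carrier L" if "x \<in> Q" for x by (rule component_props(1)[OF LW(1) that PiE_mem[OF u(1) that]])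
      have "(\<lambda>x\<in>Q. compose (carrier L) g f (u x)) = (\<lambda>x\<in>Q. g ((\<lambda>x\<in>Q. f (u x)) x))"
        by (rule restrict_ext) (use uc in \<open>simp add: compose_def\<close>)
      then show "Fm a c (Cmp ?C a b c g f) z = Cmp ?D (Fo a) (Fo b) (Fo c) (Fm b c g) (Fm a b f) z"
        unfolding e u(2) Fapply[OF u(1)] Rep_simps D_simps Fo_def using u(1) Fapply[OF u(1)] Fapply[OF fu]
        by (simp add: rep_module_simps compose_def)
    qed
  qed
  show ?thesis
  proof (rule equivalence_if_fully_faithful_dense[OF F])
    fix a b assume o: "a \<in> Obj ?C" "b \<in> Obj ?C"
    obtain L W L' W' where e: "a = (L, W)" "b = (L', W')" by (metis surj_pair)
    have LW: "is_rep L W" "is_rep L' W'" using o e by simp_all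
    note RM = right_module_rep_module[OF LW(1)] right_module_rep_module[OF LW(2)]
    show "bij_betw (Fm a b) (Hom ?C a b) (Hom ?D (Fo a) (Fo b))"
      unfolding bij_betw_def
    proof
      show "inj_on (Fm a b) (Hom ?C a b)"
      proof (rule inj_onI)
        fix h h' assume h: "h \<in> Hom ?C a b" "h' \<in> Hom ?C a b" and eq: "Fm a b h = Fm a b h'"
        show "h = h'"
        proof (rule rep_map_faithful[OF LW h[unfolded e]])
          fix u assume u: "u \<in> PiE Q (component L W)"
          have "\<iota> (\<lambda>x\<in>Q. h (u x)) = \<iota> (\<lambda>x\<in>Q. h' (u x))"
            using fun_cong[OF eq, of "\<iota> u"] unfolding e Fapply[OF u] .
          then show "(\<lambda>x\<in>Q. h (u x)) = (\<lambda>x\<in>Q. h' (u x))" by (rule inj_onD[OF \<iota>]) simp_all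
        qed
      qed
      show "Fm a b ` Hom ?C a b = Hom ?D (Fo a) (Fo b)"
      proof
        show "Fm a b ` Hom ?C a b \<subseteq> Hom ?D (Fo a) (Fo b)" using Fhom[OF LW] unfolding e by blast
        show "Hom ?D (Fo a) (Fo b) \<subseteq> Fm a b ` Hom ?C a b"
        proof
          fix k assume "k \<in> Hom ?D (Fo a) (Fo b)"
          then have k: "k \<in> rmod_hom R.\<Lambda> (image_rmod \<iota> (rep_module L W)) (image_rmod \<iota> (rep_module L' W'))"
            "k \<in> extensional (\<iota> ` carrier (rep_module L W))" unfolding e Fo_def D_simps by simp_all
          obtain g where g: "g \<in> rmod_hom R.\<Lambda> (rep_module L W) (rep_module L' W')"
            "transport_map \<iota> (carrier (rep_module L W)) g = k" using transport_map_surj[OF RM \<iota>' \<iota>' k] by blast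
          obtain h where h: "h \<in> Hom ?C (L, W) (L', W')" "\<forall>u \<in> PiE Q (component L W). g u = (\<lambda>x\<in>Q. h (u x))"
            using rep_map_full[OF LW g(1)] by blast
          have "Fm a b h = k"
          proof (rule extensionalityI[OF _ k(2)])
            show "Fm a b h \<in> extensional (\<iota> ` carrier (rep_module L W))" unfolding Fm_def e by (simp add: transport_map_def)
            fix z assume "z \<in> \<iota> ` carrier (rep_module L W)"
            then obtain u where u: "u \<in> carrier (rep_module L W)" "z = \<iota> u" by blast
            then have u': "u \<in> PiE Q (component L W)" by (simp only: rep_module_simps)
            show "Fm a b h z = k z"
              unfolding u(2) e Fapply[OF u'] g(2)[symmetric] transport_map_apply[OF \<iota>' u(1)] using h(2) u' by simp
          qed
          then show "k \<in> Fm a b ` Hom ?C a b" using h(1) e by blast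
        qed
      qed
    qed
  next
    fix M assume M: "M \<in> Obj ?D"
    note MM = D_mod[OF M]
    interpret E: extended_module K A P r T \<epsilon> M by (rule em[OF MM])
    \<comment> \<open>Density: M is isomorphic to the row vectors of some representation, and these
      to their copy in \<open>'v\<close>.\<close>
    obtain L :: "('a, 'v) rmodule" and W where LW: "is_rep L W" "rmod_isomorphic R.\<Lambda> M (rep_module L W)"
      using E.representation_exists[OF _ _ inf] M E.category_U_iff[OF inf \<kappa>] by blast
    have "rmod_isomorphic R.\<Lambda> M (Fo (L, W))"
      unfolding Fo_def using rmod_isomorphic_trans[OF LW(2) Fiso[OF LW(1)]] by simp
    then have "rmod_isomorphic R.\<Lambda> (Fo (L, W)) M"
      using rmod_isomorphic_sym[OF MM] Fmod[OF LW(1)] unfolding Fo_def by simp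
    then obtain f where "iso_arrow (rmod_category R.\<Lambda>) (Fo (L, W)) M f"
      using rmod_isomorphic_iff_iso_arrow[OF _ MM, of "Fo (L, W)"] Fmod[OF LW(1)] unfolding Fo_def by auto
    then have "iso_arrow ?D (Fo (L, W)) M f" unfolding D iso_arrow_full_subcategory .
    then show "\<exists>c \<in> Obj ?C. \<exists>f. iso_arrow ?D (Fo c) M f" by (intro bexI[OF _ LW(1)] exI)
  qed
qed

end
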